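(* Let $\{a_n\}_{n\ge0}$ be complex numbers with $\sum_{n=1}^\infty|a_n|^2(\log n)^3<\infty$, and for $t\in[0,1]$ let $f_t(z)=\sum_{n=0}^\infty r_n(t)a_nz^n$, $z\in\mathbb D$. Then for almost every $t\in[0,1]$: (i) $\int_0^1(1-r)\left(\log\frac1{1-r}\right)^2[M_\infty(r,f_t')]^2\,dr<\infty$; (ii) $f_t\in BMOA_{\log}\cap H^\infty$; (iii) $f_t\in\mathcal M(\mathcal D^p_{p-1}\cap BMOA,\ \mathcal D^q_{q-1}\cap BMOA)$ whenever $0<p\le q$ and $q>\frac12$. Furthermore, for each $0<q<\frac12$ there exists a sequence $\{a_n\}$ satisfying $\sum_{n=1}^\infty|a_n|^2(\log n)^3<\infty$ such that $f_t\notin\mathcal D^q_{q-1}$ for almost every $t$; hence for this sequence and almost every $t$: (a) $f_t\in\mathcal M(BMOA)$; (b) $f_t\in\mathcal M(\mathcal D^p_{p-1}\cap BMOA,\ \mathcal D^\lambda_{\lambda-1}\cap BMOA)$ whenever $\lambda>\frac12$ and $0<p\le\lambda$; (c) $f_t\notin\mathcal M(\mathcal D^p_{p-1}\cap BMOA,\ \mathcal D^q_{q-1}\cap BMOA)$ whenever $0<p\le q$.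
   Context: $\mathbb D$ is the open unit disc, $dA=\frac1\pi dx\,dy$, $M_\infty(r,f)=\max_{|z|=r}|f(z)|$. The Rademacher functions are $r_0(t)=1$ on $(0,1/2)$, $-1$ on $(1/2,1)$, $0$ at $t=0,1/2,1$, and $r_n(t)=r_0(2^nt)$ for $n\ge1$. For $0<p<\infty$, $\mathcal D^p_{p-1}$ is the space of analytic $f$ with $\int_{\mathbb D}(1-|z|)^{p-1}|f'(z)|^p\,dA(z)<\infty$. $BMOA$ is the space of $f\in H^1$ whose boundary values have bounded mean oscillation. For an arc $I\subset\partial\mathbb D$ of length $|I|$, $S(I)=\{re^{it}: e^{it}\in I,\ 1-\frac{|I|}{2\pi}\le r<1\}$. $BMOA_{\log}$ is the space of $g\in H^1$ for which there is $C>0$ with $\int_{S(I)}(1-|z|^2)|g'(z)|^2\,dA(z)\le C|I|(\log\frac{2}{|I|})^{-2}$ for every arc $I$. $H^\infty$ is the space of bounded analytic functions. $\mathcal M(X,Y)=\{g\text{ analytic}: fg\in Y\ \forall f\in X\}$, $\mathcal M(X)=\mathcal M(X,X)$. *)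

theory Defs
  imports "HOL-Analysis.Analysis"
begin

definition udisc :: "complex set" where
  "udisc = ball 0 1"

definition Minf :: "real \<Rightarrow> (complex \<Rightarrow> complex) \<Rightarrow> real" where
  "Minf r f = (SUP z\<in>sphere 0 r. norm (f z))"

text \<open>Rademacher functions. r_0 is given on [0,1] as in the paper and extended
  1-periodically to the real line, so that r_n(t) = r_0(2^n t) makes sense.\<close>
definition rad0 :: "real \<Rightarrow> real" where
  "rad0 t = (let s = frac t in if 0 < s \<and> s < 1/2 then 1 else if 1/2 < s then -1 else 0)"

definition rad :: "nat \<Rightarrow> real \<Rightarrow> real" where
  "rad n t = rad0 (2 ^ n * t)"

definition rand_series :: "(nat \<Rightarrow> complex) \<Rightarrow> real \<Rightarrow> complex \<Rightarrow> complex" where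
  "rand_series a t z = (\<Sum>n. of_real (rad n t) * a n * z ^ n)"

definition H1 :: "(complex \<Rightarrow> complex) set" where
  "H1 = {f. f holomorphic_on udisc \<and>
     (\<exists>B. \<forall>r\<in>{0..<1}. (\<integral>\<^sup>+ \<theta>\<in>{0..2*pi}. ennreal (norm (f (of_real r * cis \<theta>))) \<partial>lborel) \<le> ennreal B)}"

definition Hinf :: "(complex \<Rightarrow> complex) set" where
  "Hinf = {f. f holomorphic_on udisc \<and> (\<exists>B. \<forall>z\<in>udisc. norm (f z) \<le> B)}"

definition bdry :: "(complex \<Rightarrow> complex) \<Rightarrow> real \<Rightarrow> complex" where
  "bdry f \<theta> = Lim (at_left 1) (\<lambda>r::real. f (of_real r * cis \<theta>))"

text \<open>BMOA: H^1 functions whose boundary values have bounded mean oscillation.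
  An arc I of length l (0 < l \<le> 2 pi) is {e^(i theta) : a \<le> theta \<le> a + l}.\<close>
definition BMOA :: "(complex \<Rightarrow> complex) set" where
  "BMOA = {f. f \<in> H1 \<and> (\<exists>C. \<forall>a l. 0 < l \<and> l \<le> 2*pi \<longrightarrow>
      (let avg = (1 / l) *\<^sub>R (LINT \<theta>:{a..a+l}|lborel. bdry f \<theta>) in
        (\<integral>\<^sup>+ \<theta>\<in>{a..a+l}. ennreal (norm (bdry f \<theta> - avg)) \<partial>lborel) \<le> ennreal (C * l)))}"

definition Sbox :: "real \<Rightarrow> real \<Rightarrow> complex set" where
  "Sbox a l = {of_real r * cis \<theta> | r \<theta>. a \<le> \<theta> \<and> \<theta> \<le> a + l \<and> 1 - l / (2*pi) \<le> r \<and> r < 1}"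

text \<open>BMOA_log. dA = (1/pi) dx dy. For |I| = 2 the right-hand side is +infinity
  (log(2/|I|) = 0), so the condition is vacuous there.\<close>
definition BMOA_log :: "(complex \<Rightarrow> complex) set" where
  "BMOA_log = {g. g \<in> H1 \<and> (\<exists>C>0. \<forall>a l. 0 < l \<and> l \<le> 2*pi \<and> l \<noteq> 2 \<longrightarrow>
      (\<integral>\<^sup>+ z\<in>Sbox a l. ennreal (1/pi * (1 - (norm z)^2) * (norm (deriv g z))^2) \<partial>lborel)
        \<le> ennreal (C * l / (ln (2 / l))^2))}"

definition Dir :: "real \<Rightarrow> (complex \<Rightarrow> complex) set" where
  "Dir p = {f. f holomorphic_on udisc \<and>
     (\<integral>\<^sup>+ z\<in>udisc. ennreal (1/pi * (1 - norm z) powr (p - 1) * norm (deriv f z) powr p) \<partial>lborel) < \<infinity>}"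

definition Mult :: "(complex \<Rightarrow> complex) set \<Rightarrow> (complex \<Rightarrow> complex) set \<Rightarrow> (complex \<Rightarrow> complex) set" where
  "Mult X Y = {g. g holomorphic_on udisc \<and> (\<forall>f\<in>X. (\<lambda>z. f z * g z) \<in> Y)}"

definition coeff_cond :: "(nat \<Rightarrow> complex) \<Rightarrow> bool" where
  "coeff_cond a \<longleftrightarrow> summable (\<lambda>n. (norm (a (Suc n)))^2 * (ln (real (Suc n)))^3)"

end

theory Submission imports Defs "HOL-Complex_Analysis.Complex_Analysis"
begin

text \<open>
  Write the random series in dyadic blocks. A sub-Gaussian bound on a grid of points shows that almost surely
  the maxima \<open>S\<^sub>k\<close> of the \<open>k\<close>-th block and \<open>D\<^sub>k\<close> of its derivative satisfy
  \<open>\<Sum>(k+1)\<^sup>2S\<^sub>k\<^sup>2 < \<infinity>\<close> and \<open>\<Sum>(k+1)\<^sup>2(D\<^sub>k/2\<^sup>k)\<^sup>2 < \<infinity>\<close>; the rest of the positive part is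
  deterministic. The weights \<open>(k+1)\<^sup>2\<close> are what the logarithms in (i) and in \<open>BMOA\<^sub>l\<^sub>o\<^sub>g\<close> cost, and they
  make \<open>g\<close> continuous up to the circle. Its mean oscillation over an arc of length \<open>l\<close> is
  \<open>O(1/log(1/l))\<close>: blocks of frequency below \<open>1/l\<close> are Lipschitz, and blocks of higher frequency are almost
  orthogonal on the arc. Since averages of a \<open>BMO\<close> function over such an arc are \<open>O(log(1/l))\<close>, multiplication
  by \<open>g\<close> preserves \<open>BMOA\<close>.

  In \<open>(fg)' = f'g + fg'\<close> the first term is harmless because \<open>f\<close> is a Bloch function. As \<open>fg\<close> is a Bloch
  function too, the second term only has to be integrated with an exponent \<open>q \<in> (1/2, 2/3]\<close>, where Young's inequality
  compares it with \<open>(1-|z|)L\<^sup>3|g'|\<^sup>2\<close>, \<open>L = 1 + log(1/(1-|z|))\<close>, and with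
  \<open>(1+|f|)L\<^sup>-\<^sup>\<delta>/(1-|z|)\<close>; here \<open>\<delta> = 3q/(2-q) > 1\<close> exactly when \<open>q > 1/2\<close>.

  For \<open>q < 1/2\<close> the coefficients \<open>(k+1)\<^sup>-\<^sup>\<beta>\<close> at the powers \<open>1024\<^sup>k\<close> are admissible if \<open>\<beta> > 2\<close>, whereas on
  the annulus \<open>1-|z| \<sim> 1024\<^sup>-\<^sup>k\<close> one term of the derivative dominates whatever the signs, so the
  \<open>D\<^sup>q\<close> integral is at least \<open>\<Sum>(k+1)\<^sup>-\<^sup>\<beta>\<^sup>q\<close>, divergent for \<open>\<beta> \<le> 1/q\<close>.
\<close>

section \<open>The Poisson kernel\<close>

text \<open>\<open>BMOA\<close> is defined through \<open>bdry\<close>, a radial limit that has a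
  meaning only where the limit exists. Three facts about H^1 therefore come before any multiplier:
  radial limits exist almost everywhere (so the boundary function of a product is the product of the
  boundary functions), they are limits in L^1 (so Cauchy's formula for f' can be written with
  boundary values), and, as a consequence, a function in \<open>BMOA\<close> satisfies the Bloch
  bound. The first two rest on a maximal inequality for H^2 and pass to H^1 by writing a function as
  a product of two H^2 functions.

  The exponent 3 in the hypothesis is 1 + 2: the expected squared maximum of the k-th block is at
  most a constant times k+1 (the logarithm of the number of grid points) times its coefficient sum,
  and the weight (k+1)^2 accounts for the rest.

  One exceptional null set has to serve all p and q at once. Chance therefore enters only through
  the inequalities collected in \<open>block_series\<close>, which mention no exponent.\<close>

text \<open>Lebesgue measure on the parameter interval of the circle. A density on the whole line rather than a
  restriction, so that measurability is plain Borel measurability.\<close>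

definition circ :: "real measure" where
  "circ = density lborel (indicator {0..2 * pi})"

lemma sets_circ [simp, measurable_cong]: "sets circ = sets borel"
  by (simp add: circ_def)

lemma space_circ [simp]: "space circ = UNIV"
  by (simp add: circ_def)

lemma emeasure_circ: "emeasure circ UNIV = ennreal (2 * pi)"
  by (simp add: circ_def emeasure_density)

lemma finite_measure_circ: "finite_measure circ"
  by (rule finite_measureI) (simp add: emeasure_circ)

interpretation circ: finite_measure circ
  by (rule finite_measure_circ)

interpretation circ2: pair_sigma_finite circ circ
  by unfold_locales

lemma nn_integral_circ: "f \<in> borel_measurable borel \<Longrightarrow> (\<integral>\<^sup>+x. f x \<partial>circ) = (\<integral>\<^sup>+x\<in>{0..2*pi}. f x \<partial>lborel)"
  unfolding circ_def by (subst nn_integral_density) (auto simp: mult.commute)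

lemma AE_circ_iff: "(AE x in circ. P x) \<longleftrightarrow> (AE x in lborel. x \<in> {0..2*pi} \<longrightarrow> P x)"
  unfolding circ_def by (subst AE_density) (auto simp: indicator_def)

lemma integrable_circ:
  fixes f :: "real \<Rightarrow> 'b::euclidean_space"
  assumes "continuous_on UNIV f"
  shows "integrable circ f" and "(LINT x|circ. f x) = integral {0..2*pi} f"
proof -
  have m: "f \<in> borel_measurable lborel"
    using borel_measurable_continuous_onI[OF assms] by simp
  have c: "circ = density lborel (\<lambda>x. ennreal (indicator {0..2*pi} x))"
    unfolding circ_def by (simp add: ennreal_indicator)
  have s: "set_integrable lborel {0..2*pi} f"
    unfolding set_integrable_def
    by (rule borel_integrable_compact) (use assms continuous_on_subset in auto)
  then show "integrable circ f"
    unfolding c set_integrable_def using m by (subst integrable_density) auto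
  show "(LINT x|circ. f x) = integral {0..2*pi} f"
    using set_borel_integral_eq_integral(2)[OF s] m
    unfolding c set_lebesgue_integral_def by (subst integral_density) auto
qed

lemma integral_circ_cis: "(LINT x|circ. cis (real_of_int k * x)) = (if k = 0 then 2 * pi else 0)"
proof -
  have "integral {0..2*pi} (\<lambda>x. cis (real_of_int k * x)) = (if k = 0 then 2 * pi else 0)"
  proof (cases "k = 0")
    case False
    have "((\<lambda>x. cis (real_of_int k * x)) has_integral
        (cis (real_of_int k * (2*pi)) / (\<i> * k) - cis (real_of_int k * 0) / (\<i> * k))) {0..2*pi}"
      by (rule fundamental_theorem_of_calculus)
        (simp, simp only: cis_conv_exp of_real_mult of_real_of_int_eq,
          rule has_vector_derivative_real_field[where f="\<lambda>z. exp (\<i> * (of_int k * z)) / (\<i> * of_int k)"],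
          use False in \<open>auto intro!: derivative_eq_intros simp: mult_ac\<close>)
    moreover have "cis (real_of_int k * (2*pi)) = 1"
      using cis_multiple_2pi[of "real_of_int k"] by (simp add: mult_ac)
    ultimately show ?thesis using False by (auto dest: integral_unique)
  qed (simp add: scaleR_conv_of_real)
  then show ?thesis
    by (subst integrable_circ(2)) (auto intro!: continuous_intros)
qed

lemma Parseval_finite:
  fixes d :: "nat \<Rightarrow> complex"
  assumes "finite A"
  shows "(LINT x|circ. (cmod (\<Sum>n\<in>A. d n * cis (real n * x)))\<^sup>2) = 2 * pi * (\<Sum>n\<in>A. (cmod (d n))\<^sup>2)"
proof -
  have cint: "integrable circ (\<lambda>x. cis (k * x))" for k
    by (rule integrable_circ) (auto intro!: continuous_intros)
  have "complex_of_real (LINT x|circ. (cmod (\<Sum>n\<in>A. d n * cis (real n * x)))\<^sup>2)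
     = (LINT x|circ. complex_of_real ((cmod (\<Sum>n\<in>A. d n * cis (real n * x)))\<^sup>2))"
    by (rule integral_complex_of_real[symmetric])
  also have "\<dots> = (LINT x|circ. (\<Sum>n\<in>A. \<Sum>m\<in>A. (d n * cnj (d m)) * cis (real_of_int (int n - int m) * x)))"
    by (rule Bochner_Integration.integral_cong)
      (auto simp del: of_real_power simp: complex_norm_square sum_product cis_cnj cis_mult algebra_simps intro!: sum.cong)
  also have "\<dots> = (\<Sum>n\<in>A. \<Sum>m\<in>A. (d n * cnj (d m)) * (if int n - int m = 0 then 2 * pi else 0))"
    by (subst Bochner_Integration.integral_sum | subst integral_mult_right_zero integral_circ_cis |
        intro sum.cong refl Bochner_Integration.integrable_sum integrable_mult_right cint)+
  also have "\<dots> = (\<Sum>n\<in>A. (d n * cnj (d n)) * (2 * pi))"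
    using assms by (simp add: sum.delta' if_distrib cong: if_cong)
  also have "\<dots> = complex_of_real (2 * pi * (\<Sum>n\<in>A. (cmod (d n))\<^sup>2))"
    by (simp add: sum_distrib_left sum_distrib_right complex_norm_square[symmetric] mult_ac del: of_real_power)
  finally show ?thesis
    using of_real_eq_iff by blast
qed

lemma Parseval:
  fixes d :: "nat \<Rightarrow> complex"
  assumes "summable (\<lambda>n. cmod (d n))"
  shows "(\<integral>\<^sup>+x. ennreal ((cmod (\<Sum>n. d n * cis (real n * x)))\<^sup>2) \<partial>circ) = ennreal (2 * pi * (\<Sum>n. (cmod (d n))\<^sup>2))"
proof -
  define M where "M = (\<Sum>n. cmod (d n))"
  have sm: "summable (\<lambda>n. d n * cis (real n * x))" for x
    by (rule summable_norm_cancel) (use assms in \<open>simp add: norm_mult\<close>)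
  have lim: "(\<lambda>N. (cmod (\<Sum>n<N. d n * cis (real n * x)))\<^sup>2) \<longlonglongrightarrow> (cmod (\<Sum>n. d n * cis (real n * x)))\<^sup>2" for x
    using summable_LIMSEQ[OF sm] by (intro tendsto_intros)
  have bd: "(cmod (\<Sum>n<N. d n * cis (real n * x)))\<^sup>2 \<le> M\<^sup>2" for x N
  proof -
    have "cmod (\<Sum>n<N. d n * cis (real n * x)) \<le> (\<Sum>n<N. cmod (d n))"
      by (rule sum_norm_le) (simp add: norm_mult)
    also have "\<dots> \<le> M" unfolding M_def by (rule sum_le_suminf) (use assms in auto)
    finally show ?thesis by (simp add: power_mono)
  qed
  have meas: "(\<lambda>x. (cmod (\<Sum>n<N. d n * cis (real n * x)))\<^sup>2) \<in> borel_measurable circ" for N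
    unfolding measurable_cong_sets[OF sets_circ refl]
    by (rule borel_measurable_continuous_onI) (intro continuous_intros)
  have meas2: "(\<lambda>x. (cmod (\<Sum>n. d n * cis (real n * x)))\<^sup>2) \<in> borel_measurable circ"
    by (rule borel_measurable_LIMSEQ_metric[OF meas lim])
  have sq: "summable (\<lambda>n. (cmod (d n))\<^sup>2)"
    by (rule summable_comparison_test_ev[OF _ summable_mult[OF assms, of M]])
      (use assms in \<open>auto intro!: always_eventually mult_right_mono sum_le_suminf[of _ "{_}", simplified] simp: power2_eq_square M_def\<close>)
  have w: "integrable circ (\<lambda>_. M\<^sup>2)" by simp
  have l: "AE x in circ. (\<lambda>N. (cmod (\<Sum>n<N. d n * cis (real n * x)))\<^sup>2) \<longlonglongrightarrow> (cmod (\<Sum>n. d n * cis (real n * x)))\<^sup>2"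
    using lim by simp
  have b: "AE x in circ. norm ((cmod (\<Sum>n<N. d n * cis (real n * x)))\<^sup>2) \<le> M\<^sup>2" for N
    using bd by simp
  note dct = integrable_dominated_convergence[OF meas2 meas w l b] integral_dominated_convergence[OF meas2 meas w l b]
  have "(\<lambda>N. LINT x|circ. (cmod (\<Sum>n<N. d n * cis (real n * x)))\<^sup>2) \<longlonglongrightarrow> 2 * pi * (\<Sum>n. (cmod (d n))\<^sup>2)"
    using summable_LIMSEQ[OF sq] by (simp add: Parseval_finite tendsto_mult_left)
  with dct(2) have "(LINT x|circ. (cmod (\<Sum>n. d n * cis (real n * x)))\<^sup>2) = 2 * pi * (\<Sum>n. (cmod (d n))\<^sup>2)"
    by (rule LIMSEQ_unique)
  then show ?thesis
    by (subst nn_integral_eq_integral[OF dct(1)]) auto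
qed

lemma holomorphic_disc_series:
  assumes "h holomorphic_on ball 0 1"
  obtains c where "\<And>z. cmod z < 1 \<Longrightarrow> (\<lambda>n. c n * z ^ n) sums h z"
    and "\<And>r. 0 \<le> r \<Longrightarrow> r < 1 \<Longrightarrow> summable (\<lambda>n. cmod (c n) * r ^ n)"
proof -
  define c where "c n = (deriv ^^ n) h 0 / fact n" for n
  have s: "(\<lambda>n. c n * z ^ n) sums h z" if "cmod z < 1" for z
    using holomorphic_power_series[OF assms, of z] that by (simp add: c_def)
  have "summable (\<lambda>n. cmod (c n) * r ^ n)" if "0 \<le> r" "r < 1" for r
  proof -
    \<comment> \<open>Convergence at the larger radius (1+r)/2 gives absolute convergence at
      r.\<close>
    have "summable (\<lambda>n. c n * (complex_of_real ((1+r)/2)) ^ n)"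
      using s[of "complex_of_real ((1+r)/2)"] that by (auto simp: sums_iff norm_of_real simp del: of_real_divide of_real_add)
    from powser_insidea[OF this, of "complex_of_real r"] that show ?thesis
      by (simp add: norm_mult norm_power del: of_real_divide of_real_add)
  qed
  with s show ?thesis using that by blast
qed

lemma cauchy_circ:
  fixes h :: "complex \<Rightarrow> complex"
  assumes "h holomorphic_on ball 0 R" "1 < R" "cmod z < 1"
  shows "(LINT x|circ. h (cis x) * cis x / (cis x - z)) = 2 * pi * h z"
proof -
  have "cball 0 1 \<subseteq> ball (0::complex) R" using assms by auto
  then have hol: "h holomorphic_on cball 0 1" using assms holomorphic_on_subset by blast
  have "((\<lambda>u. h u / (u - z)) has_contour_integral 2 * complex_of_real pi * \<i> * h z) (circlepath 0 1)"
    by (rule Cauchy_integral_circlepath_simple[OF hol]) (use assms in simp)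
  then have "((\<lambda>t. h (cis t) / (cis t - z) * \<i> * cis t) has_integral 2 * complex_of_real pi * \<i> * h z) {0..2*pi}"
    by (simp add: circlepath_def has_contour_integral_part_circlepath_iff)
  from has_integral_mult_right[OF this, of "-\<i>"]
  have *: "((\<lambda>t. h (cis t) * cis t / (cis t - z)) has_integral 2 * complex_of_real pi * h z) {0..2*pi}"
    by (simp add: mult_ac)
  have "continuous_on UNIV (\<lambda>x. h (cis x) * cis x / (cis x - z))"
  proof (intro continuous_intros ballI)
    show "continuous_on UNIV (\<lambda>x. h (cis x))"
      by (rule continuous_on_compose2[OF holomorphic_on_imp_continuous_on[OF hol]]) (auto intro!: continuous_intros)
    show "cis x - z \<noteq> 0" for x using assms(3) by auto
  qed
  from integrable_circ(2)[OF this] * show ?thesis by (simp add: integral_unique)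
qed

text \<open>The Poisson kernel without the factor 1/(2 pi): for 0 <= r < 1 its integral over
  \<open>circ\<close> is 2 pi.\<close>

definition pk :: "real \<Rightarrow> real \<Rightarrow> real" where
  "pk r x = (1 - r\<^sup>2) / (cmod (1 - of_real r * cis x))\<^sup>2"

lemma pk_denom_pos: "0 \<le> r \<Longrightarrow> r < 1 \<Longrightarrow> 1 - r \<le> cmod (1 - of_real r * cis x)"
  using norm_triangle_ineq2[of 1 "of_real r * cis x"] by (simp add: norm_mult)

lemma pk_nonneg: "0 \<le> r \<Longrightarrow> r < 1 \<Longrightarrow> 0 \<le> pk r x"
  by (simp add: pk_def abs_square_le_1)

lemma pk_minus: "pk r (- x) = pk r x"
proof -
  have "1 - of_real r * cis (-x) = cnj (1 - of_real r * cis x)"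
    by (simp add: cis_cnj)
  then show ?thesis unfolding pk_def by (simp only: complex_mod_cnj)
qed

lemma pk_measurable [measurable]: "(\<lambda>p. pk (fst p) (snd p)) \<in> borel_measurable borel"
  unfolding pk_def cis_conv_exp borel_prod[symmetric]
  by measurable

lemma pk_measurable' [measurable (raw)]:
  assumes [measurable]: "r \<in> borel_measurable M" "x \<in> borel_measurable M"
  shows "(\<lambda>w. pk (r w) (x w)) \<in> borel_measurable M"
  using measurable_compose[OF _ pk_measurable, of "\<lambda>w. (r w, x w)" M] by (simp add: borel_prod[symmetric])

text \<open>If r is the smaller radius, replacing r by r s at most doubles the numerator 1 - r^2 and
  at most halves the distance |1 - r e^(ix)|, whence 8 = 2 * 4. The sum on the right makes the bound
  independent of which radius is the smaller one.\<close>

lemma pk_le: 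
  assumes "0 \<le> r" "r < 1" "0 \<le> s" "s < 1"
  shows "pk (r * s) x \<le> 8 * (pk r x + pk s x)"
proof -
  have main: "pk (r * s) x \<le> 8 * pk r x" if rs: "0 \<le> r" "r \<le> s" "s < 1" for r s
  proof -
    have r1: "r < 1" using rs by simp
    have "r * s \<le> r" using rs by (simp add: mult_left_le)
    then have rs1: "r * s < 1" "0 \<le> r * s" using rs by auto
    let ?a = "cmod (1 - of_real r * cis x)" and ?b = "cmod (1 - of_real (r * s) * cis x)"
    have "?a \<le> ?b + cmod (of_real (r * s) * cis x - of_real r * cis x)"
      using norm_triangle_ineq[of "1 - of_real (r * s) * cis x" "of_real (r * s) * cis x - of_real r * cis x"] by simp
    also have "cmod (of_real (r * s) * cis x - of_real r * cis x) = r * (1 - s)"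
    proof -
      have "of_real (r * s) * cis x - of_real r * cis x = of_real (- (r * (1 - s))) * cis x"
        by (simp add: algebra_simps)
      then show ?thesis using rs by (simp add: norm_mult del: of_real_mult of_real_minus)
    qed
    also have "r * (1 - s) \<le> 1 - r * s" using r1 by (simp add: algebra_simps)
    also have "1 - r * s \<le> ?b" by (rule pk_denom_pos) (use rs1 in auto)
    finally have ab: "?a \<le> 2 * ?b" by simp
    have a0: "0 < ?a" using pk_denom_pos[of r x] rs(1) r1 by linarith
    have b0: "0 < ?b" using pk_denom_pos[of "r * s" x] rs1 by linarith
    have "?a\<^sup>2 \<le> (2 * ?b)\<^sup>2" using ab a0 by (intro power_mono) auto
    then have ab2: "?a\<^sup>2 \<le> 4 * ?b\<^sup>2" by (simp add: power_mult_distrib)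
    have "r\<^sup>2 * r\<^sup>2 \<le> r\<^sup>2 * s\<^sup>2" using rs by (intro mult_left_mono power_mono) auto
    moreover have "0 \<le> (1 - r\<^sup>2)\<^sup>2" by simp
    ultimately have num: "1 - (r * s)\<^sup>2 \<le> 2 * (1 - r\<^sup>2)"
      by (simp add: power_mult_distrib power2_eq_square algebra_simps)
    have n0: "0 \<le> 1 - r\<^sup>2" using rs r1 by (simp add: abs_square_le_1)
    have "pk (r * s) x \<le> (2 * (1 - r\<^sup>2)) / ?b\<^sup>2"
      unfolding pk_def using num by (intro divide_right_mono) auto
    also have "\<dots> \<le> (2 * (1 - r\<^sup>2)) / (?a\<^sup>2 / 4)"
      using ab2 n0 a0 b0 by (intro divide_left_mono) (auto intro!: mult_pos_pos)
    also have "\<dots> = 8 * pk r x" by (simp add: pk_def)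
    finally show ?thesis .
  qed
  show ?thesis
  proof (cases "r \<le> s")
    case True
    then show ?thesis using main[of r s] pk_nonneg[of s x] assms by (simp add: distrib_left)
  next
    case False
    then show ?thesis using main[of s r] pk_nonneg[of r x] assms by (simp add: distrib_left mult.commute)
  qed
qed

lemma poisson_circ:
  fixes h :: "complex \<Rightarrow> complex"
  assumes "h holomorphic_on ball 0 R" "1 < R" "0 \<le> r" "r < 1"
  shows "(LINT x|circ. of_real (pk r (t - x)) * h (cis x)) = 2 * pi * h (of_real r * cis t)"
proof -
  define z where "z = of_real r * cis t"
  have z1: "cmod z < 1" using assms by (simp add: z_def norm_mult)
  \<comment> \<open>\<open>h2\<close> carries the antiholomorphic half of the kernel: on the circle
    it equals h times cnj u / (1 - cnj u), where u = r cis (t - x). It is nevertheless holomorphic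
    across the circle and vanishes at 0, so its mean is zero and only the Cauchy half
    contributes.\<close>
  define h2 where "h2 w = h w * cnj z * w / (1 - cnj z * w)" for w
  \<comment> \<open>The pole of \<open>h2\<close> has modulus 1/r; \<open>R'\<close> keeps it
    outside the disc.\<close>
  define R' where "R' = (if r = 0 then R else min R (1 / r))"
  have R': "1 < R'" using assms by (auto simp: R'_def)
  have nz: "1 - cnj z * w \<noteq> 0" if "cmod w < R'" for w
  proof
    assume "1 - cnj z * w = 0"
    then have "cmod (cnj z * w) = 1" by (metis diff_eq_diff_eq diff_self norm_one right_minus_eq)
    then have "r * cmod w = 1" using assms by (simp add: norm_mult z_def)
    then show False using that assms by (auto simp: R'_def field_simps split: if_splits)
  qed
  have "ball 0 R' \<subseteq> ball (0::complex) R" by (auto simp: R'_def)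
  then have "h holomorphic_on ball 0 R'" using assms holomorphic_on_subset by blast
  then have h2: "h2 holomorphic_on ball 0 R'"
    unfolding h2_def using nz by (intro holomorphic_intros) auto
  have nz1: "cis x - z \<noteq> 0" for x using z1 by auto
  have ch: "continuous_on UNIV (\<lambda>x. h (cis x))"
    by (rule continuous_on_compose2[OF holomorphic_on_imp_continuous_on[OF assms(1)]]) (use assms in \<open>auto intro!: continuous_intros\<close>)
  have e1: "(LINT x|circ. h (cis x) * cis x / (cis x - z)) = 2 * pi * h z"
    by (rule cauchy_circ[OF assms(1,2) z1])
  have e2: "(LINT x|circ. h2 (cis x)) = 0"
  proof -
    have "(LINT x|circ. h2 (cis x) * cis x / (cis x - 0)) = 2 * pi * h2 0"
      by (rule cauchy_circ[OF h2 R']) simp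
    then show ?thesis by (simp add: h2_def)
  qed
  have nzz: "1 - cnj z * cis x \<noteq> 0" for x using nz[of "cis x"] R' by simp
  have i1: "integrable circ (\<lambda>x. h (cis x) * cis x / (cis x - z))"
    by (rule integrable_circ) (intro continuous_intros ballI continuous_on_subset[OF ch] nz1; simp)
  have i2: "integrable circ (\<lambda>x. h2 (cis x))"
    unfolding h2_def
    by (rule integrable_circ) (intro continuous_intros ballI continuous_on_subset[OF ch] nzz; simp)
  have eq: "of_real (pk r (t - x)) * h (cis x) = h (cis x) * cis x / (cis x - z) + h2 (cis x)" for x
  proof -
    define u where "u = of_real r * cis (t - x)"
    have z: "z = u * cis x" by (simp add: z_def u_def cis_mult)
    have cz: "cnj z * cis x = cnj u" by (simp add: z cis_cnj cis_mult)
    have nu: "1 - u \<noteq> 0" using nz1[of x] by (auto simp: z)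
    have cu: "1 - cnj u \<noteq> 0" using nzz[of x] by (simp add: cz)
    have nsq: "of_real ((cmod (1 - u))\<^sup>2) = (1 - u) * (1 - cnj u)"
      by (simp add: complex_norm_square del: of_real_power)
    have usq: "of_real (r\<^sup>2) = u * cnj u"
      by (simp add: u_def cis_cnj cis_mult power2_eq_square)
    have "complex_of_real (pk r (t - x)) = (1 - u * cnj u) / ((1 - u) * (1 - cnj u))"
      unfolding pk_def u_def[symmetric] by (simp only: of_real_divide of_real_diff of_real_1 nsq usq)
    also have "\<dots> = 1 / (1 - u) + cnj u / (1 - cnj u)"
      using nu cu by (simp add: divide_simps) (simp add: algebra_simps)
    also have "1 / (1 - u) = cis x / (cis x - z)"
      using nu nz1[of x] by (simp add: z divide_simps) (simp add: algebra_simps)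
    finally show ?thesis
      using cz by (simp add: h2_def algebra_simps)
  qed
  have "(LINT x|circ. of_real (pk r (t - x)) * h (cis x)) = 2 * pi * h z"
    unfolding eq by (subst Bochner_Integration.integral_add[OF i1 i2]) (simp add: e1 e2)
  then show ?thesis by (simp add: z_def)
qed

text \<open>The semigroup law of the Poisson kernel: \<open>poisson_circ\<close> is applied to the
  Herglotz function (1+u)/(1-u), whose real part is the kernel of radius s.\<close>

lemma pk_convolution:
  assumes "0 \<le> r" "r < 1" "0 \<le> s" "s < 1"
  shows "(\<integral>\<^sup>+x. ennreal (pk r (t - x) * pk s (t' - x)) \<partial>circ) = ennreal (2 * pi * pk (r * s) (t - t'))"
proof -
  define h where "h w = (1 + of_real s * cis (-t') * w) / (1 - of_real s * cis (-t') * w)" for w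
  define R where "R = (if s = 0 then 2 else 1 / s)"
  have R: "1 < R" using assms by (auto simp: R_def)
  have nz: "1 - of_real s * cis (-t') * w \<noteq> 0" if "cmod w < R" for w
  proof
    assume "1 - of_real s * cis (-t') * w = 0"
    then have "cmod (of_real s * cis (-t') * w) = 1" by (metis diff_eq_diff_eq diff_self norm_one right_minus_eq)
    then have "s * cmod w = 1" using assms by (simp add: norm_mult)
    then show False using that assms by (auto simp: R_def field_simps split: if_splits)
  qed
  have hol: "h holomorphic_on ball 0 R"
    unfolding h_def using nz by (intro holomorphic_intros) auto
  have Reh: "Re ((1 + u) / (1 - u)) = (1 - (cmod u)\<^sup>2) / (cmod (1 - u))\<^sup>2" for u
    by (simp add: Re_divide cmod_power2) (simp add: power2_eq_square algebra_simps)
  have Re1: "Re (h (of_real q * cis x)) = pk (q * s) (x - t')" if "0 \<le> q" for q x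
  proof -
    define u where "u = of_real (q * s) * cis (x - t')"
    have "of_real s * cis (-t') * (of_real q * cis x) = u"
      by (simp add: u_def cis_mult[symmetric] diff_conv_add_uminus mult_ac del: add_uminus_conv_diff)
    then have "h (of_real q * cis x) = (1 + u) / (1 - u)" by (simp add: h_def)
    moreover have "cmod u = q * s" using that assms by (simp add: u_def norm_mult)
    ultimately show ?thesis using Reh[of u] by (simp add: pk_def u_def)
  qed
  have ch: "continuous_on UNIV (\<lambda>x. h (cis x))"
    by (rule continuous_on_compose2[OF holomorphic_on_imp_continuous_on[OF hol]]) (use R in \<open>auto intro!: continuous_intros\<close>)
  have nz1: "1 - of_real r * cis (t - x) \<noteq> 0" for x
    using pk_denom_pos[of r "t - x"] assms by auto
  have cp: "continuous_on UNIV (\<lambda>x. pk r (t - x))"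
    unfolding pk_def by (intro continuous_intros) (use nz1 in auto)
  have int: "integrable circ (\<lambda>x. of_real (pk r (t - x)) * h (cis x))"
    by (rule integrable_circ) (intro continuous_intros ballI continuous_on_subset[OF ch] continuous_on_subset[OF cp]; simp)
  have *: "Re (of_real (pk r (t - x)) * h (cis x)) = pk r (t - x) * pk s (t' - x)" for x
    using Re1[of 1 x] pk_minus[of s "x - t'"] by simp
  have "(LINT x|circ. pk r (t - x) * pk s (t' - x)) = Re (LINT x|circ. of_real (pk r (t - x)) * h (cis x))"
    using integral_Re[OF int] by (simp only: *)
  also have "\<dots> = 2 * pi * pk (r * s) (t - t')"
    unfolding poisson_circ[OF hol R assms(1,2)] using Re1[of r t] assms by simp
  finally have "(LINT x|circ. pk r (t - x) * pk s (t' - x)) = 2 * pi * pk (r * s) (t - t')" .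
  moreover have "integrable circ (\<lambda>x. pk r (t - x) * pk s (t' - x))"
    using integrable_Re[OF int] by (simp only: *)
  ultimately show ?thesis
    by (subst nn_integral_eq_integral) (use assms pk_nonneg in auto)
qed

section \<open>The radial maximal function\<close>

text \<open>With a radius \<open>\<rho> t\<close> chosen at each point t, \<open>T\<close> is the
  adjoint of the linearized maximal operator applied to g. Expanding the square of its norm and
  using the semigroup law produces the kernel of radius \<open>\<rho> t * \<rho> t'\<close>; by
  \<open>pk_le\<close> it splits into two copies of the original kernel. So the quantity X satisfies
  X <= 32 pi <g, T>, and Cauchy-Schwarz gives X^2 <= (32 pi)^2 G X.\<close>

lemma pk_transpose_bound:
  fixes \<rho> :: "real \<Rightarrow> real" and g :: "real \<Rightarrow> ennreal"
  assumes [measurable]: "\<rho> \<in> borel_measurable borel" "g \<in> borel_measurable borel"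
    and \<rho>: "\<And>t. 0 \<le> \<rho> t" "\<And>t. \<rho> t \<le> b" and b: "b < 1"
    and fin: "(\<integral>\<^sup>+t. (g t)\<^sup>2 \<partial>circ) < \<infinity>"
  defines "T \<equiv> \<lambda>x. \<integral>\<^sup>+t. ennreal (pk (\<rho> t) (t - x)) * g t \<partial>circ"
  shows "(\<integral>\<^sup>+x. (T x)\<^sup>2 \<partial>circ) \<le> ennreal ((32 * pi)\<^sup>2) * (\<integral>\<^sup>+t. (g t)\<^sup>2 \<partial>circ)"
proof -
  have \<rho>1: "\<rho> t < 1" for t using \<rho>(2)[of t] b by linarith
  have b0: "0 \<le> b" using \<rho>(1)[of 0] \<rho>(2)[of 0] by linarith
  have [measurable]: "T \<in> borel_measurable circ" unfolding T_def by measurable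
  define G where "G = (\<integral>\<^sup>+t. (g t)\<^sup>2 \<partial>circ)"
  define X where "X = (\<integral>\<^sup>+x. (T x)\<^sup>2 \<partial>circ)"
  have Xeq: "X = (\<integral>\<^sup>+t. \<integral>\<^sup>+t'. ennreal (2 * pi * pk (\<rho> t * \<rho> t') (t - t')) * (g t * g t') \<partial>circ \<partial>circ)"
  proof -
    have "X = (\<integral>\<^sup>+x. \<integral>\<^sup>+t. \<integral>\<^sup>+t'. ennreal (pk (\<rho> t) (t - x) * pk (\<rho> t') (t' - x)) * (g t * g t') \<partial>circ \<partial>circ \<partial>circ)"
      unfolding X_def
    proof (rule nn_integral_cong)
      fix x
      have "(T x)\<^sup>2 = T x * T x" by (rule power2_eq_square)
      also have "\<dots> = (\<integral>\<^sup>+t. ennreal (pk (\<rho> t) (t - x)) * g t * T x \<partial>circ)"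
        unfolding T_def by (rule nn_integral_multc[symmetric]) measurable
      also have "\<dots> = (\<integral>\<^sup>+t. \<integral>\<^sup>+t'. ennreal (pk (\<rho> t) (t - x)) * g t * (ennreal (pk (\<rho> t') (t' - x)) * g t') \<partial>circ \<partial>circ)"
        by (rule nn_integral_cong, unfold T_def, rule nn_integral_cmult[symmetric]) measurable
      also have "\<dots> = (\<integral>\<^sup>+t. \<integral>\<^sup>+t'. ennreal (pk (\<rho> t) (t - x) * pk (\<rho> t') (t' - x)) * (g t * g t') \<partial>circ \<partial>circ)"
        by (intro nn_integral_cong) (simp add: ennreal_mult pk_nonneg \<rho> \<rho>1 mult_ac)
      finally show "(T x)\<^sup>2 = \<dots>" .
    qed
    also have "\<dots> = (\<integral>\<^sup>+t. \<integral>\<^sup>+x. \<integral>\<^sup>+t'. ennreal (pk (\<rho> t) (t - x) * pk (\<rho> t') (t' - x)) * (g t * g t') \<partial>circ \<partial>circ \<partial>circ)"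
      by (rule circ2.Fubini') measurable
    also have "\<dots> = (\<integral>\<^sup>+t. \<integral>\<^sup>+t'. \<integral>\<^sup>+x. ennreal (pk (\<rho> t) (t - x) * pk (\<rho> t') (t' - x)) * (g t * g t') \<partial>circ \<partial>circ \<partial>circ)"
      by (rule nn_integral_cong, rule circ2.Fubini') measurable
    also have "\<dots> = (\<integral>\<^sup>+t. \<integral>\<^sup>+t'. ennreal (2 * pi * pk (\<rho> t * \<rho> t') (t - t')) * (g t * g t') \<partial>circ \<partial>circ)"
      by (intro nn_integral_cong) (simp add: nn_integral_multc pk_convolution \<rho> \<rho>1)
    finally show ?thesis .
  qed
  have pkle: "ennreal (2 * pi * pk (\<rho> t * \<rho> t') (t - t'))
      \<le> ennreal (16 * pi) * (ennreal (pk (\<rho> t) (t - t')) + ennreal (pk (\<rho> t') (t' - t)))" for t t'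
  proof -
    have "2 * pi * pk (\<rho> t * \<rho> t') (t - t') \<le> 2 * pi * (8 * (pk (\<rho> t) (t - t') + pk (\<rho> t') (t - t')))"
      using pk_le[of "\<rho> t" "\<rho> t'"] \<rho> \<rho>1 by (intro mult_left_mono) auto
    also have "pk (\<rho> t') (t - t') = pk (\<rho> t') (t' - t)"
      using pk_minus[of "\<rho> t'" "t - t'"] by simp
    finally have le: "2 * pi * pk (\<rho> t * \<rho> t') (t - t') \<le> 16 * pi * (pk (\<rho> t) (t - t') + pk (\<rho> t') (t' - t))"
      by simp
    have nn: "0 \<le> pk (\<rho> t) (t - t')" "0 \<le> pk (\<rho> t') (t' - t)" using pk_nonneg \<rho> \<rho>1 by auto
    have "ennreal (16 * pi) * (ennreal (pk (\<rho> t) (t - t')) + ennreal (pk (\<rho> t') (t' - t)))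
       = ennreal (16 * pi * (pk (\<rho> t) (t - t') + pk (\<rho> t') (t' - t)))"
      using nn by (simp add: ennreal_mult)
    then show ?thesis using le by (simp only: ennreal_leI)
  qed
  have tx: "(\<integral>\<^sup>+t. ennreal (pk (\<rho> t) (t - x)) * g t * g x \<partial>circ) = g x * T x" for x
    unfolding T_def mult.commute[of "g x"] by (rule nn_integral_multc) measurable
  have "X \<le> (\<integral>\<^sup>+t. \<integral>\<^sup>+t'. ennreal (16 * pi) * (ennreal (pk (\<rho> t) (t - t')) + ennreal (pk (\<rho> t') (t' - t))) * (g t * g t') \<partial>circ \<partial>circ)"
    unfolding Xeq by (intro nn_integral_mono mult_right_mono pkle) simp
  also have "\<dots> = ennreal (16 * pi) * ((\<integral>\<^sup>+t. \<integral>\<^sup>+t'. ennreal (pk (\<rho> t) (t - t')) * g t * g t' \<partial>circ \<partial>circ)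
      + (\<integral>\<^sup>+t. \<integral>\<^sup>+t'. ennreal (pk (\<rho> t') (t' - t)) * g t' * g t \<partial>circ \<partial>circ))"
  proof -
    have e: "c * (A + B) * (a * b) = c * (A * a * b + B * b * a)" for c A B a b :: ennreal
      by (simp add: distrib_left distrib_right mult_ac)
    show ?thesis unfolding e by (simp add: nn_integral_cmult nn_integral_add)
  qed
  finally have X00: "X \<le> ennreal (16 * pi) * ((\<integral>\<^sup>+t. \<integral>\<^sup>+t'. ennreal (pk (\<rho> t) (t - t')) * g t * g t' \<partial>circ \<partial>circ)
      + (\<integral>\<^sup>+t. \<integral>\<^sup>+t'. ennreal (pk (\<rho> t') (t' - t)) * g t' * g t \<partial>circ \<partial>circ))" .
  have "(\<integral>\<^sup>+t. \<integral>\<^sup>+t'. ennreal (pk (\<rho> t) (t - t')) * g t * g t' \<partial>circ \<partial>circ)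
      = (\<integral>\<^sup>+t'. \<integral>\<^sup>+t. ennreal (pk (\<rho> t) (t - t')) * g t * g t' \<partial>circ \<partial>circ)"
    by (rule circ2.Fubini') measurable
  also have "\<dots> = (\<integral>\<^sup>+x. g x * T x \<partial>circ)"
    by (simp only: tx)
  finally have s1: "(\<integral>\<^sup>+t. \<integral>\<^sup>+t'. ennreal (pk (\<rho> t) (t - t')) * g t * g t' \<partial>circ \<partial>circ) = (\<integral>\<^sup>+x. g x * T x \<partial>circ)" .
  have s2: "(\<integral>\<^sup>+t. \<integral>\<^sup>+t'. ennreal (pk (\<rho> t') (t' - t)) * g t' * g t \<partial>circ \<partial>circ) = (\<integral>\<^sup>+x. g x * T x \<partial>circ)"
    by (simp only: tx)
  have X0: "X \<le> ennreal (16 * pi) * ((\<integral>\<^sup>+x. g x * T x \<partial>circ) + (\<integral>\<^sup>+x. g x * T x \<partial>circ))"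
    using X00 unfolding s1 s2 .
  have "ennreal (32 * pi) = ennreal (16 * pi) + ennreal (16 * pi)"
    by (subst ennreal_plus[symmetric]) auto
  with X0 have X1: "X \<le> ennreal (32 * pi) * (\<integral>\<^sup>+x. g x * T x \<partial>circ)"
    by (simp only: distrib_left distrib_right)
  have cs: "(\<integral>\<^sup>+x. g x * T x \<partial>circ)\<^sup>2 \<le> G * X"
    unfolding G_def X_def by (rule Cauchy_Schwarz_nn_integral) auto
  have "X\<^sup>2 \<le> (ennreal (32 * pi) * (\<integral>\<^sup>+x. g x * T x \<partial>circ))\<^sup>2"
    using X1 by (intro power_mono) auto
  also have "\<dots> \<le> ennreal ((32 * pi)\<^sup>2) * (G * X)"
  proof -
    have "(ennreal (32 * pi))\<^sup>2 = ennreal ((32 * pi)\<^sup>2)" by (rule ennreal_power) simp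
    then show ?thesis unfolding power_mult_distrib[of "ennreal (32 * pi)"] by (simp only:) (rule mult_left_mono[OF cs zero_le])
  qed
  finally have X2: "X * X \<le> (ennreal ((32 * pi)\<^sup>2) * G) * X" by (simp add: power2_eq_square mult.assoc)
  \<comment> \<open>Finiteness allows X to be cancelled from X * X <= C * X. It is the reason for
    keeping the radii below a fixed b < 1, where the kernel is at most 1/(1-b)^2; this b does not
    enter the final constant.\<close>
  have "X < \<infinity>"
  proof -
    have pkb: "pk (\<rho> t) x \<le> 1 / (1 - b)\<^sup>2" for t x
    proof -
      have "1 - b \<le> cmod (1 - of_real (\<rho> t) * cis x)"
        using pk_denom_pos[of "\<rho> t" x] \<rho>[of t] \<rho>1[of t] by linarith
      then have "(1 - b)\<^sup>2 \<le> (cmod (1 - of_real (\<rho> t) * cis x))\<^sup>2" using b by (intro power_mono) auto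
      then show ?thesis unfolding pk_def using b \<rho>[of t] \<rho>1[of t]
        by (intro frac_le) (auto simp: abs_square_le_1)
    qed
    define I where "I = (\<integral>\<^sup>+t. g t \<partial>circ)"
    have "I\<^sup>2 \<le> G * (\<integral>\<^sup>+t. 1 \<partial>circ)"
      using Cauchy_Schwarz_nn_integral[of g circ "\<lambda>_. 1"] by (simp add: I_def G_def)
    also have "\<dots> < \<infinity>" using fin by (simp add: G_def emeasure_circ ennreal_mult_less_top)
    finally have I: "I < \<infinity>" by (simp add: power_less_top_ennreal)
    have Tb: "T x \<le> ennreal (1 / (1 - b)\<^sup>2) * I" for x
      unfolding T_def I_def
      by (subst nn_integral_cmult[symmetric]) (auto intro!: nn_integral_mono mult_right_mono ennreal_leI pkb)
    have "X \<le> (\<integral>\<^sup>+x. (ennreal (1 / (1 - b)\<^sup>2) * I)\<^sup>2 \<partial>circ)"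
      unfolding X_def by (intro nn_integral_mono power_mono Tb) auto
    also have "\<dots> < \<infinity>" using I by (simp add: emeasure_circ ennreal_mult_less_top power_less_top_ennreal)
    finally show ?thesis .
  qed
  have "X \<le> ennreal ((32 * pi)\<^sup>2) * G"
  proof (cases "X = 0")
    case False
    have "X \<noteq> top" using \<open>X < \<infinity>\<close> by auto
    have "X = X * X / X" using False \<open>X \<noteq> top\<close> by (simp add: ennreal_mult_divide_eq)
    also have "\<dots> \<le> (ennreal ((32 * pi)\<^sup>2) * G) * X / X" by (rule divide_right_mono_ennreal[OF X2])
    also have "\<dots> = ennreal ((32 * pi)\<^sup>2) * G" using False \<open>X \<noteq> top\<close> by (simp add: ennreal_mult_divide_eq)
    finally show ?thesis .
  qed simp
  then show ?thesis by (simp add: X_def G_def)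
qed

text \<open>Duality: pairing the Poisson representation with g moves the kernel onto g, so 2 pi G <=
  <T, u>, and \<open>pk_transpose_bound\<close> estimates T. The constant is (32 pi)^2 / (2 pi)^2 =
  256.\<close>

lemma linearized_maximal_bound:
  fixes h :: "complex \<Rightarrow> complex"
  assumes h: "h holomorphic_on ball 0 R" "1 < R"
    and [measurable]: "\<rho> \<in> borel_measurable borel"
    and \<rho>: "\<And>t. 0 \<le> \<rho> t" "\<And>t. \<rho> t \<le> b" and b: "b < 1"
  shows "(\<integral>\<^sup>+t. ennreal ((cmod (h (of_real (\<rho> t) * cis t)))\<^sup>2) \<partial>circ) \<le> 256 * (\<integral>\<^sup>+t. ennreal ((cmod (h (cis t)))\<^sup>2) \<partial>circ)"
proof -
  have \<rho>1: "\<rho> t < 1" for t using \<rho>(2)[of t] b by linarith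
  have ch: "continuous_on (cball 0 1) h"
    by (rule continuous_on_subset[OF holomorphic_on_imp_continuous_on[OF h(1)]]) (use h(2) in auto)
  \<comment> \<open>Nothing is known of h far from the disc, so measurability is established for its
    extension by zero, which agrees with h at every point that occurs.\<close>
  define hb where "hb z = (if z \<in> cball 0 1 then h z else 0)" for z
  have [measurable]: "hb \<in> borel_measurable borel"
    unfolding hb_def by (rule borel_measurable_continuous_on_if) (use ch in auto)
  have in1: "of_real (\<rho> t) * cis t \<in> cball 0 1" "cis t \<in> cball 0 1" for t
    using \<rho>(1)[of t] \<rho>1[of t] by (auto simp: norm_mult)
  have [measurable]: "cis \<in> borel_measurable borel"
    by (intro borel_measurable_continuous_onI continuous_intros)
  have [measurable]: "(\<lambda>t. complex_of_real (\<rho> t)) \<in> borel_measurable borel"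
    by (rule measurable_compose[OF assms(3)]) (intro borel_measurable_continuous_onI continuous_intros)
  define g where "g t = ennreal (cmod (h (of_real (\<rho> t) * cis t)))" for t
  define u where "u t = ennreal (cmod (h (cis t)))" for t
  have "g = (\<lambda>t. ennreal (cmod (hb (of_real (\<rho> t) * cis t))))" "u = (\<lambda>t. ennreal (cmod (hb (cis t))))"
    using in1 by (auto simp: g_def u_def hb_def fun_eq_iff)
  then have [measurable]: "g \<in> borel_measurable borel" "u \<in> borel_measurable borel" by simp_all
  obtain B where B: "\<And>z. z \<in> cball 0 1 \<Longrightarrow> cmod (h z) \<le> B"
    using compact_imp_bounded[OF compact_continuous_image[OF ch compact_cball]] by (force simp: bounded_iff)
  have gB: "g t \<le> ennreal B" for t unfolding g_def using B in1 by (intro ennreal_leI) auto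
  define G where "G = (\<integral>\<^sup>+t. (g t)\<^sup>2 \<partial>circ)"
  have "G \<le> (\<integral>\<^sup>+t. (ennreal B)\<^sup>2 \<partial>circ)" unfolding G_def by (intro nn_integral_mono power_mono gB) auto
  also have "\<dots> < \<infinity>" by (simp add: emeasure_circ ennreal_mult_less_top power_less_top_ennreal)
  finally have Gfin: "G < \<infinity>" .
  define T where "T = (\<lambda>x. \<integral>\<^sup>+t. ennreal (pk (\<rho> t) (t - x)) * g t \<partial>circ)"
  have [measurable]: "T \<in> borel_measurable circ" unfolding T_def by measurable
  have TT: "(\<integral>\<^sup>+x. (T x)\<^sup>2 \<partial>circ) \<le> ennreal ((32 * pi)\<^sup>2) * G"
    unfolding T_def G_def by (rule pk_transpose_bound[OF _ _ \<rho> b]) (use Gfin in \<open>auto simp: G_def\<close>)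
  define U where "U = (\<integral>\<^sup>+t. (u t)\<^sup>2 \<partial>circ)"
  have gp: "ennreal (2 * pi) * g t \<le> (\<integral>\<^sup>+x. ennreal (pk (\<rho> t) (t - x)) * u x \<partial>circ)" for t
  proof -
    have nz1: "1 - of_real (\<rho> t) * cis (t - x) \<noteq> 0" for x
      using pk_denom_pos[of "\<rho> t" "t - x"] \<rho>[of t] \<rho>1[of t] by auto
    have int: "integrable circ (\<lambda>x. of_real (pk (\<rho> t) (t - x)) * h (cis x))"
      by (rule integrable_circ, unfold pk_def)
        (intro continuous_intros continuous_on_compose2[OF ch]; use nz1 in auto)
    have "2 * pi * cmod (h (of_real (\<rho> t) * cis t)) = cmod (LINT x|circ. of_real (pk (\<rho> t) (t - x)) * h (cis x))"
      unfolding poisson_circ[OF h \<rho>(1) \<rho>1] by (simp add: norm_mult)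
    also have "\<dots> \<le> (LINT x|circ. cmod (of_real (pk (\<rho> t) (t - x)) * h (cis x)))"
      by (rule integral_norm_bound)
    finally have "ennreal (2 * pi * cmod (h (of_real (\<rho> t) * cis t))) \<le> ennreal (LINT x|circ. cmod (of_real (pk (\<rho> t) (t - x)) * h (cis x)))"
      by (rule ennreal_leI)
    also have "\<dots> = (\<integral>\<^sup>+x. ennreal (cmod (of_real (pk (\<rho> t) (t - x)) * h (cis x))) \<partial>circ)"
      by (rule nn_integral_eq_integral[symmetric]) (use int in auto)
    also have "\<dots> = (\<integral>\<^sup>+x. ennreal (pk (\<rho> t) (t - x)) * u x \<partial>circ)"
      by (auto simp: norm_mult u_def ennreal_mult pk_nonneg \<rho> \<rho>1 intro!: nn_integral_cong)
    finally show ?thesis by (simp add: g_def ennreal_mult)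
  qed
  have "ennreal (2 * pi) * G = (\<integral>\<^sup>+t. g t * (ennreal (2 * pi) * g t) \<partial>circ)"
    unfolding G_def by (subst nn_integral_cmult[symmetric]) (auto simp: power2_eq_square mult_ac)
  also have "\<dots> \<le> (\<integral>\<^sup>+t. g t * (\<integral>\<^sup>+x. ennreal (pk (\<rho> t) (t - x)) * u x \<partial>circ) \<partial>circ)"
    by (intro nn_integral_mono mult_left_mono gp) simp
  also have "\<dots> = (\<integral>\<^sup>+t. \<integral>\<^sup>+x. ennreal (pk (\<rho> t) (t - x)) * g t * u x \<partial>circ \<partial>circ)"
  proof (rule nn_integral_cong)
    fix t
    have "g t * (\<integral>\<^sup>+x. ennreal (pk (\<rho> t) (t - x)) * u x \<partial>circ) = (\<integral>\<^sup>+x. g t * (ennreal (pk (\<rho> t) (t - x)) * u x) \<partial>circ)"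
      by (rule nn_integral_cmult[symmetric]) measurable
    then show "g t * (\<integral>\<^sup>+x. ennreal (pk (\<rho> t) (t - x)) * u x \<partial>circ) = (\<integral>\<^sup>+x. ennreal (pk (\<rho> t) (t - x)) * g t * u x \<partial>circ)"
      by (simp add: mult_ac)
  qed
  also have "\<dots> = (\<integral>\<^sup>+x. \<integral>\<^sup>+t. ennreal (pk (\<rho> t) (t - x)) * g t * u x \<partial>circ \<partial>circ)"
    by (rule circ2.Fubini') measurable
  also have "\<dots> = (\<integral>\<^sup>+x. T x * u x \<partial>circ)"
    unfolding T_def by (simp add: nn_integral_multc)
  finally have 1: "ennreal (2 * pi) * G \<le> (\<integral>\<^sup>+x. T x * u x \<partial>circ)" .
  have "(ennreal (2 * pi) * G)\<^sup>2 \<le> (\<integral>\<^sup>+x. T x * u x \<partial>circ)\<^sup>2" using 1 by (intro power_mono) auto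
  also have "\<dots> \<le> (\<integral>\<^sup>+x. (T x)\<^sup>2 \<partial>circ) * U"
    unfolding U_def by (rule Cauchy_Schwarz_nn_integral) auto
  also have "\<dots> \<le> (ennreal ((32 * pi)\<^sup>2) * G) * U" by (intro mult_right_mono TT) simp
  finally have 2: "(ennreal (2 * pi) * G)\<^sup>2 \<le> (ennreal ((32 * pi)\<^sup>2) * G) * U" .
  have "G \<le> 256 * U"
  proof (cases "G = 0")
    case False
    show ?thesis
    proof (cases U)
      case (real u')
      obtain g' where g': "G = ennreal g'" "0 \<le> g'" using Gfin by (cases G) auto
      have "(2 * pi * g')\<^sup>2 \<le> (32 * pi)\<^sup>2 * g' * u'"
        using 2 real g' by (simp add: ennreal_mult[symmetric] ennreal_power ennreal_le_iff)
      then have "4 * pi\<^sup>2 * g' * g' \<le> 4 * pi\<^sup>2 * g' * (256 * u')"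
        by (simp add: power2_eq_square algebra_simps)
      moreover have "0 < 4 * pi\<^sup>2 * g'" using False g' by (auto simp: less_le)
      ultimately have "g' \<le> 256 * u'" by (metis mult_le_cancel_left_pos)
      then have "ennreal g' \<le> ennreal (256 * u')" by (rule ennreal_leI)
      then show ?thesis using g' real by (simp add: ennreal_mult)
    next
      case top
      then show ?thesis by (simp add: ennreal_mult_top)
    qed
  qed simp
  then show ?thesis by (simp add: G_def U_def g_def u_def ennreal_power)
qed

text \<open>A radius among r 0, ..., r n at which |h| is largest on the ray of angle t. The
  recursion with a comparison at each step makes the selection measurable in t.\<close>

primrec argmax_radius :: "(complex \<Rightarrow> complex) \<Rightarrow> (nat \<Rightarrow> real) \<Rightarrow> nat \<Rightarrow> real \<Rightarrow> real" where
  "argmax_radius h r 0 t = r 0"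
| "argmax_radius h r (Suc n) t =
     (if cmod (h (of_real (argmax_radius h r n t) * cis t)) < cmod (h (of_real (r (Suc n)) * cis t))
      then r (Suc n) else argmax_radius h r n t)"

lemma argmax_radius_range: "argmax_radius h r n t \<in> r ` {..n}"
  by (induction n) auto

lemma argmax_radius_max: "j \<le> n \<Longrightarrow> cmod (h (of_real (r j) * cis t)) \<le> cmod (h (of_real (argmax_radius h r n t) * cis t))"
proof (induction n)
  case (Suc n)
  then show ?case by (cases "j = Suc n") (auto simp: le_Suc_eq intro: order_trans less_imp_le)
qed simp

lemma argmax_radius_mono: "cmod (h (of_real (argmax_radius h r n t) * cis t)) \<le> cmod (h (of_real (argmax_radius h r (Suc n) t) * cis t))"
  by simp

lemma argmax_radius_measurable:
  fixes h :: "complex \<Rightarrow> complex" and r :: "nat \<Rightarrow> real"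
  assumes h: "continuous_on (ball 0 1) h" and r: "\<And>n. 0 \<le> r n \<and> r n < 1"
  shows "argmax_radius h r n \<in> borel_measurable borel"
proof (induction n)
  case 0
  have "argmax_radius h r 0 = (\<lambda>t. r 0)" by auto
  then show ?case by simp
next
  case (Suc n)
  define hb where "hb z = (if z \<in> ball 0 1 then h z else 0)" for z :: complex
  have [measurable]: "hb \<in> borel_measurable borel"
    unfolding hb_def by (rule borel_measurable_continuous_on_if) (use h in auto)
  have [measurable]: "cis \<in> borel_measurable borel"
    by (intro borel_measurable_continuous_onI continuous_intros)
  have ar: "0 \<le> argmax_radius h r n t \<and> argmax_radius h r n t < 1" for t
    using argmax_radius_range[of h r n t] r by auto
  have [measurable]: "argmax_radius h r n \<in> borel_measurable borel" by (rule Suc)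
  have [measurable]: "(\<lambda>t. complex_of_real (argmax_radius h r n t)) \<in> borel_measurable borel"
    by (rule measurable_compose[OF Suc]) (intro borel_measurable_continuous_onI continuous_intros)
  have eq: "argmax_radius h r (Suc n) = (\<lambda>t. (if cmod (hb (of_real (argmax_radius h r n t) * cis t)) < cmod (hb (of_real (r (Suc n)) * cis t))
      then r (Suc n) else argmax_radius h r n t))"
    using ar r by (auto simp: fun_eq_iff hb_def norm_mult)
  show ?case unfolding eq by measurable
qed

text \<open>For finitely many radii the maximum is attained at the selected radius, which
  \<open>linearized_maximal_bound\<close> admits with a constant independent of their number;
  monotone convergence then handles the whole sequence.\<close>

lemma H2_maximal_closed:
  fixes h :: "complex \<Rightarrow> complex" and r :: "nat \<Rightarrow> real"
  assumes h: "h holomorphic_on ball 0 R" "1 < R" and r: "\<And>n. 0 \<le> r n \<and> r n < 1"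
  shows "(\<integral>\<^sup>+t. (SUP n. ennreal ((cmod (h (of_real (r n) * cis t)))\<^sup>2)) \<partial>circ) \<le> 256 * (\<integral>\<^sup>+t. ennreal ((cmod (h (cis t)))\<^sup>2) \<partial>circ)"
proof -
  let ?a = "argmax_radius h r"
  have ch: "continuous_on (ball 0 1) h"
    by (rule continuous_on_subset[OF holomorphic_on_imp_continuous_on[OF h(1)]]) (use h(2) in auto)
  define hb where "hb z = (if z \<in> ball 0 1 then h z else 0)" for z :: complex
  have [measurable]: "hb \<in> borel_measurable borel"
    unfolding hb_def by (rule borel_measurable_continuous_on_if) (use ch in auto)
  have [measurable]: "cis \<in> borel_measurable borel"
    by (intro borel_measurable_continuous_onI continuous_intros)
  have ar: "0 \<le> ?a n t \<and> ?a n t < 1" for n t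
    using argmax_radius_range[of h r n t] r by auto
  have am [measurable]: "?a n \<in> borel_measurable borel" for n
    by (rule argmax_radius_measurable[OF ch r])
  have [measurable]: "(\<lambda>t. complex_of_real (?a n t)) \<in> borel_measurable borel" for n
    by (rule measurable_compose[OF am]) (intro borel_measurable_continuous_onI continuous_intros)
  have "(\<lambda>t. ennreal ((cmod (h (of_real (?a n t) * cis t)))\<^sup>2)) = (\<lambda>t. ennreal ((cmod (hb (of_real (?a n t) * cis t)))\<^sup>2))" for n
    using ar by (auto simp: hb_def norm_mult fun_eq_iff)
  then have m: "(\<lambda>t. ennreal ((cmod (h (of_real (?a n t) * cis t)))\<^sup>2)) \<in> borel_measurable circ" for n
    by simp
  have "(\<integral>\<^sup>+t. (SUP n. ennreal ((cmod (h (of_real (r n) * cis t)))\<^sup>2)) \<partial>circ)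
     \<le> (\<integral>\<^sup>+t. (SUP n. ennreal ((cmod (h (of_real (?a n t) * cis t)))\<^sup>2)) \<partial>circ)"
    by (intro nn_integral_mono SUP_mono bexI[of _ "n" for n] ennreal_leI power_mono argmax_radius_max) auto
  also have "\<dots> = (SUP n. \<integral>\<^sup>+t. ennreal ((cmod (h (of_real (?a n t) * cis t)))\<^sup>2) \<partial>circ)"
    by (rule nn_integral_monotone_convergence_SUP)
      (use m argmax_radius_mono in \<open>auto intro!: incseq_SucI ennreal_leI power_mono simp: le_fun_def simp del: argmax_radius.simps\<close>)
  also have "\<dots> \<le> 256 * (\<integral>\<^sup>+t. ennreal ((cmod (h (cis t)))\<^sup>2) \<partial>circ)"
  proof (rule SUP_least)
    fix n
    show "(\<integral>\<^sup>+t. ennreal ((cmod (h (of_real (?a n t) * cis t)))\<^sup>2) \<partial>circ) \<le> 256 * (\<integral>\<^sup>+t. ennreal ((cmod (h (cis t)))\<^sup>2) \<partial>circ)"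
    proof (rule linearized_maximal_bound[OF h, where b="Max (r ` {..n})"])
      show "Max (r ` {..n}) < 1" using r by (subst Max_less_iff) auto
      show "?a n t \<le> Max (r ` {..n})" for t using argmax_radius_range[of h r n t] by (intro Max_ge) auto
    qed (use ar am in auto)
  qed
  finally show ?thesis .
qed

section \<open>Boundary values in the Hardy space of exponent two\<close>

text \<open>Starting at 1/2 instead of 0 makes \<open>1 / rs n\<close> meaningful: dilations by
  \<open>rs n\<close> live on a disc of that radius, which is larger than 1.\<close>

definition rs :: "nat \<Rightarrow> real" where
  "rs n = 1 - 1 / (real n + 2)"

lemma rs_bounds: "0 \<le> rs n" "rs n < 1" "0 < rs n"
  by (auto simp: rs_def field_simps)

lemma rs_tendsto: "rs \<longlonglongrightarrow> 1"
  unfolding rs_def by real_asymp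

lemma rs_at_left: "filterlim rs (at_left 1) sequentially"
  unfolding filterlim_at using rs_tendsto by (auto intro!: always_eventually simp: rs_bounds less_imp_neq[OF rs_bounds(2)])

lemma continuous_disc_circle:
  assumes "continuous_on (ball 0 1) (h :: complex \<Rightarrow> complex)" "0 \<le> r" "r < 1"
  shows "continuous_on UNIV (\<lambda>t. h (of_real r * cis t))"
  by (rule continuous_on_compose2[OF assms(1)]) (use assms in \<open>auto intro!: continuous_intros simp: norm_mult\<close>)

lemma measurable_disc_circle:
  assumes "continuous_on (ball 0 1) (h :: complex \<Rightarrow> complex)" "0 \<le> r" "r < 1"
  shows "(\<lambda>t. h (of_real r * cis t)) \<in> borel_measurable borel"
  by (intro borel_measurable_continuous_onI continuous_disc_circle assms)

lemma continuous_disc_radius: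
  assumes "continuous_on (ball 0 1) (h :: complex \<Rightarrow> complex)"
  shows "continuous_on {0..<1} (\<lambda>r. h (of_real r * cis t))"
  by (rule continuous_on_compose2[OF assms]) (auto intro!: continuous_intros simp: norm_mult)

lemma rational_radii:
  obtains q :: "nat \<Rightarrow> real" where "range q = \<rat> \<inter> {0..<1}"
proof
  have "(0::real) \<in> \<rat> \<inter> {0..<1}" by auto
  then show "range (from_nat_into (\<rat> \<inter> {0..<1::real})) = \<rat> \<inter> {0..<1}"
    by (intro range_from_nat_into) (auto simp: countable_rat)
qed

text \<open>Suprema over all radii have to be replaced by countable ones to be measurable;
  continuity in the radius is what permits this.\<close>

lemma le_by_rationals:
  fixes u :: "real \<Rightarrow> real"
  assumes c: "continuous_on {0..<1} u" and q: "\<And>q. q \<in> \<rat> \<Longrightarrow> a < q \<Longrightarrow> 0 \<le> q \<Longrightarrow> q < 1 \<Longrightarrow> u q \<le> B"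
    and r: "0 \<le> r" "r < 1" "a < r"
  shows "u r \<le> B"
proof (rule ccontr)
  assume "\<not> u r \<le> B"
  then have "0 < u r - B" by simp
  with c r obtain d where d: "d > 0" "\<And>x. x \<in> {0..<1} \<Longrightarrow> dist x r < d \<Longrightarrow> dist (u x) (u r) < u r - B"
    unfolding continuous_on_iff by (metis atLeastLessThan_iff)
  obtain p where p: "p \<in> \<rat>" "r < p" "p < min 1 (r + d)"
    using Rats_dense_in_real[of r "min 1 (r + d)"] d r by auto
  have "u p \<le> B" using q[of p] p r by auto
  moreover have "dist (u p) (u r) < u r - B" using d(2)[of p] p r by (auto simp: dist_real_def)
  ultimately show False by (auto simp: dist_real_def)
qed

lemma radial_Cauchy_limit:
  fixes u :: "real \<Rightarrow> complex"
  assumes "\<And>e. e > 0 \<Longrightarrow> \<exists>a<1. \<forall>r s. a < r \<and> r < 1 \<and> a < s \<and> s < 1 \<longrightarrow> cmod (u r - u s) \<le> e"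
  shows "\<exists>l. (u \<longlongrightarrow> l) (at_left 1)"
proof -
  have "Cauchy (\<lambda>n. u (rs n))"
  proof (rule metric_CauchyI)
    fix e :: real assume "e > 0"
    then obtain a where a: "a < 1" "\<And>r s. a < r \<Longrightarrow> r < 1 \<Longrightarrow> a < s \<Longrightarrow> s < 1 \<Longrightarrow> cmod (u r - u s) \<le> e / 2"
      using assms[of "e / 2"] by auto
    obtain M where "\<And>n. n \<ge> M \<Longrightarrow> a < rs n"
      using order_tendstoD(1)[OF rs_tendsto a(1)] by (auto simp: eventually_sequentially)
    then show "\<exists>M. \<forall>m\<ge>M. \<forall>n\<ge>M. dist (u (rs m)) (u (rs n)) < e"
    proof (intro exI[of _ M] allI impI)
      fix m n assume "M \<le> m" "M \<le> n"
      then have "cmod (u (rs m) - u (rs n)) \<le> e / 2" using a(2) rs_bounds \<open>\<And>n. n \<ge> M \<Longrightarrow> a < rs n\<close> by blast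
      then show "dist (u (rs m)) (u (rs n)) < e" using \<open>e > 0\<close> by (simp add: dist_norm)
    qed
  qed
  then obtain l where l: "(\<lambda>n. u (rs n)) \<longlonglongrightarrow> l" using Cauchy_convergent convergent_def by blast
  have "(u \<longlongrightarrow> l) (at_left 1)"
  proof (rule tendstoI)
    fix e :: real assume "e > 0"
    then obtain a where a: "a < 1" "\<And>r s. a < r \<Longrightarrow> r < 1 \<Longrightarrow> a < s \<Longrightarrow> s < 1 \<Longrightarrow> cmod (u r - u s) \<le> e / 3"
      using assms[of "e / 3"] by auto
    have "eventually (\<lambda>n. a < rs n \<and> dist (u (rs n)) l < e / 3) sequentially"
      using order_tendstoD(1)[OF rs_tendsto a(1)] tendstoD[OF l, of "e/3"] \<open>e > 0\<close> by (auto elim: eventually_elim2)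
    then obtain n where n: "a < rs n" "dist (u (rs n)) l < e / 3"
      by (auto simp: eventually_sequentially)
    have "dist (u r) l < e" if "a < r" "r < 1" for r
      using dist_triangle[of "u r" l "u (rs n)"] a(2)[of r "rs n"] n rs_bounds[of n] that \<open>e > 0\<close>
      by (simp add: dist_norm)
    then show "\<forall>\<^sub>F x in at_left 1. dist (u x) l < e"
      unfolding eventually_at_left_field using a(1) by blast
  qed
  then show ?thesis ..
qed

lemma bdry_eqI: "((\<lambda>r. f (of_real r * cis t)) \<longlongrightarrow> l) (at_left 1) \<Longrightarrow> bdry f t = l"
  unfolding bdry_def by (rule tendsto_Lim) auto

text \<open>Existence of the radial limit is the Cauchy condition, and by continuity this can be
  tested with countably many quantifiers over rational radii (the predicate \<open>C\<close>). On
  that Borel set the boundary function is the limit along \<open>rs\<close>.\<close>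

lemma bdry_measurable:
  assumes "continuous_on (ball 0 1) f"
  shows "bdry f \<in> borel_measurable borel"
proof -
  obtain q :: "nat \<Rightarrow> real" where q: "range q = \<rat> \<inter> {0..<1}" by (rule rational_radii)
  have q1: "0 \<le> q i" "q i < 1" for i using q by (auto dest: equalityD1 simp: image_subset_iff)
  define conv where "conv t \<longleftrightarrow> (\<exists>l. ((\<lambda>r. f (of_real r * cis t)) \<longlongrightarrow> l) (at_left 1))" for t
  define C where "C t \<longleftrightarrow> (\<forall>m::nat. \<exists>n::nat. \<forall>i j. 1 - 1 / (real n + 1) < q i \<longrightarrow> 1 - 1 / (real n + 1) < q j \<longrightarrow>
      cmod (f (of_real (q i) * cis t) - f (of_real (q j) * cis t)) \<le> 1 / (real m + 1))" for t
  have convC: "conv t \<longleftrightarrow> C t" for t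
  proof
    assume "conv t"
    then obtain l where l: "((\<lambda>r. f (of_real r * cis t)) \<longlongrightarrow> l) (at_left 1)" by (auto simp: conv_def)
    show "C t" unfolding C_def
    proof
      fix m :: nat
      have "eventually (\<lambda>r. dist (f (of_real r * cis t)) l < 1 / (2 * (real m + 1))) (at_left 1)"
        by (rule tendstoD[OF l]) simp
      then obtain b where b: "b < 1" "\<And>r. b < r \<Longrightarrow> r < 1 \<Longrightarrow> dist (f (of_real r * cis t)) l < 1 / (2 * (real m + 1))"
        by (auto simp: eventually_at_left_field)
      obtain n :: nat where n: "1 / (real n + 1) < 1 - b"
        using b(1) by (metis add.commute diff_gt_0_iff_gt nat_approx_posE of_nat_Suc)
      show "\<exists>n::nat. \<forall>i j. 1 - 1 / (real n + 1) < q i \<longrightarrow> 1 - 1 / (real n + 1) < q j \<longrightarrow>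
          cmod (f (of_real (q i) * cis t) - f (of_real (q j) * cis t)) \<le> 1 / (real m + 1)"
      proof (intro exI[of _ n] allI impI)
        fix i j assume "1 - 1 / (real n + 1) < q i" "1 - 1 / (real n + 1) < q j"
        then have "b < q i" "b < q j" using n by auto
        then have "dist (f (of_real (q i) * cis t)) l < 1 / (2 * (real m + 1))" "dist (f (of_real (q j) * cis t)) l < 1 / (2 * (real m + 1))"
          using b(2) q1 by auto
        then have "dist (f (of_real (q i) * cis t)) (f (of_real (q j) * cis t)) < 1 / (2 * (real m + 1)) + 1 / (2 * (real m + 1))"
          using dist_triangle2[of "f (of_real (q i) * cis t)" "f (of_real (q j) * cis t)" l] by linarith
        then show "cmod (f (of_real (q i) * cis t) - f (of_real (q j) * cis t)) \<le> 1 / (real m + 1)"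
          by (simp add: dist_norm field_simps)
      qed
    qed
  next
    assume Ct: "C t"
    show "conv t" unfolding conv_def
    proof (rule radial_Cauchy_limit)
      fix e :: real assume "e > 0"
      then obtain m :: nat where m: "1 / (real m + 1) < e" by (metis add.commute nat_approx_posE of_nat_Suc)
      obtain n :: nat where n: "\<And>i j. 1 - 1 / (real n + 1) < q i \<Longrightarrow> 1 - 1 / (real n + 1) < q j \<Longrightarrow>
          cmod (f (of_real (q i) * cis t) - f (of_real (q j) * cis t)) \<le> 1 / (real m + 1)"
        using Ct unfolding C_def by meson
      let ?a = "1 - 1 / (real n + 1)"
      have a: "0 \<le> ?a" "?a < 1" by auto
      have cu: "continuous_on {0..<1} (\<lambda>r. f (of_real r * cis t))" by (rule continuous_disc_radius[OF assms])
      have 1: "cmod (f (of_real r * cis t) - f (of_real p * cis t)) \<le> 1 / (real m + 1)"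
        if p: "p \<in> \<rat>" "?a < p" "p < 1" and r: "?a < r" "r < 1" for p r
      proof (rule le_by_rationals[where a="?a" and u="\<lambda>r. cmod (f (of_real r * cis t) - f (of_real p * cis t))"])
        show "continuous_on {0..<1} (\<lambda>r. cmod (f (of_real r * cis t) - f (of_real p * cis t)))"
          by (intro continuous_intros cu)
        fix s assume s: "s \<in> \<rat>" "?a < s" "0 \<le> s" "s < 1"
        have "0 \<le> p" using p(2) a(1) by linarith
        then have "s \<in> range q" "p \<in> range q" unfolding q using s p by auto
        then show "cmod (f (of_real s * cis t) - f (of_real p * cis t)) \<le> 1 / (real m + 1)" using n s p by auto
      qed (use r a in linarith)+
      have "cmod (f (of_real r * cis t) - f (of_real s * cis t)) \<le> 1 / (real m + 1)"
        if r: "?a < r" "r < 1" and s: "?a < s" "s < 1" for r s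
      proof (rule le_by_rationals[where a="?a" and u="\<lambda>s. cmod (f (of_real r * cis t) - f (of_real s * cis t))"])
        show "continuous_on {0..<1} (\<lambda>s. cmod (f (of_real r * cis t) - f (of_real s * cis t)))"
          by (intro continuous_intros cu)
        fix p :: real assume "p \<in> \<rat>" "?a < p" "0 \<le> p" "p < 1"
        then show "cmod (f (of_real r * cis t) - f (of_real p * cis t)) \<le> 1 / (real m + 1)" using 1 r by blast
      qed (use s a in linarith)+
      then show "\<exists>a<1. \<forall>r s. a < r \<and> r < 1 \<and> a < s \<and> s < 1 \<longrightarrow> cmod (f (of_real r * cis t) - f (of_real s * cis t)) \<le> e"
        using order_trans[OF _ less_imp_le[OF m]] a(2) by (intro exI[of _ ?a] conjI allI impI) blast+
    qed
  qed
  have m [measurable]: "(\<lambda>t. f (of_real (q i) * cis t)) \<in> borel_measurable borel" for i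
    by (rule measurable_disc_circle[OF assms q1])
  have m2 [measurable]: "(\<lambda>t. f (of_real (rs n) * cis t)) \<in> borel_measurable borel" for n
    by (rule measurable_disc_circle[OF assms rs_bounds(1,2)])
  have [measurable]: "Measurable.pred borel C" unfolding C_def by measurable
  \<comment> \<open>Where no limit exists, \<open>Lim\<close> is a description without solution. Its
    value is unspecified but the same for every such t, so \<open>bdry f\<close> is constant off the
    set \<open>C\<close>.\<close>
  define J where "J = (THE l::complex. False)"
  have eq: "bdry f t = (if C t then lim (\<lambda>n. f (of_real (rs n) * cis t)) else J)" for t
  proof (cases "C t")
    case True
    then obtain l where l: "((\<lambda>r. f (of_real r * cis t)) \<longlongrightarrow> l) (at_left 1)" using convC[of t] by (auto simp: conv_def)
    have "(\<lambda>n. f (of_real (rs n) * cis t)) \<longlonglongrightarrow> l"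
      using filterlim_compose[OF l rs_at_left] .
    then show ?thesis using True bdry_eqI[OF l] by (simp add: limI)
  next
    case False
    then show ?thesis using convC[of t] by (auto simp: conv_def bdry_def Topological_Spaces.t2_space_class.Lim_def J_def)
  qed
  have "bdry f = (\<lambda>t. if C t then lim (\<lambda>n. f (of_real (rs n) * cis t)) else J)" using eq by (simp add: fun_eq_iff)
  then show ?thesis by simp
qed

text \<open>The constant bounds the squared \<open>L\<^sup>2\<close>-means, not the norm.\<close>

definition in_H2 :: "(complex \<Rightarrow> complex) \<Rightarrow> real \<Rightarrow> bool" where
  "in_H2 h B \<longleftrightarrow> h holomorphic_on ball 0 1 \<and> 0 \<le> B \<and>
     (\<forall>r. 0 \<le> r \<longrightarrow> r < 1 \<longrightarrow> (\<integral>\<^sup>+t. ennreal ((cmod (h (of_real r * cis t)))\<^sup>2) \<partial>circ) \<le> ennreal B)"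

text \<open>\<open>H2_maximal_closed\<close> wants holomorphy across the circle. The dilations by
  \<open>rs m\<close> have it, and Fatou's lemma removes the dilation.\<close>

lemma H2_maximal:
  assumes h: "h holomorphic_on ball 0 1"
    and B: "\<And>R. 0 \<le> R \<Longrightarrow> R < 1 \<Longrightarrow> (\<integral>\<^sup>+t. ennreal ((cmod (h (of_real R * cis t)))\<^sup>2) \<partial>circ) \<le> B"
    and r: "\<And>n. 0 \<le> r n \<and> r n < 1"
  shows "(\<integral>\<^sup>+t. (SUP n::nat. ennreal ((cmod (h (of_real (r n) * cis t)))\<^sup>2)) \<partial>circ) \<le> 256 * B"
proof -
  have ch: "continuous_on (ball 0 1) h" using h holomorphic_on_imp_continuous_on by blast
  define S where "S m t = (SUP n. ennreal ((cmod (h (of_real (rs m * r n) * cis t)))\<^sup>2))" for m t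
  have rr: "0 \<le> rs m * r n" "rs m * r n < 1" for m n
    using r[of n] rs_bounds[of m] mult_strict_mono[of "rs m" 1 "r n" 1] by auto
  have [measurable]: "(\<lambda>t. h (of_real (rs m * r n) * cis t)) \<in> borel_measurable borel" for m n
    by (rule measurable_disc_circle[OF ch rr])
  have Sm: "S m \<in> borel_measurable circ" for m unfolding S_def by measurable
  have SB: "(\<integral>\<^sup>+t. S m t \<partial>circ) \<le> 256 * B" for m
  proof -
    let ?h = "\<lambda>z. h (of_real (rs m) * z)"
    have im: "(\<lambda>z. of_real (rs m) * z) ` ball 0 (1 / rs m) \<subseteq> ball (0::complex) 1"
      using rs_bounds[of m] by (auto simp: norm_mult field_simps)
    have hol: "?h holomorphic_on ball 0 (1 / rs m)"
      by (rule holomorphic_on_compose_gen[OF _ h im, unfolded o_def]) (auto intro!: holomorphic_intros)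
    have "(\<integral>\<^sup>+t. S m t \<partial>circ) \<le> 256 * (\<integral>\<^sup>+t. ennreal ((cmod (?h (cis t)))\<^sup>2) \<partial>circ)"
      using H2_maximal_closed[OF hol _ r] rs_bounds[of m] unfolding S_def by (simp add: mult.assoc)
    also have "\<dots> \<le> 256 * B" by (intro mult_left_mono B rs_bounds) simp
    finally show ?thesis .
  qed
  have le: "(SUP n. ennreal ((cmod (h (of_real (r n) * cis t)))\<^sup>2)) \<le> liminf (\<lambda>m. S m t)" for t
  proof (rule SUP_least)
    fix n
    have "(\<lambda>m. of_real (rs m * r n) * cis t) \<longlonglongrightarrow> of_real (1 * r n) * cis t"
      by (intro tendsto_intros rs_tendsto)
    then have "(\<lambda>m. h (of_real (rs m * r n) * cis t)) \<longlonglongrightarrow> h (of_real (1 * r n) * cis t)"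
    proof (rule continuous_on_tendsto_compose[OF ch])
      show "of_real (1 * r n) * cis t \<in> ball 0 1" using r[of n] by (simp add: norm_mult)
      show "\<forall>\<^sub>F m in sequentially. of_real (rs m * r n) * cis t \<in> ball 0 1"
        using rr by (auto simp: norm_mult abs_of_nonneg simp del: of_real_mult)
    qed
    then have "(\<lambda>m. ennreal ((cmod (h (of_real (rs m * r n) * cis t)))\<^sup>2)) \<longlonglongrightarrow> ennreal ((cmod (h (of_real (1 * r n) * cis t)))\<^sup>2)"
      by (intro tendsto_intros tendsto_ennrealI)
    then have "ennreal ((cmod (h (of_real (r n) * cis t)))\<^sup>2) = liminf (\<lambda>m. ennreal ((cmod (h (of_real (rs m * r n) * cis t)))\<^sup>2))"
      by (intro lim_imp_Liminf[symmetric]) simp_all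
    also have "\<dots> \<le> liminf (\<lambda>m. S m t)"
      unfolding S_def by (intro Liminf_mono always_eventually allI SUP_upper) auto
    finally show "ennreal ((cmod (h (of_real (r n) * cis t)))\<^sup>2) \<le> liminf (\<lambda>m. S m t)" .
  qed
  have "(\<integral>\<^sup>+t. (SUP n. ennreal ((cmod (h (of_real (r n) * cis t)))\<^sup>2)) \<partial>circ) \<le> (\<integral>\<^sup>+t. liminf (\<lambda>m. S m t) \<partial>circ)"
    by (intro nn_integral_mono le)
  also have "\<dots> \<le> liminf (\<lambda>m. \<integral>\<^sup>+t. S m t \<partial>circ)" by (rule nn_integral_liminf[OF Sm])
  also have "\<dots> \<le> liminf (\<lambda>m::nat. 256 * B)" by (intro Liminf_mono always_eventually allI SB)
  finally show ?thesis by (simp add: Liminf_const)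
qed

lemma Parseval_disc:
  assumes c: "\<And>z. cmod z < 1 \<Longrightarrow> (\<lambda>n. c n * z ^ n) sums h z"
    and s: "\<And>r. 0 \<le> r \<Longrightarrow> r < 1 \<Longrightarrow> summable (\<lambda>n. cmod (c n) * r ^ n)"
    and r: "0 \<le> r" "r < 1"
  shows "(\<integral>\<^sup>+t. ennreal ((cmod (h (of_real r * cis t)))\<^sup>2) \<partial>circ) = ennreal (2 * pi * (\<Sum>n. (cmod (c n) * r ^ n)\<^sup>2))"
proof -
  have "h (of_real r * cis t) = (\<Sum>n. (c n * of_real (r ^ n)) * cis (real n * t))" for t
    using c[of "of_real r * cis t"] r
    by (simp add: sums_iff norm_mult power_mult_distrib Complex.DeMoivre mult.assoc)
  then show ?thesis
    using Parseval[of "\<lambda>n. c n * of_real (r ^ n)"] s[OF r] r by (simp add: norm_mult norm_power)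
qed

lemma Parseval_disc_diff:
  assumes c: "\<And>z. cmod z < 1 \<Longrightarrow> (\<lambda>n. c n * z ^ n) sums h z"
    and s: "\<And>r. 0 \<le> r \<Longrightarrow> r < 1 \<Longrightarrow> summable (\<lambda>n. cmod (c n) * r ^ n)"
    and r: "0 \<le> a" "a \<le> b" "b < 1"
  shows "(\<integral>\<^sup>+t. ennreal ((cmod (h (of_real b * cis t) - h (of_real a * cis t)))\<^sup>2) \<partial>circ)
     = ennreal (2 * pi * (\<Sum>n. (cmod (c n) * (b ^ n - a ^ n))\<^sup>2))"
proof -
  have ser: "(\<lambda>n. (c n * of_real (r ^ n)) * cis (real n * t)) sums h (of_real r * cis t)" if "0 \<le> r" "r < 1" for r t
    using c[of "of_real r * cis t"] that by (simp add: norm_mult power_mult_distrib Complex.DeMoivre mult.assoc)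
  have "h (of_real b * cis t) - h (of_real a * cis t) = (\<Sum>n. (c n * of_real (b ^ n - a ^ n)) * cis (real n * t))" for t
    using sums_diff[OF ser[of b t] ser[of a t]] r by (simp add: sums_iff algebra_simps)
  moreover have "cmod (c n * of_real (b ^ n - a ^ n)) = cmod (c n) * (b ^ n - a ^ n)" for n
    using r by (simp add: norm_mult power_mono del: of_real_diff of_real_power)
  moreover have "summable (\<lambda>n. cmod (c n) * (b ^ n - a ^ n))"
    using summable_diff[OF s[of b] s[of a]] r by (simp add: algebra_simps)
  ultimately show ?thesis
    using Parseval[of "\<lambda>n. c n * of_real (b ^ n - a ^ n)"] by simp
qed

lemma in_H2_coeffs_sum:
  assumes h: "in_H2 h B"
    and c: "\<And>z. cmod z < 1 \<Longrightarrow> (\<lambda>n. c n * z ^ n) sums h z"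
    and s: "\<And>r. 0 \<le> r \<Longrightarrow> r < 1 \<Longrightarrow> summable (\<lambda>n. cmod (c n) * r ^ n)"
  shows "(\<Sum>n\<le>N. (cmod (c n))\<^sup>2) \<le> B"
proof -
  have B: "0 \<le> B" using h by (simp add: in_H2_def)
  have le: "(\<Sum>n\<le>N. (cmod (c n) * r ^ n)\<^sup>2) \<le> B" if r: "0 \<le> r" "r < 1" for r
  proof -
    have "(\<integral>\<^sup>+t. ennreal ((cmod (h (of_real r * cis t)))\<^sup>2) \<partial>circ) \<le> ennreal B"
      using h r by (simp add: in_H2_def)
    then have "ennreal (2 * pi * (\<Sum>n. (cmod (c n) * r ^ n)\<^sup>2)) \<le> ennreal B"
      by (simp only: Parseval_disc[of c h, OF c s r])
    then have 1: "2 * pi * (\<Sum>n. (cmod (c n) * r ^ n)\<^sup>2) \<le> B" using B by (simp add: ennreal_le_iff)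
    have sq: "summable (\<lambda>n. (cmod (c n) * r ^ n)\<^sup>2)"
    proof (rule summable_comparison_test_ev[OF _ summable_mult[OF s[OF r], of "\<Sum>n. cmod (c n) * r ^ n"]])
      have "cmod (c n) * r ^ n \<le> (\<Sum>n. cmod (c n) * r ^ n)" for n
        using sum_le_suminf[OF s[OF r], of "{n}"] r by simp
      then show "\<forall>\<^sub>F n in sequentially. norm ((cmod (c n) * r ^ n)\<^sup>2) \<le> (\<Sum>n. cmod (c n) * r ^ n) * (cmod (c n) * r ^ n)"
        using r by (auto intro!: always_eventually mult_right_mono simp: power2_eq_square)
    qed
    have 2: "(\<Sum>n\<le>N. (cmod (c n) * r ^ n)\<^sup>2) \<le> (\<Sum>n. (cmod (c n) * r ^ n)\<^sup>2)"
      by (rule sum_le_suminf[OF sq]) auto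
    have "1 * (\<Sum>n. (cmod (c n) * r ^ n)\<^sup>2) \<le> 2 * pi * (\<Sum>n. (cmod (c n) * r ^ n)\<^sup>2)"
      by (intro mult_right_mono suminf_nonneg sq) (use pi_gt3 in auto)
    with 1 2 show ?thesis by linarith
  qed
  have "(\<lambda>m. \<Sum>n\<le>N. (cmod (c n) * rs m ^ n)\<^sup>2) \<longlonglongrightarrow> (\<Sum>n\<le>N. (cmod (c n) * 1 ^ n)\<^sup>2)"
    by (intro tendsto_intros rs_tendsto)
  then have "(\<Sum>n\<le>N. (cmod (c n) * 1 ^ n)\<^sup>2) \<le> B"
    by (rule tendsto_upperbound) (use le rs_bounds in auto)
  then show ?thesis by simp
qed

lemma in_H2_coeffs:
  assumes h: "in_H2 h B"
    and c: "\<And>z. cmod z < 1 \<Longrightarrow> (\<lambda>n. c n * z ^ n) sums h z"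
    and s: "\<And>r. 0 \<le> r \<Longrightarrow> r < 1 \<Longrightarrow> summable (\<lambda>n. cmod (c n) * r ^ n)"
  shows "summable (\<lambda>n. (cmod (c n))\<^sup>2)"
  using in_H2_coeffs_sum[of h B c, OF h c s] by (intro bounded_imp_summable) auto

text \<open>In both kinds of difference the n-th coefficient is multiplied by a number between 0 and
  1 - q^n, with q = a in the first and q = s in the second, since R^n (1 - s^n) <= 1 - s^n. One
  modulus \<open>E\<close> thus serves both, and it tends to 0 by dominated convergence in the
  coefficient series.\<close>

lemma in_H2_dilation_defect:
  assumes h: "in_H2 h B"
  shows "\<exists>E :: real \<Rightarrow> real. (E \<longlongrightarrow> 0) (at_left 1) \<and> (\<forall>a. 0 \<le> E a) \<and>
    (\<forall>a b. 0 \<le> a \<and> a \<le> b \<and> b < 1 \<longrightarrow>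
       (\<integral>\<^sup>+t. ennreal ((cmod (h (of_real b * cis t) - h (of_real a * cis t)))\<^sup>2) \<partial>circ) \<le> ennreal (E a)) \<and>
    (\<forall>s R. 0 \<le> s \<and> s < 1 \<and> 0 \<le> R \<and> R < 1 \<longrightarrow>
       (\<integral>\<^sup>+t. ennreal ((cmod (h (of_real R * cis t) - h (of_real (s * R) * cis t)))\<^sup>2) \<partial>circ) \<le> ennreal (E s))"
proof -
  obtain c where c: "\<And>z. cmod z < 1 \<Longrightarrow> (\<lambda>n. c n * z ^ n) sums h z"
    and s: "\<And>r. 0 \<le> r \<Longrightarrow> r < 1 \<Longrightarrow> summable (\<lambda>n. cmod (c n) * r ^ n)"
    using h holomorphic_disc_series[of h] unfolding in_H2_def by metis
  note c2 = in_H2_coeffs[OF h c s]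
  define E where "E a = (if 0 \<le> a \<and> a < 1 then 2 * pi * (\<Sum>n. (cmod (c n) * (1 - a ^ n))\<^sup>2) else 0)" for a
  have dom: "(cmod (c n) * (1 - a ^ n))\<^sup>2 \<le> (cmod (c n))\<^sup>2" if "0 \<le> a" "a < 1" for a n
  proof -
    have "0 \<le> 1 - a ^ n" "1 - a ^ n \<le> 1" using that by (auto simp: power_le_one)
    then have "cmod (c n) * (1 - a ^ n) \<le> cmod (c n)" by (simp add: mult_left_le)
    then show ?thesis using \<open>0 \<le> 1 - a ^ n\<close> by (intro power_mono) auto
  qed
  have sm: "summable (\<lambda>n. (cmod (c n) * (1 - a ^ n))\<^sup>2)" if "0 \<le> a" "a < 1" for a
    by (rule summable_comparison_test_ev[OF _ c2]) (use dom[OF that] in auto)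
  have e0: "\<forall>\<^sub>F a in at_left (1::real). 0 < a \<and> a < 1"
    unfolding eventually_at_left_field by (intro exI[of _ 0]) auto
  have "((\<lambda>a. \<Sum>n. (cmod (c n) * (1 - a ^ n))\<^sup>2) \<longlongrightarrow> (\<Sum>n. (cmod (c n) * (1 - 1 ^ n))\<^sup>2)) (at_left 1)"
  proof (rule tannerys_theorem[THEN conjunct2, THEN conjunct2])
    show "((\<lambda>a. (cmod (c n) * (1 - a ^ n))\<^sup>2) \<longlongrightarrow> (cmod (c n) * (1 - 1 ^ n))\<^sup>2) (at_left 1)" for n
      by (intro tendsto_intros)
    show "\<forall>\<^sub>F (k, a) in sequentially \<times>\<^sub>F at_left 1. norm ((cmod (c k) * (1 - a ^ k))\<^sup>2) \<le> (cmod (c k))\<^sup>2"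
      unfolding eventually_prod_filter
      by (rule exI[of _ "\<lambda>_. True"], rule exI[of _ "\<lambda>a. 0 < a \<and> a < 1"]) (use e0 dom in auto)
  qed (use c2 in auto)
  then have "((\<lambda>a. 2 * pi * (\<Sum>n. (cmod (c n) * (1 - a ^ n))\<^sup>2)) \<longlongrightarrow> 2 * pi * 0) (at_left 1)"
    by (intro tendsto_intros) simp
  moreover have "\<forall>\<^sub>F a in at_left 1. 2 * pi * (\<Sum>n. (cmod (c n) * (1 - a ^ n))\<^sup>2) = E a"
    using e0 by eventually_elim (simp add: E_def)
  ultimately have "(E \<longlongrightarrow> 2 * pi * 0) (at_left 1)"
    by (rule Lim_transform_eventually)
  then have E0: "(E \<longlongrightarrow> 0) (at_left 1)" by simp
  have En: "0 \<le> E a" for a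
    unfolding E_def using sm by (auto intro!: mult_nonneg_nonneg suminf_nonneg)
  have Ediff: "(\<integral>\<^sup>+t. ennreal ((cmod (h (of_real b * cis t) - h (of_real a * cis t)))\<^sup>2) \<partial>circ) \<le> ennreal (E q)"
    if ab: "0 \<le> a" "a \<le> b" "b < 1" and q: "0 \<le> q" "q < 1" "\<And>n. b ^ n - a ^ n \<le> 1 - q ^ n" for a b q
  proof -
    have le: "(cmod (c n) * (b ^ n - a ^ n))\<^sup>2 \<le> (cmod (c n) * (1 - q ^ n))\<^sup>2" for n
      using q(3)[of n] power_mono[OF ab(2,1), of n] by (intro power_mono mult_left_mono mult_nonneg_nonneg) auto
    have "summable (\<lambda>n. (cmod (c n) * (b ^ n - a ^ n))\<^sup>2)"
      by (rule summable_comparison_test_ev[OF _ sm[OF q(1,2)]]) (use le in auto)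
    then have "(\<Sum>n. (cmod (c n) * (b ^ n - a ^ n))\<^sup>2) \<le> (\<Sum>n. (cmod (c n) * (1 - q ^ n))\<^sup>2)"
      by (intro suminf_le le sm q)
    then have "2 * pi * (\<Sum>n. (cmod (c n) * (b ^ n - a ^ n))\<^sup>2) \<le> E q"
      using q by (simp add: E_def)
    then show ?thesis
      using Parseval_disc_diff[of c h a b, OF c s ab] by (simp add: ennreal_leI)
  qed
  show ?thesis
  proof (intro exI[of _ E] conjI E0 allI En impI; elim conjE)
    fix a b :: real assume ab: "0 \<le> a" "a \<le> b" "b < 1"
    have "b ^ n - a ^ n \<le> 1 - a ^ n" for n using ab by (simp add: power_le_one)
    then show "(\<integral>\<^sup>+t. ennreal ((cmod (h (of_real b * cis t) - h (of_real a * cis t)))\<^sup>2) \<partial>circ) \<le> ennreal (E a)"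
      using ab by (intro Ediff) auto
  next
    fix s R :: real assume sR: "0 \<le> s" "s < 1" "0 \<le> R" "R < 1"
    have "R ^ n - (s * R) ^ n \<le> 1 - s ^ n" for n
    proof -
      have "R ^ n - (s * R) ^ n = R ^ n * (1 - s ^ n)" by (simp add: algebra_simps power_mult_distrib)
      also have "\<dots> \<le> 1 * (1 - s ^ n)" using sR by (intro mult_right_mono) (auto simp: power_le_one)
      finally show ?thesis by simp
    qed
    moreover have "s * R \<le> R" using sR by (simp add: mult_left_le_one_le)
    ultimately show "(\<integral>\<^sup>+t. ennreal ((cmod (h (of_real R * cis t) - h (of_real (s * R) * cis t)))\<^sup>2) \<partial>circ) \<le> ennreal (E s)"
      using sR by (intro Ediff) auto
  qed
qed

text \<open>The function h is compared with the dilations h(s_j z), which are continuous up to the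
  circle. The maximal functions of the differences have summable integrals, hence tend to 0 almost
  everywhere, and this bounds the radial oscillation of h.\<close>

lemma H2_radial_limit:
  assumes h: "in_H2 h B"
  shows "AE t in circ. ((\<lambda>r. h (of_real r * cis t)) \<longlongrightarrow> bdry h t) (at_left 1)"
proof -
  have hol: "h holomorphic_on ball 0 1" using h by (simp add: in_H2_def)
  then have ch: "continuous_on (ball 0 1) h" using holomorphic_on_imp_continuous_on by blast
  obtain E :: "real \<Rightarrow> real" where E0: "(E \<longlongrightarrow> 0) (at_left 1)" and E1: "\<forall>a. 0 \<le> E a"
    and E2: "\<forall>a b. 0 \<le> a \<and> a \<le> b \<and> b < 1 \<longrightarrow>
       (\<integral>\<^sup>+t. ennreal ((cmod (h (of_real b * cis t) - h (of_real a * cis t)))\<^sup>2) \<partial>circ) \<le> ennreal (E a)"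
    and E3: "\<forall>s R. 0 \<le> s \<and> s < 1 \<and> 0 \<le> R \<and> R < 1 \<longrightarrow>
       (\<integral>\<^sup>+t. ennreal ((cmod (h (of_real R * cis t) - h (of_real (s * R) * cis t)))\<^sup>2) \<partial>circ) \<le> ennreal (E s)"
    using in_H2_dilation_defect[OF h] by (elim exE conjE) (rule that)
  \<comment> \<open>Geometric decay of the defects makes the maximal functions \<open>N j\<close>
    summable in L^1, so one null set suffices for all j.\<close>
  have "\<exists>s. 0 \<le> s \<and> s < 1 \<and> E s \<le> (1/2) ^ j" for j :: nat
  proof -
    have "\<forall>\<^sub>F a in at_left (1::real). 0 < a \<and> a < 1"
      unfolding eventually_at_left_field by (intro exI[of _ 0]) auto
    moreover have "\<forall>\<^sub>F a in at_left 1. E a < (1/2) ^ j" by (rule order_tendstoD(2)[OF E0]) simp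
    ultimately have "\<forall>\<^sub>F a in at_left 1. 0 \<le> a \<and> a < 1 \<and> E a \<le> (1/2) ^ j" by eventually_elim auto
    from eventually_happens'[OF _ this] show ?thesis by (auto simp: trivial_limit_at_left_real)
  qed
  then obtain s where s: "\<And>j. 0 \<le> s j" "\<And>j. s j < 1" "\<And>j. E (s j) \<le> (1/2) ^ j" by metis
  obtain q :: "nat \<Rightarrow> real" where q: "range q = \<rat> \<inter> {0..<1}" by (rule rational_radii)
  have q1: "0 \<le> q i \<and> q i < 1" for i using q by (auto dest: equalityD1 simp: image_subset_iff)
  define d where "d j z = h z - h (of_real (s j) * z)" for j z
  have im: "(\<lambda>z. of_real (s j) * z) ` ball 0 1 \<subseteq> ball (0::complex) 1" for j
    using s[of j] by (auto simp: norm_mult) (metis abs_of_nonneg less_imp_le mult_left_le_one_le norm_ge_zero order_le_less_trans)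
  have dhol: "d j holomorphic_on ball 0 1" for j
    unfolding d_def
    by (intro holomorphic_intros hol holomorphic_on_compose_gen[OF _ hol im, unfolded o_def])
  then have cd: "continuous_on (ball 0 1) (d j)" for j using holomorphic_on_imp_continuous_on by blast
  define N where "N j t = (SUP n. ennreal ((cmod (d j (of_real (q n) * cis t)))\<^sup>2))" for j t
  have [measurable]: "(\<lambda>t. d j (of_real (q n) * cis t)) \<in> borel_measurable borel" for j n
    using q1 by (intro measurable_disc_circle[OF cd]) auto
  have [measurable]: "N j \<in> borel_measurable circ" for j unfolding N_def by measurable
  have NB: "(\<integral>\<^sup>+t. N j t \<partial>circ) \<le> 256 * ennreal ((1/2) ^ j)" for j
    unfolding N_def
  proof (rule H2_maximal[OF dhol _ q1])
    fix R :: real assume "0 \<le> R" "R < 1"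
    then have "(\<integral>\<^sup>+t. ennreal ((cmod (d j (of_real R * cis t)))\<^sup>2) \<partial>circ) \<le> ennreal (E (s j))"
      using E3[rule_format, of "s j" R] s by (simp add: d_def mult.assoc)
    also have "\<dots> \<le> ennreal ((1/2) ^ j)" by (intro ennreal_leI s)
    finally show "(\<integral>\<^sup>+t. ennreal ((cmod (d j (of_real R * cis t)))\<^sup>2) \<partial>circ) \<le> ennreal ((1/2) ^ j)" .
  qed
  have "(\<integral>\<^sup>+t. (\<Sum>j. N j t) \<partial>circ) = (\<Sum>j. \<integral>\<^sup>+t. N j t \<partial>circ)" by (rule nn_integral_suminf) measurable
  also have "\<dots> \<le> (\<Sum>j. 256 * ennreal ((1/2) ^ j))" by (intro suminf_le NB) auto
  also have "\<dots> = 256 * ennreal (\<Sum>j. (1/2) ^ j)"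
    by (simp add: suminf_ennreal2 summable_geometric)
  also have "\<dots> < \<infinity>" by (simp add: ennreal_mult_less_top)
  finally have "AE t in circ. (\<Sum>j. N j t) \<noteq> \<infinity>" by (intro nn_integral_PInf_AE) auto
  then show ?thesis
  proof (rule AE_mp, intro AE_I2 impI)
    fix t assume fin: "(\<Sum>j. N j t) \<noteq> \<infinity>"
    have Nle: "N j t \<le> (\<Sum>j. N j t)" for j
      using sum_le_suminf[of "\<lambda>j. N j t" "{j}"] by simp
    have Nf: "N j t = ennreal (enn2real (N j t))" for j
      using Nle[of j] fin by (metis ennreal_enn2real_if infinity_ennreal_def neq_top_trans)
    have "summable (\<lambda>j. enn2real (N j t))"
      by (rule summable_suminf_not_top) (use fin Nf in auto)
    then have N0: "(\<lambda>j. enn2real (N j t)) \<longlonglongrightarrow> 0" by (rule summable_LIMSEQ_zero)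
    have dle: "(cmod (d j (of_real r * cis t)))\<^sup>2 \<le> enn2real (N j t)" if "0 \<le> r" "r < 1" for r j
    proof (rule le_by_rationals[where a="-1" and u="\<lambda>r. (cmod (d j (of_real r * cis t)))\<^sup>2"])
      show "continuous_on {0..<1} (\<lambda>r. (cmod (d j (of_real r * cis t)))\<^sup>2)"
        by (intro continuous_intros continuous_disc_radius cd)
      fix p :: real assume "p \<in> \<rat>" "0 \<le> p" "p < 1"
      then obtain n where "p = q n" using q by (metis IntI atLeastLessThan_iff rangeE)
      then have "ennreal ((cmod (d j (of_real p * cis t)))\<^sup>2) \<le> N j t" unfolding N_def by (auto intro: SUP_upper)
      then have "ennreal ((cmod (d j (of_real p * cis t)))\<^sup>2) \<le> ennreal (enn2real (N j t))" using Nf[of j] by simp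
      then show "(cmod (d j (of_real p * cis t)))\<^sup>2 \<le> enn2real (N j t)" by (simp add: ennreal_le_iff)
    qed (use that in auto)
    have "\<exists>l. ((\<lambda>r. h (of_real r * cis t)) \<longlongrightarrow> l) (at_left 1)"
    proof (rule radial_Cauchy_limit)
      fix e :: real assume e: "e > 0"
      have "eventually (\<lambda>j. enn2real (N j t) < (e/3)\<^sup>2) sequentially"
        by (rule order_tendstoD(2)[OF N0]) (use e in simp)
      then obtain j where j: "enn2real (N j t) < (e/3)\<^sup>2" by (auto simp: eventually_sequentially)
      have d3: "cmod (d j (of_real r * cis t)) \<le> e/3" if "0 \<le> r" "r < 1" for r
      proof -
        have "(cmod (d j (of_real r * cis t)))\<^sup>2 \<le> (e/3)\<^sup>2" using dle[OF that, of j] j by linarith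
        then show ?thesis using e by (simp add: abs_le_square_iff[symmetric])
      qed
      define g where "g r = h (of_real (s j) * (of_real r * cis t))" for r
      have ins: "of_real (s j) * cis t \<in> ball 0 1" using s[of j] by (simp add: norm_mult)
      have "((\<lambda>r. of_real (s j) * (of_real r * cis t)) \<longlongrightarrow> of_real (s j) * (of_real 1 * cis t)) (at_left (1::real))"
        by (intro tendsto_intros)
      moreover have "isCont h (of_real (s j) * (of_real 1 * cis t))"
        using ch ins by (simp add: continuous_on_eq_continuous_at)
      ultimately have "(g \<longlongrightarrow> h (of_real (s j) * (of_real 1 * cis t))) (at_left 1)"
        unfolding g_def by (rule isCont_tendsto_compose[rotated])
      from tendstoD[OF this, of "e/6"] e obtain a where a: "a < 1" "\<And>r. a < r \<Longrightarrow> r < 1 \<Longrightarrow> dist (g r) (h (of_real (s j) * (of_real 1 * cis t))) < e/6"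
        by (auto simp: eventually_at_left_field)
      show "\<exists>a<1. \<forall>r r'. a < r \<and> r < 1 \<and> a < r' \<and> r' < 1 \<longrightarrow> cmod (h (of_real r * cis t) - h (of_real r' * cis t)) \<le> e"
      proof (intro exI[of _ "max a 0"] conjI allI impI)
        fix r r' assume rr: "max a 0 < r \<and> r < 1 \<and> max a 0 < r' \<and> r' < 1"
        have 1: "dist (g r) (g r') \<le> e/3"
          using dist_triangle2[of "g r" "g r'" "h (of_real (s j) * (of_real 1 * cis t))"] a(2)[of r] a(2)[of r'] rr by simp
        have "h (of_real r * cis t) - h (of_real r' * cis t) = d j (of_real r * cis t) - d j (of_real r' * cis t) + (g r - g r')"
          by (simp add: d_def g_def)
        also have "cmod \<dots> \<le> cmod (d j (of_real r * cis t)) + cmod (d j (of_real r' * cis t)) + cmod (g r - g r')"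
          by (metis (no_types, lifting) add_mono_thms_linordered_semiring(3) norm_triangle_ineq norm_triangle_ineq4 order_trans)
        also have "\<dots> \<le> e/3 + e/3 + e/3" using d3[of r] d3[of r'] rr 1 by (intro add_mono) (auto simp: dist_norm)
        finally show "cmod (h (of_real r * cis t) - h (of_real r' * cis t)) \<le> e" by simp
      qed (use a in auto)
    qed
    then show "((\<lambda>r. h (of_real r * cis t)) \<longlongrightarrow> bdry h t) (at_left 1)" using bdry_eqI by metis
  qed
qed

lemma H2_radial_limit_seq:
  assumes h: "in_H2 h B"
  shows "AE t in circ. (\<lambda>n. h (of_real (rs n) * cis t)) \<longlonglongrightarrow> bdry h t"
  using H2_radial_limit[OF h] by (rule AE_mp) (auto intro!: AE_I2 filterlim_compose[OF _ rs_at_left])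

lemma H2_boundary_bound:
  assumes h: "in_H2 h B"
  shows "(\<integral>\<^sup>+t. ennreal ((cmod (bdry h t))\<^sup>2) \<partial>circ) \<le> ennreal B"
proof -
  have ch: "continuous_on (ball 0 1) h" using h holomorphic_on_imp_continuous_on by (auto simp: in_H2_def)
  have [measurable]: "(\<lambda>t. h (of_real (rs n) * cis t)) \<in> borel_measurable borel" for n
    by (rule measurable_disc_circle[OF ch rs_bounds(1,2)])
  have "(\<integral>\<^sup>+t. ennreal ((cmod (bdry h t))\<^sup>2) \<partial>circ) \<le> (\<integral>\<^sup>+t. liminf (\<lambda>n. ennreal ((cmod (h (of_real (rs n) * cis t)))\<^sup>2)) \<partial>circ)"
  proof (rule nn_integral_mono_AE)
    show "AE t in circ. ennreal ((cmod (bdry h t))\<^sup>2) \<le> liminf (\<lambda>n. ennreal ((cmod (h (of_real (rs n) * cis t)))\<^sup>2))"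
      using H2_radial_limit_seq[OF h]
    proof (rule AE_mp, intro AE_I2 impI)
      fix t assume "(\<lambda>n. h (of_real (rs n) * cis t)) \<longlonglongrightarrow> bdry h t"
      then have "(\<lambda>n. ennreal ((cmod (h (of_real (rs n) * cis t)))\<^sup>2)) \<longlonglongrightarrow> ennreal ((cmod (bdry h t))\<^sup>2)"
        by (intro tendsto_intros tendsto_ennrealI)
      from lim_imp_Liminf[OF _ this] show "ennreal ((cmod (bdry h t))\<^sup>2) \<le> liminf (\<lambda>n. ennreal ((cmod (h (of_real (rs n) * cis t)))\<^sup>2))"
        by simp
    qed
  qed
  also have "\<dots> \<le> liminf (\<lambda>n. \<integral>\<^sup>+t. ennreal ((cmod (h (of_real (rs n) * cis t)))\<^sup>2) \<partial>circ)"
    by (rule nn_integral_liminf) measurable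
  also have "\<dots> \<le> liminf (\<lambda>n::nat. ennreal B)"
    using h rs_bounds by (intro Liminf_mono always_eventually allI) (auto simp: in_H2_def)
  finally show ?thesis by (simp add: Liminf_const)
qed

text \<open>Fatou's lemma in the outer radius: the defect between two interior radii is controlled
  by the inner one alone, so the outer radius may be sent to 1.\<close>

lemma H2_boundary_L2:
  assumes h: "in_H2 h B"
  shows "(\<lambda>n. \<integral>\<^sup>+t. ennreal ((cmod (h (of_real (rs n) * cis t) - bdry h t))\<^sup>2) \<partial>circ) \<longlonglongrightarrow> 0"
proof -
  have ch: "continuous_on (ball 0 1) h" using h holomorphic_on_imp_continuous_on by (auto simp: in_H2_def)
  have [measurable]: "(\<lambda>t. h (of_real (rs n) * cis t)) \<in> borel_measurable borel" for n
    by (rule measurable_disc_circle[OF ch rs_bounds(1,2)])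
  obtain E :: "real \<Rightarrow> real" where E0: "(E \<longlongrightarrow> 0) (at_left 1)" and E1: "\<forall>a. 0 \<le> E a"
    and E2: "\<forall>a b. 0 \<le> a \<and> a \<le> b \<and> b < 1 \<longrightarrow>
       (\<integral>\<^sup>+t. ennreal ((cmod (h (of_real b * cis t) - h (of_real a * cis t)))\<^sup>2) \<partial>circ) \<le> ennreal (E a)"
    and E3: "\<forall>s R. 0 \<le> s \<and> s < 1 \<and> 0 \<le> R \<and> R < 1 \<longrightarrow>
       (\<integral>\<^sup>+t. ennreal ((cmod (h (of_real R * cis t) - h (of_real (s * R) * cis t)))\<^sup>2) \<partial>circ) \<le> ennreal (E s)"
    using in_H2_dilation_defect[OF h] by (elim exE conjE) (rule that)
  have le: "(\<integral>\<^sup>+t. ennreal ((cmod (h (of_real (rs n) * cis t) - bdry h t))\<^sup>2) \<partial>circ) \<le> ennreal (E (rs n))" for n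
  proof -
    have "(\<integral>\<^sup>+t. ennreal ((cmod (h (of_real (rs n) * cis t) - bdry h t))\<^sup>2) \<partial>circ)
       \<le> (\<integral>\<^sup>+t. liminf (\<lambda>m. ennreal ((cmod (h (of_real (rs m) * cis t) - h (of_real (rs n) * cis t)))\<^sup>2)) \<partial>circ)"
    proof (rule nn_integral_mono_AE)
      show "AE t in circ. ennreal ((cmod (h (of_real (rs n) * cis t) - bdry h t))\<^sup>2)
          \<le> liminf (\<lambda>m. ennreal ((cmod (h (of_real (rs m) * cis t) - h (of_real (rs n) * cis t)))\<^sup>2))"
        using H2_radial_limit_seq[OF h]
      proof (rule AE_mp, intro AE_I2 impI)
        fix t assume "(\<lambda>n. h (of_real (rs n) * cis t)) \<longlonglongrightarrow> bdry h t"
        then have "(\<lambda>m. ennreal ((cmod (h (of_real (rs m) * cis t) - h (of_real (rs n) * cis t)))\<^sup>2)) \<longlonglongrightarrow> ennreal ((cmod (bdry h t - h (of_real (rs n) * cis t)))\<^sup>2)"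
          by (intro tendsto_intros tendsto_ennrealI)
        from lim_imp_Liminf[OF _ this] show "ennreal ((cmod (h (of_real (rs n) * cis t) - bdry h t))\<^sup>2)
          \<le> liminf (\<lambda>m. ennreal ((cmod (h (of_real (rs m) * cis t) - h (of_real (rs n) * cis t)))\<^sup>2))"
          by (simp add: norm_minus_commute)
      qed
    qed
    also have "\<dots> \<le> liminf (\<lambda>m. \<integral>\<^sup>+t. ennreal ((cmod (h (of_real (rs m) * cis t) - h (of_real (rs n) * cis t)))\<^sup>2) \<partial>circ)"
      by (rule nn_integral_liminf) measurable
    also have "\<dots> \<le> liminf (\<lambda>m::nat. ennreal (E (rs n)))"
    proof (rule Liminf_mono)
      have "rs n \<le> rs m" if "n \<le> m" for m using that by (simp add: rs_def frac_le)
      then show "\<forall>\<^sub>F m in sequentially. (\<integral>\<^sup>+t. ennreal ((cmod (h (of_real (rs m) * cis t) - h (of_real (rs n) * cis t)))\<^sup>2) \<partial>circ) \<le> ennreal (E (rs n))"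
        unfolding eventually_sequentially using E2 rs_bounds by blast
    qed
    finally show ?thesis by (simp add: Liminf_const)
  qed
  have "(\<lambda>n. ennreal (E (rs n))) \<longlonglongrightarrow> ennreal 0"
    by (intro tendsto_ennrealI filterlim_compose[OF E0 rs_at_left])
  then have lim: "(\<lambda>n. ennreal (E (rs n))) \<longlonglongrightarrow> 0" by simp
  show ?thesis
    by (rule tendsto_sandwich[OF _ _ tendsto_const lim]) (simp_all add: le)
qed

section \<open>Factorization and boundary values in the Hardy space of exponent one\<close>

lemma cmod_one_minus_cnj:
  assumes "cmod z = 1"
  shows "cmod (1 - cnj a * z) = cmod (z - a)"
proof -
  have "cnj z * z = 1" using complex_norm_square[of z] assms by (simp add: mult.commute)
  then have "1 - cnj a * z = cnj (z - a) * z" by (simp add: algebra_simps)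
  then show ?thesis by (simp only: norm_mult complex_mod_cnj assms mult_1_right)
qed

lemma cmod_Moebius_le_1:
  assumes "cmod z < 1" "cmod a < 1"
  shows "cmod (z - a) \<le> cmod (1 - cnj a * z)"
proof -
  have "(cmod (1 - cnj a * z))\<^sup>2 - (cmod (z - a))\<^sup>2 = (1 - (cmod z)\<^sup>2) * (1 - (cmod a)\<^sup>2)"
    by (simp add: cmod_power2) (simp add: power2_eq_square algebra_simps)
  also have "\<dots> \<ge> 0" using assms by (intro mult_nonneg_nonneg) (auto simp: abs_square_le_1)
  finally show ?thesis by (simp add: abs_le_square_iff[symmetric])
qed

text \<open>Induction on the number of distinct zeros in the open disc. A zero a of order n is moved
  into b as the n-th power of its Blaschke factor, while e keeps (1 - cnj a z)^n, which has the
  modulus of (z - a)^n on the circle. Zeros on the circle itself stay in e.\<close>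

lemma remove_zeros_disc:
  fixes f :: "complex \<Rightarrow> complex"
  assumes "f holomorphic_on ball 0 R" "1 < R" "finite {z \<in> ball 0 1. f z = 0}" "\<exists>z\<in>ball 0 R. f z \<noteq> 0"
  shows "\<exists>b e. e holomorphic_on ball 0 R \<and> b holomorphic_on ball 0 1 \<and> (\<forall>z\<in>ball 0 1. f z = b z * e z) \<and>
     (\<forall>z\<in>ball 0 1. cmod (b z) \<le> 1) \<and> (\<forall>z\<in>ball 0 1. e z \<noteq> 0) \<and> (\<forall>z\<in>sphere 0 1. cmod (e z) = cmod (f z))"
  using assms
proof (induction "card {z \<in> ball 0 1. f z = 0}" arbitrary: f rule: less_induct)
  case less
  show ?case
  proof (cases "{z \<in> ball 0 1. f z = 0} = {}")
    case True
    then show ?thesis using less.prems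
      by (intro exI[of _ "\<lambda>_. 1"] exI[of _ f]) auto
  next
    case False
    then obtain a where a: "cmod a < 1" "f a = 0" by auto
    have aR: "a \<in> ball 0 R" using a less.prems(2) by auto
    have nc: "\<not> f constant_on ball 0 R"
      using less.prems(4) a(2) aR unfolding constant_on_def by metis
    have "\<exists>g r n. 0 < n \<and> 0 < r \<and> ball a r \<subseteq> ball 0 R \<and> g holomorphic_on ball a r \<and>
        (\<forall>w\<in>ball a r. f w = (w - a) ^ n * g w) \<and> (\<forall>w\<in>ball a r. g w \<noteq> 0)"
    proof (rule holomorphic_factor_zero_nonconstant[OF less.prems(1) open_ball connected_ball aR a(2) nc])
      fix g r and n :: nat
      assume g: "0 < n" "0 < r" "ball a r \<subseteq> ball 0 R" "g holomorphic_on ball a r"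
        "\<And>w. w \<in> ball a r \<Longrightarrow> f w = (w - a) ^ n * g w" "\<And>w. w \<in> ball a r \<Longrightarrow> g w \<noteq> 0"
      show "\<exists>g r n. 0 < n \<and> 0 < r \<and> ball a r \<subseteq> ball 0 R \<and> g holomorphic_on ball a r \<and>
        (\<forall>w\<in>ball a r. f w = (w - a) ^ n * g w) \<and> (\<forall>w\<in>ball a r. g w \<noteq> 0)"
        by (intro exI[of _ g] exI[of _ r] exI[of _ n] conjI ballI g)
    qed
    then obtain g r n where g: "0 < n" "0 < r" "ball a r \<subseteq> ball 0 R" "g holomorphic_on ball a r"
        "\<forall>w\<in>ball a r. f w = (w - a) ^ n * g w" "\<forall>w\<in>ball a r. g w \<noteq> 0"
      by (elim exE conjE) (rule that)
    define q where "q z = (if z = a then g a else f z / (z - a) ^ n)" for z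
    have q1: "q holomorphic_on ball 0 R - {a}"
    proof (rule holomorphic_transform)
      show "(\<lambda>z. f z / (z - a) ^ n) holomorphic_on ball 0 R - {a}"
        by (intro holomorphic_intros holomorphic_on_subset[OF less.prems(1)]) auto
    qed (auto simp: q_def)
    have q2: "q holomorphic_on ball a r"
      by (rule holomorphic_transform[OF g(4)]) (use g(5) in \<open>auto simp: q_def\<close>)
    have un: "ball 0 R = (ball 0 R - {a}) \<union> ball a r" using g(2,3) by auto
    have q: "q holomorphic_on ball 0 R"
      by (subst un, rule holomorphic_on_Un[OF q1 q2]) (auto intro: open_delete)
    have fq: "f z = (z - a) ^ n * q z" if "z \<in> ball 0 R" for z
      using a(2) g(1) by (auto simp: q_def)
    have qa: "q a \<noteq> 0" using g(6)[rule_format, of a] g(2) by (auto simp: q_def)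
    define f1 where "f1 z = q z * (1 - cnj a * z) ^ n" for z
    have nz: "1 - cnj a * z \<noteq> 0" if "cmod z < 1" for z
    proof
      assume "1 - cnj a * z = 0"
      then have "cnj a * z = 1" by simp
      then have "cmod a * cmod z = 1" by (metis complex_mod_cnj norm_mult norm_one)
      moreover have "cmod a * cmod z < 1" using a(1) that mult_strict_mono[of "cmod a" 1 "cmod z" 1] by simp
      ultimately show False by simp
    qed
    have f1: "f1 holomorphic_on ball 0 R" unfolding f1_def by (intro holomorphic_intros q)
    have z1: "{z \<in> ball 0 1. f1 z = 0} = {z \<in> ball 0 1. f z = 0} - {a}"
    proof (intro equalityI subsetI)
      fix z assume "z \<in> {z \<in> ball 0 1. f1 z = 0}"
      then have z: "cmod z < 1" "q z = 0" using nz[of z] by (auto simp: f1_def)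
      then show "z \<in> {z \<in> ball 0 1. f z = 0} - {a}" using fq[of z] qa less.prems(2) by auto
    next
      fix z assume "z \<in> {z \<in> ball 0 1. f z = 0} - {a}"
      then show "z \<in> {z \<in> ball 0 1. f1 z = 0}" using fq[of z] less.prems(2) by (auto simp: f1_def)
    qed
    have "card {z \<in> ball 0 1. f1 z = 0} < card {z \<in> ball 0 1. f z = 0}"
      unfolding z1 by (rule card_Diff1_less) (use less.prems a in auto)
    moreover have "\<exists>z\<in>ball 0 R. f1 z \<noteq> 0"
      by (intro bexI[of _ a]) (use nz[OF a(1)] qa aR in \<open>auto simp: f1_def\<close>)
    ultimately obtain b e where be: "e holomorphic_on ball 0 R" "b holomorphic_on ball 0 1" "\<forall>z\<in>ball 0 1. f1 z = b z * e z"
       "\<forall>z\<in>ball 0 1. cmod (b z) \<le> 1" "\<forall>z\<in>ball 0 1. e z \<noteq> 0" "\<forall>z\<in>sphere 0 1. cmod (e z) = cmod (f1 z)"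
      using less.hyps[of f1] f1 less.prems(2,3) z1 by auto
    define b' where "b' z = ((z - a) / (1 - cnj a * z)) ^ n * b z" for z
    have "b' holomorphic_on ball 0 1" unfolding b'_def by (intro holomorphic_intros be) (use nz in auto)
    moreover have "f z = b' z * e z" if "z \<in> ball 0 1" for z
    proof -
      have "b' z * e z = ((z - a) / (1 - cnj a * z)) ^ n * f1 z" using be(3) that by (simp add: b'_def)
      also have "\<dots> = (z - a) ^ n * q z" using nz[of z] that by (simp add: f1_def power_divide)
      finally show ?thesis using fq[of z] that less.prems(2) by simp
    qed
    moreover have "cmod (b' z) \<le> 1" if "z \<in> ball 0 1" for z
    proof -
      have "cmod ((z - a) / (1 - cnj a * z)) \<le> 1"
        using cmod_Moebius_le_1[of z a] that a nz[of z] by (simp add: norm_divide divide_le_eq_1)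
      then have "cmod (((z - a) / (1 - cnj a * z)) ^ n) \<le> 1" by (simp add: norm_power power_le_one)
      then show ?thesis using be(4) that unfolding b'_def norm_mult by (simp add: mult_le_one)
    qed
    moreover have "cmod (e z) = cmod (f z)" if "z \<in> sphere 0 1" for z
    proof -
      have "cmod (f1 z) = cmod (f z)"
        using fq[of z] that less.prems(2) cmod_one_minus_cnj[of z a] by (simp add: f1_def norm_mult norm_power)
      then show ?thesis using be(6) that by simp
    qed
    ultimately show ?thesis using be(1,5) by blast
  qed
qed

text \<open>The zero-free part e has a square root g in the disc, and f = (b g) g with |b| <= 1. The
  squared L^2 means of g are the L^1 means of e, whose boundary value is the mean of |f|.\<close>

lemma factor_L1_closed:
  fixes f :: "complex \<Rightarrow> complex"
  assumes f: "f holomorphic_on ball 0 R" "1 < R" "\<exists>z\<in>ball 0 R. f z \<noteq> 0"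
    and B: "(\<integral>\<^sup>+t. ennreal (cmod (f (cis t))) \<partial>circ) \<le> ennreal B" "0 \<le> B"
  shows "\<exists>h k. in_H2 h B \<and> in_H2 k B \<and> (\<forall>z\<in>ball 0 1. f z = h z * k z)"
proof -
  have "finite {z \<in> ball 0 1. f z = 0}"
  proof (cases "f constant_on ball 0 R")
    case True
    then have "{z \<in> ball 0 1. f z = 0} = {}" using f(2,3) unfolding constant_on_def by force
    then show ?thesis by (simp only: finite.emptyI)
  next
    case False
    have "finite {z \<in> cball 0 1. f z = 0}"
      by (rule holomorphic_compact_finite_zeros[OF f(1) _ _ _ _ False]) (use f(2) in auto)
    then show ?thesis by (rule finite_subset[rotated]) auto
  qed
  then obtain b e where be: "e holomorphic_on ball 0 R" "b holomorphic_on ball 0 1" "\<forall>z\<in>ball 0 1. f z = b z * e z"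
     "\<forall>z\<in>ball 0 1. cmod (b z) \<le> 1" "\<forall>z\<in>ball 0 1. e z \<noteq> 0" "\<forall>z\<in>sphere 0 1. cmod (e z) = cmod (f z)"
    using remove_zeros_disc[OF f(1,2) _ f(3)] by blast
  have e1: "e holomorphic_on ball 0 1" using be(1) by (rule holomorphic_on_subset) (use f(2) in auto)
  have ce: "continuous_on (cball 0 1) e"
    by (rule continuous_on_subset[OF holomorphic_on_imp_continuous_on[OF be(1)]]) (use f(2) in auto)
  obtain g where g: "g holomorphic_on ball 0 1" "\<And>z. z \<in> ball 0 1 \<Longrightarrow> e z = (g z)\<^sup>2"
    using contractible_imp_holomorphic_sqrt[OF e1 convex_imp_contractible[OF convex_ball]] be(5) by blast
  have cg: "continuous_on (ball 0 1) g" using g(1) by (rule holomorphic_on_imp_continuous_on)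
  obtain c where c: "\<And>z. cmod z < 1 \<Longrightarrow> (\<lambda>n. c n * z ^ n) sums g z"
    and s: "\<And>r. 0 \<le> r \<Longrightarrow> r < 1 \<Longrightarrow> summable (\<lambda>n. cmod (c n) * r ^ n)"
    using holomorphic_disc_series[OF g(1)] by blast
  have sq: "summable (\<lambda>n. (cmod (c n) * r ^ n)\<^sup>2)" if r: "0 \<le> r" "r < 1" for r
  proof (rule summable_comparison_test_ev[OF _ summable_mult[OF s[OF r], of "\<Sum>n. cmod (c n) * r ^ n"]])
    have "cmod (c n) * r ^ n \<le> (\<Sum>n. cmod (c n) * r ^ n)" for n
      using sum_le_suminf[OF s[OF r], of "{n}"] r by simp
    then show "\<forall>\<^sub>F n in sequentially. norm ((cmod (c n) * r ^ n)\<^sup>2) \<le> (\<Sum>n. cmod (c n) * r ^ n) * (cmod (c n) * r ^ n)"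
      using r by (auto intro!: always_eventually mult_right_mono simp: power2_eq_square)
  qed
  \<comment> \<open>Since e may vanish on the circle, g need not be holomorphic there. Monotonicity
    of its means, read off from Parseval, bounds the interior means by the limit of those of
    e.\<close>
  have mono: "(\<integral>\<^sup>+t. ennreal ((cmod (g (of_real r * cis t)))\<^sup>2) \<partial>circ) \<le> (\<integral>\<^sup>+t. ennreal ((cmod (g (of_real r' * cis t)))\<^sup>2) \<partial>circ)"
    if r: "0 \<le> r" "r \<le> r'" "r' < 1" for r r'
  proof -
    have "(\<Sum>n. (cmod (c n) * r ^ n)\<^sup>2) \<le> (\<Sum>n. (cmod (c n) * r' ^ n)\<^sup>2)"
      by (intro suminf_le sq power_mono mult_left_mono) (use r in auto)
    then show ?thesis
      using Parseval_disc[of c g r, OF c s] Parseval_disc[of c g r', OF c s] r by (simp add: ennreal_leI)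
  qed
  define I where "I r = (LINT t|circ. cmod (e (of_real r * cis t)))" for r
  have ce2: "continuous_on UNIV (\<lambda>t. e (of_real r * cis t))" if "0 \<le> r" "r \<le> 1" for r
    by (rule continuous_on_compose2[OF ce]) (use that in \<open>auto intro!: continuous_intros simp: norm_mult\<close>)
  have eqI: "(\<integral>\<^sup>+t. ennreal (cmod (e (of_real r * cis t))) \<partial>circ) = ennreal (I r)" if "0 \<le> r" "r \<le> 1" for r
    unfolding I_def by (rule nn_integral_eq_integral) (use ce2[OF that] in \<open>auto intro!: integrable_circ continuous_intros\<close>)
  obtain M where M: "\<And>z. z \<in> cball 0 1 \<Longrightarrow> cmod (e z) \<le> M"
    using compact_imp_bounded[OF compact_continuous_image[OF ce compact_cball]] by (force simp: bounded_iff)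
  have rs1: "rs n \<le> 1" "\<bar>rs n\<bar> \<le> 1" for n using rs_bounds[of n] by auto
  have "(\<lambda>n. I (rs n)) \<longlonglongrightarrow> I 1"
    unfolding I_def
  proof (rule integral_dominated_convergence[where w="\<lambda>_. M"])
    show "(\<lambda>t. cmod (e (of_real 1 * cis t))) \<in> borel_measurable circ" "(\<lambda>t. cmod (e (of_real (rs n) * cis t))) \<in> borel_measurable circ" for n
      unfolding measurable_cong_sets[OF sets_circ refl] using rs_bounds[of n]
      by (auto intro!: borel_measurable_continuous_onI continuous_intros ce2 simp del: of_real_1)
    show "AE t in circ. (\<lambda>n. cmod (e (of_real (rs n) * cis t))) \<longlonglongrightarrow> cmod (e (of_real 1 * cis t))"
    proof (intro AE_I2 tendsto_norm continuous_on_tendsto_compose[OF ce])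
      show "(\<lambda>n. of_real (rs n) * cis t) \<longlonglongrightarrow> of_real 1 * cis t" for t
        by (intro tendsto_intros rs_tendsto)
    qed (use rs1 in \<open>auto simp: norm_mult\<close>)
    show "AE t in circ. norm (cmod (e (of_real (rs n) * cis t))) \<le> M" for n
      using M rs1 by (auto intro!: AE_I2 simp: norm_mult)
  qed simp
  moreover have "I 1 \<le> B"
  proof -
    have "ennreal (I 1) = (\<integral>\<^sup>+t. ennreal (cmod (f (cis t))) \<partial>circ)"
      using be(6) by (subst eqI[symmetric]) (auto intro!: nn_integral_cong)
    then have "ennreal (I 1) \<le> ennreal B" using B(1) by (simp only:)
    then show ?thesis by (simp only: ennreal_le_iff[OF B(2)])
  qed
  moreover have g2: "(\<integral>\<^sup>+t. ennreal ((cmod (g (of_real r * cis t)))\<^sup>2) \<partial>circ) = ennreal (I r)" if "0 \<le> r" "r < 1" for r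
    using that g(2) by (subst eqI[symmetric]) (auto intro!: nn_integral_cong simp: norm_mult norm_power)
  ultimately have gB: "(\<integral>\<^sup>+t. ennreal ((cmod (g (of_real r * cis t)))\<^sup>2) \<partial>circ) \<le> ennreal B" if r: "0 \<le> r" "r < 1" for r
  proof -
    have "\<forall>\<^sub>F n in sequentially. r < rs n" by (rule order_tendstoD(1)[OF rs_tendsto r(2)])
    then have ev: "\<forall>\<^sub>F n in sequentially. I r \<le> I (rs n)"
    proof eventually_elim
      case (elim n)
      have "0 \<le> I (rs n)" unfolding I_def by simp
      then show ?case using mono[of r "rs n"] elim r rs_bounds g2 by (simp add: ennreal_le_iff)
    qed
    have "I r \<le> I 1" by (rule tendsto_lowerbound[OF \<open>(\<lambda>n. I (rs n)) \<longlonglongrightarrow> I 1\<close> ev]) simp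
    then have "I r \<le> B" using \<open>I 1 \<le> B\<close> by simp
    then show ?thesis using g2[OF r] by (simp add: ennreal_leI)
  qed
  have "in_H2 g B" using g gB B by (auto simp: in_H2_def)
  moreover have "in_H2 (\<lambda>z. b z * g z) B"
    unfolding in_H2_def
  proof (intro conjI allI impI)
    show "(\<lambda>z. b z * g z) holomorphic_on ball 0 1" by (intro holomorphic_intros be g)
    fix r :: real assume r: "0 \<le> r" "r < 1"
    have "cmod (b (of_real r * cis t)) \<le> 1" for t using be(4) r by (auto simp: norm_mult)
    then have "(\<integral>\<^sup>+t. ennreal ((cmod (b (of_real r * cis t) * g (of_real r * cis t)))\<^sup>2) \<partial>circ) \<le> (\<integral>\<^sup>+t. ennreal ((cmod (g (of_real r * cis t)))\<^sup>2) \<partial>circ)"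
      by (intro nn_integral_mono ennreal_leI power_mono) (auto simp: norm_mult mult_left_le_one_le)
    then show "(\<integral>\<^sup>+t. ennreal ((cmod (b (of_real r * cis t) * g (of_real r * cis t)))\<^sup>2) \<partial>circ) \<le> ennreal B"
      using gB[OF r] by (rule order_trans)
  qed (use B in simp)
  moreover have "f z = (b z * g z) * g z" if "z \<in> ball 0 1" for z
    using be(3) g(2) that by (simp add: power2_eq_square)
  ultimately show ?thesis by blast
qed

text \<open>Local boundedness for Montel's theorem is the purpose. Each |c n|^2 is at most B, hence
  2 |c n| <= 1 + B, and a geometric series does the rest.\<close>

lemma in_H2_pointwise:
  assumes h: "in_H2 h B" and z: "cmod z < 1"
  shows "cmod (h z) \<le> (1 + B) / (1 - cmod z)"
proof -
  have "h holomorphic_on ball 0 1" using h by (simp add: in_H2_def)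
  then obtain c where c: "\<And>z. cmod z < 1 \<Longrightarrow> (\<lambda>n. c n * z ^ n) sums h z"
    and s: "\<And>r. 0 \<le> r \<Longrightarrow> r < 1 \<Longrightarrow> summable (\<lambda>n. cmod (c n) * r ^ n)"
    using holomorphic_disc_series[of h] by metis
  have B: "0 \<le> B" using h by (simp add: in_H2_def)
  have cb: "cmod (c n) \<le> 1 + B" for n
  proof -
    have "(cmod (c n))\<^sup>2 \<le> (\<Sum>m\<le>n. (cmod (c m))\<^sup>2)"
      by (rule member_le_sum) auto
    also have "\<dots> \<le> B" by (rule in_H2_coeffs_sum[of h B c, OF h c s])
    finally have "(cmod (c n))\<^sup>2 \<le> B" .
    moreover have "0 \<le> (cmod (c n) - 1)\<^sup>2" by simp
    moreover have "0 \<le> (cmod (c n))\<^sup>2" by simp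
    ultimately show ?thesis using B by (simp add: power2_eq_square algebra_simps) 
  qed
  have sg: "(\<lambda>n. (1 + B) * cmod z ^ n) sums ((1 + B) * (1 / (1 - cmod z)))"
    by (intro sums_mult geometric_sums) (use z in simp)
  have sn: "summable (\<lambda>n. norm (c n * z ^ n))" using s[of "cmod z"] z by (simp add: norm_mult norm_power)
  have "cmod (h z) \<le> (\<Sum>n. norm (c n * z ^ n))"
    using c[OF z] summable_norm[OF sn] by (simp add: sums_iff)
  also have "\<dots> \<le> (\<Sum>n. (1 + B) * cmod z ^ n)"
    by (rule suminf_le[OF _ sn]) (use cb sg in \<open>auto simp: norm_mult norm_power sums_iff intro!: mult_right_mono\<close>)
  also have "\<dots> = (1 + B) / (1 - cmod z)" using sg by (simp add: sums_iff)
  finally show ?thesis .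
qed

lemma in_H2_limit:
  assumes h: "\<And>n::nat. in_H2 (hn n) B" and l: "\<And>z. z \<in> ball 0 1 \<Longrightarrow> (\<lambda>n. hn n z) \<longlonglongrightarrow> h z"
    and hol: "h holomorphic_on ball 0 1"
  shows "in_H2 h B"
  unfolding in_H2_def
proof (intro conjI allI impI hol)
  show "0 \<le> B" using h[of 0] by (simp add: in_H2_def)
  fix r :: real assume r: "0 \<le> r" "r < 1"
  have c: "continuous_on (ball 0 1) (hn n)" for n using h[of n] holomorphic_on_imp_continuous_on by (auto simp: in_H2_def)
  have [measurable]: "(\<lambda>t. hn n (of_real r * cis t)) \<in> borel_measurable borel" for n
    by (rule measurable_disc_circle[OF c r])
  have "(\<integral>\<^sup>+t. ennreal ((cmod (h (of_real r * cis t)))\<^sup>2) \<partial>circ) \<le> (\<integral>\<^sup>+t. liminf (\<lambda>n. ennreal ((cmod (hn n (of_real r * cis t)))\<^sup>2)) \<partial>circ)"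
  proof (rule nn_integral_mono)
    fix t
    have "(\<lambda>n. hn n (of_real r * cis t)) \<longlonglongrightarrow> h (of_real r * cis t)" using r by (intro l) (simp add: norm_mult)
    then have "(\<lambda>n. ennreal ((cmod (hn n (of_real r * cis t)))\<^sup>2)) \<longlonglongrightarrow> ennreal ((cmod (h (of_real r * cis t)))\<^sup>2)"
      by (intro tendsto_intros tendsto_ennrealI)
    from lim_imp_Liminf[OF _ this]
    show "ennreal ((cmod (h (of_real r * cis t)))\<^sup>2) \<le> liminf (\<lambda>n. ennreal ((cmod (hn n (of_real r * cis t)))\<^sup>2))" by simp
  qed
  also have "\<dots> \<le> liminf (\<lambda>n. \<integral>\<^sup>+t. ennreal ((cmod (hn n (of_real r * cis t)))\<^sup>2) \<partial>circ)"
    by (rule nn_integral_liminf) measurable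
  also have "\<dots> \<le> liminf (\<lambda>n::nat. ennreal B)"
    using h r by (intro Liminf_mono always_eventually allI) (auto simp: in_H2_def)
  finally show "(\<integral>\<^sup>+t. ennreal ((cmod (h (of_real r * cis t)))\<^sup>2) \<partial>circ) \<le> ennreal B" by (simp add: Liminf_const)
qed

lemma in_H2_Montel:
  assumes h: "\<And>n::nat. in_H2 (hn n) B"
  shows "\<exists>h r. strict_mono (r :: nat \<Rightarrow> nat) \<and> in_H2 h B \<and> (\<forall>z\<in>ball 0 1. (\<lambda>n. hn (r n) z) \<longlonglongrightarrow> h z)"
proof -
  have B: "0 \<le> B" using h[of 0] by (simp add: in_H2_def)
  have bd: "\<exists>C. \<forall>h\<in>range hn. \<forall>z\<in>K. cmod (h z) \<le> C" if K: "compact K" "K \<subseteq> ball 0 1" for K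
  proof (cases "K = {}")
    case False
    obtain x where x: "x \<in> K" "\<And>y. y \<in> K \<Longrightarrow> cmod y \<le> cmod x"
      using continuous_attains_sup[OF K(1) False, of cmod] by (auto intro!: continuous_intros)
    have x1: "cmod x < 1" using x K by auto
    have "cmod (hn n z) \<le> (1 + B) / (1 - cmod x)" if "z \<in> K" for n z
    proof -
      have "cmod (hn n z) \<le> (1 + B) / (1 - cmod z)" by (rule in_H2_pointwise[OF h]) (use K that in auto)
      also have "\<dots> \<le> (1 + B) / (1 - cmod x)" using x(2)[OF that] x1 B by (intro divide_left_mono mult_pos_pos) auto
      finally show ?thesis .
    qed
    then show ?thesis by blast
  qed simp
  have "\<exists>g r. g holomorphic_on ball 0 1 \<and> strict_mono (r :: nat \<Rightarrow> nat) \<and> (\<forall>x\<in>ball 0 1. (\<lambda>n. hn (r n) x) \<longlonglongrightarrow> g x)"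
  proof (rule Montel[of "ball 0 1" "range hn" hn])
    show "h \<in> range hn \<Longrightarrow> h holomorphic_on ball 0 1" for h using h by (auto simp: in_H2_def)
  qed (use bd in blast)+
  then obtain g r where g: "g holomorphic_on ball 0 1" "strict_mono (r :: nat \<Rightarrow> nat)" "\<forall>x\<in>ball 0 1. (\<lambda>n. hn (r n) x) \<longlonglongrightarrow> g x"
    by blast
  have "in_H2 g B" by (rule in_H2_limit[where hn="\<lambda>n. hn (r n)"]) (use h g in auto)
  with g show ?thesis by blast
qed

text \<open>A function in the disc may have infinitely many zeros, but its dilations extend across
  the circle and factor with the same constant B. A normal family argument passes to the limit in
  both factors. The radii are kept above |z0|, where f z0 is nonzero, so that no dilation vanishes
  identically.\<close>

lemma H1_factorization:
  fixes f :: "complex \<Rightarrow> complex"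
  assumes f: "f holomorphic_on ball 0 1" and "0 \<le> B"
    and B: "\<And>r. 0 \<le> r \<Longrightarrow> r < 1 \<Longrightarrow> (\<integral>\<^sup>+t. ennreal (cmod (f (of_real r * cis t))) \<partial>circ) \<le> ennreal B"
  shows "\<exists>h k. in_H2 h B \<and> in_H2 k B \<and> (\<forall>z\<in>ball 0 1. f z = h z * k z)"
proof (cases "\<forall>z\<in>ball 0 1. f z = 0")
  case True
  have "in_H2 (\<lambda>_. 0) B" using \<open>0 \<le> B\<close> by (simp add: in_H2_def)
  with True show ?thesis by (intro exI[of _ "\<lambda>_. 0"]) auto
next
  case False
  then obtain z0 where z0: "cmod z0 < 1" "f z0 \<noteq> 0" by auto
  have "\<exists>h k. in_H2 h B \<and> in_H2 k B \<and> (\<forall>z\<in>ball 0 1. f (of_real \<rho> * z) = h z * k z)"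
    if \<rho>: "0 < \<rho>" "\<rho> < 1" "cmod z0 < \<rho>" for \<rho>
  proof (rule factor_L1_closed[of _ "1 / \<rho>"])
    have im: "(\<lambda>z. of_real \<rho> * z) ` ball 0 (1 / \<rho>) \<subseteq> ball (0::complex) 1"
      using \<rho> by (auto simp: norm_mult field_simps)
    show "(\<lambda>z. f (of_real \<rho> * z)) holomorphic_on ball 0 (1 / \<rho>)"
      by (rule holomorphic_on_compose_gen[OF _ f im, unfolded o_def]) (auto intro!: holomorphic_intros)
    show "1 < 1 / \<rho>" using \<rho> by simp
    have "z0 / of_real \<rho> \<in> ball 0 (1 / \<rho>)" using \<rho> z0 by (simp add: norm_divide divide_strict_right_mono)
    moreover have "f (of_real \<rho> * (z0 / of_real \<rho>)) \<noteq> 0" using z0 \<rho> by simp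
    ultimately show "\<exists>z\<in>ball 0 (1 / \<rho>). f (of_real \<rho> * z) \<noteq> 0" by blast
  qed (use B[of \<rho>] \<rho> \<open>0 \<le> B\<close> in auto)
  note fac = this
  obtain N where N: "\<And>n. n \<ge> N \<Longrightarrow> cmod z0 < rs n"
    using order_tendstoD(1)[OF rs_tendsto z0(1)] by (auto simp: eventually_sequentially)
  have "\<forall>n. \<exists>h k. in_H2 h B \<and> in_H2 k B \<and> (\<forall>z\<in>ball 0 1. f (of_real (rs (N + n)) * z) = h z * k z)"
    using fac[OF rs_bounds(3,2)] N by simp
  then obtain hn kn where hk: "\<And>n. in_H2 (hn n) B" "\<And>n. in_H2 (kn n) B"
     "\<And>n z. z \<in> ball 0 1 \<Longrightarrow> f (of_real (rs (N + n)) * z) = hn n z * kn n z" by metis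
  obtain h r where h: "strict_mono (r :: nat \<Rightarrow> nat)" "in_H2 h B" "\<forall>z\<in>ball 0 1. (\<lambda>n. hn (r n) z) \<longlonglongrightarrow> h z"
    using in_H2_Montel[of hn, OF hk(1)] by blast
  \<comment> \<open>The second factor is extracted along the subsequence of the first, so that both
    converge along the same indices.\<close>
  obtain k s where k: "strict_mono (s :: nat \<Rightarrow> nat)" "in_H2 k B" "\<forall>z\<in>ball 0 1. (\<lambda>n. kn (r (s n)) z) \<longlonglongrightarrow> k z"
    using in_H2_Montel[of "\<lambda>n. kn (r n)", OF hk(2)] by blast
  have "f z = h z * k z" if z: "z \<in> ball 0 1" for z
  proof (rule LIMSEQ_unique)
    have cf: "continuous_on (ball 0 1) f" using f by (rule holomorphic_on_imp_continuous_on)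
    have sub: "filterlim (\<lambda>n. N + r (s n)) sequentially sequentially"
      using strict_mono_compose[OF h(1) k(1)] 
      by (intro filterlim_subseq) (auto simp: strict_mono_def o_def)
    have "(\<lambda>n. of_real (rs (N + r (s n))) * z) \<longlonglongrightarrow> of_real 1 * z"
      by (intro tendsto_intros filterlim_compose[OF rs_tendsto sub])
    then have "(\<lambda>n. f (of_real (rs (N + r (s n))) * z)) \<longlonglongrightarrow> f (of_real 1 * z)"
    proof (rule continuous_on_tendsto_compose[OF cf])
      have "cmod (of_real (rs m) * z) < 1" for m
        using rs_bounds[of m] z mult_strict_mono[of "rs m" 1 "cmod z" 1] by (simp add: norm_mult)
      then show "\<forall>\<^sub>F n in sequentially. of_real (rs (N + r (s n))) * z \<in> ball 0 1" by simp
    qed (use z in simp)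
    then show "(\<lambda>n. f (of_real (rs (N + r (s n))) * z)) \<longlonglongrightarrow> f z" by simp
    have "(\<lambda>n. hn (r (s n)) z) \<longlonglongrightarrow> h z"
      using LIMSEQ_subseq_LIMSEQ[OF h(3)[rule_format, OF z] k(1)] by (simp add: o_def)
    then have "(\<lambda>n. hn (r (s n)) z * kn (r (s n)) z) \<longlonglongrightarrow> h z * k z"
      using k(3) z by (intro tendsto_mult) auto
    then show "(\<lambda>n. f (of_real (rs (N + r (s n))) * z)) \<longlonglongrightarrow> h z * k z" using hk(3) z by simp
  qed
  with h k show ?thesis by blast
qed

section \<open>Boundary behaviour of functions in H^1\<close>

lemma H1_iff:
  "f \<in> H1 \<longleftrightarrow> f holomorphic_on ball 0 1 \<and>
     (\<exists>B\<ge>0. \<forall>r. 0 \<le> r \<longrightarrow> r < 1 \<longrightarrow> (\<integral>\<^sup>+t. ennreal (cmod (f (of_real r * cis t))) \<partial>circ) \<le> ennreal B)"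
proof -
  have eq: "(\<integral>\<^sup>+t. ennreal (cmod (f (of_real r * cis t))) \<partial>circ) = (\<integral>\<^sup>+ t\<in>{0..2*pi}. ennreal (norm (f (of_real r * cis t))) \<partial>lborel)"
    if "f holomorphic_on ball 0 1" "0 \<le> r" "r < 1" for r
  proof (rule nn_integral_circ)
    have "(\<lambda>t. f (of_real r * cis t)) \<in> borel_measurable borel"
      by (rule measurable_disc_circle[OF holomorphic_on_imp_continuous_on]) (use that in auto)
    then show "(\<lambda>t. ennreal (cmod (f (of_real r * cis t)))) \<in> borel_measurable borel" by measurable
  qed
  show ?thesis
  proof
    assume f: "f \<in> H1"
    then have hol: "f holomorphic_on ball 0 1" by (simp add: H1_def udisc_def)
    obtain B where B: "\<forall>r\<in>{0..<1}. (\<integral>\<^sup>+ t\<in>{0..2*pi}. ennreal (norm (f (of_real r * cis t))) \<partial>lborel) \<le> ennreal B"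
      using f by (auto simp: H1_def)
    have "(\<integral>\<^sup>+t. ennreal (cmod (f (of_real r * cis t))) \<partial>circ) \<le> ennreal (max B 0)" if "0 \<le> r" "r < 1" for r
    proof -
      have "(\<integral>\<^sup>+t. ennreal (cmod (f (of_real r * cis t))) \<partial>circ) \<le> ennreal B"
        unfolding eq[OF hol that] using B that by auto
      also have "\<dots> \<le> ennreal (max B 0)" by (intro ennreal_leI) simp
      finally show ?thesis .
    qed
    then show "f holomorphic_on ball 0 1 \<and> (\<exists>B\<ge>0. \<forall>r. 0 \<le> r \<longrightarrow> r < 1 \<longrightarrow> (\<integral>\<^sup>+t. ennreal (cmod (f (of_real r * cis t))) \<partial>circ) \<le> ennreal B)"
      using hol by (intro conjI exI[of _ "max B 0"]) auto
  next
    assume R: "f holomorphic_on ball 0 1 \<and> (\<exists>B\<ge>0. \<forall>r. 0 \<le> r \<longrightarrow> r < 1 \<longrightarrow> (\<integral>\<^sup>+t. ennreal (cmod (f (of_real r * cis t))) \<partial>circ) \<le> ennreal B)"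
    then have hol: "f holomorphic_on ball 0 1" by simp
    obtain B where "\<forall>r. 0 \<le> r \<longrightarrow> r < 1 \<longrightarrow> (\<integral>\<^sup>+t. ennreal (cmod (f (of_real r * cis t))) \<partial>circ) \<le> ennreal B"
      using R by (elim conjE exE) (rule that)
    then have "\<forall>r\<in>{0..<1}. (\<integral>\<^sup>+ t\<in>{0..2*pi}. ennreal (norm (f (of_real r * cis t))) \<partial>lborel) \<le> ennreal B"
      using eq[OF hol] by simp
    then show "f \<in> H1" using hol by (auto simp: H1_def udisc_def)
  qed
qed

lemma ennreal_tendsto_zeroI:
  fixes x :: "'a \<Rightarrow> ennreal"
  assumes "\<And>e. e > 0 \<Longrightarrow> eventually (\<lambda>n. x n \<le> ennreal e) F"
  shows "(x \<longlongrightarrow> 0) F"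
proof (rule order_tendstoI)
  fix a :: ennreal assume "0 < a"
  then obtain y where y: "0 < y" "y < a" using dense by blast
  then obtain e where e: "y = ennreal e" "0 \<le> e" by (cases y) (auto simp: top.not_eq_extremum)
  then have "0 < e" using y by (auto simp: less_le)
  from assms[OF this] show "\<forall>\<^sub>F n in F. x n < a"
    by eventually_elim (use y e in auto)
qed simp

lemma ennreal_tendsto_zero_of_square:
  fixes x :: "'a \<Rightarrow> ennreal"
  assumes "((\<lambda>n. (x n)\<^sup>2) \<longlongrightarrow> 0) F"
  shows "(x \<longlongrightarrow> 0) F"
proof (rule ennreal_tendsto_zeroI)
  fix e :: real assume e: "e > 0"
  have "eventually (\<lambda>n. (x n)\<^sup>2 < ennreal (e\<^sup>2)) F" by (rule order_tendstoD(2)[OF assms]) (use e in simp)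
  then show "eventually (\<lambda>n. x n \<le> ennreal e) F"
  proof eventually_elim
    case (elim n)
    show ?case
    proof (cases "x n")
      case (real r)
      then have "r\<^sup>2 < e\<^sup>2" using elim by (simp add: ennreal_power ennreal_less_iff)
      then have "r \<le> e" using e real(2) by (simp add: power2_less_imp_less less_imp_le)
      then show ?thesis using real by (simp add: ennreal_leI)
    next
      case top
      then show ?thesis using elim by (simp add: power2_eq_square)
    qed
  qed
qed

lemma nn_integral_product_tendsto_zero:
  fixes u v :: "nat \<Rightarrow> real \<Rightarrow> complex"
  assumes [measurable]: "\<And>n. u n \<in> borel_measurable borel" "\<And>n. v n \<in> borel_measurable borel"
    and u: "\<And>n. (\<integral>\<^sup>+t. ennreal ((cmod (u n t))\<^sup>2) \<partial>circ) \<le> ennreal B"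
    and v: "(\<lambda>n. \<integral>\<^sup>+t. ennreal ((cmod (v n t))\<^sup>2) \<partial>circ) \<longlonglongrightarrow> 0"
  shows "(\<lambda>n. \<integral>\<^sup>+t. ennreal (cmod (u n t)) * ennreal (cmod (v n t)) \<partial>circ) \<longlonglongrightarrow> 0"
proof (rule ennreal_tendsto_zero_of_square)
  have le: "(\<integral>\<^sup>+t. ennreal (cmod (u n t)) * ennreal (cmod (v n t)) \<partial>circ)\<^sup>2 \<le> ennreal B * (\<integral>\<^sup>+t. ennreal ((cmod (v n t))\<^sup>2) \<partial>circ)" for n
  proof -
    have "(\<integral>\<^sup>+t. ennreal (cmod (u n t)) * ennreal (cmod (v n t)) \<partial>circ)\<^sup>2
       \<le> (\<integral>\<^sup>+t. (ennreal (cmod (u n t)))\<^sup>2 \<partial>circ) * (\<integral>\<^sup>+t. (ennreal (cmod (v n t)))\<^sup>2 \<partial>circ)"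
      by (rule Cauchy_Schwarz_nn_integral) measurable
    also have "\<dots> = (\<integral>\<^sup>+t. ennreal ((cmod (u n t))\<^sup>2) \<partial>circ) * (\<integral>\<^sup>+t. ennreal ((cmod (v n t))\<^sup>2) \<partial>circ)"
      by (simp add: ennreal_power)
    also have "\<dots> \<le> ennreal B * (\<integral>\<^sup>+t. ennreal ((cmod (v n t))\<^sup>2) \<partial>circ)" by (intro mult_right_mono u) simp
    finally show ?thesis .
  qed
  have "(\<lambda>n. ennreal B * (\<integral>\<^sup>+t. ennreal ((cmod (v n t))\<^sup>2) \<partial>circ)) \<longlonglongrightarrow> ennreal B * 0"
    by (rule ennreal_tendsto_cmult[OF _ v]) simp
  then have lim: "(\<lambda>n. ennreal B * (\<integral>\<^sup>+t. ennreal ((cmod (v n t))\<^sup>2) \<partial>circ)) \<longlonglongrightarrow> 0" by simp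
  show "(\<lambda>n. (\<integral>\<^sup>+t. ennreal (cmod (u n t)) * ennreal (cmod (v n t)) \<partial>circ)\<^sup>2) \<longlonglongrightarrow> 0"
    by (rule tendsto_sandwich[OF _ _ tendsto_const lim]) (simp_all add: le)
qed

lemma H1_boundary:
  assumes f: "f \<in> H1"
  shows "AE t in circ. ((\<lambda>r. f (of_real r * cis t)) \<longlongrightarrow> bdry f t) (at_left 1)"
    and "(\<lambda>n. \<integral>\<^sup>+t. ennreal (cmod (f (of_real (rs n) * cis t) - bdry f t)) \<partial>circ) \<longlonglongrightarrow> 0"
    and "(\<integral>\<^sup>+t. ennreal (cmod (bdry f t)) \<partial>circ) < \<infinity>"
proof -
  obtain B where hol: "f holomorphic_on ball 0 1" and B: "0 \<le> B"
     "\<And>r. 0 \<le> r \<Longrightarrow> r < 1 \<Longrightarrow> (\<integral>\<^sup>+t. ennreal (cmod (f (of_real r * cis t))) \<partial>circ) \<le> ennreal B"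
    using f unfolding H1_iff by metis
  obtain h k where hk: "in_H2 h B" "in_H2 k B" "\<And>z. z \<in> ball 0 1 \<Longrightarrow> f z = h z * k z"
    using H1_factorization[OF hol B(1)] B(2) by metis
  have cont: "continuous_on (ball 0 1) f" "continuous_on (ball 0 1) h" "continuous_on (ball 0 1) k"
    using hol hk holomorphic_on_imp_continuous_on by (auto simp: in_H2_def)
  note [measurable] = bdry_measurable[OF cont(1)] bdry_measurable[OF cont(2)] bdry_measurable[OF cont(3)]
  have [measurable]: "(\<lambda>t. f (of_real (rs n) * cis t)) \<in> borel_measurable borel"
     "(\<lambda>t. h (of_real (rs n) * cis t)) \<in> borel_measurable borel"
     "(\<lambda>t. k (of_real (rs n) * cis t)) \<in> borel_measurable borel" for n
    by (rule measurable_disc_circle[OF cont(1) rs_bounds(1,2)] measurable_disc_circle[OF cont(2) rs_bounds(1,2)]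
        measurable_disc_circle[OF cont(3) rs_bounds(1,2)])+
  have fr: "f (of_real r * cis t) = h (of_real r * cis t) * k (of_real r * cis t)" if "0 \<le> r" "r < 1" for r t
    using hk(3)[of "of_real r * cis t"] that by (simp add: norm_mult)
  have ev: "\<forall>\<^sub>F r in at_left (1::real). 0 < r \<and> r < 1"
    unfolding eventually_at_left_field by (intro exI[of _ 0]) auto
  have ae: "AE t in circ. ((\<lambda>r. f (of_real r * cis t)) \<longlongrightarrow> bdry h t * bdry k t) (at_left 1)"
    using H2_radial_limit[OF hk(1)] H2_radial_limit[OF hk(2)]
  proof (eventually_elim)
    case (elim t)
    show ?case
    proof (rule Lim_transform_eventually[OF tendsto_mult[OF elim]])
      show "\<forall>\<^sub>F r in at_left 1. h (of_real r * cis t) * k (of_real r * cis t) = f (of_real r * cis t)"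
        using ev by eventually_elim (simp add: fr)
    qed
  qed
  then show "AE t in circ. ((\<lambda>r. f (of_real r * cis t)) \<longlongrightarrow> bdry f t) (at_left 1)"
    by (rule AE_mp) (use bdry_eqI in \<open>force intro!: AE_I2\<close>)
  have aeq: "AE t in circ. bdry f t = bdry h t * bdry k t"
    using ae by (rule AE_mp) (use bdry_eqI in \<open>force intro!: AE_I2\<close>)
  let ?H = "\<lambda>n t. h (of_real (rs n) * cis t)" and ?K = "\<lambda>n t. k (of_real (rs n) * cis t)"
  have l1: "(\<lambda>n. \<integral>\<^sup>+t. ennreal (cmod (?H n t)) * ennreal (cmod (?K n t - bdry k t)) \<partial>circ) \<longlonglongrightarrow> 0"
    by (rule nn_integral_product_tendsto_zero[where B=B])
      (use hk(1) rs_bounds H2_boundary_L2[OF hk(2)] in \<open>auto simp: in_H2_def\<close>)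
  have l2: "(\<lambda>n. \<integral>\<^sup>+t. ennreal (cmod (bdry k t)) * ennreal (cmod (?H n t - bdry h t)) \<partial>circ) \<longlonglongrightarrow> 0"
    by (rule nn_integral_product_tendsto_zero[where B=B])
      (use H2_boundary_bound[OF hk(2)] H2_boundary_L2[OF hk(1)] in auto)
  have le: "(\<integral>\<^sup>+t. ennreal (cmod (f (of_real (rs n) * cis t) - bdry f t)) \<partial>circ)
     \<le> (\<integral>\<^sup>+t. ennreal (cmod (?H n t)) * ennreal (cmod (?K n t - bdry k t)) \<partial>circ)
      + (\<integral>\<^sup>+t. ennreal (cmod (bdry k t)) * ennreal (cmod (?H n t - bdry h t)) \<partial>circ)" for n
  proof -
    have "(\<integral>\<^sup>+t. ennreal (cmod (f (of_real (rs n) * cis t) - bdry f t)) \<partial>circ)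
      \<le> (\<integral>\<^sup>+t. ennreal (cmod (?H n t)) * ennreal (cmod (?K n t - bdry k t)) + ennreal (cmod (bdry k t)) * ennreal (cmod (?H n t - bdry h t)) \<partial>circ)"
    proof (rule nn_integral_mono_AE, use aeq in eventually_elim)
      case (elim t)
      have "f (of_real (rs n) * cis t) - bdry f t = ?H n t * (?K n t - bdry k t) + bdry k t * (?H n t - bdry h t)"
        using elim fr[of "rs n" t] rs_bounds by (simp add: algebra_simps)
      then have "cmod (f (of_real (rs n) * cis t) - bdry f t) \<le> cmod (?H n t) * cmod (?K n t - bdry k t) + cmod (bdry k t) * cmod (?H n t - bdry h t)"
        by (metis norm_mult norm_triangle_ineq)
      then show ?case by (simp add: ennreal_mult[symmetric] ennreal_plus[symmetric] ennreal_leI del: ennreal_plus)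
    qed
    also have "\<dots> = (\<integral>\<^sup>+t. ennreal (cmod (?H n t)) * ennreal (cmod (?K n t - bdry k t)) \<partial>circ)
      + (\<integral>\<^sup>+t. ennreal (cmod (bdry k t)) * ennreal (cmod (?H n t - bdry h t)) \<partial>circ)"
      by (rule nn_integral_add) measurable
    finally show ?thesis .
  qed
  have lim: "(\<lambda>n. (\<integral>\<^sup>+t. ennreal (cmod (?H n t)) * ennreal (cmod (?K n t - bdry k t)) \<partial>circ)
      + (\<integral>\<^sup>+t. ennreal (cmod (bdry k t)) * ennreal (cmod (?H n t - bdry h t)) \<partial>circ)) \<longlonglongrightarrow> 0"
    using tendsto_add[OF l1 l2] by simp
  show "(\<lambda>n. \<integral>\<^sup>+t. ennreal (cmod (f (of_real (rs n) * cis t) - bdry f t)) \<partial>circ) \<longlonglongrightarrow> 0"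
    by (rule tendsto_sandwich[OF _ _ tendsto_const lim]) (simp_all add: le)
  have "(\<integral>\<^sup>+t. ennreal (cmod (bdry f t)) \<partial>circ)\<^sup>2 = (\<integral>\<^sup>+t. ennreal (cmod (bdry h t)) * ennreal (cmod (bdry k t)) \<partial>circ)\<^sup>2"
    by (rule arg_cong[where f="\<lambda>x. x\<^sup>2"], rule nn_integral_cong_AE, use aeq in eventually_elim) (simp add: norm_mult ennreal_mult)
  also have "\<dots> \<le> (\<integral>\<^sup>+t. (ennreal (cmod (bdry h t)))\<^sup>2 \<partial>circ) * (\<integral>\<^sup>+t. (ennreal (cmod (bdry k t)))\<^sup>2 \<partial>circ)"
    by (rule Cauchy_Schwarz_nn_integral) measurable
  also have "\<dots> \<le> ennreal B * ennreal B"
    using H2_boundary_bound[OF hk(1)] H2_boundary_bound[OF hk(2)] by (intro mult_mono) (simp_all add: ennreal_power)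
  also have "\<dots> < \<infinity>" by (simp add: ennreal_mult_less_top)
  finally show "(\<integral>\<^sup>+t. ennreal (cmod (bdry f t)) \<partial>circ) < \<infinity>" by (simp add: power_less_top_ennreal)
qed

lemma cauchy_deriv_circ:
  fixes h :: "complex \<Rightarrow> complex"
  assumes "h holomorphic_on ball 0 R" "1 < R" "cmod z < 1"
  shows "(LINT x|circ. h (cis x) * cis x / (cis x - z)\<^sup>2) = 2 * pi * deriv h z"
proof -
  have "cball 0 1 \<subseteq> ball (0::complex) R" using assms by auto
  then have hol: "h holomorphic_on cball 0 1" using assms holomorphic_on_subset by blast
  then have hol': "h holomorphic_on ball 0 1" and ch: "continuous_on (cball 0 1) h"
    by (auto intro: holomorphic_on_subset holomorphic_on_imp_continuous_on)
  have zin: "z \<in> ball 0 1" using assms(3) by simp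
  have "(h has_field_derivative 1 / (2 * complex_of_real pi * \<i>) * contour_integral (circlepath 0 1) (\<lambda>u. h u / (u - z)\<^sup>2)) (at z)"
    by (rule Cauchy_derivative_integral_circlepath(2)[OF ch hol' zin])
  then have d: "contour_integral (circlepath 0 1) (\<lambda>u. h u / (u - z)\<^sup>2) = 2 * complex_of_real pi * \<i> * deriv h z"
    by (simp add: DERIV_imp_deriv)
  have "((\<lambda>u. h u / (u - z)\<^sup>2) has_contour_integral 2 * complex_of_real pi * \<i> * deriv h z) (circlepath 0 1)"
    using has_contour_integral_integral[OF Cauchy_derivative_integral_circlepath(1)[OF ch hol' zin]] unfolding d .
  then have "((\<lambda>t. h (cis t) / (cis t - z)\<^sup>2 * \<i> * cis t) has_integral 2 * complex_of_real pi * \<i> * deriv h z) {0..2*pi}"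
    by (simp add: circlepath_def has_contour_integral_part_circlepath_iff)
  from has_integral_mult_right[OF this, of "-\<i>"]
  have *: "((\<lambda>t. h (cis t) * cis t / (cis t - z)\<^sup>2) has_integral 2 * complex_of_real pi * deriv h z) {0..2*pi}"
    by (simp add: mult_ac)
  have "continuous_on UNIV (\<lambda>x. h (cis x) * cis x / (cis x - z)\<^sup>2)"
  proof (intro continuous_intros ballI)
    show "continuous_on UNIV (\<lambda>x. h (cis x))"
      by (rule continuous_on_compose2[OF ch]) (auto intro!: continuous_intros)
    show "(cis x - z)\<^sup>2 \<noteq> 0" for x using assms(3) by auto
  qed
  from integrable_circ(2)[OF this] * show ?thesis by (simp add: integral_unique)
qed

text \<open>The Cauchy formula for \<open>f'\<close> is insensitive to subtracting a constant from the boundary values.\<close>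

lemma H1_deriv_bound:
  assumes f: "f \<in> H1" and z: "cmod z < 1"
  shows "ennreal (2 * pi * cmod (deriv f z)) \<le> (\<integral>\<^sup>+t. ennreal (cmod (bdry f t - c) / (cmod (cis t - z))\<^sup>2) \<partial>circ)"
proof -
  have hol: "f holomorphic_on ball 0 1" using f by (simp add: H1_iff)
  then have cont: "continuous_on (ball 0 1) f" by (rule holomorphic_on_imp_continuous_on)
  note [measurable] = bdry_measurable[OF cont]
  have [measurable]: "(\<lambda>t. f (of_real (rs n) * cis t)) \<in> borel_measurable borel" for n
    by (rule measurable_disc_circle[OF cont rs_bounds(1,2)])
  have [measurable]: "cis \<in> borel_measurable borel"
    by (intro borel_measurable_continuous_onI continuous_intros)
  define \<delta> where "\<delta> = 1 - cmod z"
  have \<delta>: "0 < \<delta>" using z by (simp add: \<delta>_def)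
  have den: "\<delta> \<le> cmod (cis t - z)" for t
    using norm_triangle_ineq2[of "cis t" z] by (simp add: \<delta>_def)
  define I where "I = (\<integral>\<^sup>+t. ennreal (cmod (bdry f t - c) / (cmod (cis t - z))\<^sup>2) \<partial>circ)"
  have rz: "of_real (rs n) * z \<in> ball 0 1" for n
    using rs_bounds[of n] z mult_strict_mono[of "rs n" 1 "cmod z" 1] by (simp add: norm_mult)
  \<comment> \<open>Cauchy's formula is applied to the dilation by \<open>rs n\<close> minus c.
    Exchanging its circle values for the boundary values costs an L^1 distance divided by
    \<delta>^2, which vanishes in the limit because z is fixed.\<close>
  have main: "ennreal (2 * pi * (rs n * cmod (deriv f (of_real (rs n) * z))))
     \<le> I + ennreal (1 / \<delta>\<^sup>2) * (\<integral>\<^sup>+t. ennreal (cmod (f (of_real (rs n) * cis t) - bdry f t)) \<partial>circ)" for n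
  proof -
    let ?g = "\<lambda>w. f (of_real (rs n) * w) - c"
    have im: "(\<lambda>z. of_real (rs n) * z) ` ball 0 (1 / rs n) \<subseteq> ball (0::complex) 1"
      using rs_bounds[of n] by (auto simp: norm_mult field_simps)
    have g: "?g holomorphic_on ball 0 (1 / rs n)"
      by (intro holomorphic_intros holomorphic_on_compose_gen[OF _ hol im, unfolded o_def])
    have R: "1 < 1 / rs n" using rs_bounds[of n] by simp
    have "(f has_field_derivative deriv f (of_real (rs n) * z)) (at (of_real (rs n) * z))"
      by (rule holomorphic_derivI[OF hol open_ball rz])
    then have "(?g has_field_derivative deriv f (of_real (rs n) * z) * of_real (rs n)) (at z)"
      by (auto intro!: derivative_eq_intros DERIV_chain2[where f=f])
    then have dg: "deriv ?g z = of_real (rs n) * deriv f (of_real (rs n) * z)"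
      by (simp add: DERIV_imp_deriv mult.commute)
    have cg: "continuous_on UNIV (\<lambda>t. f (of_real (rs n) * cis t))"
      by (rule continuous_disc_circle[OF cont rs_bounds(1,2)])
    have nz: "cis t - z \<noteq> 0" for t using den[of t] \<delta> by auto
    have int: "integrable circ (\<lambda>t. ?g (cis t) * cis t / (cis t - z)\<^sup>2)"
      by (rule integrable_circ) (use nz in \<open>auto intro!: continuous_intros cg\<close>)
    have "2 * pi * (rs n * cmod (deriv f (of_real (rs n) * z))) = cmod (LINT t|circ. ?g (cis t) * cis t / (cis t - z)\<^sup>2)"
      unfolding cauchy_deriv_circ[OF g R z] dg using rs_bounds[of n] by (simp add: norm_mult)
    also have "\<dots> \<le> (LINT t|circ. cmod (?g (cis t) * cis t / (cis t - z)\<^sup>2))" by (rule integral_norm_bound)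
    finally have "ennreal (2 * pi * (rs n * cmod (deriv f (of_real (rs n) * z)))) \<le> ennreal (LINT t|circ. cmod (?g (cis t) * cis t / (cis t - z)\<^sup>2))"
      by (rule ennreal_leI)
    also have "\<dots> = (\<integral>\<^sup>+t. ennreal (cmod (?g (cis t) * cis t / (cis t - z)\<^sup>2)) \<partial>circ)"
      by (rule nn_integral_eq_integral[symmetric]) (use int in auto)
    also have "\<dots> \<le> (\<integral>\<^sup>+t. ennreal (cmod (bdry f t - c) / (cmod (cis t - z))\<^sup>2) + ennreal (1 / \<delta>\<^sup>2) * ennreal (cmod (f (of_real (rs n) * cis t) - bdry f t)) \<partial>circ)"
    proof (rule nn_integral_mono)
      fix t
      let ?d = "(cmod (cis t - z))\<^sup>2"
      have d: "\<delta>\<^sup>2 \<le> ?d" using den[of t] \<delta> by (intro power_mono) auto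
      have d0: "0 < ?d" using nz[of t] by simp
      have "cmod (?g (cis t)) \<le> cmod (bdry f t - c) + cmod (f (of_real (rs n) * cis t) - bdry f t)"
        using norm_triangle_ineq[of "bdry f t - c" "f (of_real (rs n) * cis t) - bdry f t"] by (simp add: algebra_simps)
      then have "cmod (?g (cis t)) / ?d \<le> cmod (bdry f t - c) / ?d + cmod (f (of_real (rs n) * cis t) - bdry f t) / ?d"
        using d0 by (simp add: add_divide_distrib[symmetric] divide_right_mono)
      also have "cmod (f (of_real (rs n) * cis t) - bdry f t) / ?d \<le> cmod (f (of_real (rs n) * cis t) - bdry f t) / \<delta>\<^sup>2"
        using d \<delta> d0 by (intro divide_left_mono) auto
      finally have "cmod (?g (cis t)) / ?d \<le> cmod (bdry f t - c) / ?d + (1 / \<delta>\<^sup>2) * cmod (f (of_real (rs n) * cis t) - bdry f t)" by simp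
      moreover have "cmod (?g (cis t) * cis t / (cis t - z)\<^sup>2) = cmod (?g (cis t)) / ?d"
        by (simp add: norm_mult norm_divide norm_power)
      moreover have "ennreal (cmod (bdry f t - c) / ?d) + ennreal (1 / \<delta>\<^sup>2) * ennreal (cmod (f (of_real (rs n) * cis t) - bdry f t))
         = ennreal (cmod (bdry f t - c) / ?d + (1 / \<delta>\<^sup>2) * cmod (f (of_real (rs n) * cis t) - bdry f t))"
        by (subst ennreal_mult[symmetric], simp, simp, rule ennreal_plus[symmetric]) auto
      ultimately show "ennreal (cmod (?g (cis t) * cis t / (cis t - z)\<^sup>2)) \<le> ennreal (cmod (bdry f t - c) / ?d) + ennreal (1 / \<delta>\<^sup>2) * ennreal (cmod (f (of_real (rs n) * cis t) - bdry f t))"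
        by (simp only: ennreal_leI)
    qed
    also have "\<dots> = I + ennreal (1 / \<delta>\<^sup>2) * (\<integral>\<^sup>+t. ennreal (cmod (f (of_real (rs n) * cis t) - bdry f t)) \<partial>circ)"
      unfolding I_def by (subst nn_integral_add, measurable) (simp add: nn_integral_cmult)
    finally show ?thesis .
  qed
  have dc: "continuous_on (ball 0 1) (deriv f)"
    by (intro holomorphic_on_imp_continuous_on holomorphic_deriv hol open_ball)
  have "(\<lambda>n. of_real (rs n) * z) \<longlonglongrightarrow> of_real 1 * z" by (intro tendsto_intros rs_tendsto)
  then have "(\<lambda>n. deriv f (of_real (rs n) * z)) \<longlonglongrightarrow> deriv f (of_real 1 * z)"
    by (rule continuous_on_tendsto_compose[OF dc]) (use rz z in auto)
  then have "(\<lambda>n. ennreal (2 * pi * (rs n * cmod (deriv f (of_real (rs n) * z))))) \<longlonglongrightarrow> ennreal (2 * pi * (1 * cmod (deriv f (of_real 1 * z))))"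
    by (intro tendsto_ennrealI tendsto_intros rs_tendsto)
  moreover have "(\<lambda>n. I + ennreal (1 / \<delta>\<^sup>2) * (\<integral>\<^sup>+t. ennreal (cmod (f (of_real (rs n) * cis t) - bdry f t)) \<partial>circ)) \<longlonglongrightarrow> I + ennreal (1 / \<delta>\<^sup>2) * 0"
    by (intro tendsto_add tendsto_const ennreal_tendsto_cmult H1_boundary f) simp
  ultimately have "ennreal (2 * pi * (1 * cmod (deriv f (of_real 1 * z)))) \<le> I + ennreal (1 / \<delta>\<^sup>2) * 0"
    by (rule LIMSEQ_le) (use main in auto)
  then show ?thesis by (simp add: I_def)
qed

section \<open>Bounded mean oscillation\<close>

lemma half_le_sin:
  assumes "0 \<le> x" "x \<le> pi / 2"
  shows "x / 2 \<le> sin x"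
proof (cases "x \<le> pi / 3")
  case True
  have "sin 0 - 0 / 2 \<le> sin x - x / 2"
  proof (rule DERIV_nonneg_imp_nondecreasing[OF assms(1)])
    fix y assume y: "0 \<le> y" "y \<le> x"
    have "cos (pi / 3) \<le> cos y" using y True by (intro cos_monotone_0_pi_le) auto
    then show "\<exists>z. ((\<lambda>x. sin x - x / 2) has_real_derivative z) (at y) \<and> 0 \<le> z"
      by (intro exI[of _ "cos y - 1 / 2"] conjI) (auto intro!: derivative_eq_intros simp: cos_60)
  qed
  then show ?thesis by simp
next
  case False
  \<comment> \<open>Beyond pi/3 the derivative of sin x - x/2 is negative, so constants are
    compared: x/2 <= pi/4 <= 4/5 <= sin (pi/3) <= sin x.\<close>
  have "x / 2 \<le> pi / 4" using assms by simp
  also have "\<dots> \<le> 4 / 5" using pi_less_4 pi_approx by simp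
  also have "\<dots> \<le> sqrt 3 / 2" using real_le_rsqrt[of "8 / 5" 3] by (simp add: power2_eq_square)
  also have "\<dots> = sin (pi / 3)" by (simp add: sin_60)
  also have "\<dots> \<le> sin x" using False assms by (intro sin_monotone_2pi_le) auto
  finally show ?thesis .
qed

text \<open>Together the two bounds say that the distance is comparable to |x| + (1 - \<rho>), the
  form in which the Cauchy kernel is estimated on dyadic arcs.\<close>

lemma cmod_cis_minus_real_ge:
  assumes "\<bar>x\<bar> \<le> pi" "0 \<le> \<rho>" "\<rho> \<le> 1"
  shows "\<bar>x\<bar> / 4 \<le> cmod (cis x - of_real \<rho>)" "1 - \<rho> \<le> cmod (cis x - of_real \<rho>)"
proof -
  show *: "1 - \<rho> \<le> cmod (cis x - of_real \<rho>)"
    using norm_triangle_ineq2[of "cis x" "of_real \<rho>"] assms by simp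
  have "\<bar>sin (x / 2)\<bar> = sin (\<bar>x\<bar> / 2)"
    using assms sin_ge_zero[of "\<bar>x\<bar> / 2"] by (cases "0 \<le> x") auto
  then have "\<bar>x\<bar> / 2 \<le> cmod (cis x - 1)"
    using half_le_sin[of "\<bar>x\<bar> / 2"] assms by (simp add: cis_conv_exp dist_exp_i_1)
  also have "\<dots> \<le> cmod (cis x - of_real \<rho>) + cmod (of_real \<rho> - 1)"
    using norm_triangle_ineq[of "cis x - of_real \<rho>" "of_real \<rho> - 1"] by simp
  also have "cmod (of_real \<rho> - 1) = 1 - \<rho>"
    using assms by (metis abs_minus_commute abs_of_nonneg diff_ge_0_iff_ge norm_of_real of_real_1 of_real_diff)
  finally show "\<bar>x\<bar> / 4 \<le> cmod (cis x - of_real \<rho>)" using * by simp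
qed

lemma nn_integral_periodic:
  fixes u :: "real \<Rightarrow> ennreal"
  assumes [measurable]: "u \<in> borel_measurable borel" and p: "\<And>x. u (x + 2 * pi) = u x"
  shows "(\<integral>\<^sup>+x\<in>{a..a+2*pi}. u x \<partial>lborel) = (\<integral>\<^sup>+x\<in>{0..2*pi}. u x \<partial>lborel)"
proof -
  have pn: "u (x + 2 * pi * real n) = u x" for x n
    by (induction n) (use p[of "x + 2 * pi * real n" for n] in \<open>auto simp: algebra_simps\<close>)
  have pz: "u (x + 2 * pi * real_of_int k) = u x" for x k
  proof (cases "k \<ge> 0")
    case True
    then show ?thesis using pn[of x "nat k"] by simp
  next
    case False
    then show ?thesis using pn[of "x + 2 * pi * real_of_int k" "nat (- k)"] by simp
  qed
  have shift: "(\<integral>\<^sup>+x. u x * indicator {b + 2 * pi * real_of_int k..<c + 2 * pi * real_of_int k} x \<partial>lborel) = (\<integral>\<^sup>+x. u x * indicator {b..<c} x \<partial>lborel)" for b c k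
    by (subst nn_integral_real_affine[where c=1 and t="2 * pi * real_of_int k"])
      (auto intro!: nn_integral_cong simp: indicator_def pz add.commute[of "2 * pi * real_of_int k"])
  define k where "k = \<lfloor>a / (2 * pi)\<rfloor>"
  define b where "b = a - 2 * pi * real_of_int k"
  have b: "0 \<le> b" "b < 2 * pi"
  proof -
    have "real_of_int k \<le> a / (2 * pi)" "a / (2 * pi) < real_of_int k + 1" unfolding k_def by linarith+
    then have "real_of_int k * (2 * pi) \<le> a" "a < (real_of_int k + 1) * (2 * pi)"
      by (simp_all add: pos_le_divide_eq pos_divide_less_eq)
    then show "0 \<le> b" "b < 2 * pi" by (simp_all add: b_def algebra_simps)
  qed
  have ab: "a = b + 2 * pi * real_of_int k" by (simp add: b_def)
  have half: "(\<integral>\<^sup>+x\<in>{c..d}. u x \<partial>lborel) = (\<integral>\<^sup>+x. u x * indicator {c..<d} x \<partial>lborel)" for c d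
    by (rule nn_integral_cong_AE, rule AE_mp[OF AE_lborel_singleton[of d]]) (auto simp: indicator_def)
  have split: "(\<integral>\<^sup>+x. u x * indicator {c..<e} x \<partial>lborel) = (\<integral>\<^sup>+x. u x * indicator {c..<d} x \<partial>lborel) + (\<integral>\<^sup>+x. u x * indicator {d..<e} x \<partial>lborel)"
    if "c \<le> d" "d \<le> e" for c d e
    by (subst nn_integral_add[symmetric]) (use that in \<open>auto intro!: nn_integral_cong simp: indicator_def\<close>)
  have "(\<integral>\<^sup>+x\<in>{a..a+2*pi}. u x \<partial>lborel) = (\<integral>\<^sup>+x. u x * indicator {b + 2 * pi * real_of_int k..<(b + 2 * pi) + 2 * pi * real_of_int k} x \<partial>lborel)"
    unfolding half by (simp add: ab algebra_simps)
  also have "\<dots> = (\<integral>\<^sup>+x. u x * indicator {b..<b + 2 * pi} x \<partial>lborel)" by (rule shift)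
  also have "\<dots> = (\<integral>\<^sup>+x. u x * indicator {b..<2 * pi} x \<partial>lborel) + (\<integral>\<^sup>+x. u x * indicator {2 * pi..<b + 2 * pi} x \<partial>lborel)"
    by (rule split) (use b in auto)
  also have "(\<integral>\<^sup>+x. u x * indicator {2 * pi..<b + 2 * pi} x \<partial>lborel) = (\<integral>\<^sup>+x. u x * indicator {0..<b} x \<partial>lborel)"
    using shift[of 0 1 b] by simp
  also have "(\<integral>\<^sup>+x. u x * indicator {b..<2 * pi} x \<partial>lborel) + (\<integral>\<^sup>+x. u x * indicator {0..<b} x \<partial>lborel) = (\<integral>\<^sup>+x. u x * indicator {0..<2 * pi} x \<partial>lborel)"
    by (subst add.commute, rule split[symmetric]) (use b in auto)
  finally show ?thesis unfolding half .
qed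

definition arc_avg :: "(real \<Rightarrow> complex) \<Rightarrow> real \<Rightarrow> real \<Rightarrow> complex" where
  "arc_avg F a l = (1 / l) *\<^sub>R (LINT t:{a..a+l}|lborel. F t)"

text \<open>\<open>0 \<le> C\<close> is included because \<open>ennreal\<close> sends negative
  numbers to 0, which would hide the sign of C from later real arithmetic.\<close>

definition bmo_const :: "(real \<Rightarrow> complex) \<Rightarrow> real \<Rightarrow> bool" where
  "bmo_const F C \<longleftrightarrow> 0 \<le> C \<and> (\<forall>a l. 0 < l \<and> l \<le> 2 * pi \<longrightarrow>
     (\<integral>\<^sup>+t\<in>{a..a+l}. ennreal (cmod (F t - arc_avg F a l)) \<partial>lborel) \<le> ennreal (C * l))"

lemma BMOA_iff: "f \<in> BMOA \<longleftrightarrow> f \<in> H1 \<and> (\<exists>C. bmo_const (bdry f) C)"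
proof
  assume f: "f \<in> BMOA"
  then obtain C where C: "\<forall>a l. 0 < l \<and> l \<le> 2*pi \<longrightarrow>
      (\<integral>\<^sup>+t\<in>{a..a+l}. ennreal (cmod (bdry f t - arc_avg (bdry f) a l)) \<partial>lborel) \<le> ennreal (C * l)"
    by (auto simp: BMOA_def arc_avg_def Let_def)
  have "bmo_const (bdry f) (max C 0)" unfolding bmo_const_def
  proof (intro conjI allI impI)
    fix a l :: real assume l: "0 < l \<and> l \<le> 2 * pi"
    have "(\<integral>\<^sup>+t\<in>{a..a+l}. ennreal (cmod (bdry f t - arc_avg (bdry f) a l)) \<partial>lborel) \<le> ennreal (C * l)" using C l by blast
    also have "\<dots> \<le> ennreal (max C 0 * l)" using l by (intro ennreal_leI mult_right_mono) auto
    finally show "(\<integral>\<^sup>+t\<in>{a..a+l}. ennreal (cmod (bdry f t - arc_avg (bdry f) a l)) \<partial>lborel) \<le> ennreal (max C 0 * l)" .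
  qed simp
  then show "f \<in> H1 \<and> (\<exists>C. bmo_const (bdry f) C)" using f by (auto simp: BMOA_def)
qed (auto simp: BMOA_def bmo_const_def arc_avg_def Let_def)

locale circle_L1 =
  fixes F :: "real \<Rightarrow> complex"
  assumes meas [measurable]: "F \<in> borel_measurable borel"
    and per: "F (t + 2 * pi) = F t"
    and int: "(\<integral>\<^sup>+t. ennreal (cmod (F t)) \<partial>circ) < \<infinity>"
begin

lemma norm_period: "(\<integral>\<^sup>+t\<in>{a..a+2*pi}. ennreal (cmod (F t)) \<partial>lborel) = (\<integral>\<^sup>+t. ennreal (cmod (F t)) \<partial>circ)"
  by (subst nn_integral_periodic) (simp_all add: per nn_integral_circ)

lemma arc_le_period:
  assumes "l \<le> 2 * pi"
  shows "(\<integral>\<^sup>+t\<in>{a..a+l}. ennreal (cmod (F t)) \<partial>lborel) \<le> (\<integral>\<^sup>+t. ennreal (cmod (F t)) \<partial>circ)"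
  unfolding norm_period[of a, symmetric] by (rule nn_set_integral_set_mono) (use assms in auto)

lemma arc_integrable:
  assumes "l \<le> 2 * pi"
  shows "set_integrable lborel {a..a+l} F"
  unfolding set_integrable_def
proof (rule integrableI_bounded)
  have "(\<integral>\<^sup>+t. ennreal (norm (indicat_real {a..a+l} t *\<^sub>R F t)) \<partial>lborel) = (\<integral>\<^sup>+t\<in>{a..a+l}. ennreal (cmod (F t)) \<partial>lborel)"
    by (rule nn_integral_cong) (auto simp: indicator_def)
  also have "\<dots> < \<infinity>" using arc_le_period[OF assms, of a] int by (simp add: le_less_trans)
  finally show "(\<integral>\<^sup>+t. ennreal (norm (indicat_real {a..a+l} t *\<^sub>R F t)) \<partial>lborel) < \<infinity>" .
qed measurable

lemma arc_avg_diff_le: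
  assumes l: "0 < l" "l \<le> 2 * pi"
  shows "ennreal (l * cmod (arc_avg F a l - c)) \<le> (\<integral>\<^sup>+t\<in>{a..a+l}. ennreal (cmod (F t - c)) \<partial>lborel)"
proof -
  have i1: "integrable lborel (\<lambda>t. indicat_real {a..a+l} t *\<^sub>R F t)"
    using arc_integrable[OF l(2), of a] by (simp add: set_integrable_def)
  have i2: "integrable lborel (\<lambda>t. indicat_real {a..a+l} t *\<^sub>R c)"
    by (intro integrable_scaleR_left) (simp add: emeasure_lborel_Icc_eq)
  have "l *\<^sub>R (arc_avg F a l - c) = (LINT t|lborel. indicat_real {a..a+l} t *\<^sub>R F t) - (LINT t|lborel. indicat_real {a..a+l} t *\<^sub>R c)"
    using l by (simp add: arc_avg_def set_lebesgue_integral_def scaleR_diff_right)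
  also have "\<dots> = (LINT t|lborel. indicat_real {a..a+l} t *\<^sub>R (F t - c))"
    using Bochner_Integration.integral_diff[OF i1 i2] by (simp add: scaleR_diff_right)
  finally have "l * cmod (arc_avg F a l - c) = cmod (LINT t|lborel. indicat_real {a..a+l} t *\<^sub>R (F t - c))"
    using l by (metis abs_of_pos norm_scaleR)
  also have "\<dots> \<le> (LINT t|lborel. cmod (indicat_real {a..a+l} t *\<^sub>R (F t - c)))" by (rule integral_norm_bound)
  finally have "ennreal (l * cmod (arc_avg F a l - c)) \<le> ennreal (LINT t|lborel. cmod (indicat_real {a..a+l} t *\<^sub>R (F t - c)))"
    by (rule ennreal_leI)
  also have "\<dots> = (\<integral>\<^sup>+t. ennreal (cmod (indicat_real {a..a+l} t *\<^sub>R (F t - c))) \<partial>lborel)"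
    by (rule nn_integral_eq_integral[symmetric])
      (use Bochner_Integration.integrable_diff[OF i1 i2] in \<open>auto simp: scaleR_diff_right intro!: integrable_norm\<close>)
  also have "\<dots> = (\<integral>\<^sup>+t\<in>{a..a+l}. ennreal (cmod (F t - c)) \<partial>lborel)"
    by (rule nn_integral_cong) (auto simp: indicator_def)
  finally show ?thesis .
qed

lemma osc_change_const:
  assumes l: "0 < l" "l \<le> 2 * pi"
  shows "(\<integral>\<^sup>+t\<in>{a..a+l}. ennreal (cmod (F t - d)) \<partial>lborel) \<le> (\<integral>\<^sup>+t\<in>{a..a+l}. ennreal (cmod (F t - c)) \<partial>lborel) + ennreal (l * cmod (c - d))"
proof -
  have "(\<integral>\<^sup>+t\<in>{a..a+l}. ennreal (cmod (F t - d)) \<partial>lborel) \<le> (\<integral>\<^sup>+t. ennreal (cmod (F t - c)) * indicator {a..a+l} t + ennreal (cmod (c - d)) * indicator {a..a+l} t \<partial>lborel)"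
  proof (rule nn_integral_mono)
    fix t
    have "ennreal (cmod (F t - d)) \<le> ennreal (cmod (F t - c) + cmod (c - d))"
      using norm_triangle_ineq[of "F t - c" "c - d"] by (intro ennreal_leI) simp
    then show "ennreal (cmod (F t - d)) * indicator {a..a+l} t \<le> ennreal (cmod (F t - c)) * indicator {a..a+l} t + ennreal (cmod (c - d)) * indicator {a..a+l} t"
      by (auto simp: indicator_def)
  qed
  also have "\<dots> = (\<integral>\<^sup>+t\<in>{a..a+l}. ennreal (cmod (F t - c)) \<partial>lborel) + (\<integral>\<^sup>+t. ennreal (cmod (c - d)) * indicator {a..a+l} t \<partial>lborel)"
    by (rule nn_integral_add) measurable
  also have "(\<integral>\<^sup>+t. ennreal (cmod (c - d)) * indicator {a..a+l} t \<partial>lborel) = ennreal (l * cmod (c - d))"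
    using l by (simp add: nn_integral_cmult_indicator ennreal_mult[symmetric] mult.commute)
  finally show ?thesis .
qed

text \<open>Any constant may stand in for the average: the average is itself within K of c, hence
  the factor 2.\<close>

lemma bmo_constI:
  assumes K: "0 \<le> K" and c: "\<And>a l. 0 < l \<Longrightarrow> l \<le> 2 * pi \<Longrightarrow> \<exists>c. (\<integral>\<^sup>+t\<in>{a..a+l}. ennreal (cmod (F t - c)) \<partial>lborel) \<le> ennreal (K * l)"
  shows "bmo_const F (2 * K)"
  unfolding bmo_const_def
proof (intro conjI allI impI)
  fix a l :: real assume l: "0 < l \<and> l \<le> 2 * pi"
  obtain c where c: "(\<integral>\<^sup>+t\<in>{a..a+l}. ennreal (cmod (F t - c)) \<partial>lborel) \<le> ennreal (K * l)" using c l by blast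
  have "ennreal (l * cmod (c - arc_avg F a l)) \<le> ennreal (K * l)"
    using arc_avg_diff_le[where l=l and a=a and c=c] c l by (simp add: norm_minus_commute)
  then have "(\<integral>\<^sup>+t\<in>{a..a+l}. ennreal (cmod (F t - arc_avg F a l)) \<partial>lborel) \<le> ennreal (K * l) + ennreal (K * l)"
    using osc_change_const[where l=l and a=a and c=c and d="arc_avg F a l"] c l by (meson add_mono order_trans)
  also have "\<dots> = ennreal (2 * K * l)" using K l by (subst ennreal_plus[symmetric]) auto
  finally show "(\<integral>\<^sup>+t\<in>{a..a+l}. ennreal (cmod (F t - arc_avg F a l)) \<partial>lborel) \<le> ennreal (2 * K * l)" .
qed (use K in simp)

lemma bmo_avg_subarc:
  assumes C: "bmo_const F C" and l: "0 < l'" "l' \<le> l" "l \<le> 2 * pi" "l \<le> 2 * l'" and sub: "a \<le> a'" "a' + l' \<le> a + l"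
  shows "cmod (arc_avg F a' l' - arc_avg F a l) \<le> 2 * C"
proof -
  have C0: "0 \<le> C" using C by (simp add: bmo_const_def)
  have "ennreal (l' * cmod (arc_avg F a' l' - arc_avg F a l)) \<le> (\<integral>\<^sup>+t\<in>{a'..a'+l'}. ennreal (cmod (F t - arc_avg F a l)) \<partial>lborel)"
    by (rule arc_avg_diff_le) (use l in auto)
  also have "\<dots> \<le> (\<integral>\<^sup>+t\<in>{a..a+l}. ennreal (cmod (F t - arc_avg F a l)) \<partial>lborel)"
    by (rule nn_set_integral_set_mono) (use sub in auto)
  also have "\<dots> \<le> ennreal (C * l)" using C l by (simp add: bmo_const_def)
  finally have "l' * cmod (arc_avg F a' l' - arc_avg F a l) \<le> C * l"
    using C0 l by (simp add: ennreal_le_iff)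
  also have "\<dots> \<le> C * (2 * l')" using C0 l by (intro mult_left_mono) auto
  finally have "l' * cmod (arc_avg F a' l' - arc_avg F a l) \<le> l' * (2 * C)" by (simp add: mult_ac)
  then show ?thesis using l by simp
qed

text \<open>The arc is doubled until it is the whole circle, where the average is bounded by the L^1
  norm. Each doubling moves the average by at most 2 C, and the number of doublings is logarithmic
  in 1/l.\<close>

lemma bmo_avg_log:
  assumes C: "bmo_const F C"
  shows "\<exists>M\<ge>0. \<forall>a l. 0 < l \<and> l \<le> 2 * pi \<longrightarrow> cmod (arc_avg F a l) \<le> M * (1 + ln (2 * pi / l))"
proof -
  have C0: "0 \<le> C" using C by (simp add: bmo_const_def)
  define N where "N = enn2real (\<integral>\<^sup>+t. ennreal (cmod (F t)) \<partial>circ)"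
  have N: "(\<integral>\<^sup>+t. ennreal (cmod (F t)) \<partial>circ) = ennreal N" "0 \<le> N"
    using int by (auto simp: N_def less_top[symmetric])
  have "cmod (arc_avg F a l) \<le> (N + 4 * C) * (1 + ln (2 * pi / l))" if l: "0 < l" "l \<le> 2 * pi" for a l
  proof -
    define L where "L k = min (2 ^ k * l) (2 * pi)" for k :: nat
    have L: "0 < L k" "L k \<le> L (Suc k)" "L k \<le> 2 * pi" "L (Suc k) \<le> 2 * L k" for k
    proof -
      have "0 < 2 ^ k * l" using l by simp
      then show "0 < L k" "L k \<le> L (Suc k)" "L k \<le> 2 * pi" "L (Suc k) \<le> 2 * L k"
        using l unfolding L_def power_Suc mult.assoc by (auto simp: min_def)
    qed
    have step: "cmod (arc_avg F a (L k) - arc_avg F a (L (Suc k))) \<le> 2 * C" for k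
      by (rule bmo_avg_subarc[OF C]) (use L in auto)
    have chain: "cmod (arc_avg F a (L 0)) \<le> cmod (arc_avg F a (L k)) + 2 * C * real k" for k
    proof (induction k)
      case (Suc k)
      have "cmod (arc_avg F a (L k)) \<le> cmod (arc_avg F a (L k) - arc_avg F a (L (Suc k))) + cmod (arc_avg F a (L (Suc k)))"
        using norm_triangle_ineq[of "arc_avg F a (L k) - arc_avg F a (L (Suc k))" "arc_avg F a (L (Suc k))"] by simp
      with Suc step[of k] show ?case by (simp add: algebra_simps)
    qed simp
    define x where "x = ln (2 * pi / l)"
    have x0: "0 \<le> x" unfolding x_def using l by (intro ln_ge_zero) simp
    \<comment> \<open>Since ln 2 >= 1/2, about 2 x doublings give 2^K >= exp x = 2 pi / l.\<close>
    define K where "K = nat \<lceil>2 * x\<rceil>"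
    have K: "2 * x \<le> real K" "real K \<le> 2 * x + 1" using x0 by (auto simp: K_def)
    have "2 * pi / l = exp x" using l by (simp add: x_def)
    also have "exp x \<le> (2::real) ^ K"
    proof -
      have "x = 2 * x * (1 / 2)" by simp
      also have "\<dots> \<le> real K * ln 2" using K(1) x0 ln2_ge_two_thirds by (intro mult_mono) auto
      finally have "exp x \<le> exp (real K * ln 2)" by simp
      then show ?thesis by (simp add: exp_of_nat_mult)
    qed
    finally have "L K = 2 * pi" using l by (simp add: L_def field_simps)
    have "ennreal (2 * pi * cmod (arc_avg F a (2 * pi) - 0)) \<le> (\<integral>\<^sup>+t\<in>{a..a+2*pi}. ennreal (cmod (F t - 0)) \<partial>lborel)"
      by (rule arc_avg_diff_le) auto
    then have "2 * pi * cmod (arc_avg F a (2 * pi)) \<le> N"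
      using N by (simp add: norm_period ennreal_le_iff)
    moreover have "1 * cmod (arc_avg F a (2 * pi)) \<le> 2 * pi * cmod (arc_avg F a (2 * pi))"
      using pi_gt3 by (intro mult_right_mono) auto
    ultimately have top: "cmod (arc_avg F a (L K)) \<le> N" using \<open>L K = 2 * pi\<close> by simp
    have "L 0 = l" using l by (simp add: L_def)
    then have "cmod (arc_avg F a l) \<le> N + 2 * C * real K" using chain[of K] top by simp
    also have "\<dots> \<le> N + 2 * C * (2 * x + 1)" using K C0 by (intro add_left_mono mult_left_mono) auto
    also have "\<dots> \<le> (N + 4 * C) * (1 + x)" using C0 N x0 by (simp add: algebra_simps)
    finally show ?thesis by (simp add: x_def)
  qed
  then show ?thesis using N C0 by (intro exI[of _ "N + 4 * C"]) auto
qed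

end

lemma H1_circle_L1: "f \<in> H1 \<Longrightarrow> circle_L1 (bdry f)"
proof
  assume f: "f \<in> H1"
  show "bdry f \<in> borel_measurable borel"
    by (rule bdry_measurable[OF holomorphic_on_imp_continuous_on]) (use f in \<open>simp add: H1_iff\<close>)
  show "bdry f (t + 2 * pi) = bdry f t" for t
    unfolding bdry_def by (simp add: cis.code)
qed (rule H1_boundary)

lemma ennreal_le_suminf: "(f :: nat \<Rightarrow> ennreal) k \<le> (\<Sum>k. f k)"
  using sum_le_suminf[of f "{k}"] by simp

text \<open>\<open>H1_deriv_bound\<close> is used with the average over the smallest arc as
  constant. Around the direction of z the circle is covered by arcs of half-length 2^k \<delta>,
  with \<delta> = 1 - |z|: up to constants, on the k-th the kernel is at most 4^(-k) \<delta>^(-2),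
  while the oscillation about the fixed constant is at most 2^k \<delta> (1 + 2 k). The sum over k
  converges and leaves 1/\<delta>.\<close>

lemma BMOA_Bloch:
  assumes f: "f \<in> BMOA"
  shows "\<exists>M\<ge>0. \<forall>z. cmod z < 1 \<longrightarrow> cmod (deriv f z) * (1 - cmod z) \<le> M"
proof -
  obtain C where f1: "f \<in> H1" and C: "bmo_const (bdry f) C" using f unfolding BMOA_iff by blast
  interpret circle_L1 "bdry f" by (rule H1_circle_L1[OF f1])
  let ?F = "bdry f"
  have C0: "0 \<le> C" using C by (simp add: bmo_const_def)
  define S where "S = (\<Sum>k. 512 * C * (3/4) ^ k :: real)"
  have Ssum: "summable (\<lambda>k. 512 * C * (3/4) ^ k :: real)" by (intro summable_mult summable_geometric) simp
  have S0: "0 \<le> S" unfolding S_def using C0 by (intro suminf_nonneg Ssum) auto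
  have "cmod (deriv f z) * (1 - cmod z) \<le> S" if z: "cmod z < 1" for z
  proof -
    define \<rho> where "\<rho> = cmod z"
    define \<alpha> where "\<alpha> = Arg z"
    have zpol: "z = of_real \<rho> * cis \<alpha>" unfolding \<rho>_def \<alpha>_def using rcis_cmod_Arg[of z] by (simp add: rcis_def)
    have \<rho>: "0 \<le> \<rho>" "\<rho> < 1" using z by (auto simp: \<rho>_def)
    define \<delta> where "\<delta> = 1 - \<rho>"
    have \<delta>: "0 < \<delta>" "\<delta> \<le> 1" using \<rho> by (auto simp: \<delta>_def)
    \<comment> \<open>The cap at pi stops the arcs at the full circle while keeping consecutive
      lengths within a factor 2.\<close>
    define s where "s k = min (2 ^ k * \<delta>) pi" for k :: nat
    have s: "0 < s k" "s k \<le> s (Suc k)" "s k \<le> pi" "s (Suc k) \<le> 2 * s k" "s k \<le> 2 ^ k * \<delta>" for k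
    proof -
      define q where "q = 2 ^ k * \<delta>"
      have "0 < q" using \<delta> by (simp add: q_def)
      then show "0 < s k" "s k \<le> s (Suc k)" "s k \<le> pi" "s (Suc k) \<le> 2 * s k" "s k \<le> 2 ^ k * \<delta>"
        unfolding s_def power_Suc mult.assoc q_def[symmetric] by (auto simp: min_def)
    qed
    define A where "A k = arc_avg ?F (\<alpha> - s k) (2 * s k)" for k
    have step: "cmod (A k - A (Suc k)) \<le> 2 * C" for k
      unfolding A_def by (rule bmo_avg_subarc[OF C]) (use s[of k] s[of "Suc k"] in auto)
    have chain: "cmod (A k - A 0) \<le> 2 * C * real k" for k
    proof (induction k)
      case (Suc k)
      have "cmod (A (Suc k) - A 0) \<le> cmod (A (Suc k) - A k) + cmod (A k - A 0)"
        using norm_triangle_ineq[of "A (Suc k) - A k" "A k - A 0"] by simp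
      with Suc step[of k] show ?case by (simp add: algebra_simps norm_minus_commute)
    qed simp
    let ?I = "\<lambda>k. {\<alpha> - s k..\<alpha> - s k + 2 * s k}"
    have osc: "(\<integral>\<^sup>+t\<in>?I k. ennreal (cmod (?F t - A 0)) \<partial>lborel) \<le> ennreal (2 * s k * (C * (1 + 2 * real k)))" for k
    proof -
      have "(\<integral>\<^sup>+t\<in>?I k. ennreal (cmod (?F t - A 0)) \<partial>lborel) \<le> (\<integral>\<^sup>+t\<in>?I k. ennreal (cmod (?F t - A k)) \<partial>lborel) + ennreal (2 * s k * cmod (A k - A 0))"
        by (rule osc_change_const) (use s[of k] in auto)
      also have "\<dots> \<le> ennreal (C * (2 * s k)) + ennreal (2 * s k * (2 * C * real k))"
      proof (rule add_mono)
        show "(\<integral>\<^sup>+t\<in>?I k. ennreal (cmod (?F t - A k)) \<partial>lborel) \<le> ennreal (C * (2 * s k))"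
          unfolding A_def by (rule C[unfolded bmo_const_def, THEN conjunct2, rule_format]) (use s[of k] in auto)
        show "ennreal (2 * s k * cmod (A k - A 0)) \<le> ennreal (2 * s k * (2 * C * real k))"
          using chain[of k] s[of k] by (intro ennreal_leI mult_left_mono) auto
      qed
      also have "\<dots> = ennreal (2 * s k * (C * (1 + 2 * real k)))"
        using C0 s[of k] by (subst ennreal_plus[symmetric]) (auto simp: algebra_simps)
      finally show ?thesis .
    qed
    have cz: "cmod (cis t - z) = cmod (cis (t - \<alpha>) - of_real \<rho>)" for t
    proof -
      have "cis t - z = cis \<alpha> * (cis (t - \<alpha>) - of_real \<rho>)"
        by (simp add: zpol algebra_simps cis_mult)
      then show ?thesis by (simp add: norm_mult)
    qed
    define w where "w k = 64 / (4 ^ k * \<delta>\<^sup>2)" for k :: nat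
    have w0: "0 \<le> w k" for k by (simp add: w_def)
    have ker: "ennreal (1 / (cmod (cis t - z))\<^sup>2) \<le> (\<Sum>k. ennreal (w k) * indicator (?I k) t)"
      if t: "\<bar>t - \<alpha>\<bar> \<le> pi" for t
    proof -
      have ex: "\<exists>k. \<bar>t - \<alpha>\<bar> \<le> 2 ^ k * \<delta>"
      proof -
        obtain k :: nat where "\<bar>t - \<alpha>\<bar> / \<delta> < 2 ^ k" using real_arch_pow[of 2] by auto
        then show ?thesis using \<delta> by (auto simp: field_simps intro!: exI[of _ k])
      qed
      \<comment> \<open>Minimality puts t outside the preceding arc, which bounds |cis t - z| from
        below by 2^k \<delta> / 8; for k = 0 the distance \<delta> to the circle plays that
        role.\<close>
      define k where "k = (LEAST k. \<bar>t - \<alpha>\<bar> \<le> 2 ^ k * \<delta>)"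
      have k: "\<bar>t - \<alpha>\<bar> \<le> 2 ^ k * \<delta>" unfolding k_def by (rule LeastI_ex[OF ex])
      have low: "2 ^ k * \<delta> / 8 \<le> cmod (cis t - z)"
      proof (cases k)
        case 0
        have "\<delta> \<le> cmod (cis t - z)" using cmod_cis_minus_real_ge(2)[OF t, of \<rho>] \<rho> by (simp add: cz \<delta>_def)
        then show ?thesis using 0 \<delta> by simp
      next
        case (Suc j)
        then have "\<not> \<bar>t - \<alpha>\<bar> \<le> 2 ^ j * \<delta>" unfolding k_def by (metis lessI not_less_Least)
        then have "2 ^ j * \<delta> / 4 \<le> \<bar>t - \<alpha>\<bar> / 4" by simp
        also have "\<dots> \<le> cmod (cis t - z)" using cmod_cis_minus_real_ge(1)[OF t, of \<rho>] \<rho> by (simp add: cz)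
        finally show ?thesis using Suc by (simp add: mult.commute)
      qed
      have pos: "0 < 2 ^ k * \<delta> / 8" using \<delta> by simp
      have "1 / (cmod (cis t - z))\<^sup>2 \<le> 1 / (2 ^ k * \<delta> / 8)\<^sup>2"
        using low pos by (intro divide_left_mono power_mono mult_pos_pos) auto
      also have "\<dots> = w k" by (simp add: w_def power_divide power_mult_distrib power_mult[symmetric] mult.commute[of k] power_mult)
      finally have "ennreal (1 / (cmod (cis t - z))\<^sup>2) \<le> ennreal (w k) * indicator (?I k) t"
        using k t by (auto simp: indicator_def s_def ennreal_leI abs_le_iff)
      also have "\<dots> \<le> (\<Sum>k. ennreal (w k) * indicator (?I k) t)"
        by (rule ennreal_le_suminf)
      finally show ?thesis .
    qed
    let ?G = "\<lambda>t. ennreal (cmod (?F t - A 0) / (cmod (cis t - z))\<^sup>2)"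
    have [measurable]: "cis \<in> borel_measurable borel"
      by (intro borel_measurable_continuous_onI continuous_intros)
    have [measurable]: "?G \<in> borel_measurable borel" by measurable
    have Gper: "?G (t + 2 * pi) = ?G t" for t using per by (simp add: cis.code)
    have "ennreal (2 * pi * cmod (deriv f z)) \<le> (\<integral>\<^sup>+t. ?G t \<partial>circ)"
      by (rule H1_deriv_bound[OF f1 z])
    also have "\<dots> = (\<integral>\<^sup>+t\<in>{\<alpha> - pi..\<alpha> - pi + 2 * pi}. ?G t \<partial>lborel)"
      by (subst nn_integral_periodic[where u="?G"]) (use Gper in \<open>auto simp: nn_integral_circ\<close>)
    also have "\<dots> \<le> (\<integral>\<^sup>+t. (\<Sum>k. ennreal (w k) * (ennreal (cmod (?F t - A 0)) * indicator (?I k) t)) \<partial>lborel)"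
    proof (rule nn_integral_mono)
      fix t
      show "?G t * indicator {\<alpha> - pi..\<alpha> - pi + 2 * pi} t \<le> (\<Sum>k. ennreal (w k) * (ennreal (cmod (?F t - A 0)) * indicator (?I k) t))"
      proof (cases "t \<in> {\<alpha> - pi..\<alpha> - pi + 2 * pi}")
        case True
        then have t: "\<bar>t - \<alpha>\<bar> \<le> pi" by (auto simp: abs_le_iff)
        have "?G t = ennreal (cmod (?F t - A 0)) * ennreal (1 / (cmod (cis t - z))\<^sup>2)"
          by (subst ennreal_mult[symmetric]) auto
        also have "\<dots> \<le> ennreal (cmod (?F t - A 0)) * (\<Sum>k. ennreal (w k) * indicator (?I k) t)"
          by (rule mult_left_mono[OF ker[OF t]]) simp
        also have "\<dots> = (\<Sum>k. ennreal (w k) * (ennreal (cmod (?F t - A 0)) * indicator (?I k) t))"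
          by (subst ennreal_suminf_cmult[symmetric]) (simp add: mult_ac)
        finally show ?thesis using True by simp
      qed simp
    qed
    also have "\<dots> = (\<Sum>k. \<integral>\<^sup>+t. ennreal (w k) * (ennreal (cmod (?F t - A 0)) * indicator (?I k) t) \<partial>lborel)"
      by (rule nn_integral_suminf) measurable
    also have "\<dots> = (\<Sum>k. ennreal (w k) * (\<integral>\<^sup>+t\<in>?I k. ennreal (cmod (?F t - A 0)) \<partial>lborel))"
      by (intro suminf_cong nn_integral_cmult) measurable
    also have "\<dots> \<le> (\<Sum>k. ennreal (512 * C * (3/4) ^ k / \<delta>))"
    proof (intro suminf_le)
      fix k
      \<comment> \<open>The linear drift of the averages is absorbed into a geometric factor: 2^k
        (3/2)^k / 4^k = (3/4)^k is still summable, and 64 * 2 * 4 = 512.\<close>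
      have bern: "1 + 2 * real k \<le> 4 * (3/2) ^ k"
        using Bernoulli_inequality[of "1/2 :: real" k] by simp
      have "w k * (2 * s k * (C * (1 + 2 * real k))) \<le> w k * (2 * (2 ^ k * \<delta>) * (C * (4 * (3/2) ^ k)))"
        using s[of k] C0 bern w0 \<delta> by (intro mult_left_mono mult_mono) auto
      also have "\<dots> = 512 * C * (3/4) ^ k / \<delta>"
      proof -
        have "(4::real) ^ k = 2 ^ k * 2 ^ k" by (simp add: power_mult_distrib[symmetric])
        then show ?thesis using \<delta> by (simp add: w_def power2_eq_square power_divide field_simps)
      qed
      finally have "ennreal (w k) * ennreal (2 * s k * (C * (1 + 2 * real k))) \<le> ennreal (512 * C * (3/4) ^ k / \<delta>)"
        using w0 C0 s[of k] by (subst ennreal_mult[symmetric]) (auto intro!: ennreal_leI mult_nonneg_nonneg)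
      then show "ennreal (w k) * (\<integral>\<^sup>+t\<in>?I k. ennreal (cmod (?F t - A 0)) \<partial>lborel) \<le> ennreal (512 * C * (3/4) ^ k / \<delta>)"
        using mult_left_mono[OF osc[of k], of "ennreal (w k)"] by (rule order_trans[rotated]) simp
    qed auto
    also have "\<dots> = ennreal (\<Sum>k. 512 * C * (3/4) ^ k / \<delta>)"
      by (rule suminf_ennreal2) (use C0 \<delta> in \<open>auto intro!: summable_divide Ssum\<close>)
    also have "(\<Sum>k. 512 * C * (3/4) ^ k / \<delta>) = S / \<delta>"
      unfolding S_def by (rule suminf_divide[OF Ssum])
    finally have "2 * pi * cmod (deriv f z) \<le> S / \<delta>"
      using S0 \<delta> by (simp add: ennreal_le_iff)
    moreover have "1 * cmod (deriv f z) \<le> 2 * pi * cmod (deriv f z)" using pi_gt3 by (intro mult_right_mono) auto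
    ultimately have "cmod (deriv f z) \<le> S / \<delta>" by simp
    then show ?thesis using \<delta> by (simp add: \<delta>_def \<rho>_def field_simps)
  qed
  then show ?thesis using S0 by blast
qed

section \<open>Polar coordinates\<close>

lemma lborel_complex_pair: "lborel = distr (lborel \<Otimes>\<^sub>M lborel) borel (\<lambda>(x, y). Complex x y)"
proof (rule lborel_eqI)
  have c: "continuous_on UNIV (\<lambda>p. Complex (fst p) (snd p))"
    unfolding Complex_eq by (intro continuous_intros)
  have m [measurable]: "(\<lambda>(x, y). Complex x y) \<in> borel_measurable (lborel \<Otimes>\<^sub>M lborel)"
    using borel_measurable_continuous_onI[OF c] by (simp add: lborel_prod split_beta')
  fix l u :: complex
  assume lu: "\<And>b. b \<in> Basis \<Longrightarrow> l \<bullet> b \<le> u \<bullet> b"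
  have le: "Re l \<le> Re u" "Im l \<le> Im u" using lu[of 1] lu[of \<i>] by (auto simp: Basis_complex_def)
  have "emeasure (distr (lborel \<Otimes>\<^sub>M lborel) borel (\<lambda>(x, y). Complex x y)) (box l u)
     = emeasure (lborel \<Otimes>\<^sub>M lborel) ((\<lambda>(x, y). Complex x y) -` box l u)"
    by (subst emeasure_distr) (auto simp: space_pair_measure)
  also have "(\<lambda>(x, y). Complex x y) -` box l u = {Re l<..<Re u} \<times> {Im l<..<Im u}"
    by (auto simp: box_def Basis_complex_def)
  also have "emeasure (lborel \<Otimes>\<^sub>M lborel) \<dots> = ennreal (Re u - Re l) * ennreal (Im u - Im l)"
    using le by (subst lborel.emeasure_pair_measure_Times) auto
  also have "\<dots> = ennreal (\<Prod>b\<in>Basis. (u - l) \<bullet> b)"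
    using le by (simp add: Basis_complex_def ennreal_mult)
  finally show "emeasure (distr (lborel \<Otimes>\<^sub>M lborel) borel (\<lambda>(x, y). Complex x y)) (box l u) = ennreal (\<Prod>b\<in>Basis. (u - l) \<bullet> b)" .
qed simp

lemma Complex_measurable [measurable (raw)]:
  assumes [measurable]: "f \<in> borel_measurable M" "g \<in> borel_measurable M"
  shows "(\<lambda>x. Complex (f x) (g x)) \<in> borel_measurable M"
  unfolding Complex_eq by measurable

lemma nn_integral_complex:
  fixes F :: "complex \<Rightarrow> ennreal"
  assumes [measurable]: "F \<in> borel_measurable borel"
  shows "(\<integral>\<^sup>+z. F z \<partial>lborel) = (\<integral>\<^sup>+x. \<integral>\<^sup>+y. F (Complex x y) \<partial>lborel \<partial>lborel)"
  apply (subst lborel_complex_pair)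
  apply (subst nn_integral_distr)
    apply (auto simp: split_beta' intro: measurable_compose)[2]
  apply (subst lborel.nn_integral_fst[symmetric])
   apply (auto simp: split_beta')
  done

text \<open>A rotation is a product of three shears, each of which preserves area by Fubini and translation invariance.\<close>

lemma nn_integral_rotate:
  fixes F :: "complex \<Rightarrow> ennreal"
  assumes [measurable]: "F \<in> borel_measurable borel" and s: "sin t \<noteq> 0"
  shows "(\<integral>\<^sup>+z. F (cis t * z) \<partial>lborel) = (\<integral>\<^sup>+z. F z \<partial>lborel)"
proof -
  \<comment> \<open>This is -tan (t/2), the parameter of the two horizontal shears; the vertical one
    between them has parameter sin t.\<close>
  define a where "a = (cos t - 1) / sin t"
  have trans: "(\<integral>\<^sup>+x. u (x + b) \<partial>lborel) = (\<integral>\<^sup>+x. u x \<partial>lborel)" if "u \<in> borel_measurable borel" for u :: "real \<Rightarrow> ennreal" and b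
    using nn_integral_real_affine[OF that, of 1 b] by (simp add: add.commute)
  have shx: "(\<integral>\<^sup>+x. \<integral>\<^sup>+y. G (x + b * y) y \<partial>lborel \<partial>lborel) = (\<integral>\<^sup>+x. \<integral>\<^sup>+y. G x y \<partial>lborel \<partial>lborel)"
    if [measurable]: "case_prod G \<in> borel_measurable (borel \<Otimes>\<^sub>M borel)" for G :: "real \<Rightarrow> real \<Rightarrow> ennreal" and b
  proof -
    have "(\<integral>\<^sup>+x. \<integral>\<^sup>+y. G (x + b * y) y \<partial>lborel \<partial>lborel) = (\<integral>\<^sup>+y. \<integral>\<^sup>+x. G (x + b * y) y \<partial>lborel \<partial>lborel)"
      by (rule lborel_pair.Fubini') measurable
    also have "\<dots> = (\<integral>\<^sup>+y. \<integral>\<^sup>+x. G x y \<partial>lborel \<partial>lborel)"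
      by (rule nn_integral_cong, rule trans) measurable
    also have "\<dots> = (\<integral>\<^sup>+x. \<integral>\<^sup>+y. G x y \<partial>lborel \<partial>lborel)"
      by (rule lborel_pair.Fubini') measurable
    finally show ?thesis .
  qed
  have shy: "(\<integral>\<^sup>+x. \<integral>\<^sup>+y. G x (y + b * x) \<partial>lborel \<partial>lborel) = (\<integral>\<^sup>+x. \<integral>\<^sup>+y. G x y \<partial>lborel \<partial>lborel)"
    if [measurable]: "case_prod G \<in> borel_measurable (borel \<Otimes>\<^sub>M borel)" for G :: "real \<Rightarrow> real \<Rightarrow> ennreal" and b
    by (rule nn_integral_cong, rule trans) measurable
  define G2 where "G2 x y = F (Complex (x + a * y) y)" for x y
  define G1 where "G1 x y = G2 x (y + sin t * x)" for x y
  have m2 [measurable]: "case_prod G2 \<in> borel_measurable (borel \<Otimes>\<^sub>M borel)"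
    unfolding G2_def by measurable
  have m1 [measurable]: "case_prod G1 \<in> borel_measurable (borel \<Otimes>\<^sub>M borel)"
    unfolding G1_def G2_def by measurable
  have m0: "case_prod (\<lambda>x y. F (Complex x y)) \<in> borel_measurable (borel \<Otimes>\<^sub>M borel)"
    by measurable
  have rot: "F (cis t * Complex x y) = G1 (x + a * y) y" for x y
  proof -
    have as: "a * sin t = cos t - 1" using s by (simp add: a_def)
    have y1: "y + sin t * (x + a * y) = sin t * x + cos t * y"
      using as by (simp add: algebra_simps) (metis distrib_right left_diff_distrib mult.commute mult.left_commute mult_1 diff_add_cancel)
    have "a * (cos t + 1) * sin t = - sin t * sin t"
    proof -
      have "a * (cos t + 1) * sin t = (a * sin t) * (cos t + 1)" by simp
      also have "\<dots> = (cos t)\<^sup>2 - 1" unfolding as by (simp add: power2_eq_square algebra_simps)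
      also have "\<dots> = - sin t * sin t" using sin_cos_squared_add[of t] by (simp add: power2_eq_square)
      finally show ?thesis .
    qed
    then have ac: "a * (cos t + 1) = - sin t" using s by (metis mult_right_cancel)
    have "x + a * y + a * (sin t * x + cos t * y) = x + (a * sin t) * x + (a * (cos t + 1)) * y"
      by (simp add: algebra_simps)
    also have "\<dots> = cos t * x - sin t * y" unfolding as ac by (simp add: algebra_simps)
    finally have x2: "x + a * y + a * (sin t * x + cos t * y) = cos t * x - sin t * y" .
    have "cis t * Complex x y = Complex (cos t * x - sin t * y) (sin t * x + cos t * y)"
      by (simp add: complex_eq_iff algebra_simps)
    then show ?thesis by (simp only: G1_def G2_def y1 x2)
  qed
  have "(\<integral>\<^sup>+z. F (cis t * z) \<partial>lborel) = (\<integral>\<^sup>+x. \<integral>\<^sup>+y. G1 (x + a * y) y \<partial>lborel \<partial>lborel)"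
    by (subst nn_integral_complex) (simp_all add: rot)
  also have "\<dots> = (\<integral>\<^sup>+x. \<integral>\<^sup>+y. G1 x y \<partial>lborel \<partial>lborel)" by (rule shx[OF m1])
  also have "\<dots> = (\<integral>\<^sup>+x. \<integral>\<^sup>+y. G2 x y \<partial>lborel \<partial>lborel)" unfolding G1_def by (rule shy[OF m2])
  also have "\<dots> = (\<integral>\<^sup>+x. \<integral>\<^sup>+y. F (Complex x y) \<partial>lborel \<partial>lborel)" unfolding G2_def by (rule shx[OF m0])
  also have "\<dots> = (\<integral>\<^sup>+z. F z \<partial>lborel)" by (rule nn_integral_complex[symmetric]) measurable
  finally show ?thesis .
qed

lemma ball_sets_borel [measurable]: "ball (a :: 'a :: metric_space) r \<in> sets borel"
  by simp

text \<open>Both sides are finite measures on the line, so it suffices to compare half-lines, where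
  the left side is the area of an annulus.\<close>

lemma radial_distribution:
  "distr (density lborel (indicator (ball (0::complex) 1))) borel cmod
    = density lborel (\<lambda>r. ennreal (2 * pi * r) * indicator {0..<1} r)"
proof (rule measure_eqI_lessThan)
  let ?M = "distr (density lborel (indicator (ball (0::complex) 1))) borel cmod"
  let ?N = "density lborel (\<lambda>r. ennreal (2 * pi * r) * indicator {0..<1} r)"
  have M: "emeasure ?M {x<..} = emeasure lborel (ball (0::complex) 1 - cball 0 x)" for x
  proof -
    have A: "{z::complex. x < cmod z} \<in> sets borel" by measurable
    have "emeasure ?M {x<..} = emeasure (density lborel (indicator (ball (0::complex) 1))) {z. x < cmod z}"
      by (subst emeasure_distr) (auto simp: vimage_def)
    also have "\<dots> = (\<integral>\<^sup>+z. indicator (ball 0 1) z * indicator {z. x < cmod z} z \<partial>lborel)"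
      using A by (intro emeasure_density) auto
    also have "\<dots> = (\<integral>\<^sup>+z. indicator (ball (0::complex) 1 - cball 0 x) z \<partial>lborel)"
      by (rule nn_integral_cong) (auto simp: indicator_def)
    finally show ?thesis by simp
  qed
  have N: "emeasure ?N {x<..} = ennreal (pi - pi * (max x 0)\<^sup>2)" if x: "x < 1" for x
  proof -
    have "emeasure ?N {x<..} = (\<integral>\<^sup>+r. ennreal (2 * pi * r) * indicator {max x 0..1} r \<partial>lborel)"
    proof -
      have "emeasure ?N {x<..} = (\<integral>\<^sup>+r. ennreal (2 * pi * r) * indicator {0..<1} r * indicator {x<..} r \<partial>lborel)"
        by (rule emeasure_density) auto
      also have "\<dots> = (\<integral>\<^sup>+r. ennreal (2 * pi * r) * indicator {max x 0..1} r \<partial>lborel)"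
      proof (rule nn_integral_cong_AE)
        have "AE r in lborel. r \<noteq> (1::real) \<and> r \<noteq> x" by (intro AE_conjI AE_lborel_singleton)
        then show "AE r in lborel. ennreal (2 * pi * r) * indicator {0..<1} r * indicator {x<..} r = ennreal (2 * pi * r) * indicator {max x 0..1} r"
          by eventually_elim (auto simp: indicator_def)
      qed
      finally show ?thesis .
    qed
    also have "\<dots> = ennreal (pi * 1\<^sup>2 - pi * (max x 0)\<^sup>2)"
      by (rule nn_integral_FTC_Icc[where F="\<lambda>r. pi * r\<^sup>2"]) (use x in \<open>auto intro!: derivative_eq_intros\<close>)
    finally show ?thesis by simp
  qed
  show "emeasure ?M {x<..} < \<infinity>" for x
    unfolding M by (rule le_less_trans[OF emeasure_mono[of _ "ball (0::complex) 1"]]) (auto simp: emeasure_ball)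
  show "emeasure ?M {x<..} = emeasure ?N {x<..}" for x
  proof (cases "x < 1")
    case True
    have c: "emeasure lborel (cball (0::complex) x) = ennreal (pi * (max x 0)\<^sup>2)"
      by (cases "0 \<le> x") (auto simp: emeasure_cball unit_ball_vol_2 max_def)
    have b: "emeasure lborel (ball (0::complex) 1) = ennreal pi"
      by (simp add: emeasure_ball unit_ball_vol_2)
    have "emeasure lborel (ball (0::complex) 1 - cball 0 x) = emeasure lborel (ball (0::complex) 1) - emeasure lborel (cball (0::complex) x)"
      by (rule emeasure_Diff) (use True c in auto)
    also have "\<dots> = ennreal (pi - pi * (max x 0)\<^sup>2)"
      unfolding b c by (rule ennreal_minus) simp
    finally show ?thesis unfolding M N[OF True] .
  next
    case False
    then have d: "ball (0::complex) 1 - cball 0 x = {}" by auto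
    have "emeasure ?N {x<..} = 0"
      using False by (subst emeasure_density) (auto simp: indicator_def nn_integral_0_iff_AE)
    then show ?thesis unfolding M d by simp
  qed
qed simp_all

lemma nn_integral_radial:
  fixes \<phi> :: "real \<Rightarrow> ennreal"
  assumes [measurable]: "\<phi> \<in> borel_measurable borel"
  shows "(\<integral>\<^sup>+z\<in>ball 0 1. \<phi> (cmod z) \<partial>lborel) = (\<integral>\<^sup>+r\<in>{0..<1}. ennreal (2 * pi * r) * \<phi> r \<partial>lborel)"
proof -
  have "(\<integral>\<^sup>+z\<in>ball (0::complex) 1. \<phi> (cmod z) \<partial>lborel) = (\<integral>\<^sup>+r. \<phi> r \<partial>distr (density lborel (indicator (ball (0::complex) 1))) borel cmod)"
  proof -
    have "(\<integral>\<^sup>+r. \<phi> r \<partial>distr (density lborel (indicator (ball (0::complex) 1))) borel cmod)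
        = (\<integral>\<^sup>+z. \<phi> (cmod z) \<partial>density lborel (indicator (ball (0::complex) 1)))"
      by (rule nn_integral_distr) measurable
    also have "\<dots> = (\<integral>\<^sup>+z. indicator (ball 0 1) z * \<phi> (cmod z) \<partial>lborel)"
      by (rule nn_integral_density) measurable
    finally show ?thesis by (simp add: mult.commute)
  qed
  also have "\<dots> = (\<integral>\<^sup>+r\<in>{0..<1}. ennreal (2 * pi * r) * \<phi> r \<partial>lborel)"
    unfolding radial_distribution by (subst nn_integral_density) (auto simp: mult_ac)
  finally show ?thesis .
qed

interpretation circ_plane: pair_sigma_finite circ "lborel :: complex measure"
  by unfold_locales

lemma cis_measurable [measurable]: "cis \<in> borel_measurable borel"
  by (intro borel_measurable_continuous_onI continuous_intros)

text \<open>Area is rotation invariant, so F may be averaged over all rotations without changing its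
  integral. The average is radial and \<open>nn_integral_radial\<close> applies. The rotations with
  sin t = 0, which \<open>nn_integral_rotate\<close> excludes, form a null set.\<close>

theorem nn_integral_polar:
  fixes F :: "complex \<Rightarrow> ennreal"
  assumes [measurable]: "F \<in> borel_measurable borel"
  shows "(\<integral>\<^sup>+z\<in>ball 0 1. F z \<partial>lborel) = (\<integral>\<^sup>+r\<in>{0..<1}. ennreal r * (\<integral>\<^sup>+t. F (of_real r * cis t) \<partial>circ) \<partial>lborel)"
proof -
  define G where "G z = F z * indicator (ball 0 1) z" for z
  have [measurable]: "G \<in> borel_measurable borel" unfolding G_def by measurable
  define \<Phi> where "\<Phi> r = (\<integral>\<^sup>+t. F (of_real r * cis t) \<partial>circ)" for r :: real
  have [measurable]: "\<Phi> \<in> borel_measurable borel" unfolding \<Phi>_def by measurable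
  have rot: "(\<integral>\<^sup>+t. G (cis t * z) \<partial>circ) = \<Phi> (cmod z) * indicator (ball 0 1) z" for z
  proof -
    define v where "v t = G (of_real (cmod z) * cis t)" for t
    have [measurable]: "v \<in> borel_measurable borel" unfolding v_def by measurable
    have z: "z = of_real (cmod z) * cis (Arg z)" using rcis_cmod_Arg[of z] by (simp add: rcis_def)
    have "G (cis t * z) = v (t + Arg z)" for t
    proof -
      have "cis t * z = of_real (cmod z) * (cis t * cis (Arg z))" using z by (metis mult.left_commute)
      then show ?thesis by (simp add: v_def cis_mult)
    qed
    then have "(\<integral>\<^sup>+t. G (cis t * z) \<partial>circ) = (\<integral>\<^sup>+t\<in>{0..2*pi}. v (t + Arg z) \<partial>lborel)"
      by (simp add: nn_integral_circ)
    also have "\<dots> = (\<integral>\<^sup>+t\<in>{Arg z..Arg z + 2*pi}. v t \<partial>lborel)"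
      by (subst (2) nn_integral_real_affine[where c=1 and t="Arg z"])
        (auto intro!: nn_integral_cong simp: indicator_def add.commute)
    also have "\<dots> = (\<integral>\<^sup>+t. v t \<partial>circ)"
      by (subst nn_integral_periodic) (auto simp: v_def cis.code nn_integral_circ)
    also have "\<dots> = \<Phi> (cmod z) * indicator (ball 0 1) z"
      by (auto simp: v_def G_def \<Phi>_def indicator_def norm_mult)
    finally show ?thesis .
  qed
  have "countable {t. sin t = (0::real)}"
  proof -
    have "{t. sin t = (0::real)} = range (\<lambda>k::int. of_int k * pi)"
      by (auto simp: sin_zero_iff_int2)
    then show ?thesis by simp
  qed
  then have "{t. sin t = (0::real)} \<in> null_sets lborel" by (rule countable_imp_null_set_lborel)
  then have ae: "AE t in lborel. sin t \<noteq> (0::real)" by (rule AE_not_in[THEN AE_mp]) auto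
  have "ennreal (2 * pi) * (\<integral>\<^sup>+z. G z \<partial>lborel) = (\<integral>\<^sup>+t. (\<integral>\<^sup>+z. G z \<partial>lborel) \<partial>circ)"
    by (simp add: emeasure_circ mult.commute)
  also have "\<dots> = (\<integral>\<^sup>+t. (\<integral>\<^sup>+z. G (cis t * z) \<partial>lborel) \<partial>circ)"
  proof (rule nn_integral_cong_AE)
    show "AE t in circ. (\<integral>\<^sup>+z. G z \<partial>lborel) = (\<integral>\<^sup>+z. G (cis t * z) \<partial>lborel)"
      unfolding AE_circ_iff using ae by eventually_elim (simp add: nn_integral_rotate)
  qed
  also have "\<dots> = (\<integral>\<^sup>+z. (\<integral>\<^sup>+t. G (cis t * z) \<partial>circ) \<partial>lborel)"
    by (rule circ_plane.Fubini'[symmetric]) measurable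
  also have "\<dots> = (\<integral>\<^sup>+z\<in>ball 0 1. \<Phi> (cmod z) \<partial>lborel)"
    by (simp only: rot)
  also have "\<dots> = (\<integral>\<^sup>+r\<in>{0..<1}. ennreal (2 * pi * r) * \<Phi> r \<partial>lborel)"
    by (rule nn_integral_radial) measurable
  also have "\<dots> = (\<integral>\<^sup>+r. ennreal (2 * pi) * (ennreal r * \<Phi> r * indicator {0..<1} r) \<partial>lborel)"
    by (rule nn_integral_cong) (auto simp: indicator_def ennreal_mult mult_ac)
  also have "\<dots> = ennreal (2 * pi) * (\<integral>\<^sup>+r\<in>{0..<1}. ennreal r * \<Phi> r \<partial>lborel)"
    by (rule nn_integral_cmult) measurable
  finally show ?thesis
    by (simp add: ennreal_mult_cancel_left G_def \<Phi>_def)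
qed

section \<open>Suprema of random polynomials\<close>

lemma rad_Suc: "rad (Suc n) t = rad n (2 * t)"
  by (simp add: rad_def mult_ac)

lemma rad_add_1: "rad n (t + 1) = rad n t"
proof -
  have "(2::real) ^ n * (t + 1) = 2 ^ n * t + real_of_int (2 ^ n)" by (simp add: algebra_simps)
  then have "frac ((2::real) ^ n * (t + 1)) = frac (2 ^ n * t)"
    by (simp only: frac_def floor_add_int) simp
  then show ?thesis by (simp add: rad_def rad0_def)
qed

lemma rad_abs_le: "\<bar>rad n t\<bar> \<le> 1"
  by (simp add: rad_def rad0_def Let_def)

lemma rad_measurable [measurable]: "rad n \<in> borel_measurable borel"
  unfolding rad_def rad0_def Let_def frac_def by measurable

lemma rad_0_left: "0 < t \<Longrightarrow> t < 1/2 \<Longrightarrow> rad 0 t = 1"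
  and rad_0_right: "1/2 < t \<Longrightarrow> t < 1 \<Longrightarrow> rad 0 t = -1"
  by (simp_all add: rad_def rad0_def frac_eq Let_def)

lemma cosh_le_exp_square: "cosh (x::real) \<le> exp (x\<^sup>2)"
proof -
  have *: "cosh x \<le> exp (x\<^sup>2)" if x: "0 \<le> x" for x :: real
  proof (cases "x \<le> 1")
    case True
    have "exp x \<le> 1 + x + x\<^sup>2" using exp_bound[of x] x True by simp
    moreover have "exp (- x) \<le> 1 - x + x\<^sup>2"
    proof -
      have "exp (- x) = 1 / exp x" by (simp add: exp_minus inverse_eq_divide)
      also have "\<dots> \<le> 1 / (1 + x)" using x exp_ge_add_one_self[of x] by (intro divide_left_mono) auto
      also have "\<dots> \<le> 1 - x + x\<^sup>2"
      proof -
        have "1 \<le> (1 - x + x\<^sup>2) * (1 + x)" using x by (simp add: algebra_simps power2_eq_square)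
        then show ?thesis using x by (simp add: pos_divide_le_eq)
      qed
      finally show ?thesis .
    qed
    ultimately have "cosh x \<le> 1 + x\<^sup>2" by (simp add: cosh_field_def)
    also have "\<dots> \<le> exp (x\<^sup>2)" by (rule exp_ge_add_one_self)
    finally show ?thesis .
  next
    case False
    have "exp (- x) \<le> exp x" using x by simp
    then have "cosh x \<le> exp x" by (simp add: cosh_field_def)
    also have "x \<le> x\<^sup>2" using False by (simp add: power2_eq_square)
    finally show ?thesis by simp
  qed
  from *[of "\<bar>x\<bar>"] show ?thesis by (cases "0 \<le> x") auto
qed

text \<open>Independence in the form of self-similarity: on each half of the unit interval
  \<open>rad 0\<close> is constant, and the map t -> 2 t turns \<open>rad (Suc n)\<close> into
  \<open>rad n\<close>. The induction therefore runs over all coefficient sequences at once.\<close>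

lemma rademacher_mgf:
  "(\<integral>\<^sup>+t\<in>{0..1}. ennreal (exp (\<Sum>n<N. c n * rad n t)) \<partial>lborel) = ennreal (\<Prod>n<N. cosh (c n))"
proof (induction N arbitrary: c)
  case 0
  then show ?case by simp
next
  case (Suc N)
  define g where "g t = exp (\<Sum>n<N. c (Suc n) * rad n t)" for t
  have g_per: "g (t + 1) = g t" for t by (simp add: g_def rad_add_1)
  have [measurable]: "g \<in> borel_measurable borel" unfolding g_def by measurable
  have step: "exp (\<Sum>n<Suc N. c n * rad n t) = exp (c 0 * rad 0 t) * g (2 * t)" for t
    unfolding sum.lessThan_Suc_shift by (simp add: g_def exp_add rad_Suc)
  define P where "P = (\<integral>\<^sup>+t\<in>{0..1}. ennreal (g t) \<partial>lborel)"
  have P: "P = ennreal (\<Prod>n<N. cosh (c (Suc n)))" unfolding P_def g_def by (rule Suc.IH)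
  have half: "(\<integral>\<^sup>+t\<in>{h..h+1/2}. ennreal (g (2 * t)) \<partial>lborel) = ennreal (1/2) * P" if h: "h = 0 \<or> h = 1/2" for h
  proof -
    have e: "ennreal (g (2 * (h + 1/2 * x))) * indicator {h..h+1/2} (h + 1/2 * x) = ennreal (g x) * indicator {0..1} x" for x
      using h g_per[of x] by (auto simp: indicator_def algebra_simps)
    have "(\<integral>\<^sup>+t\<in>{h..h+1/2}. ennreal (g (2 * t)) \<partial>lborel)
        = ennreal \<bar>1/2\<bar> * (\<integral>\<^sup>+x. ennreal (g (2 * (h + 1/2 * x))) * indicator {h..h+1/2} (h + 1/2 * x) \<partial>lborel)"
      by (rule nn_integral_real_affine) auto
    then show ?thesis unfolding e P_def by simp
  qed
  have half1: "(\<integral>\<^sup>+t\<in>{0..1/2}. ennreal (g (2 * t)) \<partial>lborel) = ennreal (1/2) * P"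
    and half2: "(\<integral>\<^sup>+t\<in>{1/2..1}. ennreal (g (2 * t)) \<partial>lborel) = ennreal (1/2) * P"
    using half[of 0] half[of "1/2"] by simp_all
  have "(\<integral>\<^sup>+t\<in>{0..1}. ennreal (exp (\<Sum>n<Suc N. c n * rad n t)) \<partial>lborel)
     = (\<integral>\<^sup>+t. ennreal (exp (c 0)) * (ennreal (g (2 * t)) * indicator {0..1/2} t)
        + ennreal (exp (- c 0)) * (ennreal (g (2 * t)) * indicator {1/2..1} t) \<partial>lborel)"
    unfolding step
  proof (rule nn_integral_cong_AE)
    have "AE t in lborel. t \<noteq> (0::real) \<and> t \<noteq> 1/2 \<and> t \<noteq> 1"
      by (intro AE_conjI AE_lborel_singleton)
    then show "AE t in lborel. ennreal (exp (c 0 * rad 0 t) * g (2 * t)) * indicator {0..1} t =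
        ennreal (exp (c 0)) * (ennreal (g (2 * t)) * indicator {0..1/2} t)
        + ennreal (exp (- c 0)) * (ennreal (g (2 * t)) * indicator {1/2..1} t)"
    proof eventually_elim
      case (elim t)
      show ?case
      proof (cases "t \<in> {0..1}")
        case True
        show ?thesis
        proof (cases "t < 1/2")
          case True
          then show ?thesis using elim \<open>t \<in> {0..1}\<close> rad_0_left[of t] by (simp add: ennreal_mult g_def indicator_def)
        next
          case False
          then show ?thesis using elim \<open>t \<in> {0..1}\<close> rad_0_right[of t] by (simp add: ennreal_mult g_def indicator_def)
        qed
      qed (auto simp: indicator_def)
    qed
  qed
  also have "\<dots> = ennreal (exp (c 0)) * (ennreal (1/2) * P) + ennreal (exp (- c 0)) * (ennreal (1/2) * P)"
  proof -
    have "(\<integral>\<^sup>+t. ennreal (exp (c 0)) * (ennreal (g (2 * t)) * indicator {0..1/2} t)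
        + ennreal (exp (- c 0)) * (ennreal (g (2 * t)) * indicator {1/2..1} t) \<partial>lborel)
      = ennreal (exp (c 0)) * (\<integral>\<^sup>+t\<in>{0..1/2}. ennreal (g (2 * t)) \<partial>lborel)
        + ennreal (exp (- c 0)) * (\<integral>\<^sup>+t\<in>{1/2..1}. ennreal (g (2 * t)) \<partial>lborel)"
      by (subst nn_integral_add) (simp_all add: nn_integral_cmult)
    then show ?thesis by (simp only: half1 half2)
  qed
  also have "\<dots> = ennreal (cosh (c 0) * (\<Prod>n<N. cosh (c (Suc n))))"
  proof -
    define Q where "Q = (\<Prod>n<N. cosh (c (Suc n)))"
    have Q0: "0 \<le> Q" by (simp add: Q_def prod_nonneg)
    have e: "ennreal x * (ennreal y * ennreal Q) = ennreal (x * (y * Q))" if "0 \<le> x" "0 \<le> y" for x y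
      using that Q0 by (simp add: ennreal_mult)
    have "ennreal (exp (c 0)) * (ennreal (1/2) * ennreal Q) + ennreal (exp (- c 0)) * (ennreal (1/2) * ennreal Q)
        = ennreal (exp (c 0) * (1/2 * Q)) + ennreal (exp (- c 0) * (1/2 * Q))"
      by (subst e, simp, simp, subst e, simp_all)
    also have "\<dots> = ennreal (exp (c 0) * (1/2 * Q) + exp (- c 0) * (1/2 * Q))"
      using Q0 by (intro ennreal_plus[symmetric]) auto
    also have "exp (c 0) * (1/2 * Q) + exp (- c 0) * (1/2 * Q) = cosh (c 0) * Q"
      by (simp add: cosh_field_def field_simps)
    finally show ?thesis by (simp only: P Q_def)
  qed
  finally show ?case unfolding prod.lessThan_Suc_shift .
qed

lemma rademacher_subgaussian:
  "(\<integral>\<^sup>+t\<in>{0..1}. ennreal (exp (\<Sum>m<N. c m * rad (d + m) t)) \<partial>lborel) \<le> ennreal (exp (\<Sum>m<N. (c m)\<^sup>2))"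
proof -
  \<comment> \<open>Zero coefficients below d turn the shifted family into an initial segment, the
    form that \<open>rademacher_mgf\<close> treats.\<close>
  define c' where "c' n = (if n < d then 0 else c (n - d))" for n
  have shift: "(\<Sum>n<d + N. c' n * u n) = (\<Sum>m<N. c m * u (d + m))" for N and u :: "nat \<Rightarrow> real"
    by (induction N) (simp_all add: c'_def)
  have "(\<integral>\<^sup>+t\<in>{0..1}. ennreal (exp (\<Sum>m<N. c m * rad (d + m) t)) \<partial>lborel) = ennreal (\<Prod>n<d + N. cosh (c' n))"
    using rademacher_mgf[of c' "d + N"] shift[of "\<lambda>n. rad n t" for t] by simp
  also have "\<dots> \<le> ennreal (\<Prod>n<d + N. exp ((c' n)\<^sup>2))"
    by (intro ennreal_leI prod_mono) (simp add: cosh_le_exp_square)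
  also have "(\<Prod>n<d + N. exp ((c' n)\<^sup>2)) = exp (\<Sum>n<d + N. c' n * c' n)"
    by (simp add: exp_sum power2_eq_square)
  also have "(\<Sum>n<d + N. c' n * c' n) = (\<Sum>m<N. (c m)\<^sup>2)"
    unfolding shift by (simp add: c'_def power2_eq_square)
  finally show ?thesis .
qed

text \<open>Splits a square into a deterministic part of the expected size and an exponentially small tail.\<close>

lemma square_le_exp_tail:
  fixes u s :: real
  assumes s: "1 \<le> s"
  shows "u\<^sup>2 \<le> 8 * s\<^sup>2 + 4 * exp (- 2 * s\<^sup>2) * (exp (s * u) + exp (- s * u))"
proof -
  have *: "u\<^sup>2 \<le> 8 * s\<^sup>2 + 4 * exp (- 2 * s\<^sup>2) * exp (s * u)" if u: "0 \<le> u" for u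
  proof (cases "u \<le> 2 * s")
    case True
    then have "u\<^sup>2 \<le> (2 * s)\<^sup>2" using u by (intro power_mono) auto
    moreover have "0 \<le> 4 * exp (- 2 * s\<^sup>2) * exp (s * u)" by simp
    moreover have "(2 * s)\<^sup>2 = 4 * s\<^sup>2" "0 \<le> s\<^sup>2" by (simp_all add: power_mult_distrib)
    ultimately show ?thesis by linarith
  next
    case False
    define v where "v = u - 2 * s"
    have v: "0 < v" "u = 2 * s + v" using False by (auto simp: v_def)
    have "1 + s * v + (s * v)\<^sup>2 / 2 \<le> exp (s * v)" using exp_lower_Taylor_quadratic[of "s * v"] v s by simp
    moreover have "0 \<le> s * v" using v s by simp
    moreover have "v\<^sup>2 \<le> (s * v)\<^sup>2" using v s by (intro power_mono) (auto simp: mult_le_cancel_right1)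
    ultimately have "v\<^sup>2 \<le> 2 * exp (s * v)" by linarith
    moreover have "u\<^sup>2 \<le> 8 * s\<^sup>2 + 2 * v\<^sup>2"
    proof -
      have "0 \<le> (2 * s - v)\<^sup>2" by simp
      then show ?thesis unfolding v(2) by (simp add: power2_eq_square algebra_simps)
    qed
    moreover have "exp (- 2 * s\<^sup>2) * exp (s * u) = exp (s * v)"
      unfolding v(2) exp_add[symmetric] by (simp add: power2_eq_square algebra_simps)
    ultimately show ?thesis by (simp add: mult.assoc)
  qed
  have pos: "0 \<le> 4 * exp (- 2 * s\<^sup>2) * exp y" for y by simp
  show ?thesis
  proof (cases "0 \<le> u")
    case True
    show ?thesis unfolding distrib_left using *[OF True] pos[of "- s * u"] by linarith
  next
    case False
    then have "u\<^sup>2 \<le> 8 * s\<^sup>2 + 4 * exp (- 2 * s\<^sup>2) * exp (- s * u)" using *[of "- u"] by simp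
    then show ?thesis unfolding distrib_left using pos[of "s * u"] by linarith
  qed
qed

lemma cmod_cis_diff_le: "cmod (cis x - cis y) \<le> \<bar>x - y\<bar>"
proof -
  have "cis x - cis y = cis y * (cis (x - y) - 1)" by (simp add: algebra_simps cis_mult)
  then have "cmod (cis x - cis y) = 2 * \<bar>sin ((x - y) / 2)\<bar>"
    using dist_exp_i_1[of "x - y"] by (simp only: norm_mult norm_cis mult_1 cis_conv_exp[of "x - y"])
  also have "\<dots> \<le> 2 * \<bar>(x - y) / 2\<bar>" by (intro mult_left_mono abs_sin_x_le_abs_x) simp
  finally show ?thesis by simp
qed

text \<open>A block that begins at index d, with the factor z^d taken out: the signs are indexed
  from d while the powers start at 0, so that the degree is below N.\<close>

definition rpoly :: "nat \<Rightarrow> nat \<Rightarrow> (nat \<Rightarrow> complex) \<Rightarrow> real \<Rightarrow> complex \<Rightarrow> complex" where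
  "rpoly d N b t z = (\<Sum>m<N. of_real (rad (d + m) t) * b m * z ^ m)"

text \<open>The maximum over the circle is controlled on a grid of \<open>N\<^sup>2\<close> points: a polynomial of degree below \<open>N\<close> has
  Lipschitz constant at most \<open>N\<^bsup>3/2\<^esup>\<close> times the \<open>\<ell>\<^sup>2\<close>-norm of its coefficients.\<close>

lemma rpoly_grid:
  assumes N: "0 < N" and z: "cmod z \<le> 1"
  shows "\<exists>j<N\<^sup>2. (cmod (rpoly d N b t z))\<^sup>2 \<le> 2 * (cmod (rpoly d N b t (cis (2 * pi * real j / real (N\<^sup>2)))))\<^sup>2 + 128 * (\<Sum>m<N. (cmod (b m))\<^sup>2)"
proof -
  let ?q = "rpoly d N b t"
  have hq: "?q holomorphic_on UNIV" unfolding rpoly_def by (intro holomorphic_intros)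
  have cn: "continuous_on (sphere 0 1) (\<lambda>y. cmod (?q y))"
    by (intro continuous_intros continuous_on_subset[OF holomorphic_on_imp_continuous_on[OF hq]]) auto
  have "sphere (0::complex) 1 \<noteq> {}" by simp
  then obtain w where w: "cmod w = 1" "\<And>y. cmod y = 1 \<Longrightarrow> cmod (?q y) \<le> cmod (?q w)"
    using continuous_attains_sup[OF compact_sphere _ cn] by auto
  have zw: "cmod (?q z) \<le> cmod (?q w)"
  proof (rule maximum_modulus_frontier[where S="cball 0 1" and f="?q" and \<xi>=z])
    show "?q holomorphic_on interior (cball 0 1)" using hq by (rule holomorphic_on_subset) auto
    show "continuous_on (closure (cball 0 1)) ?q"
      using holomorphic_on_imp_continuous_on[OF hq] by (rule continuous_on_subset) auto
  qed (use w z in auto)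
  have "\<exists>\<theta>. 0 \<le> \<theta> \<and> \<theta> < 2 * pi \<and> w = cis \<theta>"
    using w(1) Arg2pi_ge_0[of w] Arg2pi_lt_2pi[of w] Arg2pi_eq[of w] by (auto intro!: exI[of _ "Arg2pi w"] simp: cis_conv_exp)
  then obtain \<theta> where \<theta>: "0 \<le> \<theta>" "\<theta> < 2 * pi" "w = cis \<theta>" by blast
  define M where "M = real (N\<^sup>2)"
  have M: "0 < M" using N by (simp add: M_def)
  define j where "j = nat \<lfloor>\<theta> * M / (2 * pi)\<rfloor>"
  have x0: "0 \<le> \<theta> * M / (2 * pi)" using \<theta> M by simp
  have j: "real j \<le> \<theta> * M / (2 * pi)" "\<theta> * M / (2 * pi) < real j + 1"
    using x0 by (auto simp: j_def)
  have "\<theta> * M / (2 * pi) < M" using \<theta> M by (simp add: pos_divide_less_eq)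
  then have jM: "j < N\<^sup>2" using j(1) unfolding M_def by linarith
  define p where "p = cis (2 * pi * real j / M)"
  have d: "cmod (w - p) \<le> 2 * pi / M"
  proof -
    have "\<theta> - 2 * pi * real j / M = (\<theta> * M / (2 * pi) - real j) * (2 * pi / M)"
      using M by (simp add: field_simps)
    also have "\<bar>\<dots>\<bar> \<le> 1 * (2 * pi / M)"
      unfolding abs_mult using j M by (intro mult_mono) auto
    finally have "\<bar>\<theta> - 2 * pi * real j / M\<bar> \<le> 2 * pi / M" by simp
    then show ?thesis unfolding p_def \<theta>(3) using cmod_cis_diff_le order_trans by blast
  qed
  define S where "S = (\<Sum>m<N. cmod (b m))"
  define V where "V = (\<Sum>m<N. (cmod (b m))\<^sup>2)"
  have S2: "S\<^sup>2 \<le> real N * V"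
    using Cauchy_Schwarz_ineq_sum[of "\<lambda>_. 1" "\<lambda>m. cmod (b m)" "{..<N}"] by (simp add: S_def V_def)
  have "?q w - ?q p = (\<Sum>m<N. of_real (rad (d + m) t) * b m * (w ^ m - p ^ m))"
    by (simp add: rpoly_def sum_subtractf algebra_simps)
  also have "cmod \<dots> \<le> (\<Sum>m<N. cmod (b m) * (real N * (2 * pi / M)))"
  proof (rule sum_norm_le)
    fix m assume m: "m \<in> {..<N}"
    have "cmod (w ^ m - p ^ m) \<le> real m * cmod (w - p)"
      by (rule norm_power_diff) (use w in \<open>auto simp: p_def\<close>)
    also have "\<dots> \<le> real N * (2 * pi / M)" using d m by (intro mult_mono) auto
    finally have 1: "cmod (w ^ m - p ^ m) \<le> real N * (2 * pi / M)" .
    have "cmod (of_real (rad (d + m) t) * b m * (w ^ m - p ^ m)) = \<bar>rad (d + m) t\<bar> * (cmod (b m) * cmod (w ^ m - p ^ m))"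
      by (simp add: norm_mult)
    also have "\<dots> \<le> 1 * (cmod (b m) * (real N * (2 * pi / M)))"
      using 1 by (intro mult_mono rad_abs_le) auto
    finally show "cmod (of_real (rad (d + m) t) * b m * (w ^ m - p ^ m)) \<le> cmod (b m) * (real N * (2 * pi / M))" by simp
  qed
  also have "\<dots> = S * (2 * pi / real N)"
    unfolding sum_distrib_right[symmetric] S_def[symmetric] using N by (simp add: M_def power2_eq_square)
  finally have E: "cmod (?q w - ?q p) \<le> S * (2 * pi / real N)" .
  \<comment> \<open>By Cauchy-Schwarz S^2 <= N V. Against the squared factor (2 pi / N)^2, left from
    the spacing 2 pi / N^2 and the degree bound N, this is 4 pi^2 V / N <= 64 V.\<close>
  have "(cmod (?q w - ?q p))\<^sup>2 \<le> (S * (2 * pi / real N))\<^sup>2" using E by (intro power_mono) auto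
  also have "\<dots> = S\<^sup>2 * (4 * pi\<^sup>2 / (real N)\<^sup>2)" by (simp add: power_mult_distrib power_divide)
  also have "\<dots> \<le> (real N * V) * (4 * pi\<^sup>2 / (real N)\<^sup>2)" using S2 by (intro mult_right_mono) auto
  also have "\<dots> = V * (4 * pi\<^sup>2) / real N" using N by (simp add: power2_eq_square)
  also have "\<dots> \<le> V * (4 * pi\<^sup>2) / 1"
    using N by (intro divide_left_mono) (auto simp: V_def intro!: mult_nonneg_nonneg sum_nonneg)
  also have "\<dots> \<le> V * 64"
  proof -
    have "pi\<^sup>2 \<le> 4\<^sup>2" using pi_less_4 by (intro power_mono) auto
    then have "V * (4 * pi\<^sup>2) \<le> V * 64" by (intro mult_left_mono) (auto simp: V_def sum_nonneg)
    then show ?thesis by simp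
  qed
  finally have E2: "(cmod (?q w - ?q p))\<^sup>2 \<le> 64 * V" by simp
  have "cmod (?q z) \<le> cmod (?q p) + cmod (?q w - ?q p)"
    using zw norm_triangle_ineq[of "?q p" "?q w - ?q p"] by simp
  then have "(cmod (?q z))\<^sup>2 \<le> (cmod (?q p) + cmod (?q w - ?q p))\<^sup>2" by (intro power_mono) auto
  also have "\<dots> \<le> 2 * (cmod (?q p))\<^sup>2 + 2 * (cmod (?q w - ?q p))\<^sup>2"
    using sum_squares_bound[of "cmod (?q p)" "cmod (?q w - ?q p)"] by (simp add: power2_sum)
  finally have "(cmod (?q z))\<^sup>2 \<le> 2 * (cmod (?q p))\<^sup>2 + 128 * V" using E2 by linarith
  then show ?thesis using jM unfolding p_def M_def V_def by blast
qed

text \<open>A sum over the grid replaces the maximum. By \<open>square_le_exp_tail\<close> each of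
  the N^2 grid values contributes a tail of order V exp (-2 s^2) exp (s^2) in expectation. With s^2
  = 1 + 2 ln N the number N^2 of points is at most exp (s^2), so all tails together are bounded by a
  multiple of V and the deterministic part V s^2 dominates. \<open>W\<close> is this explicit
  measurable majorant.\<close>

lemma random_sup_bound:
  assumes N: "0 < N"
  shows "\<exists>W. W \<in> borel_measurable borel \<and> (\<forall>t z. cmod z \<le> 1 \<longrightarrow> (cmod (rpoly d N b t z))\<^sup>2 \<le> W t) \<and>
    (\<integral>\<^sup>+t\<in>{0..1}. ennreal (W t) \<partial>lborel) \<le> ennreal (200 * (1 + ln (real N)) * (\<Sum>m<N. (cmod (b m))\<^sup>2))"
proof -
  define V where "V = (\<Sum>m<N. (cmod (b m))\<^sup>2)"
  have V0: "0 \<le> V" by (simp add: V_def sum_nonneg)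
  show ?thesis
  proof (cases "V = 0")
    case True
    then have "b m = 0" if "m < N" for m using that by (simp add: V_def sum_nonneg_eq_0_iff)
    then have "rpoly d N b t z = 0" for t z by (simp add: rpoly_def)
    then show ?thesis by (intro exI[of _ "\<lambda>_. 0"]) simp
  next
    case False
    define \<sigma> where "\<sigma> = sqrt V"
    have \<sigma>: "0 < \<sigma>" "\<sigma>\<^sup>2 = V" using False V0 by (auto simp: \<sigma>_def)
    define s where "s = sqrt (1 + 2 * ln (real N))"
    have lnN: "0 \<le> ln (real N)" using N by simp
    \<comment> \<open>The logarithm of the number of grid points, raised by 1 so that s >= 1 also
      for N = 1.\<close>
    have s: "1 \<le> s" "s\<^sup>2 = 1 + 2 * ln (real N)" using lnN by (auto simp: s_def)
    define X where "X j t = rpoly d N b t (cis (2 * pi * real j / real (N\<^sup>2)))" for j t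
    define e where "e j y t = exp (s * (y (X j t) / \<sigma>)) + exp (- s * (y (X j t) / \<sigma>))" for j y t
    define W where "W t = 128 * V + 2 * V * (16 * s\<^sup>2 + 4 * exp (- 2 * s\<^sup>2) * (\<Sum>j<N\<^sup>2. e j Re t + e j Im t))" for t
    have e0: "0 \<le> e j y t" for j y t by (simp add: e_def)
    have sup: "(cmod (rpoly d N b t z))\<^sup>2 \<le> W t" if z: "cmod z \<le> 1" for t z
    proof -
      obtain j where j: "j < N\<^sup>2" "(cmod (rpoly d N b t z))\<^sup>2 \<le> 2 * (cmod (X j t))\<^sup>2 + 128 * V"
        using rpoly_grid[OF N z, of d b t] unfolding X_def V_def by blast
      have y: "(y (X j t))\<^sup>2 \<le> V * (8 * s\<^sup>2 + 4 * exp (- 2 * s\<^sup>2) * e j y t)" for y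
      proof -
        have "(y (X j t) / \<sigma>)\<^sup>2 \<le> 8 * s\<^sup>2 + 4 * exp (- 2 * s\<^sup>2) * e j y t"
          using square_le_exp_tail[OF s(1), of "y (X j t) / \<sigma>"] by (simp add: e_def)
        then have "V * (y (X j t) / \<sigma>)\<^sup>2 \<le> V * (8 * s\<^sup>2 + 4 * exp (- 2 * s\<^sup>2) * e j y t)"
          using V0 by (intro mult_left_mono)
        then show ?thesis using \<sigma> False by (simp add: power_divide)
      qed
      have "e j Re t + e j Im t \<le> (\<Sum>j<N\<^sup>2. e j Re t + e j Im t)"
        using j(1) e0 by (intro member_le_sum[of j "{..<N\<^sup>2}" "\<lambda>j. e j Re t + e j Im t"]) (auto intro: add_nonneg_nonneg)
      then have ee: "V * (4 * exp (- 2 * s\<^sup>2) * (e j Re t + e j Im t)) \<le> V * (4 * exp (- 2 * s\<^sup>2) * (\<Sum>j<N\<^sup>2. e j Re t + e j Im t))"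
        using V0 by (intro mult_left_mono) auto
      have "(cmod (X j t))\<^sup>2 \<le> V * (8 * s\<^sup>2 + 4 * exp (- 2 * s\<^sup>2) * e j Re t) + V * (8 * s\<^sup>2 + 4 * exp (- 2 * s\<^sup>2) * e j Im t)"
        unfolding cmod_power2 by (intro add_mono y)
      also have "\<dots> = V * (16 * s\<^sup>2) + V * (4 * exp (- 2 * s\<^sup>2) * (e j Re t + e j Im t))"
      proof -
        have "V * (8 * q + 4 * E * x) + V * (8 * q + 4 * E * y) = V * (16 * q) + V * (4 * E * (x + y))" for q E x y :: real
          by (simp add: algebra_simps)
        then show ?thesis .
      qed
      also have "\<dots> \<le> V * (16 * s\<^sup>2) + V * (4 * exp (- 2 * s\<^sup>2) * (\<Sum>j<N\<^sup>2. e j Re t + e j Im t))" by (rule add_left_mono[OF ee])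
      finally have up: "2 * (cmod (X j t))\<^sup>2 + 128 * V
          \<le> 2 * (V * (16 * s\<^sup>2) + V * (4 * exp (- 2 * s\<^sup>2) * (\<Sum>j<N\<^sup>2. e j Re t + e j Im t))) + 128 * V"
        by (intro add_right_mono mult_left_mono) simp_all
      have id: "2 * (V * (16 * q) + V * (4 * E * T)) + 128 * V = 128 * V + 2 * V * (16 * q + 4 * E * T)" for q E T :: real
        by (simp add: algebra_simps)
      show ?thesis unfolding W_def id[symmetric] by (rule order_trans[OF j(2) up])
    qed
    have re: "Re (of_real r * x * w) = Re (x * w) * r" "Im (of_real r * x * w) = Im (x * w) * r" for r x w
      by (simp_all add: algebra_simps)
    have ReX: "Re (X j t) = (\<Sum>m<N. Re (b m * cis (2 * pi * real j / real (N\<^sup>2)) ^ m) * rad (d + m) t)" for j t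
      unfolding X_def rpoly_def Re_sum Im_sum re ..
    have ImX: "Im (X j t) = (\<Sum>m<N. Im (b m * cis (2 * pi * real j / real (N\<^sup>2)) ^ m) * rad (d + m) t)" for j t
      unfolding X_def rpoly_def Re_sum Im_sum re ..
    have em [measurable]: "e j Re \<in> borel_measurable borel" "e j Im \<in> borel_measurable borel" for j
      unfolding e_def ReX ImX by measurable
    have Wm: "W \<in> borel_measurable borel" unfolding W_def by measurable
    have mgf: "(\<integral>\<^sup>+t\<in>{0..1}. ennreal (exp (r * s * ((\<Sum>m<N. c m * rad (d + m) t) / \<sigma>))) \<partial>lborel) \<le> ennreal (exp (s\<^sup>2))"
      if r: "r\<^sup>2 = 1" and c: "\<And>m. \<bar>c m\<bar> \<le> cmod (b m)" for c :: "nat \<Rightarrow> real" and r :: real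
    proof -
      have "r * s * ((\<Sum>m<N. c m * rad (d + m) t) / \<sigma>) = (\<Sum>m<N. (r * s / \<sigma> * c m) * rad (d + m) t)" for t
        by (simp add: sum_divide_distrib sum_distrib_left mult_ac)
      then have "(\<integral>\<^sup>+t\<in>{0..1}. ennreal (exp (r * s * ((\<Sum>m<N. c m * rad (d + m) t) / \<sigma>))) \<partial>lborel) \<le> ennreal (exp (\<Sum>m<N. (r * s / \<sigma> * c m)\<^sup>2))"
        using rademacher_subgaussian[where N=N and c="\<lambda>m. r * s / \<sigma> * c m" and d=d] by simp
      also have "(\<Sum>m<N. (r * s / \<sigma> * c m)\<^sup>2) = s\<^sup>2 / V * (\<Sum>m<N. (c m)\<^sup>2)"
        using \<sigma> r by (simp add: power_mult_distrib power_divide sum_distrib_left)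
      also have "exp \<dots> \<le> exp (s\<^sup>2 / V * V)"
      proof -
        have "(\<Sum>m<N. (c m)\<^sup>2) \<le> V" unfolding V_def
          using c by (intro sum_mono) (metis abs_ge_zero power2_abs power_mono)
        then have "s\<^sup>2 / V * (\<Sum>m<N. (c m)\<^sup>2) \<le> s\<^sup>2 / V * V" using V0 by (intro mult_left_mono) auto
        then show ?thesis by simp
      qed
      also have "s\<^sup>2 / V * V = s\<^sup>2" using False by simp
      finally show ?thesis by (simp add: ennreal_leI)
    qed
    have eint: "(\<integral>\<^sup>+t\<in>{0..1}. ennreal (e j y t) \<partial>lborel) \<le> ennreal (2 * exp (s\<^sup>2))"
      if y: "\<And>t. y (X j t) = (\<Sum>m<N. c m * rad (d + m) t)" and c: "\<And>m. \<bar>c m\<bar> \<le> cmod (b m)" for j y c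
    proof -
      have "(\<integral>\<^sup>+t\<in>{0..1}. ennreal (e j y t) \<partial>lborel)
         = (\<integral>\<^sup>+t. ennreal (exp (1 * s * ((\<Sum>m<N. c m * rad (d + m) t) / \<sigma>))) * indicator {0..1} t
            + ennreal (exp ((-1) * s * ((\<Sum>m<N. c m * rad (d + m) t) / \<sigma>))) * indicator {0..1} t \<partial>lborel)"
        by (rule nn_integral_cong) (simp add: e_def y indicator_def)
      also have "\<dots> = (\<integral>\<^sup>+t\<in>{0..1}. ennreal (exp (1 * s * ((\<Sum>m<N. c m * rad (d + m) t) / \<sigma>))) \<partial>lborel)
            + (\<integral>\<^sup>+t\<in>{0..1}. ennreal (exp ((-1) * s * ((\<Sum>m<N. c m * rad (d + m) t) / \<sigma>))) \<partial>lborel)"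
        by (rule nn_integral_add) measurable
      also have "\<dots> \<le> ennreal (exp (s\<^sup>2)) + ennreal (exp (s\<^sup>2))"
        by (intro add_mono mgf c) auto
      also have "\<dots> = ennreal (2 * exp (s\<^sup>2))" by (subst ennreal_plus[symmetric]) auto
      finally show ?thesis .
    qed
    have cis1: "cmod (b m * cis x ^ m) = cmod (b m)" for m x by (simp add: norm_mult norm_power)
    have ej: "(\<integral>\<^sup>+t\<in>{0..1}. ennreal (e j Re t + e j Im t) \<partial>lborel) \<le> ennreal (4 * exp (s\<^sup>2))" for j
    proof -
      have "(\<integral>\<^sup>+t\<in>{0..1}. ennreal (e j Re t + e j Im t) \<partial>lborel)
        = (\<integral>\<^sup>+t. ennreal (e j Re t) * indicator {0..1} t + ennreal (e j Im t) * indicator {0..1} t \<partial>lborel)"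
        by (rule nn_integral_cong) (simp add: e0 indicator_def)
      also have "\<dots> = (\<integral>\<^sup>+t\<in>{0..1}. ennreal (e j Re t) \<partial>lborel) + (\<integral>\<^sup>+t\<in>{0..1}. ennreal (e j Im t) \<partial>lborel)"
        by (rule nn_integral_add) measurable
      also have "\<dots> \<le> ennreal (2 * exp (s\<^sup>2)) + ennreal (2 * exp (s\<^sup>2))"
        by (intro add_mono eint[OF ReX] eint[OF ImX]) (metis abs_Re_le_cmod cis1, metis abs_Im_le_cmod cis1)
      also have "\<dots> = ennreal (4 * exp (s\<^sup>2))" by (subst ennreal_plus[symmetric]) auto
      finally show ?thesis .
    qed
    define k1 where "k1 = 128 * V + 2 * V * (16 * s\<^sup>2)"
    define k2 where "k2 = 8 * V * exp (- 2 * s\<^sup>2)"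
    have k: "0 \<le> k1" "0 \<le> k2" using V0 by (auto simp: k1_def k2_def)
    have "(\<integral>\<^sup>+t\<in>{0..1}. ennreal (W t) \<partial>lborel)
       = (\<integral>\<^sup>+t. ennreal k1 * indicator {0..1} t + ennreal k2 * (\<Sum>j<N\<^sup>2. ennreal (e j Re t + e j Im t) * indicator {0..1} t) \<partial>lborel)"
    proof (rule nn_integral_cong)
      fix t :: real
      have "W t = k1 + k2 * (\<Sum>j<N\<^sup>2. e j Re t + e j Im t)"
      proof -
        have "128 * V + 2 * V * (16 * q + 4 * E * T) = 128 * V + 2 * V * (16 * q) + 8 * V * E * T" for q E T :: real
          by (simp add: algebra_simps)
        then show ?thesis by (simp only: W_def k1_def k2_def)
      qed
      then have "ennreal (W t) = ennreal k1 + ennreal k2 * (\<Sum>j<N\<^sup>2. ennreal (e j Re t + e j Im t))"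
        using k e0 by (simp add: ennreal_mult sum_nonneg add_nonneg_nonneg sum_ennreal del: ennreal_plus)
          (subst ennreal_plus; simp add: ennreal_mult sum_nonneg add_nonneg_nonneg sum_ennreal del: ennreal_plus)?
      then show "ennreal (W t) * indicator {0..1} t = ennreal k1 * indicator {0..1} t + ennreal k2 * (\<Sum>j<N\<^sup>2. ennreal (e j Re t + e j Im t) * indicator {0..1} t)"
        by (simp add: indicator_def)
    qed
    also have "\<dots> = ennreal k1 + ennreal k2 * (\<Sum>j<N\<^sup>2. \<integral>\<^sup>+t\<in>{0..1}. ennreal (e j Re t + e j Im t) \<partial>lborel)"
    proof -
      let ?g = "\<lambda>j t. ennreal (e j Re t + e j Im t) * indicator {0..1} t"
      have "(\<integral>\<^sup>+t. ennreal k1 * indicator {0..1} t + ennreal k2 * (\<Sum>j<N\<^sup>2. ?g j t) \<partial>lborel)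
          = (\<integral>\<^sup>+t. ennreal k1 * indicator {0..1::real} t \<partial>lborel) + (\<integral>\<^sup>+t. ennreal k2 * (\<Sum>j<N\<^sup>2. ?g j t) \<partial>lborel)"
        by (rule nn_integral_add) measurable
      also have "(\<integral>\<^sup>+t. ennreal k1 * indicator {0..1::real} t \<partial>lborel) = ennreal k1"
        by (simp add: nn_integral_cmult_indicator)
      also have "(\<integral>\<^sup>+t. ennreal k2 * (\<Sum>j<N\<^sup>2. ?g j t) \<partial>lborel) = ennreal k2 * (\<integral>\<^sup>+t. (\<Sum>j<N\<^sup>2. ?g j t) \<partial>lborel)"
        by (rule nn_integral_cmult) measurable
      also have "(\<integral>\<^sup>+t. (\<Sum>j<N\<^sup>2. ?g j t) \<partial>lborel) = (\<Sum>j<N\<^sup>2. \<integral>\<^sup>+t. ?g j t \<partial>lborel)"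
        by (rule nn_integral_sum) measurable
      finally show ?thesis .
    qed
    also have "\<dots> \<le> ennreal k1 + ennreal k2 * (\<Sum>j<N\<^sup>2. ennreal (4 * exp (s\<^sup>2)))"
      by (intro add_left_mono mult_left_mono sum_mono ej) simp
    also have "\<dots> = ennreal (k1 + k2 * (real (N\<^sup>2) * (4 * exp (s\<^sup>2))))"
      using k by (simp add: ennreal_mult[symmetric] ennreal_of_nat_eq_real_of_nat)
    also have "\<dots> \<le> ennreal (200 * (1 + ln (real N)) * V)"
    proof (rule ennreal_leI)
      have "real (N\<^sup>2) = exp (2 * ln (real N))" using N by (simp add: exp_double)
      then have "real (N\<^sup>2) \<le> exp (s\<^sup>2)" using s(2) by simp
      then have "exp (- 2 * s\<^sup>2) * real (N\<^sup>2) * exp (s\<^sup>2) \<le> exp (- 2 * s\<^sup>2) * exp (s\<^sup>2) * exp (s\<^sup>2)"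
        by (intro mult_right_mono mult_left_mono) auto
      also have "\<dots> = 1" by (simp add: exp_add[symmetric])
      finally have h: "32 * V * (exp (- 2 * s\<^sup>2) * real (N\<^sup>2) * exp (s\<^sup>2)) \<le> 32 * V * 1"
        using V0 by (intro mult_left_mono) auto
      have id: "128 * V + 2 * V * (16 * q) + 8 * V * E * (n * (4 * x)) = 128 * V + 2 * V * (16 * q) + 32 * V * (E * n * x)" for q E n x :: real
        by simp
      have "k1 + k2 * (real (N\<^sup>2) * (4 * exp (s\<^sup>2))) = 128 * V + 2 * V * (16 * s\<^sup>2) + 32 * V * (exp (- 2 * s\<^sup>2) * real (N\<^sup>2) * exp (s\<^sup>2))"
        unfolding k1_def k2_def by (rule id)
      also have "\<dots> \<le> 128 * V + 2 * V * (16 * s\<^sup>2) + 32 * V * 1" by (rule add_left_mono[OF h])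
      also have "\<dots> = 128 * V + 2 * V * (16 * (1 + 2 * ln (real N))) + 32 * V" by (simp only: s(2) mult_1_right)
      also have "\<dots> \<le> 200 * (1 + ln (real N)) * V" using V0 lnN by (simp add: algebra_simps)
      finally show "k1 + k2 * (real (N\<^sup>2) * (4 * exp (s\<^sup>2))) \<le> 200 * (1 + ln (real N)) * V" .
    qed
    finally show ?thesis using sup Wm unfolding V_def by blast
  qed
qed

section \<open>Series with small dyadic blocks\<close>

lemma sum_lessThan_add:
  fixes f :: "nat \<Rightarrow> 'a::comm_monoid_add"
  shows "(\<Sum>n<p + q. f n) = (\<Sum>n<p. f n) + (\<Sum>m<q. f (p + m))"
  by (induction q) (simp_all add: add.assoc)

lemma sum_dyadic_blocks:
  fixes f :: "nat \<Rightarrow> 'a::comm_monoid_add"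
  shows "(\<Sum>n<2 ^ K. f n) = f 0 + (\<Sum>k<K. \<Sum>m<2 ^ k. f (2 ^ k + m))"
proof (induction K)
  case (Suc K)
  have "(\<Sum>n<2 ^ Suc K. f n) = (\<Sum>n<2 ^ K + 2 ^ K. f n)" by (simp add: mult_2)
  also have "\<dots> = (\<Sum>n<2 ^ K. f n) + (\<Sum>m<2 ^ K. f (2 ^ K + m))" by (rule sum_lessThan_add)
  finally show ?case using Suc by (simp add: add.assoc)
qed simp

lemma sums_dyadic_blocks:
  fixes f :: "nat \<Rightarrow> 'a::real_normed_vector"
  assumes "f sums s"
  shows "(\<lambda>k. \<Sum>m<2 ^ k. f (2 ^ k + m)) sums (s - f 0)"
proof -
  have "strict_mono (\<lambda>K::nat. (2::nat) ^ K)" by (simp add: strict_mono_def)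
  from LIMSEQ_subseq_LIMSEQ[OF assms[unfolded sums_def] this]
  have "(\<lambda>K. \<Sum>n<2 ^ K. f n) \<longlonglongrightarrow> s" by (simp add: o_def)
  then have "(\<lambda>K. (\<Sum>n<2 ^ K. f n) - f 0) \<longlonglongrightarrow> s - f 0"
    by (intro tendsto_diff tendsto_const)
  moreover have "(\<Sum>n<2 ^ K. f n) - f 0 = (\<Sum>k<K. \<Sum>m<2 ^ k. f (2 ^ k + m))" for K
    by (subst sum_dyadic_blocks) simp
  ultimately show ?thesis unfolding sums_def by (simp only:)
qed

text \<open>\<open>S\<close> and \<open>D\<close> bound the k-th block of the series and of its
  derivative after the factors z^(2^k) and z^(2^k - 1) have been taken out. The weight on the
  coefficients is at least 1 even at n = 0, which yields convergence in the disc from the same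
  condition.\<close>

locale block_series =
  fixes b :: "nat \<Rightarrow> complex" and S D :: "nat \<Rightarrow> real"
  assumes S: "cmod z \<le> 1 \<Longrightarrow> cmod (\<Sum>m<2 ^ k. b (2 ^ k + m) * z ^ m) \<le> S k"
    and D: "cmod z \<le> 1 \<Longrightarrow> cmod (\<Sum>m<2 ^ k. of_nat (2 ^ k + m) * b (2 ^ k + m) * z ^ m) \<le> D k"
    and sumS: "summable (\<lambda>k. (real k + 1)\<^sup>2 * (S k)\<^sup>2)"
    and sumD: "summable (\<lambda>k. (real k + 1)\<^sup>2 * (D k / 2 ^ k)\<^sup>2)"
    and coeffs: "summable (\<lambda>n. (cmod (b n))\<^sup>2 * (1 + ln (real n + 1)) ^ 3)"

text \<open>If \<open>A k\<close> is the squared coefficient sum of the k-th block, the expected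
  values of (k+1)^2 S_k^2 and (k+1)^2 (D_k / 2^k)^2 are at most a multiple of (k+1)^3 A k, which is
  summable by hypothesis. A series of nonnegative functions with summable integrals converges almost
  everywhere.\<close>

lemma block_series_AE:
  assumes a: "coeff_cond a"
  shows "AE t in lborel. t \<in> {0..1} \<longrightarrow> (\<exists>S D. block_series (\<lambda>n. of_real (rad n t) * a n) S D)"
proof -
  define f where "f n = (cmod (a n))\<^sup>2 * (ln (real n)) ^ 3" for n
  have fsuc: "summable (\<lambda>n. f (Suc n))" using a by (simp add: coeff_cond_def f_def)
  then have fs: "summable f" by (simp add: summable_Suc_iff)
  have f0: "0 \<le> f n" for n by (cases n) (auto simp: f_def)
  define A where "A k = (\<Sum>m<2 ^ k. (cmod (a (2 ^ k + m)))\<^sup>2)" for k :: nat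
  have A0: "0 \<le> A k" for k by (simp add: A_def sum_nonneg)
  \<comment> \<open>The block k = 0 consists of the index 1, where the logarithm vanishes, and is
    left out. From k >= 1 on, k + 1 <= 2 k <= 3 ln n, hence 27 = 3^3.\<close>
  have blk: "(real k + 1) ^ 3 * A k \<le> 27 * (\<Sum>m<2 ^ k. f (2 ^ k + m))" if k: "1 \<le> k" for k
  proof -
    have "(real k + 1) ^ 3 * (cmod (a (2 ^ k + m)))\<^sup>2 \<le> 27 * f (2 ^ k + m)" for m
    proof -
      have "real k * (2/3) \<le> real k * ln 2" using ln2_ge_two_thirds by (intro mult_left_mono) auto
      also have "\<dots> = ln (2 ^ k)" by (simp add: ln_realpow)
      also have "\<dots> \<le> ln (real (2 ^ k + m))" by (subst ln_le_cancel_iff) (auto simp: add_pos_nonneg)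
      finally have "real k + 1 \<le> 3 * ln (real (2 ^ k + m))" using k by simp
      then have "(real k + 1) ^ 3 \<le> (3 * ln (real (2 ^ k + m))) ^ 3" by (intro power_mono) auto
      then have "(real k + 1) ^ 3 * (cmod (a (2 ^ k + m)))\<^sup>2 \<le> (3 * ln (real (2 ^ k + m))) ^ 3 * (cmod (a (2 ^ k + m)))\<^sup>2"
        by (intro mult_right_mono) auto
      then show ?thesis unfolding f_def power_mult_distrib by (simp add: mult_ac)
    qed
    then show ?thesis unfolding A_def sum_distrib_left by (intro sum_mono)
  qed
  have sumA: "summable (\<lambda>k. (real k + 1) ^ 3 * A k)"
  proof (rule summable_comparison_test_ev)
    show "\<forall>\<^sub>F k in sequentially. norm ((real k + 1) ^ 3 * A k) \<le> 27 * (\<Sum>m<2 ^ k. f (2 ^ k + m))"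
      unfolding eventually_sequentially using blk A0 by (intro exI[of _ 1]) auto
    show "summable (\<lambda>k. 27 * (\<Sum>m<2 ^ k. f (2 ^ k + m)))"
      using sums_dyadic_blocks[OF summable_sums[OF fs]] by (intro summable_mult) (auto simp: sums_iff)
  qed
  have ex1: "\<forall>k. \<exists>W. W \<in> borel_measurable borel \<and> (\<forall>t z. cmod z \<le> 1 \<longrightarrow> (cmod (rpoly (2 ^ k) (2 ^ k) (\<lambda>m. a (2 ^ k + m)) t z))\<^sup>2 \<le> W t) \<and>
    (\<integral>\<^sup>+t\<in>{0..1}. ennreal (W t) \<partial>lborel) \<le> ennreal (200 * (1 + ln (real (2 ^ k))) * (\<Sum>m<2 ^ k. (cmod (a (2 ^ k + m)))\<^sup>2))"
    by (intro allI random_sup_bound) simp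
  have ex2: "\<forall>k. \<exists>W. W \<in> borel_measurable borel \<and> (\<forall>t z. cmod z \<le> 1 \<longrightarrow> (cmod (rpoly (2 ^ k) (2 ^ k) (\<lambda>m. of_nat (2 ^ k + m) * a (2 ^ k + m)) t z))\<^sup>2 \<le> W t) \<and>
    (\<integral>\<^sup>+t\<in>{0..1}. ennreal (W t) \<partial>lborel) \<le> ennreal (200 * (1 + ln (real (2 ^ k))) * (\<Sum>m<2 ^ k. (cmod (of_nat (2 ^ k + m) * a (2 ^ k + m)))\<^sup>2))"
    by (intro allI random_sup_bound) simp
  obtain W where W: "\<forall>k. W k \<in> borel_measurable borel \<and> (\<forall>t z. cmod z \<le> 1 \<longrightarrow> (cmod (rpoly (2 ^ k) (2 ^ k) (\<lambda>m. a (2 ^ k + m)) t z))\<^sup>2 \<le> W k t) \<and>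
    (\<integral>\<^sup>+t\<in>{0..1}. ennreal (W k t) \<partial>lborel) \<le> ennreal (200 * (1 + ln (real (2 ^ k))) * (\<Sum>m<2 ^ k. (cmod (a (2 ^ k + m)))\<^sup>2))"
    using choice[OF ex1] by (elim exE) (rule that)
  obtain V where V: "\<forall>k. V k \<in> borel_measurable borel \<and> (\<forall>t z. cmod z \<le> 1 \<longrightarrow> (cmod (rpoly (2 ^ k) (2 ^ k) (\<lambda>m. of_nat (2 ^ k + m) * a (2 ^ k + m)) t z))\<^sup>2 \<le> V k t) \<and>
    (\<integral>\<^sup>+t\<in>{0..1}. ennreal (V k t) \<partial>lborel) \<le> ennreal (200 * (1 + ln (real (2 ^ k))) * (\<Sum>m<2 ^ k. (cmod (of_nat (2 ^ k + m) * a (2 ^ k + m)))\<^sup>2))"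
    using choice[OF ex2] by (elim exE) (rule that)
  have Wm [measurable]: "W k \<in> borel_measurable borel" and Vm [measurable]: "V k \<in> borel_measurable borel" for k
    using W V by auto
  have Wb: "cmod z \<le> 1 \<Longrightarrow> (cmod (rpoly (2 ^ k) (2 ^ k) (\<lambda>m. a (2 ^ k + m)) t z))\<^sup>2 \<le> W k t"
    and Vb: "cmod z \<le> 1 \<Longrightarrow> (cmod (rpoly (2 ^ k) (2 ^ k) (\<lambda>m. of_nat (2 ^ k + m) * a (2 ^ k + m)) t z))\<^sup>2 \<le> V k t" for k t z
    using W V by auto
  have W0: "0 \<le> W k t" and V0: "0 \<le> V k t" for k t
    using Wb[of 0 k t] Vb[of 0 k t] order_trans[OF zero_le_power2] by auto
  have ln2k: "1 + ln (real (2 ^ k)) \<le> real k + 1" for k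
  proof -
    have "ln (2::real) \<le> 1" using ln_2_less_1 by simp
    then have "real k * ln 2 \<le> real k * 1" by (intro mult_left_mono) auto
    then show ?thesis by (simp add: ln_realpow)
  qed
  have ln2k0: "0 \<le> 1 + ln (real (2 ^ k))" for k by (simp add: ln_realpow)
  have Wi: "(\<integral>\<^sup>+t\<in>{0..1}. ennreal ((real k + 1)\<^sup>2 * W k t) \<partial>lborel) \<le> ennreal (800 * ((real k + 1) ^ 3 * A k))" for k
  proof -
    have "(\<integral>\<^sup>+t\<in>{0..1}. ennreal ((real k + 1)\<^sup>2 * W k t) \<partial>lborel) = ennreal ((real k + 1)\<^sup>2) * (\<integral>\<^sup>+t\<in>{0..1}. ennreal (W k t) \<partial>lborel)"
      by (subst nn_integral_cmult[symmetric]) (auto simp: ennreal_mult W0 mult_ac)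
    also have "\<dots> \<le> ennreal ((real k + 1)\<^sup>2) * ennreal (200 * (1 + ln (real (2 ^ k))) * A k)"
      using W by (intro mult_left_mono) (auto simp: A_def)
    also have "\<dots> = ennreal ((real k + 1)\<^sup>2 * (200 * (1 + ln (real (2 ^ k))) * A k))"
      by (rule ennreal_mult[symmetric]) (use A0 ln2k0 in auto)
    also have "\<dots> \<le> ennreal ((real k + 1)\<^sup>2 * (800 * (real k + 1) * A k))"
      using ln2k[of k] A0[of k] ln2k0[of k] by (intro ennreal_leI mult_left_mono mult_right_mono) auto
    finally show ?thesis by (simp add: power2_eq_square power3_eq_cube mult_ac)
  qed
  have Vi: "(\<integral>\<^sup>+t\<in>{0..1}. ennreal ((real k + 1)\<^sup>2 * (V k t / 4 ^ k)) \<partial>lborel) \<le> ennreal (800 * ((real k + 1) ^ 3 * A k))" for k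
  proof -
    \<comment> \<open>Within a block n <= 2 * 2^k, so differentiation costs the factor 4^k that the
      normalization of D by 2^k removes. The remaining 4 turns the constant 200 into 800.\<close>
    have le: "(\<Sum>m<2 ^ k. (cmod (of_nat (2 ^ k + m) * a (2 ^ k + m)))\<^sup>2) \<le> 4 * 4 ^ k * A k"
      unfolding A_def sum_distrib_left
    proof (rule sum_mono)
      fix m :: nat assume "m \<in> {..<2 ^ k}"
      then have "real (2 ^ k + m) \<le> 2 * 2 ^ k" by (simp add: less_imp_le)
      then have "(real (2 ^ k + m))\<^sup>2 \<le> (2 * 2 ^ k)\<^sup>2" by (intro power_mono) auto
      also have "\<dots> = 4 * 4 ^ k" by (simp add: power_mult_distrib power2_eq_square power_mult_distrib[symmetric])
      finally have "(real (2 ^ k + m))\<^sup>2 * (cmod (a (2 ^ k + m)))\<^sup>2 \<le> 4 * 4 ^ k * (cmod (a (2 ^ k + m)))\<^sup>2"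
        by (intro mult_right_mono) auto
      then show "(cmod (of_nat (2 ^ k + m) * a (2 ^ k + m)))\<^sup>2 \<le> 4 * 4 ^ k * (cmod (a (2 ^ k + m)))\<^sup>2"
        by (simp only: norm_mult norm_of_nat power_mult_distrib)
    qed
    have "(\<integral>\<^sup>+t\<in>{0..1}. ennreal ((real k + 1)\<^sup>2 * (V k t / 4 ^ k)) \<partial>lborel) = (\<integral>\<^sup>+t. ennreal ((real k + 1)\<^sup>2 / 4 ^ k) * (ennreal (V k t) * indicator {0..1} t) \<partial>lborel)"
    proof (rule nn_integral_cong)
      fix t :: real
      have "ennreal ((real k + 1)\<^sup>2 * (V k t / 4 ^ k)) = ennreal ((real k + 1)\<^sup>2 / 4 ^ k) * ennreal (V k t)"
        by (subst ennreal_mult[symmetric]) (auto simp: V0)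
      then show "ennreal ((real k + 1)\<^sup>2 * (V k t / 4 ^ k)) * indicator {0..1} t = ennreal ((real k + 1)\<^sup>2 / 4 ^ k) * (ennreal (V k t) * indicator {0..1} t)"
        by (simp only: mult.assoc)
    qed
    also have "\<dots> = ennreal ((real k + 1)\<^sup>2 / 4 ^ k) * (\<integral>\<^sup>+t\<in>{0..1}. ennreal (V k t) \<partial>lborel)"
      by (rule nn_integral_cmult) measurable
    also have "\<dots> \<le> ennreal ((real k + 1)\<^sup>2 / 4 ^ k) * ennreal (200 * (1 + ln (real (2 ^ k))) * (4 * 4 ^ k * A k))"
    proof (rule mult_left_mono)
      have "200 * (1 + ln (real (2 ^ k))) * (\<Sum>m<2 ^ k. (cmod (of_nat (2 ^ k + m) * a (2 ^ k + m)))\<^sup>2) \<le> 200 * (1 + ln (real (2 ^ k))) * (4 * 4 ^ k * A k)"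
        using ln2k0[of k] by (intro mult_left_mono le) auto
      then show "(\<integral>\<^sup>+t\<in>{0..1}. ennreal (V k t) \<partial>lborel) \<le> ennreal (200 * (1 + ln (real (2 ^ k))) * (4 * 4 ^ k * A k))"
        using V ennreal_leI order_trans by blast
    qed simp
    also have "\<dots> = ennreal ((real k + 1)\<^sup>2 / 4 ^ k * (200 * (1 + ln (real (2 ^ k))) * (4 * 4 ^ k * A k)))"
      by (rule ennreal_mult[symmetric]) (use A0[of k] ln2k0[of k] in \<open>auto intro!: mult_nonneg_nonneg\<close>)
    also have "(real k + 1)\<^sup>2 / 4 ^ k * (200 * (1 + ln (real (2 ^ k))) * (4 * 4 ^ k * A k)) = (real k + 1)\<^sup>2 * (800 * (1 + ln (real (2 ^ k))) * A k)"
      by simp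
    also have "ennreal \<dots> \<le> ennreal ((real k + 1)\<^sup>2 * (800 * (real k + 1) * A k))"
      using ln2k[of k] A0[of k] by (intro ennreal_leI mult_left_mono mult_right_mono) auto
    finally show ?thesis by (simp add: power2_eq_square power3_eq_cube mult_ac)
  qed
  have fin: "AE t in lborel. t \<in> {0..1} \<longrightarrow> summable (\<lambda>k. U k t)"
    if [measurable]: "\<And>k. U k \<in> borel_measurable borel" and U0: "\<And>k t. 0 \<le> U k t"
      and Ui: "\<And>k. (\<integral>\<^sup>+t\<in>{0..1}. ennreal (U k t) \<partial>lborel) \<le> ennreal (800 * ((real k + 1) ^ 3 * A k))" for U :: "nat \<Rightarrow> real \<Rightarrow> real"
  proof -
    have "(\<integral>\<^sup>+t. (\<Sum>k. ennreal (U k t) * indicator {0..1} t) \<partial>lborel) = (\<Sum>k. \<integral>\<^sup>+t\<in>{0..1}. ennreal (U k t) \<partial>lborel)"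
      by (rule nn_integral_suminf) measurable
    also have "\<dots> \<le> (\<Sum>k. ennreal (800 * ((real k + 1) ^ 3 * A k)))" by (intro suminf_le Ui) auto
    also have "\<dots> = ennreal (\<Sum>k. 800 * ((real k + 1) ^ 3 * A k))"
      by (rule suminf_ennreal2) (use A0 sumA in \<open>auto intro!: summable_mult mult_nonneg_nonneg\<close>)
    also have "\<dots> < \<infinity>" by simp
    finally have "AE t in lborel. (\<Sum>k. ennreal (U k t) * indicator {0..1} t) \<noteq> \<infinity>"
      by (intro nn_integral_PInf_AE) auto
    then show ?thesis
    proof eventually_elim
      case (elim t)
      show ?case
      proof
        assume "t \<in> {0..1}"
        then have "(\<Sum>k. ennreal (U k t)) \<noteq> top" using elim by simp
        then show "summable (\<lambda>k. U k t)" using U0 by (intro summable_suminf_not_top)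
      qed
    qed
  qed
  have "AE t in lborel. t \<in> {0..1} \<longrightarrow> summable (\<lambda>k. (real k + 1)\<^sup>2 * W k t)"
    by (rule fin) (use W0 Wi in auto)
  moreover have "AE t in lborel. t \<in> {0..1} \<longrightarrow> summable (\<lambda>k. (real k + 1)\<^sup>2 * (V k t / 4 ^ k))"
    by (rule fin) (use V0 Vi in auto)
  ultimately show ?thesis
  proof eventually_elim
    case (elim t)
    show ?case
    proof
      assume t: "t \<in> {0..1}"
      have r: "cmod (of_real (rad n t) * a n) \<le> cmod (a n)" for n
        using rad_abs_le[of n t] by (simp add: norm_mult mult_left_le_one_le)
      have "block_series (\<lambda>n. of_real (rad n t) * a n) (\<lambda>k. sqrt (W k t)) (\<lambda>k. sqrt (V k t))"
      proof
        fix z :: complex and k :: nat assume z: "cmod z \<le> 1"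
        show "cmod (\<Sum>m<2 ^ k. of_real (rad (2 ^ k + m) t) * a (2 ^ k + m) * z ^ m) \<le> sqrt (W k t)"
          using Wb[OF z, of k t] by (intro real_le_rsqrt) (simp add: rpoly_def)
        have "(\<Sum>m<2 ^ k. of_nat (2 ^ k + m) * (of_real (rad (2 ^ k + m) t) * a (2 ^ k + m)) * z ^ m)
            = rpoly (2 ^ k) (2 ^ k) (\<lambda>m. of_nat (2 ^ k + m) * a (2 ^ k + m)) t z"
          unfolding rpoly_def by (intro sum.cong refl) (simp only: mult_ac)
        then show "cmod (\<Sum>m<2 ^ k. of_nat (2 ^ k + m) * (of_real (rad (2 ^ k + m) t) * a (2 ^ k + m)) * z ^ m) \<le> sqrt (V k t)"
          using Vb[OF z, of k t] by (intro real_le_rsqrt) simp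
      next
        show "summable (\<lambda>k. (real k + 1)\<^sup>2 * (sqrt (W k t))\<^sup>2)" using elim t W0 by simp
        have "(2 ^ k)\<^sup>2 = (4::real) ^ k" for k by (simp add: power2_eq_square power_mult_distrib[symmetric])
        then show "summable (\<lambda>k. (real k + 1)\<^sup>2 * (sqrt (V k t) / 2 ^ k)\<^sup>2)" using elim t V0 by (simp add: power_divide)
        show "summable (\<lambda>n. (cmod (of_real (rad n t) * a n))\<^sup>2 * (1 + ln (real n + 1)) ^ 3)"
        proof (rule summable_comparison_test_ev)
          show "summable (\<lambda>n. 64 * f n)" using fs by (rule summable_mult)
          have "norm ((cmod (of_real (rad n t) * a n))\<^sup>2 * (1 + ln (real n + 1)) ^ 3) \<le> 64 * f n" if n: "2 \<le> n" for n
          proof -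
            have l2: "ln 2 \<le> ln (real n)" using n by (subst ln_le_cancel_iff) auto
            have "ln (real n + 1) \<le> ln (real n * 2)" using n by (subst ln_le_cancel_iff) auto
            also have "\<dots> = ln (real n) + ln 2" using n by (simp add: ln_mult)
            finally have "1 + ln (real n + 1) \<le> 4 * ln (real n)" using l2 ln2_ge_two_thirds by linarith
            then have "(1 + ln (real n + 1)) ^ 3 \<le> (4 * ln (real n)) ^ 3" by (intro power_mono) (auto intro: add_nonneg_nonneg)
            moreover have "(cmod (of_real (rad n t) * a n))\<^sup>2 \<le> (cmod (a n))\<^sup>2" using r by (intro power_mono) auto
            ultimately have "(cmod (of_real (rad n t) * a n))\<^sup>2 * (1 + ln (real n + 1)) ^ 3 \<le> (cmod (a n))\<^sup>2 * (4 * ln (real n)) ^ 3"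
              by (intro mult_mono) (auto intro: add_nonneg_nonneg)
            then show ?thesis by (simp add: f_def power_mult_distrib mult_ac)
          qed
          then show "\<forall>\<^sub>F n in sequentially. norm ((cmod (of_real (rad n t) * a n))\<^sup>2 * (1 + ln (real n + 1)) ^ 3) \<le> 64 * f n"
            unfolding eventually_sequentially by blast
        qed
      qed
      then show "\<exists>S D. block_series (\<lambda>n. of_real (rad n t) * a n) S D" by blast
    qed
  qed
qed

lemma ennreal_norm_sums_le:
  fixes f :: "nat \<Rightarrow> complex"
  assumes "f sums s"
  shows "ennreal (cmod s) \<le> (\<Sum>k. ennreal (cmod (f k)))"
proof (cases "(\<Sum>k. ennreal (cmod (f k))) = top")
  case False
  then have sm: "summable (\<lambda>k. cmod (f k))" by (intro summable_suminf_not_top) auto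
  have "cmod s \<le> (\<Sum>k. cmod (f k))" using summable_norm[OF sm] assms by (simp add: sums_iff)
  then have "ennreal (cmod s) \<le> ennreal (\<Sum>k. cmod (f k))" by (rule ennreal_leI)
  also have "\<dots> = (\<Sum>k. ennreal (cmod (f k)))" by (rule suminf_ennreal2[symmetric]) (use sm in auto)
  finally show ?thesis .
qed simp

lemma Cauchy_Schwarz_suminf:
  fixes f h :: "nat \<Rightarrow> ennreal"
  shows "(\<Sum>k. f k * h k)\<^sup>2 \<le> (\<Sum>k. (f k)\<^sup>2) * (\<Sum>k. (h k)\<^sup>2)"
  using Cauchy_Schwarz_nn_integral[of f "count_space UNIV" h] by (simp add: nn_integral_count_space_nat)

section \<open>Moments of logarithmic weights\<close>

definition Lg :: "real \<Rightarrow> real" where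
  "Lg r = 1 + ln (1 / (1 - r))"

lemma Lg_measurable [measurable]: "Lg \<in> borel_measurable borel"
  unfolding Lg_def by measurable

lemma Lg_ge_1: "0 \<le> r \<Longrightarrow> r < 1 \<Longrightarrow> 1 \<le> Lg r"
  unfolding Lg_def by (simp add: ln_ge_zero)

text \<open>The index n has the natural scale 1 - r = 1/n, where the logarithm is 1 + ln n; the
  second factor measures the excess closer to the circle. The product form is taken, instead of the
  sum that the proof yields, because it is stable under powers.\<close>

lemma Lg_le:
  assumes "1 \<le> n" "0 \<le> r" "r < 1"
  shows "Lg r \<le> (1 + ln (real n)) * (1 + max 0 (ln (1 / (real n * (1 - r)))))"
proof -
  define M where "M = max 0 (ln (1 / (real n * (1 - r))))"
  have n: "0 < real n" "0 \<le> ln (real n)" using assms by auto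
  have "1 / (1 - r) = real n * (1 / (real n * (1 - r)))" using n assms by (simp add: field_simps)
  then have "ln (1 / (1 - r)) = ln (real n * (1 / (real n * (1 - r))))" by (simp only:)
  also have "\<dots> = ln (real n) + ln (1 / (real n * (1 - r)))"
    using n assms by (intro ln_mult_pos) auto
  finally have "Lg r \<le> 1 + ln (real n) + M" by (simp add: Lg_def M_def)
  moreover have "0 \<le> ln (real n) * M" using n by (simp add: M_def)
  ultimately show ?thesis unfolding M_def[symmetric] by (simp add: algebra_simps)
qed

text \<open>The power 1/2 is chosen because (1 - r)^(-1/2) is integrable up to the circle.\<close>

lemma one_plus_ln_square_le:
  assumes "1 \<le> (y::real)"
  shows "(1 + ln y)\<^sup>2 \<le> 16 * sqrt y"
proof -
  define q where "q = sqrt (sqrt y)"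
  have q: "1 \<le> q" "sqrt y = q\<^sup>2" "y = q ^ 4"
    using assms by (auto simp: q_def power4_eq_xxxx mult.assoc)
  have "ln y = 4 * ln q" using q by (simp add: ln_realpow)
  also have "\<dots> \<le> 4 * (q - 1)" using ln_le_minus_one[of q] q by simp
  finally have "1 + ln y \<le> 4 * q" by simp
  then have "(1 + ln y)\<^sup>2 \<le> (4 * q)\<^sup>2" using assms by (intro power_mono) (auto intro: add_nonneg_nonneg)
  then show ?thesis using q by (simp add: power_mult_distrib)
qed

text \<open>Here a full power of y is affordable: in \<open>Lg_cube_le\<close> it is paid for by the
  factor 1 - r.\<close>

lemma one_plus_ln_cube_le:
  assumes "1 \<le> (y::real)"
  shows "(1 + ln y) ^ 3 \<le> 27 * y"
proof -
  define q where "q = root 3 y"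
  have q: "1 \<le> q" "y = q ^ 3" using assms by (auto simp: q_def real_root_ge_1_iff)
  have "ln y = 3 * ln q" using q by (simp add: ln_realpow)
  also have "\<dots> \<le> 3 * (q - 1)" using ln_le_minus_one[of q] q by simp
  finally have "1 + ln y \<le> 3 * q" by simp
  then have "(1 + ln y) ^ 3 \<le> (3 * q) ^ 3" using assms by (intro power_mono) (auto intro: add_nonneg_nonneg)
  then show ?thesis using q by (simp add: power_mult_distrib)
qed

lemma nn_integral_power: "(\<integral>\<^sup>+r\<in>{0..<1}. ennreal (r ^ n) \<partial>lborel) = ennreal (1 / real (Suc n))"
proof -
  have "(\<integral>\<^sup>+r\<in>{0..<1}. ennreal (r ^ n) \<partial>lborel) = (\<integral>\<^sup>+r. ennreal (r ^ n) * indicator {0..1} r \<partial>lborel)"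
    by (rule nn_integral_cong_AE, rule AE_mp[OF AE_lborel_singleton[of 1]]) (auto simp: indicator_def)
  also have "\<dots> = ennreal (1 ^ Suc n / real (Suc n) - 0 ^ Suc n / real (Suc n))"
    by (rule nn_integral_FTC_Icc[where F="\<lambda>r. r ^ Suc n / real (Suc n)"])
      (auto intro!: derivative_eq_intros simp del: power_Suc of_nat_Suc)
  finally show ?thesis by simp
qed

text \<open>At distance more than 1/n from the circle the weight is at most (1 + ln n)^2, and
  r^(n-1) integrates to 1/n. Nearer the circle the excess is at most 16 (n (1 - r))^(-1/2), whose
  integral there is 32/n. Together 33.\<close>

lemma nn_integral_Lg_square_power:
  assumes n: "1 \<le> n"
  shows "(\<integral>\<^sup>+r\<in>{0..<1}. ennreal ((Lg r)\<^sup>2 * r ^ (n - 1)) \<partial>lborel) \<le> ennreal (33 * (1 + ln (real n))\<^sup>2 / real n)"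
proof -
  define c where "c = (1 + ln (real n))\<^sup>2"
  have c0: "0 \<le> c" by (simp add: c_def)
  let ?h = "\<lambda>r. 1 / sqrt (real n * (1 - r))"
  have h: "(\<integral>\<^sup>+r. ennreal (?h r) * indicator {1 - 1 / real n..1} r \<partial>lborel) = ennreal (2 / real n)"
  proof -
    have "(?h has_integral ((- 2 * sqrt (real n * (1 - 1)) / real n) - (- 2 * sqrt (real n * (1 - (1 - 1 / real n))) / real n))) {1 - 1 / real n..1}"
    proof (rule fundamental_theorem_of_calculus_interior)
      show "continuous_on {1 - 1 / real n..1} (\<lambda>r. - 2 * sqrt (real n * (1 - r)) / real n)"
        using n by (intro continuous_intros) auto
      fix r assume "r \<in> {1 - 1 / real n<..<1}"
      then have r: "0 < real n * (1 - r)" using n by simp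
      show "((\<lambda>r. - 2 * sqrt (real n * (1 - r)) / real n) has_vector_derivative ?h r) (at r)"
        unfolding has_real_derivative_iff_has_vector_derivative[symmetric]
        using r n by (auto intro!: derivative_eq_intros simp: field_simps)
    qed (use n in auto)
    then have "(?h has_integral (2 / real n)) {1 - 1 / real n..1}" using n by simp
    then have "(\<integral>\<^sup>+r. ennreal (indicator {1 - 1 / real n..1} r * ?h r) \<partial>lborel) = ennreal (2 / real n)"
      by (intro nn_integral_has_integral_lebesgue) (use n in auto)
    moreover have "(\<integral>\<^sup>+r. ennreal (?h r) * indicator {1 - 1 / real n..1} r \<partial>lborel) = (\<integral>\<^sup>+r. ennreal (indicator {1 - 1 / real n..1} r * ?h r) \<partial>lborel)"
      by (rule nn_integral_cong) (auto simp: indicator_def)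
    ultimately show ?thesis by simp
  qed
  have "(\<integral>\<^sup>+r\<in>{0..<1}. ennreal ((Lg r)\<^sup>2 * r ^ (n - 1)) \<partial>lborel)
     \<le> (\<integral>\<^sup>+r. ennreal c * (ennreal (r ^ (n - 1)) * indicator {0..<1} r) + ennreal (16 * c) * (ennreal (?h r) * indicator {1 - 1 / real n..1} r) \<partial>lborel)"
  proof (rule nn_integral_mono)
    fix r :: real
    show "ennreal ((Lg r)\<^sup>2 * r ^ (n - 1)) * indicator {0..<1} r
       \<le> ennreal c * (ennreal (r ^ (n - 1)) * indicator {0..<1} r) + ennreal (16 * c) * (ennreal (?h r) * indicator {1 - 1 / real n..1} r)"
    proof (cases "r \<in> {0..<1}")
      case True
      then have r: "0 \<le> r" "r < 1" by auto
      have L: "Lg r \<le> (1 + ln (real n)) * (1 + max 0 (ln (1 / (real n * (1 - r)))))" by (rule Lg_le[OF n r])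
      have L1: "0 \<le> Lg r" using Lg_ge_1[OF r] by simp
      have L2: "(Lg r)\<^sup>2 \<le> c * (1 + max 0 (ln (1 / (real n * (1 - r)))))\<^sup>2"
        unfolding c_def power_mult_distrib[symmetric] by (rule power_mono[OF L L1])
      show ?thesis
      proof (cases "1 \<le> real n * (1 - r)")
        case True
        then have "ln (1 / (real n * (1 - r))) \<le> 0" by (simp add: ln_div)
        then have "(Lg r)\<^sup>2 \<le> c" using L2 by simp
        then have "(Lg r)\<^sup>2 * r ^ (n - 1) \<le> c * r ^ (n - 1)" using r by (intro mult_right_mono) auto
        then have "ennreal ((Lg r)\<^sup>2 * r ^ (n - 1)) \<le> ennreal c * ennreal (r ^ (n - 1))"
          using c0 r by (subst ennreal_mult[symmetric]) (auto intro: ennreal_leI)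
        then have "ennreal ((Lg r)\<^sup>2 * r ^ (n - 1)) * indicator {0..<1} r \<le> ennreal c * (ennreal (r ^ (n - 1)) * indicator {0..<1} r)"
          using r by simp
        then show ?thesis by (rule order_trans) simp
      next
        case False
        define y where "y = 1 / (real n * (1 - r))"
        have y: "1 \<le> y" using False r n by (simp add: y_def field_simps)
        have "(1 + max 0 (ln y))\<^sup>2 = (1 + ln y)\<^sup>2" using y by simp
        then have "(Lg r)\<^sup>2 \<le> c * (1 + ln y)\<^sup>2" using L2 by (simp add: y_def)
        also have "\<dots> \<le> c * (16 * sqrt y)" using one_plus_ln_square_le[OF y] c0 by (intro mult_left_mono)
        finally have "(Lg r)\<^sup>2 \<le> 16 * c * ?h r" using n r by (simp add: y_def real_sqrt_divide mult.commute)
        moreover have "(Lg r)\<^sup>2 * r ^ (n - 1) \<le> (Lg r)\<^sup>2 * 1" using r by (intro mult_left_mono) (auto simp: power_le_one)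
        ultimately have "(Lg r)\<^sup>2 * r ^ (n - 1) \<le> 16 * c * ?h r" by linarith
        then have "ennreal ((Lg r)\<^sup>2 * r ^ (n - 1)) \<le> ennreal (16 * c) * ennreal (?h r)"
          using c0 r by (subst ennreal_mult[symmetric]) (auto intro: ennreal_leI)
        moreover have "r \<in> {1 - 1 / real n..1}" using False n r by (simp add: field_simps)
        ultimately have "ennreal ((Lg r)\<^sup>2 * r ^ (n - 1)) * indicator {0..<1} r \<le> ennreal (16 * c) * (ennreal (?h r) * indicator {1 - 1 / real n..1} r)"
          using r by simp
        then show ?thesis by (rule order_trans) simp
      qed
    qed simp
  qed
  also have "\<dots> = ennreal c * (\<integral>\<^sup>+r\<in>{0..<1}. ennreal (r ^ (n - 1)) \<partial>lborel) + ennreal (16 * c) * (\<integral>\<^sup>+r. ennreal (?h r) * indicator {1 - 1 / real n..1} r \<partial>lborel)"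
    by (subst nn_integral_add) (auto simp: nn_integral_cmult)
  also have "\<dots> = ennreal c * ennreal (1 / real n) + ennreal (16 * c) * ennreal (2 / real n)"
    using n unfolding h nn_integral_power by simp
  also have "\<dots> = ennreal (c * (1 / real n) + 16 * c * (2 / real n))"
    using c0 by (subst ennreal_mult[symmetric], simp, simp, subst ennreal_mult[symmetric], simp, simp, intro ennreal_plus[symmetric]) auto
  also have "c * (1 / real n) + 16 * c * (2 / real n) = 33 * (1 + ln (real n))\<^sup>2 / real n"
    by (simp add: c_def)
  finally show ?thesis .
qed

lemma Lg_cube_le:
  assumes n: "1 \<le> n" and r: "0 \<le> r" "r < 1"
  shows "(1 - r) * Lg r ^ 3 \<le> 27 * (1 + ln (real n)) ^ 3 * ((1 - r) + 1 / real n)"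
proof -
  define c where "c = (1 + ln (real n)) ^ 3"
  have c0: "0 \<le> c" using n by (auto simp: c_def intro!: zero_le_power add_nonneg_nonneg)
  have L1: "0 \<le> Lg r" using Lg_ge_1[OF r] by simp
  have L2: "Lg r ^ 3 \<le> c * (1 + max 0 (ln (1 / (real n * (1 - r))))) ^ 3"
    unfolding c_def power_mult_distrib[symmetric] by (rule power_mono[OF Lg_le[OF n r] L1])
  have "(1 - r) * Lg r ^ 3 \<le> (1 - r) * (c * (1 + max 0 (ln (1 / (real n * (1 - r))))) ^ 3)"
    using r L2 by (intro mult_left_mono) auto
  also have "\<dots> \<le> 27 * c * ((1 - r) + 1 / real n)"
  proof (cases "1 \<le> real n * (1 - r)")
    case True
    then have "ln (1 / (real n * (1 - r))) \<le> 0" by (simp add: ln_div)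
    then have "(1 - r) * (c * (1 + max 0 (ln (1 / (real n * (1 - r))))) ^ 3) = c * (1 - r)" by simp
    also have "\<dots> \<le> 27 * c * ((1 - r) + 1 / real n)" using c0 r by (intro mult_mono) auto
    finally show ?thesis .
  next
    case False
    define y where "y = 1 / (real n * (1 - r))"
    have y: "1 \<le> y" using False r n by (simp add: y_def field_simps)
    have "(1 - r) * (c * (1 + max 0 (ln y)) ^ 3) \<le> (1 - r) * (c * (27 * y))"
      using one_plus_ln_cube_le[OF y] y r c0 by (intro mult_left_mono) auto
    also have "\<dots> = 27 * c * (1 / real n)" using r n by (simp add: y_def)
    also have "\<dots> \<le> 27 * c * ((1 - r) + 1 / real n)" using c0 r by (intro mult_left_mono) auto
    finally show ?thesis by (simp add: y_def)
  qed
  finally show ?thesis by (simp add: c_def)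
qed

section \<open>The block series: continuous extension and radial majorant of the derivative\<close>

context block_series
begin

definition g :: "complex \<Rightarrow> complex" where
  "g z = (\<Sum>n. b n * z ^ n)"

definition blk :: "nat \<Rightarrow> complex \<Rightarrow> complex" where
  "blk k z = (\<Sum>m<2 ^ k. b (2 ^ k + m) * z ^ m)"

definition dblk :: "nat \<Rightarrow> complex \<Rightarrow> complex" where
  "dblk k z = (\<Sum>m<2 ^ k. of_nat (2 ^ k + m) * b (2 ^ k + m) * z ^ m)"

lemma S0: "0 \<le> S k"
  by (rule order_trans[OF norm_ge_zero S[of 0]]) simp

lemma D0: "0 \<le> D k"
  by (rule order_trans[OF norm_ge_zero D[of 0]]) simp

lemma blk_le: "cmod z \<le> 1 \<Longrightarrow> cmod (blk k z) \<le> S k"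
  unfolding blk_def by (rule S)

lemma dblk_le: "cmod z \<le> 1 \<Longrightarrow> cmod (dblk k z) \<le> D k"
  unfolding dblk_def by (rule D)

lemma abs_summable: 
  assumes "0 \<le> r" "r < 1"
  shows "summable (\<lambda>n. cmod (b n) * r ^ n)"
proof (rule summable_comparison_test_ev)
  show "summable (\<lambda>n. (cmod (b n))\<^sup>2 * (1 + ln (real n + 1)) ^ 3 + r ^ n)"
    by (intro summable_add coeffs summable_geometric) (use assms in simp)
  have "norm (cmod (b n) * r ^ n) \<le> (cmod (b n))\<^sup>2 * (1 + ln (real n + 1)) ^ 3 + r ^ n" for n
  proof -
    have l: "1 \<le> (1 + ln (real n + 1)) ^ 3" by (intro one_le_power) simp
    have "(cmod (b n))\<^sup>2 * 1 \<le> (cmod (b n))\<^sup>2 * (1 + ln (real n + 1)) ^ 3" by (intro mult_left_mono l) simp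
    moreover have "cmod (b n) * r ^ n \<le> (cmod (b n))\<^sup>2 + r ^ n"
    proof (cases "cmod (b n) \<le> 1")
      case True
      then have "cmod (b n) * r ^ n \<le> 1 * r ^ n" using assms by (intro mult_right_mono) auto
      then show ?thesis by (simp add: add_increasing)
    next
      case False
      have "cmod (b n) * r ^ n \<le> cmod (b n) * cmod (b n)"
        using False assms power_le_one[of r n] by (intro mult_left_mono) linarith+
      then show ?thesis using assms by (simp add: power2_eq_square add_increasing2)
    qed
    ultimately show ?thesis using assms by simp
  qed
  then show "\<forall>\<^sub>F n in sequentially. norm (cmod (b n) * r ^ n) \<le> (cmod (b n))\<^sup>2 * (1 + ln (real n + 1)) ^ 3 + r ^ n" by simp
qed

lemma g_sums: "cmod z < 1 \<Longrightarrow> (\<lambda>n. b n * z ^ n) sums g z"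
  unfolding g_def using abs_summable[of "cmod z"]
  by (intro summable_sums summable_norm_cancel[of "\<lambda>n. b n * z ^ n"]) (simp add: norm_mult norm_power)

lemma g_deriv:
  assumes z: "cmod z < 1"
  shows "(g has_field_derivative (\<Sum>n. diffs b n * z ^ n)) (at z)"
    and "(\<lambda>n. of_nat n * b n * z ^ (n - 1)) sums (\<Sum>n. diffs b n * z ^ n)"
    and "summable (\<lambda>n. cmod (diffs b n) * cmod z ^ n)"
proof -
  have sm: "summable (\<lambda>n. b n * w ^ n)" if "norm w < 1" for w
    using g_sums[OF that] by (simp add: sums_iff)
  define K where "K = complex_of_real ((1 + cmod z) / 2)"
  have "norm K = (1 + cmod z) / 2" unfolding K_def norm_of_real by (simp add: abs_of_nonneg)
  then have K: "norm K < 1" "norm z < norm K" using z by auto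
  show "(g has_field_derivative (\<Sum>n. diffs b n * z ^ n)) (at z)"
    using termdiffs_strong[OF sm[OF K(1)] K(2)] unfolding g_def .
  have dsm: "summable (\<lambda>n. diffs b n * w ^ n)" if "norm w < 1" for w
    using termdiff_converges[of w 1 b] sm that by simp
  show "(\<lambda>n. of_nat n * b n * z ^ (n - 1)) sums (\<Sum>n. diffs b n * z ^ n)"
    using diffs_equiv[OF dsm[OF z]] by simp
  show "summable (\<lambda>n. cmod (diffs b n) * cmod z ^ n)"
    using powser_insidea[OF dsm[OF K(1)] K(2)] by (simp add: norm_mult norm_power)
qed

lemma deriv_g: "cmod z < 1 \<Longrightarrow> deriv g z = (\<Sum>n. diffs b n * z ^ n)"
  by (intro DERIV_imp_deriv g_deriv)

lemma g_holomorphic: "g holomorphic_on ball 0 1"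
  unfolding holomorphic_on_def field_differentiable_def
  by (rule ballI, rule exI, rule has_field_derivative_at_within, rule g_deriv(1)) simp

lemma g_blocks:
  assumes "cmod z < 1"
  shows "(\<lambda>k. z ^ (2 ^ k) * blk k z) sums (g z - b 0)"
proof -
  have "(\<Sum>m<2 ^ k. b (2 ^ k + m) * z ^ (2 ^ k + m)) = z ^ (2 ^ k) * blk k z" for k
    unfolding blk_def sum_distrib_left by (intro sum.cong refl) (simp add: power_add mult_ac)
  then show ?thesis using sums_dyadic_blocks[OF g_sums[OF assms]] by simp
qed

lemma dg_blocks:
  assumes "cmod z < 1"
  shows "(\<lambda>k. z ^ (2 ^ k - 1) * dblk k z) sums deriv g z"
proof -
  have "(\<Sum>m<2 ^ k. of_nat (2 ^ k + m) * b (2 ^ k + m) * z ^ (2 ^ k + m - 1)) = z ^ (2 ^ k - 1) * dblk k z" for k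
    unfolding dblk_def sum_distrib_left
  proof (intro sum.cong refl)
    fix m
    have "z ^ (2 ^ k + m - 1) = z ^ (2 ^ k - 1) * z ^ m"
      unfolding power_add[symmetric] by (simp add: Nat.add_diff_assoc2)
    then show "of_nat (2 ^ k + m) * b (2 ^ k + m) * z ^ (2 ^ k + m - 1) = z ^ (2 ^ k - 1) * (of_nat (2 ^ k + m) * b (2 ^ k + m) * z ^ m)"
      by (simp only: mult_ac)
  qed
  then show ?thesis using sums_dyadic_blocks[OF g_deriv(2)[OF assms]] deriv_g[OF assms] by simp
qed

text \<open>S_k is the product of (k+1) S_k and 1/(k+1), both square summable. This is how the
  weight yields continuity up to the circle.\<close>

lemma summable_S: "summable S"
proof (rule summable_comparison_test_ev)
  have "summable (\<lambda>k. inverse (real (Suc k) ^ 2))"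
    using inverse_power_summable[of 2, where 'a=real] by (subst summable_Suc_iff) auto
  then show "summable (\<lambda>k. (real k + 1)\<^sup>2 * (S k)\<^sup>2 + inverse (real (Suc k) ^ 2))"
    by (intro summable_add sumS)
  have "norm (S k) \<le> (real k + 1)\<^sup>2 * (S k)\<^sup>2 + inverse (real (Suc k) ^ 2)" for k
  proof -
    define x where "x = (real k + 1) * S k"
    define y where "y = inverse (real k + 1)"
    have "S k = x * y" by (simp add: x_def y_def)
    moreover have "2 * x * y \<le> x\<^sup>2 + y\<^sup>2" by (rule sum_squares_bound)
    moreover have "0 \<le> x * y" using \<open>S k = x * y\<close> S0[of k] by simp
    ultimately have "norm (S k) \<le> x\<^sup>2 + y\<^sup>2" by simp
    then show ?thesis by (simp add: x_def y_def power_mult_distrib power_inverse add.commute)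
  qed
  then show "\<forall>\<^sub>F k in sequentially. norm (S k) \<le> (real k + 1)\<^sup>2 * (S k)\<^sup>2 + inverse (real (Suc k) ^ 2)" by simp
qed

text \<open>The power series defining \<open>g\<close> is controlled only inside the disc, whereas
  the blocks converge uniformly on the closed disc. \<open>gt\<close> is therefore the continuous
  extension, and its circle values are the boundary values of \<open>g\<close>.\<close>

definition gt :: "complex \<Rightarrow> complex" where
  "gt z = b 0 + (\<Sum>k. z ^ (2 ^ k) * blk k z)"

lemma term_le:
  assumes "cmod z \<le> 1"
  shows "cmod (z ^ (2 ^ k) * blk k z) \<le> S k"
proof -
  have "cmod (z ^ (2 ^ k) * blk k z) \<le> 1 * S k"
    unfolding norm_mult norm_power using assms blk_le[OF assms] by (intro mult_mono) (auto simp: power_le_one)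
  then show ?thesis by simp
qed

lemma gt_eq_g: "cmod z < 1 \<Longrightarrow> gt z = g z"
  using g_blocks[of z] by (simp add: gt_def sums_iff)

lemma gt_uniform: "uniform_limit (cball 0 1) (\<lambda>K z. b 0 + (\<Sum>k<K. z ^ (2 ^ k) * blk k z)) gt sequentially"
  unfolding gt_def
  by (intro uniform_limit_add uniform_limit_const Weierstrass_m_test[OF _ summable_S]) (use term_le in auto)

lemma gt_continuous: "continuous_on (cball 0 1) gt"
proof (rule uniform_limit_theorem[OF _ gt_uniform])
  show "\<forall>\<^sub>F K in sequentially. continuous_on (cball 0 1) (\<lambda>z. b 0 + (\<Sum>k<K. z ^ (2 ^ k) * blk k z))"
    unfolding blk_def by (intro always_eventually allI continuous_intros)
qed simp

lemma gt_bound: "\<exists>B\<ge>0. \<forall>z. cmod z \<le> 1 \<longrightarrow> cmod (gt z) \<le> B"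
proof -
  have "cmod (gt z) \<le> cmod (b 0) + suminf S" if z: "cmod z \<le> 1" for z
  proof -
    have sm: "summable (\<lambda>k. cmod (z ^ (2 ^ k) * blk k z))"
      by (rule summable_comparison_test_ev[OF _ summable_S]) (use term_le[OF z] in auto)
    have "cmod (\<Sum>k. z ^ (2 ^ k) * blk k z) \<le> (\<Sum>k. cmod (z ^ (2 ^ k) * blk k z))" by (rule summable_norm[OF sm])
    also have "\<dots> \<le> suminf S" by (intro suminf_le term_le z sm summable_S)
    finally show ?thesis unfolding gt_def using norm_triangle_ineq[of "b 0" "\<Sum>k. z ^ (2 ^ k) * blk k z"] by simp
  qed
  moreover have "0 \<le> cmod (b 0) + suminf S" using S0 by (intro add_nonneg_nonneg suminf_nonneg summable_S) auto
  ultimately show ?thesis by blast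
qed

lemma g_radial_limit: "((\<lambda>r. g (of_real r * cis t)) \<longlongrightarrow> gt (cis t)) (at_left 1)"
proof (rule Lim_transform_eventually)
  have ev: "\<forall>\<^sub>F r in at_left (1::real). 0 < r \<and> r < 1"
    unfolding eventually_at_left_field by (intro exI[of _ 0]) auto
  have "((\<lambda>r. of_real r * cis t) \<longlongrightarrow> of_real 1 * cis t) (at_left (1::real))" by (intro tendsto_intros)
  then have "((\<lambda>r. gt (of_real r * cis t)) \<longlongrightarrow> gt (of_real 1 * cis t)) (at_left (1::real))"
    by (rule continuous_on_tendsto_compose[OF gt_continuous])
      (use ev in \<open>auto simp: norm_mult elim!: eventually_mono\<close>)
  then show "((\<lambda>r. gt (of_real r * cis t)) \<longlongrightarrow> gt (cis t)) (at_left (1::real))" by simp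
  show "\<forall>\<^sub>F r in at_left 1. gt (of_real r * cis t) = g (of_real r * cis t)"
    using ev by eventually_elim (simp add: gt_eq_g norm_mult)
qed

lemma g_Hinf: "g \<in> Hinf"
proof -
  obtain B where B: "\<And>z. cmod z \<le> 1 \<Longrightarrow> cmod (gt z) \<le> B" using gt_bound by blast
  have "cmod (g z) \<le> B" if "cmod z < 1" for z using B[of z] gt_eq_g[OF that] that by simp
  then show ?thesis using g_holomorphic by (auto simp: Hinf_def udisc_def intro!: exI[of _ B])
qed

text \<open>A majorant of |g'| that depends on the radius only; both the integral means and the
  Carleson condition are derived from it. Being extended-valued, it is measurable without any
  discussion of convergence.\<close>

definition Mr :: "real \<Rightarrow> ennreal" where
  "Mr r = (\<Sum>k. ennreal (D k * r ^ (2 ^ k - 1)))"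

lemma Mr_measurable [measurable]: "Mr \<in> borel_measurable borel"
  unfolding Mr_def by measurable

lemma deriv_g_le_Mr:
  assumes z: "cmod z < 1"
  shows "ennreal (cmod (deriv g z)) \<le> Mr (cmod z)"
proof -
  have "ennreal (cmod (deriv g z)) \<le> (\<Sum>k. ennreal (cmod (z ^ (2 ^ k - 1) * dblk k z)))"
    by (rule ennreal_norm_sums_le[OF dg_blocks[OF z]])
  also have "\<dots> \<le> Mr (cmod z)"
    unfolding Mr_def
  proof (intro suminf_le ennreal_leI)
    show "cmod (z ^ (2 ^ k - 1) * dblk k z) \<le> D k * cmod z ^ (2 ^ k - 1)" for k
      using mult_right_mono[OF dblk_le[of z k], of "cmod z ^ (2 ^ k - 1)"] z by (simp add: norm_mult norm_power mult.commute)
  qed auto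
  finally show ?thesis .
qed

text \<open>Cauchy condensation: because the powers decrease, the term of index k+1 is at most twice
  the sum of r^j over the block of the 2^k indices from 2^k on.\<close>

lemma dyadic_geometric:
  assumes r: "0 \<le> r" "r < 1"
  shows "(\<Sum>k. ennreal (2 ^ k * r ^ (2 ^ k - 1))) \<le> ennreal (2 / (1 - r))"
proof -
  have fin: "(\<Sum>k<Suc K. 2 ^ k * r ^ (2 ^ k - 1)) \<le> 2 * (\<Sum>j<2 ^ K. r ^ j)" for K
  proof (induction K)
    case (Suc K)
    have "2 ^ Suc K * r ^ (2 ^ Suc K - 1) = 2 * (\<Sum>m<(2::nat) ^ K. r ^ (2 ^ Suc K - 1))" by simp
    also have "\<dots> \<le> 2 * (\<Sum>m<2 ^ K. r ^ (2 ^ K + m))"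
      using r by (intro mult_left_mono sum_mono power_decreasing) auto
    finally have "(\<Sum>k<Suc (Suc K). 2 ^ k * r ^ (2 ^ k - 1)) \<le> 2 * (\<Sum>j<2 ^ K. r ^ j) + 2 * (\<Sum>m<2 ^ K. r ^ (2 ^ K + m))"
      using Suc by (subst sum.lessThan_Suc) (rule add_mono)
    also have "\<dots> = 2 * (\<Sum>j<2 ^ Suc K. r ^ j)"
      by (simp only: power_Suc mult_2[of "2 ^ K"] sum_lessThan_add distrib_left)
    finally show ?case .
  qed simp
  have geo: "(\<Sum>j<n. r ^ j) \<le> 1 / (1 - r)" for n
    using sum_le_suminf[OF summable_geometric[of r], of "{..<n}"] r by (simp add: suminf_geometric)
  show ?thesis
  proof (rule suminf_le_const)
    show "summable (\<lambda>k. ennreal (2 ^ k * r ^ (2 ^ k - 1)))" by simp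
    fix n
    have "(\<Sum>k<n. 2 ^ k * r ^ (2 ^ k - 1)) \<le> (\<Sum>k<Suc n. 2 ^ k * r ^ (2 ^ k - 1))" using r by simp
    also have "\<dots> \<le> 2 * (1 / (1 - r))" using fin[of n] geo[of "2 ^ n"] by linarith
    finally show "(\<Sum>k<n. ennreal (2 ^ k * r ^ (2 ^ k - 1))) \<le> ennreal (2 / (1 - r))"
      using r by (subst sum_ennreal) (auto intro: ennreal_leI)
  qed
qed

text \<open>Cauchy-Schwarz with the weights 2^k r^(2^k - 1): their sum is at most 2/(1-r), which is
  exactly what the factor 1 - r on the left cancels.\<close>

lemma Mr_square_le:
  assumes r: "0 \<le> r" "r < 1"
  shows "ennreal (1 - r) * (Mr r)\<^sup>2 \<le> 2 * (\<Sum>k. ennreal ((D k)\<^sup>2 / 2 ^ k * r ^ (2 ^ k - 1)))"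
proof -
  define x where "x k = sqrt (2 ^ k * r ^ (2 ^ k - 1))" for k :: nat
  define y where "y k = D k * sqrt (r ^ (2 ^ k - 1) / 2 ^ k)" for k :: nat
  have xy: "ennreal (x k) * ennreal (y k) = ennreal (D k * r ^ (2 ^ k - 1))" for k
  proof -
    have "x k * y k = D k * r ^ (2 ^ k - 1)"
      using r by (simp add: x_def y_def real_sqrt_mult real_sqrt_divide)
    then show ?thesis using D0 r by (subst ennreal_mult[symmetric]) (auto simp: x_def y_def)
  qed
  have x2: "(ennreal (x k))\<^sup>2 = ennreal (2 ^ k * r ^ (2 ^ k - 1))" for k
    using r by (subst ennreal_power) (auto simp: x_def)
  have y2: "(ennreal (y k))\<^sup>2 = ennreal ((D k)\<^sup>2 / 2 ^ k * r ^ (2 ^ k - 1))" for k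
    using r D0 by (subst ennreal_power) (auto simp: y_def power_mult_distrib)
  have "(Mr r)\<^sup>2 \<le> (\<Sum>k. ennreal (2 ^ k * r ^ (2 ^ k - 1))) * (\<Sum>k. ennreal ((D k)\<^sup>2 / 2 ^ k * r ^ (2 ^ k - 1)))"
    using Cauchy_Schwarz_suminf[of "\<lambda>k. ennreal (x k)" "\<lambda>k. ennreal (y k)"] unfolding xy x2 y2 Mr_def .
  also have "\<dots> \<le> ennreal (2 / (1 - r)) * (\<Sum>k. ennreal ((D k)\<^sup>2 / 2 ^ k * r ^ (2 ^ k - 1)))"
    by (intro mult_right_mono dyadic_geometric r) simp
  finally have "ennreal (1 - r) * (Mr r)\<^sup>2 \<le> ennreal (1 - r) * (ennreal (2 / (1 - r)) * (\<Sum>k. ennreal ((D k)\<^sup>2 / 2 ^ k * r ^ (2 ^ k - 1))))"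
    by (intro mult_left_mono) auto
  also have "\<dots> = ennreal 2 * (\<Sum>k. ennreal ((D k)\<^sup>2 / 2 ^ k * r ^ (2 ^ k - 1)))"
  proof -
    have "ennreal (1 - r) * ennreal (2 / (1 - r)) = ennreal ((1 - r) * (2 / (1 - r)))"
      by (rule ennreal_mult[symmetric]) (use r in auto)
    also have "(1 - r) * (2 / (1 - r)) = 2" using r by (simp add: field_simps)
    finally have "ennreal (1 - r) * ennreal (2 / (1 - r)) = ennreal 2" .
    then show ?thesis by (simp only: mult.assoc[symmetric])
  qed
  finally show ?thesis by simp
qed

text \<open>The term 2^(-k) D_k^2 meets the moment of r^(2^k - 1), of order (k+1)^2 / 2^k, and the
  product is the k-th term of the weighted series in \<open>sumD\<close>.\<close>

lemma Mr_integral: "(\<integral>\<^sup>+r\<in>{0..<1}. ennreal ((1 - r) * (Lg r)\<^sup>2) * (Mr r)\<^sup>2 \<partial>lborel) < \<infinity>"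
proof -
  have "(\<integral>\<^sup>+r\<in>{0..<1}. ennreal ((1 - r) * (Lg r)\<^sup>2) * (Mr r)\<^sup>2 \<partial>lborel)
     \<le> (\<integral>\<^sup>+r. 2 * (\<Sum>k. ennreal ((D k)\<^sup>2 / 2 ^ k) * (ennreal ((Lg r)\<^sup>2 * r ^ (2 ^ k - 1)) * indicator {0..<1} r)) \<partial>lborel)"
  proof (rule nn_integral_mono)
    fix r :: real
    show "ennreal ((1 - r) * (Lg r)\<^sup>2) * (Mr r)\<^sup>2 * indicator {0..<1} r
      \<le> 2 * (\<Sum>k. ennreal ((D k)\<^sup>2 / 2 ^ k) * (ennreal ((Lg r)\<^sup>2 * r ^ (2 ^ k - 1)) * indicator {0..<1} r))"
    proof (cases "r \<in> {0..<1}")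
      case True
      then have r: "0 \<le> r" "r < 1" by auto
      have "ennreal ((1 - r) * (Lg r)\<^sup>2) * (Mr r)\<^sup>2 = ennreal ((Lg r)\<^sup>2) * (ennreal (1 - r) * (Mr r)\<^sup>2)"
        using r by (simp add: ennreal_mult mult_ac)
      also have "\<dots> \<le> ennreal ((Lg r)\<^sup>2) * (2 * (\<Sum>k. ennreal ((D k)\<^sup>2 / 2 ^ k * r ^ (2 ^ k - 1))))"
        by (intro mult_left_mono Mr_square_le r) simp
      also have "\<dots> = 2 * (\<Sum>k. ennreal ((Lg r)\<^sup>2) * ennreal ((D k)\<^sup>2 / 2 ^ k * r ^ (2 ^ k - 1)))"
        by (simp add: mult.left_commute)
      also have "\<dots> = 2 * (\<Sum>k. ennreal ((D k)\<^sup>2 / 2 ^ k) * (ennreal ((Lg r)\<^sup>2 * r ^ (2 ^ k - 1)) * indicator {0..<1} r))"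
      proof -
        have "ennreal ((Lg r)\<^sup>2) * ennreal ((D k)\<^sup>2 / 2 ^ k * r ^ (2 ^ k - 1)) = ennreal ((D k)\<^sup>2 / 2 ^ k) * (ennreal ((Lg r)\<^sup>2 * r ^ (2 ^ k - 1)) * indicator {0..<1} r)" for k
          using r True by (simp add: ennreal_mult[symmetric] mult_ac)
        then show ?thesis by simp
      qed
      finally show ?thesis using True by simp
    qed simp
  qed
  also have "\<dots> = 2 * (\<integral>\<^sup>+r. (\<Sum>k. ennreal ((D k)\<^sup>2 / 2 ^ k) * (ennreal ((Lg r)\<^sup>2 * r ^ (2 ^ k - 1)) * indicator {0..<1} r)) \<partial>lborel)"
    by (rule nn_integral_cmult) measurable
  finally have le: "(\<integral>\<^sup>+r\<in>{0..<1}. ennreal ((1 - r) * (Lg r)\<^sup>2) * (Mr r)\<^sup>2 \<partial>lborel)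
     \<le> 2 * (\<integral>\<^sup>+r. (\<Sum>k. ennreal ((D k)\<^sup>2 / 2 ^ k) * (ennreal ((Lg r)\<^sup>2 * r ^ (2 ^ k - 1)) * indicator {0..<1} r)) \<partial>lborel)" .
  have "(\<integral>\<^sup>+r. (\<Sum>k. ennreal ((D k)\<^sup>2 / 2 ^ k) * (ennreal ((Lg r)\<^sup>2 * r ^ (2 ^ k - 1)) * indicator {0..<1} r)) \<partial>lborel)
     = (\<Sum>k. \<integral>\<^sup>+r. ennreal ((D k)\<^sup>2 / 2 ^ k) * (ennreal ((Lg r)\<^sup>2 * r ^ (2 ^ k - 1)) * indicator {0..<1} r) \<partial>lborel)"
    by (rule nn_integral_suminf) measurable
  also have "\<dots> = (\<Sum>k. ennreal ((D k)\<^sup>2 / 2 ^ k) * (\<integral>\<^sup>+r\<in>{0..<1}. ennreal ((Lg r)\<^sup>2 * r ^ (2 ^ k - 1)) \<partial>lborel))"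
    by (intro suminf_cong nn_integral_cmult) measurable
  also have "\<dots> \<le> (\<Sum>k. ennreal (33 * ((real k + 1)\<^sup>2 * (D k / 2 ^ k)\<^sup>2)))"
  proof (intro suminf_le)
    fix k
    have "1 + ln (real (2 ^ k)) \<le> real k + 1"
      using mult_left_mono[of "ln 2" 1 "real k"] ln_2_less_1 by (simp add: ln_realpow)
    then have l: "(1 + ln (real (2 ^ k)))\<^sup>2 \<le> (real k + 1)\<^sup>2" by (intro power_mono) (auto simp: ln_realpow)
    have "ennreal ((D k)\<^sup>2 / 2 ^ k) * (\<integral>\<^sup>+r\<in>{0..<1}. ennreal ((Lg r)\<^sup>2 * r ^ (2 ^ k - 1)) \<partial>lborel)
      \<le> ennreal ((D k)\<^sup>2 / 2 ^ k) * ennreal (33 * (1 + ln (real (2 ^ k)))\<^sup>2 / real (2 ^ k))"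
      by (intro mult_left_mono nn_integral_Lg_square_power) auto
    also have "\<dots> = ennreal ((D k)\<^sup>2 / 2 ^ k * (33 * (1 + ln (real (2 ^ k)))\<^sup>2 / real (2 ^ k)))"
      by (rule ennreal_mult[symmetric]) auto
    also have "\<dots> \<le> ennreal ((D k)\<^sup>2 / 2 ^ k * (33 * (real k + 1)\<^sup>2 / real (2 ^ k)))"
      by (intro ennreal_leI mult_left_mono divide_right_mono l) auto
    also have "(D k)\<^sup>2 / 2 ^ k * (33 * (real k + 1)\<^sup>2 / real (2 ^ k)) = 33 * ((real k + 1)\<^sup>2 * (D k / 2 ^ k)\<^sup>2)"
      by (simp add: power_divide power2_eq_square)
    finally show "ennreal ((D k)\<^sup>2 / 2 ^ k) * (\<integral>\<^sup>+r\<in>{0..<1}. ennreal ((Lg r)\<^sup>2 * r ^ (2 ^ k - 1)) \<partial>lborel)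
      \<le> ennreal (33 * ((real k + 1)\<^sup>2 * (D k / 2 ^ k)\<^sup>2))" .
  qed auto
  also have "\<dots> = ennreal (\<Sum>k. 33 * ((real k + 1)\<^sup>2 * (D k / 2 ^ k)\<^sup>2))"
    by (rule suminf_ennreal2) (auto intro!: summable_mult sumD)
  finally have "(\<integral>\<^sup>+r. (\<Sum>k. ennreal ((D k)\<^sup>2 / 2 ^ k) * (ennreal ((Lg r)\<^sup>2 * r ^ (2 ^ k - 1)) * indicator {0..<1} r)) \<partial>lborel) < \<infinity>"
    by (rule le_less_trans) simp
  then have "2 * (\<integral>\<^sup>+r. (\<Sum>k. ennreal ((D k)\<^sup>2 / 2 ^ k) * (ennreal ((Lg r)\<^sup>2 * r ^ (2 ^ k - 1)) * indicator {0..<1} r)) \<partial>lborel) < \<infinity>"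
    by (simp add: ennreal_mult_less_top)
  with le show ?thesis by (rule le_less_trans)
qed

end

lemma Parseval_poly:
  fixes p :: "complex poly"
  assumes "degree p < M"
  shows "(LINT t|circ. (cmod (poly p (cis t)))\<^sup>2) = 2 * pi * (\<Sum>n<M. (cmod (coeff p n))\<^sup>2)"
proof -
  have "poly p (cis t) = (\<Sum>n<M. coeff p n * cis (real n * t))" for t
  proof -
    have "poly p (cis t) = (\<Sum>n\<le>degree p. coeff p n * cis t ^ n)" by (rule poly_altdef)
    also have "\<dots> = (\<Sum>n<M. coeff p n * cis t ^ n)"
      by (rule sum.mono_neutral_left) (use assms in \<open>auto simp: coeff_eq_0\<close>)
    finally show ?thesis by (simp add: Complex.DeMoivre)
  qed
  then show ?thesis by (simp add: Parseval_finite)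
qed

lemma orthogonal_polys:
  fixes p :: "nat \<Rightarrow> complex poly"
  assumes A: "finite A" and disj: "\<And>k k' n. k \<in> A \<Longrightarrow> k' \<in> A \<Longrightarrow> k \<noteq> k' \<Longrightarrow> coeff (p k) n = 0 \<or> coeff (p k') n = 0"
  shows "(LINT t|circ. (cmod (poly (\<Sum>k\<in>A. p k) (cis t)))\<^sup>2) = (\<Sum>k\<in>A. LINT t|circ. (cmod (poly (p k) (cis t)))\<^sup>2)"
proof -
  define M where "M = Suc (\<Sum>k\<in>A. degree (p k))"
  have dk: "degree (p k) < M" if "k \<in> A" for k
    using member_le_sum[OF that, of "\<lambda>k. degree (p k)"] A by (simp add: M_def)
  have ds: "degree (\<Sum>k\<in>A. p k) < M"
  proof -
    have "degree (\<Sum>k\<in>A. p k) \<le> M - 1"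
      by (rule degree_sum_le[OF A]) (use dk in \<open>fastforce simp: M_def\<close>)
    then show ?thesis by (simp add: M_def)
  qed
  have pt: "(cmod (coeff (\<Sum>k\<in>A. p k) n))\<^sup>2 = (\<Sum>k\<in>A. (cmod (coeff (p k) n))\<^sup>2)" for n
  proof (cases "\<exists>k\<in>A. coeff (p k) n \<noteq> 0")
    case True
    then obtain k where k: "k \<in> A" "coeff (p k) n \<noteq> 0" by blast
    then have z: "coeff (p k') n = 0" if "k' \<in> A - {k}" for k' using disj[of k k' n] that by auto
    have "coeff (\<Sum>k\<in>A. p k) n = coeff (p k) n"
      unfolding coeff_sum by (subst sum.remove[OF A k(1)]) (use z in simp)
    moreover have "(\<Sum>k\<in>A. (cmod (coeff (p k) n))\<^sup>2) = (cmod (coeff (p k) n))\<^sup>2"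
      by (subst sum.remove[OF A k(1)]) (use z in simp)
    ultimately show ?thesis by simp
  next
    case False
    then show ?thesis by (simp add: coeff_sum)
  qed
  have "(LINT t|circ. (cmod (poly (\<Sum>k\<in>A. p k) (cis t)))\<^sup>2) = 2 * pi * (\<Sum>n<M. \<Sum>k\<in>A. (cmod (coeff (p k) n))\<^sup>2)"
    unfolding Parseval_poly[OF ds] pt ..
  also have "\<dots> = (\<Sum>k\<in>A. 2 * pi * (\<Sum>n<M. (cmod (coeff (p k) n))\<^sup>2))"
    by (subst sum.swap) (simp add: sum_distrib_left)
  also have "\<dots> = (\<Sum>k\<in>A. LINT t|circ. (cmod (poly (p k) (cis t)))\<^sup>2)"
    by (intro sum.cong refl Parseval_poly[symmetric] dk)
  finally show ?thesis .
qed

lemma dyadic_harmonic_sum: "(\<Sum>k<N. 2 ^ k / (real k + 1)) \<le> 5 * 2 ^ N / (real N + 1)"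
proof (induction N)
  case (Suc N)
  have "(\<Sum>k<Suc N. 2 ^ k / (real k + 1)) \<le> 5 * 2 ^ N / (real N + 1) + 2 ^ N / (real N + 1)" using Suc by simp
  also have "\<dots> = 2 ^ N * (6 / (real N + 1))" by (simp add: add_divide_distrib[symmetric])
  finally have le: "(\<Sum>k<Suc N. 2 ^ k / (real k + 1)) \<le> 2 ^ N * (6 / (real N + 1))" .
  show ?case
  \<comment> \<open>The step asks for 6/(N+1) <= 10/(N+2), which is true from N = 1 on; N = 0 is
    checked directly.\<close>
  proof (cases N)
    case (Suc M)
    then have "2 ^ N * (6 / (real N + 1)) \<le> 2 ^ N * (10 / (real N + 2))"
      by (intro mult_left_mono) (auto simp: field_simps)
    also have "2 ^ N * (10 / (real N + 2)) = 5 * 2 ^ Suc N / (real (Suc N) + 1)" by (simp add: add.commute)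
    finally show ?thesis by (rule order_trans[OF le])
  qed simp
qed simp

text \<open>Holomorphic functions and their derivatives have uncontrolled values outside the disc,
  so measurability is asked only of the truncated integrand.\<close>

lemma nn_integral_polar_disc:
  fixes F :: "complex \<Rightarrow> ennreal"
  assumes "(\<lambda>z. F z * indicator (ball 0 1) z) \<in> borel_measurable borel"
  shows "(\<integral>\<^sup>+z\<in>ball 0 1. F z \<partial>lborel) = (\<integral>\<^sup>+r\<in>{0..<1}. ennreal r * (\<integral>\<^sup>+t. F (of_real r * cis t) \<partial>circ) \<partial>lborel)"
proof -
  let ?G = "\<lambda>z. F z * indicator (ball 0 1) z"
  have "(\<integral>\<^sup>+z\<in>ball 0 1. F z \<partial>lborel) = (\<integral>\<^sup>+z\<in>ball 0 1. ?G z \<partial>lborel)"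
    by (rule nn_integral_cong) (auto simp: indicator_def)
  also have "\<dots> = (\<integral>\<^sup>+r\<in>{0..<1}. ennreal r * (\<integral>\<^sup>+t. ?G (of_real r * cis t) \<partial>circ) \<partial>lborel)"
    by (rule nn_integral_polar[OF assms])
  also have "\<dots> = (\<integral>\<^sup>+r\<in>{0..<1}. ennreal r * (\<integral>\<^sup>+t. F (of_real r * cis t) \<partial>circ) \<partial>lborel)"
    by (rule nn_integral_cong) (auto simp: indicator_def norm_mult)
  finally show ?thesis .
qed

lemma disc_measurable:
  assumes "continuous_on (ball 0 1) (h :: complex \<Rightarrow> complex)"
  shows "(\<lambda>z. if z \<in> ball 0 1 then h z else 0) \<in> borel_measurable borel"
  by (rule borel_measurable_continuous_on_if) (use assms in auto)

lemma nn_integral_power_weight: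
  assumes "0 \<le> c"
  shows "(\<integral>\<^sup>+r\<in>{0..<1}. ennreal (((1 - r) + c) * r ^ n) \<partial>lborel) = ennreal ((1 + c) / (real n + 1) - 1 / (real n + 2))"
proof -
  have "(\<integral>\<^sup>+r\<in>{0..<1}. ennreal (((1 - r) + c) * r ^ n) \<partial>lborel) = (\<integral>\<^sup>+r. ennreal (((1 - r) + c) * r ^ n) * indicator {0..1} r \<partial>lborel)"
    by (rule nn_integral_cong_AE, rule AE_mp[OF AE_lborel_singleton[of 1]]) (auto simp: indicator_def)
  also have "\<dots> = ennreal (((1 + c) * 1 ^ (n + 1) / (real n + 1) - 1 ^ (n + 2) / (real n + 2)) - ((1 + c) * 0 ^ (n + 1) / (real n + 1) - 0 ^ (n + 2) / (real n + 2)))"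
  proof (rule nn_integral_FTC_Icc[where F="\<lambda>r. (1 + c) * r ^ (n + 1) / (real n + 1) - r ^ (n + 2) / (real n + 2)"])
    fix r :: real
    have "((\<lambda>r. (1 + c) * r ^ (n + 1) / (real n + 1) - r ^ (n + 2) / (real n + 2)) has_real_derivative
       (1 + c) * (real (n + 1) * r ^ n) / (real n + 1) - (real (n + 2) * r ^ (n + 1)) / (real n + 2)) (at r)"
      by (auto intro!: derivative_eq_intros simp del: power_Suc of_nat_Suc of_nat_add)
    moreover have "(1 + c) * (real (n + 1) * r ^ n) / (real n + 1) - (real (n + 2) * r ^ (n + 1)) / (real n + 2) = ((1 - r) + c) * r ^ n"
    proof -
      have "(1 + c) * (real (n + 1) * r ^ n) / (real n + 1) = (1 + c) * r ^ n" by (simp add: add.commute)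
      moreover have "(real (n + 2) * r ^ (n + 1)) / (real n + 2) = r ^ (n + 1)" by (simp add: add.commute)
      ultimately show ?thesis by (simp add: algebra_simps)
    qed
    ultimately show "DERIV (\<lambda>r. (1 + c) * r ^ (n + 1) / (real n + 1) - r ^ (n + 2) / (real n + 2)) r :> ((1 - r) + c) * r ^ n" by simp
  qed (use assms in auto)
  finally show ?thesis by simp
qed

section \<open>Weighted area integral of the derivative\<close>

context block_series
begin

text \<open>Parseval on each circle decouples the coefficients, and the n-th moment of (1 - r) L^3
  is of order (1 + ln n)^3 / n^2. The cubic weight of the coefficient condition thus reappears as
  the weight L^3 required in \<open>weighted_Young\<close>.\<close>

lemma area_deriv_g:
  "(\<integral>\<^sup>+z\<in>ball 0 1. ennreal ((1 - cmod z) * Lg (cmod z) ^ 3 * (cmod (deriv g z))\<^sup>2) \<partial>lborel) < \<infinity>"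
proof -
  have dhol: "deriv g holomorphic_on ball 0 1" by (intro holomorphic_deriv g_holomorphic open_ball)
  have dcont: "continuous_on (ball 0 1) (deriv g)" by (rule holomorphic_on_imp_continuous_on[OF dhol])
  have dsums: "(\<lambda>n. diffs b n * z ^ n) sums deriv g z" if "cmod z < 1" for z
  proof -
    have "summable (\<lambda>n. diffs b n * z ^ n)"
      by (rule summable_norm_cancel) (use g_deriv(3)[OF that] in \<open>simp add: norm_mult norm_power\<close>)
    then show ?thesis unfolding deriv_g[OF that] by (rule summable_sums)
  qed
  have dabs: "summable (\<lambda>n. cmod (diffs b n) * r ^ n)" if "0 \<le> r" "r < 1" for r
    using g_deriv(3)[of "of_real r"] that by simp
  let ?F = "\<lambda>z. ennreal ((1 - cmod z) * Lg (cmod z) ^ 3 * (cmod (deriv g z))\<^sup>2)"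
  have meas: "(\<lambda>z. ?F z * indicator (ball 0 1) z) \<in> borel_measurable borel"
  proof -
    note [measurable] = disc_measurable[OF dcont]
    have "(\<lambda>z. ?F z * indicator (ball 0 1) z) = (\<lambda>z. ennreal ((1 - cmod z) * Lg (cmod z) ^ 3 * (cmod (if z \<in> ball 0 1 then deriv g z else 0))\<^sup>2) * indicator (ball 0 1) z)"
      by (auto simp: fun_eq_iff indicator_def)
    also have "\<dots> \<in> borel_measurable borel" by measurable
    finally show ?thesis .
  qed
  define w where "w n r = ennreal ((1 - r) * Lg r ^ 3 * (2 * pi * (cmod (diffs b n) * r ^ n)\<^sup>2))" for n r
  have [measurable]: "w n \<in> borel_measurable borel" for n unfolding w_def by measurable
  have inner: "ennreal r * (\<integral>\<^sup>+t. ?F (of_real r * cis t) \<partial>circ) \<le> (\<Sum>n. w n r)" if r: "0 \<le> r" "r < 1" for r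
  proof -
    define q where "q = (1 - r) * Lg r ^ 3"
    have q0: "0 \<le> q" using Lg_ge_1[OF r] r by (simp add: q_def)
    have [measurable]: "(\<lambda>t. deriv g (of_real r * cis t)) \<in> borel_measurable borel"
      by (rule measurable_disc_circle[OF dcont r])
    have nr: "cmod (of_real r * cis t) = r" for t using r by (simp add: norm_mult)
    have sq: "summable (\<lambda>n. (cmod (diffs b n) * r ^ n)\<^sup>2)"
    proof (rule summable_comparison_test_ev[OF _ summable_mult[OF dabs[OF r], of "\<Sum>n. cmod (diffs b n) * r ^ n"]])
      have "cmod (diffs b n) * r ^ n \<le> (\<Sum>n. cmod (diffs b n) * r ^ n)" for n
        using sum_le_suminf[OF dabs[OF r], of "{n}"] r by simp
      then show "\<forall>\<^sub>F n in sequentially. norm ((cmod (diffs b n) * r ^ n)\<^sup>2) \<le> (\<Sum>n. cmod (diffs b n) * r ^ n) * (cmod (diffs b n) * r ^ n)"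
        using r by (auto intro!: always_eventually mult_right_mono simp: power2_eq_square)
    qed
    have "(\<integral>\<^sup>+t. ?F (of_real r * cis t) \<partial>circ) = (\<integral>\<^sup>+t. ennreal q * ennreal ((cmod (deriv g (of_real r * cis t)))\<^sup>2) \<partial>circ)"
      unfolding nr q_def[symmetric] by (intro nn_integral_cong) (simp add: ennreal_mult q0)
    also have "\<dots> = ennreal q * (\<integral>\<^sup>+t. ennreal ((cmod (deriv g (of_real r * cis t)))\<^sup>2) \<partial>circ)"
      by (rule nn_integral_cmult) measurable
    also have "\<dots> = ennreal q * ennreal (2 * pi * (\<Sum>n. (cmod (diffs b n) * r ^ n)\<^sup>2))"
      by (simp only: Parseval_disc[of "diffs b" "deriv g", OF dsums dabs r])
    also have "\<dots> = ennreal (\<Sum>n. q * (2 * pi * (cmod (diffs b n) * r ^ n)\<^sup>2))"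
      by (subst ennreal_mult[symmetric]) (use q0 sq in \<open>auto simp: suminf_mult summable_mult intro!: mult_nonneg_nonneg suminf_nonneg\<close>)
    also have "\<dots> = (\<Sum>n. w n r)"
      unfolding w_def q_def[symmetric] by (rule suminf_ennreal2[symmetric]) (use q0 sq in \<open>auto intro!: summable_mult mult_nonneg_nonneg\<close>)
    finally have "(\<integral>\<^sup>+t. ?F (of_real r * cis t) \<partial>circ) = (\<Sum>n. w n r)" .
    moreover have "ennreal r * x \<le> 1 * x" for x using r by (intro mult_right_mono) (auto simp: ennreal_le_1)
    ultimately show ?thesis by (metis mult_1)
  qed
  have "(\<integral>\<^sup>+z\<in>ball 0 1. ?F z \<partial>lborel) = (\<integral>\<^sup>+r\<in>{0..<1}. ennreal r * (\<integral>\<^sup>+t. ?F (of_real r * cis t) \<partial>circ) \<partial>lborel)"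
    by (rule nn_integral_polar_disc[OF meas])
  also have "\<dots> \<le> (\<integral>\<^sup>+r. (\<Sum>n. w n r * indicator {0..<1} r) \<partial>lborel)"
    by (rule nn_integral_mono) (use inner in \<open>auto simp: indicator_def\<close>)
  also have "\<dots> = (\<Sum>n. \<integral>\<^sup>+r\<in>{0..<1}. w n r \<partial>lborel)"
    by (rule nn_integral_suminf) measurable
  also have "\<dots> \<le> (\<Sum>n. ennreal (108 * pi * ((cmod (b (Suc n)))\<^sup>2 * (1 + ln (real (Suc n) + 1)) ^ 3)))"
  proof (rule suminf_le)
    fix n
    define N where "N = real (Suc n)"
    have N: "1 \<le> N" by (simp add: N_def)
    define d where "d = 2 * pi * (cmod (diffs b n))\<^sup>2 * (27 * (1 + ln N) ^ 3)"
    have d0: "0 \<le> d" unfolding d_def using N by (intro mult_nonneg_nonneg zero_le_power) auto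
    have "(\<integral>\<^sup>+r\<in>{0..<1}. w n r \<partial>lborel) \<le> (\<integral>\<^sup>+r. ennreal d * (ennreal (((1 - r) + 1 / N) * r ^ n) * indicator {0..<1} r) \<partial>lborel)"
    proof (rule nn_integral_mono)
      fix r :: real
      show "w n r * indicator {0..<1} r \<le> ennreal d * (ennreal (((1 - r) + 1 / N) * r ^ n) * indicator {0..<1} r)"
      proof (cases "r \<in> {0..<1}")
        case True
        then have r: "0 \<le> r" "r < 1" by auto
        have "(r ^ n)\<^sup>2 \<le> r ^ n * 1" unfolding power2_eq_square using r by (intro mult_left_mono) (auto simp: power_le_one)
        then have rr: "(r ^ n)\<^sup>2 \<le> r ^ n" by simp
        have "(1 - r) * Lg r ^ 3 * (2 * pi * (cmod (diffs b n) * r ^ n)\<^sup>2) = ((1 - r) * Lg r ^ 3) * (2 * pi * (cmod (diffs b n))\<^sup>2 * (r ^ n)\<^sup>2)"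
          by (simp add: power_mult_distrib)
        also have "\<dots> \<le> (27 * (1 + ln N) ^ 3 * ((1 - r) + 1 / N)) * (2 * pi * (cmod (diffs b n))\<^sup>2 * r ^ n)"
        proof (rule mult_mono)
          show "(1 - r) * Lg r ^ 3 \<le> 27 * (1 + ln N) ^ 3 * ((1 - r) + 1 / N)"
            unfolding N_def by (rule Lg_cube_le) (use r in auto)
          show "2 * pi * (cmod (diffs b n))\<^sup>2 * (r ^ n)\<^sup>2 \<le> 2 * pi * (cmod (diffs b n))\<^sup>2 * r ^ n"
            using rr by (intro mult_left_mono) auto
          show "0 \<le> 27 * (1 + ln N) ^ 3 * ((1 - r) + 1 / N)"
            using N r by (intro mult_nonneg_nonneg zero_le_power add_nonneg_nonneg) auto
        qed (use r in auto)
        also have "\<dots> = d * (((1 - r) + 1 / N) * r ^ n)" by (simp add: d_def)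
        finally have "w n r \<le> ennreal (d * (((1 - r) + 1 / N) * r ^ n))" unfolding w_def by (rule ennreal_leI)
        also have "\<dots> = ennreal d * ennreal (((1 - r) + 1 / N) * r ^ n)"
          by (rule ennreal_mult) (use d0 r N in \<open>auto intro!: mult_nonneg_nonneg add_nonneg_nonneg\<close>)
        finally show ?thesis using True by simp
      qed simp
    qed
    also have "\<dots> = ennreal d * (\<integral>\<^sup>+r\<in>{0..<1}. ennreal (((1 - r) + 1 / N) * r ^ n) \<partial>lborel)"
      by (rule nn_integral_cmult) measurable
    also have "\<dots> = ennreal d * ennreal ((1 + 1 / N) / (real n + 1) - 1 / (real n + 2))"
      by (subst nn_integral_power_weight) (use N in auto)
    \<comment> \<open>The moment equals 1/N^2 + 1/(N (N+1)). This N^(-2) cancels the N^2 in |diffs b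
      n|^2, and 2 pi * 27 * 2 = 108 pi.\<close>
    also have "\<dots> \<le> ennreal d * ennreal (2 / N\<^sup>2)"
    proof (intro mult_left_mono ennreal_leI)
      have n: "real n + 1 = N" "real n + 2 = N + 1" by (auto simp: N_def)
      have "(1 + 1 / N) / N = 1 / N + 1 / N\<^sup>2" by (simp add: add_divide_distrib power2_eq_square)
      moreover have "1 / N - 1 / (N + 1) = 1 / (N * (N + 1))" using N by (simp add: field_simps)
      ultimately have "(1 + 1 / N) / N - 1 / (N + 1) = 1 / N\<^sup>2 + 1 / (N * (N + 1))" by simp
      also have "1 / (N * (N + 1)) \<le> 1 / N\<^sup>2"
        using N by (intro divide_left_mono) (auto simp: power2_eq_square intro!: mult_left_mono mult_pos_pos)
      finally show "(1 + 1 / N) / (real n + 1) - 1 / (real n + 2) \<le> 2 / N\<^sup>2" unfolding n by simp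
    qed simp
    also have "\<dots> = ennreal (d * (2 / N\<^sup>2))" by (rule ennreal_mult[symmetric]) (use d0 in auto)
    also have "d * (2 / N\<^sup>2) = 108 * pi * ((cmod (b (Suc n)))\<^sup>2 * (1 + ln N) ^ 3)"
    proof -
      have "cmod (diffs b n) = N * cmod (b (Suc n))" by (simp add: diffs_def norm_mult N_def del: of_nat_Suc)
      then show ?thesis using N by (simp add: d_def power_mult_distrib)
    qed
    also have "ennreal \<dots> \<le> ennreal (108 * pi * ((cmod (b (Suc n)))\<^sup>2 * (1 + ln (real (Suc n) + 1)) ^ 3))"
      using N by (intro ennreal_leI mult_left_mono power_mono add_left_mono) (auto simp: N_def intro: add_nonneg_nonneg)
    finally show "(\<integral>\<^sup>+r\<in>{0..<1}. w n r \<partial>lborel) \<le> ennreal (108 * pi * ((cmod (b (Suc n)))\<^sup>2 * (1 + ln (real (Suc n) + 1)) ^ 3))" .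
  qed auto
  also have "\<dots> = ennreal (\<Sum>n. 108 * pi * ((cmod (b (Suc n)))\<^sup>2 * (1 + ln (real (Suc n) + 1)) ^ 3))"
  proof (rule suminf_ennreal2)
    show "summable (\<lambda>n. 108 * pi * ((cmod (b (Suc n)))\<^sup>2 * (1 + ln (real (Suc n) + 1)) ^ 3))"
      by (intro summable_mult) (use coeffs in \<open>subst summable_Suc_iff\<close>)
    show "0 \<le> 108 * pi * ((cmod (b (Suc n)))\<^sup>2 * (1 + ln (real (Suc n) + 1)) ^ 3)" for n
      by (intro mult_nonneg_nonneg zero_le_power add_nonneg_nonneg) auto
  qed
  finally show ?thesis by (rule le_less_trans) simp
qed

end

section \<open>Mean oscillation of the boundary function\<close>

context block_series
begin

definition gk :: "nat \<Rightarrow> complex \<Rightarrow> complex" where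
  "gk k z = z ^ (2 ^ k) * blk k z"

lemma gk_eq: "gk k z = (\<Sum>m<2 ^ k. b (2 ^ k + m) * z ^ (2 ^ k + m))"
  unfolding gk_def blk_def sum_distrib_left by (intro sum.cong refl) (simp add: power_add mult_ac)

lemma gk_le: "cmod z \<le> 1 \<Longrightarrow> cmod (gk k z) \<le> S k"
  unfolding gk_def by (rule term_le)

lemma gk_continuous: "continuous_on A (gk k)"
  unfolding gk_def blk_def by (intro continuous_intros)

lemma gk_deriv: "(gk k has_field_derivative z ^ (2 ^ k - 1) * dblk k z) (at z within A)"
proof -
  have e: "(\<Sum>m<2 ^ k. b (2 ^ k + m) * (of_nat (2 ^ k + m) * z ^ (2 ^ k + m - 1))) = z ^ (2 ^ k - 1) * dblk k z"
    unfolding dblk_def sum_distrib_left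
  proof (intro sum.cong refl)
    fix m
    have "z ^ (2 ^ k + m - 1) = z ^ (2 ^ k - 1) * z ^ m"
      unfolding power_add[symmetric] by (simp add: Nat.add_diff_assoc2)
    then show "b (2 ^ k + m) * (of_nat (2 ^ k + m) * z ^ (2 ^ k + m - 1)) = z ^ (2 ^ k - 1) * (of_nat (2 ^ k + m) * b (2 ^ k + m) * z ^ m)"
      by (simp only: mult_ac)
  qed
  have d: "((\<lambda>z. b n * z ^ n) has_field_derivative b n * (of_nat n * z ^ (n - 1))) (at z within A)" for n
    by (auto intro!: derivative_eq_intros)
  have "((\<lambda>z. \<Sum>m<2 ^ k. b (2 ^ k + m) * z ^ (2 ^ k + m)) has_field_derivative (\<Sum>m<2 ^ k. b (2 ^ k + m) * (of_nat (2 ^ k + m) * z ^ (2 ^ k + m - 1)))) (at z within A)"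
    by (intro DERIV_sum d)
  then show ?thesis unfolding e gk_eq[abs_def] .
qed

lemma gk_lipschitz:
  assumes "cmod z \<le> 1" "cmod w \<le> 1"
  shows "cmod (gk k z - gk k w) \<le> D k * cmod (z - w)"
proof (rule field_differentiable_bound[where S="cball 0 1" and f'="\<lambda>z. z ^ (2 ^ k - 1) * dblk k z"])
  fix z :: complex assume "z \<in> cball 0 1"
  then have z: "cmod z \<le> 1" by simp
  have "cmod (z ^ (2 ^ k - 1) * dblk k z) \<le> 1 * D k"
    unfolding norm_mult norm_power using z dblk_le[OF z] by (intro mult_mono) (auto simp: power_le_one)
  then show "cmod (z ^ (2 ^ k - 1) * dblk k z) \<le> D k" by simp
qed (use assms gk_deriv in auto)

lemma D_growth: "\<exists>c\<ge>0. \<forall>k. D k \<le> c * (2 ^ k / (real k + 1))"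
proof -
  define T where "T = (\<Sum>k. (real k + 1)\<^sup>2 * (D k / 2 ^ k)\<^sup>2)"
  have "D k \<le> sqrt T * (2 ^ k / (real k + 1))" for k
  proof -
    have "((real k + 1) * (D k / 2 ^ k))\<^sup>2 \<le> T"
      unfolding T_def power_mult_distrib using sum_le_suminf[OF sumD, of "{k}"] by simp
    then have "(real k + 1) * (D k / 2 ^ k) \<le> sqrt T" by (rule real_le_rsqrt)
    then show ?thesis by (simp add: field_simps)
  qed
  moreover have "0 \<le> sqrt T" unfolding T_def by (simp add: suminf_nonneg sumD)
  ultimately show ?thesis by blast
qed

lemma S_tail: "\<exists>c\<ge>0. \<forall>N K. (\<Sum>k\<in>{N..<K}. (S k)\<^sup>2) \<le> c / (real N + 1)\<^sup>2"
proof -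
  define T where "T = (\<Sum>k. (real k + 1)\<^sup>2 * (S k)\<^sup>2)"
  have "(\<Sum>k\<in>{N..<K}. (S k)\<^sup>2) \<le> T / (real N + 1)\<^sup>2" for N K
  proof -
    have "(real N + 1)\<^sup>2 * (\<Sum>k\<in>{N..<K}. (S k)\<^sup>2) \<le> (\<Sum>k\<in>{N..<K}. (real k + 1)\<^sup>2 * (S k)\<^sup>2)"
      unfolding sum_distrib_left by (intro sum_mono mult_right_mono power_mono) auto
    also have "\<dots> \<le> T" unfolding T_def by (rule sum_le_suminf[OF sumS]) auto
    finally show ?thesis by (simp add: pos_le_divide_eq mult.commute)
  qed
  moreover have "0 \<le> T" unfolding T_def by (intro suminf_nonneg sumS) auto
  ultimately show ?thesis by blast
qed

section \<open>Localizing high-frequency blocks with a Dirichlet kernel\<close>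

definition gpoly :: "nat \<Rightarrow> complex poly" where
  "gpoly k = (\<Sum>m<2 ^ k. monom (b (2 ^ k + m)) (2 ^ k + m))"

lemma poly_gpoly: "poly (gpoly k) z = gk k z"
  by (simp add: gpoly_def gk_eq poly_sum poly_monom)

lemma coeff_gpoly_low: "n < 2 ^ k \<Longrightarrow> coeff (gpoly k) n = 0"
  by (simp add: gpoly_def coeff_sum)

lemma coeff_gpoly_high: "2 ^ Suc k \<le> n \<Longrightarrow> coeff (gpoly k) n = 0"
  by (auto simp: gpoly_def coeff_sum intro!: sum.neutral)

text \<open>After multiplication by a polynomial of degree below \<open>2\<^bsup>N-1\<^esup>\<close>, blocks of equal parity beyond \<open>N\<close> still have
  disjoint spectra.\<close>

lemma block_product_disjoint:
  assumes N: "1 \<le> N" "degree E < 2 ^ (N - 1)" and k: "N \<le> k" "k + 2 \<le> k'"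
  shows "coeff (gpoly k * E) n = 0 \<or> coeff (gpoly k' * E) n = 0"
proof (cases "n < 2 ^ k'")
  case True
  then have "coeff (gpoly k' * E) n = 0"
    unfolding coeff_mult by (intro sum.neutral) (auto simp: coeff_gpoly_low)
  then show ?thesis ..
next
  case False
  have "coeff (gpoly k * E) n = 0"
    unfolding coeff_mult
  proof (intro sum.neutral ballI)
    fix i assume i: "i \<in> {..n}"
    show "coeff (gpoly k) i * coeff E (n - i) = 0"
    proof (cases "2 ^ Suc k \<le> i")
      case True
      then show ?thesis using coeff_gpoly_high by simp
    next
      case False
      have "(2::nat) ^ (N - 1) \<le> 2 ^ k" using k by (intro power_increasing) auto
      moreover have "(2::nat) ^ (k + 2) \<le> 2 ^ k'" using k by (intro power_increasing) auto
      then have "4 * (2::nat) ^ k \<le> 2 ^ k'" by simp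
      moreover have "i < 2 * 2 ^ k" using False by simp
      ultimately have "degree E < n - i" using N(2) \<open>\<not> n < 2 ^ k'\<close> by linarith
      then show ?thesis by (simp add: coeff_eq_0)
    qed
  qed
  then show ?thesis ..
qed

text \<open>Blocks of one parity remain orthogonal after multiplication by E, so their squared norms
  add up and each is at most S_k^2 times that of E. Joining the two parities costs the factor
  2.\<close>

lemma high_blocks_L2:
  assumes N: "1 \<le> N" and E: "degree E < 2 ^ (N - 1)"
  shows "(LINT t|circ. (cmod ((\<Sum>k\<in>{N..<K}. gk k (cis t)) * poly E (cis t)))\<^sup>2)
     \<le> 2 * (\<Sum>k\<in>{N..<K}. (S k)\<^sup>2) * (LINT t|circ. (cmod (poly E (cis t)))\<^sup>2)"
proof -
  define A where "A = {k \<in> {N..<K}. even k}"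
  define B where "B = {k \<in> {N..<K}. odd k}"
  have AB: "{N..<K} = A \<union> B" "A \<inter> B = {}" "finite A" "finite B" by (auto simp: A_def B_def)
  define W where "W = (LINT t|circ. (cmod (poly E (cis t)))\<^sup>2)"
  define I where "I C t = (cmod (poly (\<Sum>k\<in>C. gpoly k * E) (cis t)))\<^sup>2" for C t
  have int: "integrable circ (\<lambda>t. (cmod (poly p (cis t)))\<^sup>2)" for p
    by (rule integrable_circ) (intro continuous_intros)
  have par: "(LINT t|circ. I C t) \<le> (\<Sum>k\<in>C. (S k)\<^sup>2) * W"
    if C: "finite C" "\<And>k. k \<in> C \<Longrightarrow> N \<le> k" "\<And>k k'. k \<in> C \<Longrightarrow> k' \<in> C \<Longrightarrow> k < k' \<Longrightarrow> k + 2 \<le> k'" for C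
  proof -
    have "(LINT t|circ. I C t) = (\<Sum>k\<in>C. LINT t|circ. (cmod (poly (gpoly k * E) (cis t)))\<^sup>2)"
      unfolding I_def
    proof (rule orthogonal_polys[OF C(1)])
      fix k k' n assume kk: "k \<in> C" "k' \<in> C" "k \<noteq> k'"
      show "coeff (gpoly k * E) n = 0 \<or> coeff (gpoly k' * E) n = 0"
      proof (cases "k < k'")
        case True
        then show ?thesis using block_product_disjoint[OF N E C(2) C(3)] kk by blast
      next
        case False
        then have "k' < k" using kk by simp
        then show ?thesis using block_product_disjoint[OF N E C(2) C(3)] kk by blast
      qed
    qed
    also have "\<dots> \<le> (\<Sum>k\<in>C. (S k)\<^sup>2 * W)"
    proof (rule sum_mono)
      fix k
      have "(LINT t|circ. (cmod (poly (gpoly k * E) (cis t)))\<^sup>2) \<le> (LINT t|circ. (S k)\<^sup>2 * (cmod (poly E (cis t)))\<^sup>2)"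
      proof (rule integral_mono[OF int])
        show "integrable circ (\<lambda>t. (S k)\<^sup>2 * (cmod (poly E (cis t)))\<^sup>2)" by (intro integrable_mult_right int)
        fix t
        have "(cmod (gk k (cis t)))\<^sup>2 \<le> (S k)\<^sup>2" using gk_le[of "cis t" k] by (intro power_mono) auto
        then show "(cmod (poly (gpoly k * E) (cis t)))\<^sup>2 \<le> (S k)\<^sup>2 * (cmod (poly E (cis t)))\<^sup>2"
          by (simp add: poly_gpoly norm_mult power_mult_distrib mult_right_mono)
      qed
      then show "(LINT t|circ. (cmod (poly (gpoly k * E) (cis t)))\<^sup>2) \<le> (S k)\<^sup>2 * W" by (simp add: W_def)
    qed
    also have "\<dots> = (\<Sum>k\<in>C. (S k)\<^sup>2) * W" by (rule sum_distrib_right[symmetric])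
    finally show ?thesis .
  qed
  have pA: "(LINT t|circ. I A t) \<le> (\<Sum>k\<in>A. (S k)\<^sup>2) * W"
    by (rule par) (auto simp: A_def elim!: evenE)
  have pB: "(LINT t|circ. I B t) \<le> (\<Sum>k\<in>B. (S k)\<^sup>2) * W"
    by (rule par) (auto simp: B_def elim!: oddE)
  have "(LINT t|circ. (cmod ((\<Sum>k\<in>{N..<K}. gk k (cis t)) * poly E (cis t)))\<^sup>2) \<le> (LINT t|circ. 2 * I A t + 2 * I B t)"
  proof (rule integral_mono)
    show "integrable circ (\<lambda>t. (cmod ((\<Sum>k\<in>{N..<K}. gk k (cis t)) * poly E (cis t)))\<^sup>2)"
      by (rule integrable_circ) (intro continuous_intros continuous_on_compose2[OF gk_continuous[of UNIV]]; simp)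
    show "integrable circ (\<lambda>t. 2 * I A t + 2 * I B t)"
      unfolding I_def by (intro Bochner_Integration.integrable_add integrable_mult_right int)
    fix t
    have "(\<Sum>k\<in>{N..<K}. gk k (cis t)) * poly E (cis t) = poly (\<Sum>k\<in>A. gpoly k * E) (cis t) + poly (\<Sum>k\<in>B. gpoly k * E) (cis t)"
      unfolding AB(1) by (subst sum.union_disjoint) (use AB in \<open>auto simp: poly_sum poly_gpoly sum_distrib_right distrib_right\<close>)
    then have "cmod ((\<Sum>k\<in>{N..<K}. gk k (cis t)) * poly E (cis t)) \<le> cmod (poly (\<Sum>k\<in>A. gpoly k * E) (cis t)) + cmod (poly (\<Sum>k\<in>B. gpoly k * E) (cis t))"
      by (simp only: norm_triangle_ineq)
    then have "(cmod ((\<Sum>k\<in>{N..<K}. gk k (cis t)) * poly E (cis t)))\<^sup>2 \<le> (cmod (poly (\<Sum>k\<in>A. gpoly k * E) (cis t)) + cmod (poly (\<Sum>k\<in>B. gpoly k * E) (cis t)))\<^sup>2"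
      by (intro power_mono) auto
    also have "\<dots> \<le> 2 * I A t + 2 * I B t"
    proof -
      have "(x + y)\<^sup>2 \<le> 2 * x\<^sup>2 + 2 * y\<^sup>2" for x y :: real
        using sum_squares_bound[of x y] by (simp add: power2_sum)
      then show ?thesis unfolding I_def .
    qed
    finally show "(cmod ((\<Sum>k\<in>{N..<K}. gk k (cis t)) * poly E (cis t)))\<^sup>2 \<le> 2 * I A t + 2 * I B t" .
  qed
  also have "\<dots> = 2 * (LINT t|circ. I A t) + 2 * (LINT t|circ. I B t)"
    unfolding I_def by (subst Bochner_Integration.integral_add) (auto intro!: integrable_mult_right int)
  also have "\<dots> \<le> 2 * ((\<Sum>k\<in>A. (S k)\<^sup>2) * W) + 2 * ((\<Sum>k\<in>B. (S k)\<^sup>2) * W)"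
    using pA pB by (intro add_mono mult_left_mono) auto
  also have "\<dots> = 2 * (\<Sum>k\<in>{N..<K}. (S k)\<^sup>2) * W"
    unfolding AB(1) by (subst sum.union_disjoint) (use AB in \<open>auto simp: algebra_simps\<close>)
  finally show ?thesis by (simp add: W_def)
qed

text \<open>A translated Dirichlet kernel of order \<open>m\<close> is comparable to \<open>m\<close> on an arc of length \<open>2/m\<close>.\<close>

definition dirichlet :: "real \<Rightarrow> nat \<Rightarrow> complex poly" where
  "dirichlet \<theta> m = (\<Sum>j<m. monom (cis (- (real j * \<theta>))) j)"

lemma poly_dirichlet: "poly (dirichlet \<theta> m) (cis t) = (\<Sum>j<m. cis (real j * (t - \<theta>)))"
  by (simp add: dirichlet_def poly_sum poly_monom Complex.DeMoivre cis_mult algebra_simps)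

lemma degree_dirichlet: "0 < m \<Longrightarrow> degree (dirichlet \<theta> m) < m"
proof -
  assume m: "0 < m"
  have "degree (dirichlet \<theta> m) \<le> m - 1"
    unfolding dirichlet_def
    by (rule degree_sum_le) (auto intro: order_trans[OF degree_monom_le])
  then show ?thesis using m by linarith
qed

lemma dirichlet_L2: "(LINT t|circ. (cmod (poly (dirichlet \<theta> m) (cis t)))\<^sup>2) = 2 * pi * real m"
proof -
  have "poly (dirichlet \<theta> m) (cis t) = (\<Sum>j<m. cis (- (real j * \<theta>)) * cis (real j * t))" for t
    by (simp add: dirichlet_def poly_sum poly_monom Complex.DeMoivre)
  then show ?thesis by (simp add: Parseval_finite)
qed

lemma dirichlet_lower:
  assumes m: "0 < m" and t: "\<bar>t - \<theta>\<bar> \<le> 1 / real m"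
  shows "real m / 2 \<le> cmod (poly (dirichlet \<theta> m) (cis t))"
proof -
  have "(\<Sum>j<m. 1 / 2) \<le> (\<Sum>j<m. cos (real j * (t - \<theta>)))"
  proof (rule sum_mono)
    fix j assume "j \<in> {..<m}"
    then have "real j * \<bar>t - \<theta>\<bar> \<le> real m * (1 / real m)" using t by (intro mult_mono) auto
    \<comment> \<open>All phases lie within 1 <= pi/3 of zero, so every cosine is at least 1/2 and
      no cancellation occurs.\<close>
    then have a: "\<bar>real j * (t - \<theta>)\<bar> \<le> pi / 3" using m pi_gt3 by (simp add: abs_mult)
    have "cos (pi / 3) \<le> cos \<bar>real j * (t - \<theta>)\<bar>" using a pi_gt3 by (intro cos_monotone_0_pi_le) auto
    then show "1 / 2 \<le> cos (real j * (t - \<theta>))" by (simp add: cos_60)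
  qed
  also have "\<dots> = Re (poly (dirichlet \<theta> m) (cis t))" by (simp add: poly_dirichlet)
  also have "\<dots> \<le> cmod (poly (dirichlet \<theta> m) (cis t))" by (rule complex_Re_le_cmod)
  finally show ?thesis by simp
qed

text \<open>On the arc |E| >= m/2, so the local integral is at most 4/m^2 times the global one with
  the factor E. As E has squared norm 2 pi m, the gain 1/m is comparable to the length scale
  2^(-N).\<close>

lemma high_blocks_arc:
  assumes N: "1 \<le> N" and l: "0 < l" "l \<le> 4 / 2 ^ N"
  shows "(\<integral>\<^sup>+t\<in>{a..a+l}. ennreal ((cmod (\<Sum>k\<in>{N..<K}. gk k (cis t)))\<^sup>2) \<partial>lborel) \<le> ennreal (32 * pi / 2 ^ N * (\<Sum>k\<in>{N..<K}. (S k)\<^sup>2))"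
proof -
  \<comment> \<open>The largest order for which the degree stays below 2^(N-1), as
    \<open>high_blocks_L2\<close> demands; it is also small enough that 2/m = 4/2^N covers the
    arc.\<close>
  define m where "m = (2::nat) ^ (N - 1)"
  have m: "0 < m" "real m = 2 ^ N / 2" using N by (cases N; simp add: m_def)+
  define \<theta> where "\<theta> = a + l / 2"
  define E where "E = dirichlet \<theta> m"
  let ?H = "\<lambda>t. \<Sum>k\<in>{N..<K}. gk k (cis t)"
  let ?u = "\<lambda>t. ennreal ((cmod (?H t * poly E (cis t)))\<^sup>2)"
  have cH: "continuous_on UNIV (\<lambda>t. (cmod (?H t * poly E (cis t)))\<^sup>2)"
    by (intro continuous_intros continuous_on_compose2[OF gk_continuous[of UNIV]]; simp)
  have [measurable]: "?u \<in> borel_measurable borel"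
    using borel_measurable_continuous_onI[OF cH] by measurable
  have cH2: "continuous_on UNIV (\<lambda>t. (cmod (?H t))\<^sup>2)"
    by (intro continuous_intros continuous_on_compose2[OF gk_continuous[of UNIV]]; simp)
  have l2: "l \<le> 2 / real m" unfolding m(2) using l by simp
  have m1: "1 \<le> m" using m by simp
  have "2 / real m \<le> 2 / 1" using m1 by (intro divide_left_mono) auto
  also have "2 / 1 \<le> 2 * pi" using pi_gt3 by simp
  finally have "2 / real m \<le> 2 * pi" .
  then have l2pi: "l \<le> 2 * pi" using l2 by simp
  have "(\<integral>\<^sup>+t\<in>{a..a+l}. ennreal ((cmod (?H t))\<^sup>2) \<partial>lborel) \<le> (\<integral>\<^sup>+t. ennreal (4 / (real m)\<^sup>2) * (?u t * indicator {a..a+2*pi} t) \<partial>lborel)"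
  proof (rule nn_integral_mono)
    fix t
    show "ennreal ((cmod (?H t))\<^sup>2) * indicator {a..a+l} t \<le> ennreal (4 / (real m)\<^sup>2) * (?u t * indicator {a..a+2*pi} t)"
    proof (cases "t \<in> {a..a+l}")
      case True
      then have "\<bar>t - \<theta>\<bar> \<le> l / 2" by (auto simp: \<theta>_def abs_le_iff field_simps)
      then have "\<bar>t - \<theta>\<bar> \<le> 1 / real m" using l2 by simp
      then have "real m / 2 \<le> cmod (poly E (cis t))" unfolding E_def by (rule dirichlet_lower[OF m(1)])
      then have "(real m / 2)\<^sup>2 \<le> (cmod (poly E (cis t)))\<^sup>2" by (intro power_mono) auto
      then have "(cmod (?H t))\<^sup>2 * ((real m)\<^sup>2 / 4) \<le> (cmod (?H t))\<^sup>2 * (cmod (poly E (cis t)))\<^sup>2"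
        by (intro mult_left_mono) (auto simp: power_divide)
      then have "(cmod (?H t))\<^sup>2 \<le> 4 / (real m)\<^sup>2 * (cmod (?H t * poly E (cis t)))\<^sup>2"
        using m(1) by (simp add: norm_mult power_mult_distrib field_simps)
      then have "ennreal ((cmod (?H t))\<^sup>2) \<le> ennreal (4 / (real m)\<^sup>2) * ?u t"
        by (subst ennreal_mult[symmetric]) (auto intro: ennreal_leI)
      then show ?thesis using True l2pi by simp
    qed simp
  qed
  also have "\<dots> = ennreal (4 / (real m)\<^sup>2) * (\<integral>\<^sup>+t\<in>{a..a+2*pi}. ?u t \<partial>lborel)"
    by (rule nn_integral_cmult) measurable
  also have "(\<integral>\<^sup>+t\<in>{a..a+2*pi}. ?u t \<partial>lborel) = (\<integral>\<^sup>+t. ?u t \<partial>circ)"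
  proof (subst nn_integral_periodic[where u="?u"])
    show "?u (x + 2 * pi) = ?u x" for x by (simp add: cis.code)
    show "?u \<in> borel_measurable borel" by fact
  qed (rule nn_integral_circ[symmetric], fact)
  also have "\<dots> = ennreal (LINT t|circ. (cmod (?H t * poly E (cis t)))\<^sup>2)"
    by (rule nn_integral_eq_integral) (auto intro: integrable_circ(1)[OF cH])
  also have "ennreal (4 / (real m)\<^sup>2) * \<dots> \<le> ennreal (4 / (real m)\<^sup>2) * ennreal (2 * (\<Sum>k\<in>{N..<K}. (S k)\<^sup>2) * (2 * pi * real m))"
  proof (intro mult_left_mono ennreal_leI)
    have "degree E < 2 ^ (N - 1)" unfolding E_def m_def[symmetric] by (rule degree_dirichlet[OF m(1)])
    from high_blocks_L2[OF N this, of K]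
    show "(LINT t|circ. (cmod (?H t * poly E (cis t)))\<^sup>2) \<le> 2 * (\<Sum>k\<in>{N..<K}. (S k)\<^sup>2) * (2 * pi * real m)"
      unfolding E_def dirichlet_L2 .
  qed simp
  also have "\<dots> = ennreal (4 / (real m)\<^sup>2 * (2 * (\<Sum>k\<in>{N..<K}. (S k)\<^sup>2) * (2 * pi * real m)))"
    by (rule ennreal_mult[symmetric]) (auto intro!: mult_nonneg_nonneg sum_nonneg)
  also have "4 / (real m)\<^sup>2 * (2 * (\<Sum>k\<in>{N..<K}. (S k)\<^sup>2) * (2 * pi * real m)) = 16 * pi / real m * (\<Sum>k\<in>{N..<K}. (S k)\<^sup>2)"
    using m(1) by (simp add: power2_eq_square field_simps)
  also have "16 * pi / real m = 32 * pi / 2 ^ N" unfolding m(2) by simp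
  finally show ?thesis .
qed

end

section \<open>Logarithmic decay of the mean oscillation\<close>

lemma dyadic_scale:
  fixes l :: real
  assumes l: "0 < l" "l \<le> 2"
  shows "\<exists>N\<ge>1. 2 / 2 ^ N < l \<and> l \<le> 4 / 2 ^ N"
proof -
  obtain n where "(1/2 :: real) ^ n < l / 2" using real_arch_pow_inv[of "l / 2" "1 / 2"] l by auto
  then have ex: "2 / 2 ^ n < l" by (simp add: power_divide field_simps)
  define N where "N = (LEAST n. 2 / 2 ^ n < l)"
  have N: "2 / 2 ^ N < l" unfolding N_def by (rule LeastI[of "\<lambda>n. 2 / 2 ^ n < l", OF ex])
  have "N \<noteq> 0"
  proof
    assume "N = 0"
    then show False using N l by simp
  qed
  then obtain M where M: "N = Suc M" by (cases N) auto
  have "\<not> 2 / 2 ^ M < l" using not_less_Least[of M "\<lambda>n. 2 / 2 ^ n < l"] unfolding N_def[symmetric] M by simp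
  then have "l \<le> 4 / 2 ^ N" unfolding M by simp
  then show ?thesis using N M by (intro exI[of _ N]) simp
qed

lemma inverse_scale_le_log:
  fixes l :: real
  assumes l: "0 < l" "2 / 2 ^ N < l" and N: "1 \<le> N" and that: "l \<le> 2 * pi"
  shows "1 / (real N + 1) \<le> 3 / (1 + ln (2 * pi / l))"
proof -
  have "2 * pi / l \<le> pi * 2 ^ N" using l pi_gt_zero by (simp add: field_simps)
  then have "ln (2 * pi / l) \<le> ln (pi * 2 ^ N)" using l by (subst ln_le_cancel_iff) auto
  also have "\<dots> = ln pi + real N * ln 2" by (simp add: ln_mult ln_realpow)
  also have "\<dots> \<le> (pi - 1) + real N * 1" using ln_le_minus_one[of pi] ln_le_minus_one[of 2]
    by (intro add_mono mult_left_mono) auto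
  finally have "1 + ln (2 * pi / l) \<le> 3 * (real N + 1)" using N pi_less_4 by simp
  moreover have "0 \<le> ln (2 * pi / l)" using l that by simp
  ultimately show ?thesis by (simp add: divide_simps)
qed

context block_series
begin

text \<open>The constant c is the value of the low blocks at the left end of the arc. Low blocks
  vary by at most l times the sum of D_k over k < N, which is O(1/(N+1)) since D_k = O(2^k/(k+1)).
  High blocks have squared norm O(l/(N+1)^2) on the arc.\<close>

lemma arc_oscillation_scale:
  "\<exists>K\<ge>0. \<forall>N a l. 1 \<le> N \<and> 2 / 2 ^ N < l \<and> l \<le> 4 / 2 ^ N \<longrightarrow>
    (\<exists>c. (\<integral>\<^sup>+t\<in>{a..a+l}. ennreal (cmod (gt (cis t) - c)) \<partial>lborel) \<le> ennreal (l * (K / (real N + 1))))"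
proof -
  obtain cD where cD: "0 \<le> cD" "\<And>k. D k \<le> cD * (2 ^ k / (real k + 1))" using D_growth by auto
  obtain T where T: "0 \<le> T" "\<And>N K. (\<Sum>k\<in>{N..<K}. (S k)\<^sup>2) \<le> T / (real N + 1)\<^sup>2" using S_tail by auto
  define Q where "Q = 20 * cD + 2 + 16 * pi * T"
  have Q0: "0 \<le> Q" using cD T by (simp add: Q_def)
  have "\<exists>c. (\<integral>\<^sup>+t\<in>{a..a+l}. ennreal (cmod (gt (cis t) - c)) \<partial>lborel) \<le> ennreal (l * (Q / (real N + 1)))"
    if N: "1 \<le> N" and l1: "2 / 2 ^ N < l" and l2: "l \<le> 4 / 2 ^ N" for N a l
  proof -
    define n where "n = real N + 1"
    have n: "0 < n" by (simp add: n_def)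
    have l0: "0 < l" using l1 by (rule le_less_trans[rotated]) simp
    define c where "c = b 0 + (\<Sum>k<N. gk k (cis a))"
    have "\<forall>\<^sub>F K in sequentially. \<forall>z\<in>cball 0 1. dist (b 0 + (\<Sum>k<K. gk k z)) (gt z) < 1 / n"
      using gt_uniform n unfolding uniform_limit_iff gk_def[symmetric] by simp
    \<comment> \<open>Uniform convergence leaves finitely many blocks at a cost of 1/n, so that the
      orthogonality argument deals with polynomials.\<close>
    then obtain K' where K': "\<forall>K\<ge>K'. \<forall>z\<in>cball 0 1. dist (b 0 + (\<Sum>k<K. gk k z)) (gt z) < 1 / n"
      unfolding eventually_sequentially by blast
    define K where "K = max K' N"
    define h where "h t = cmod (\<Sum>k\<in>{N..<K}. gk k (cis t))" for t
    have low: "(\<Sum>k<N. cmod (gk k (cis t) - gk k (cis a))) \<le> 20 * cD / n" if t: "t \<in> {a..a+l}" for t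
    proof -
      have "(\<Sum>k<N. cmod (gk k (cis t) - gk k (cis a))) \<le> (\<Sum>k<N. cD * (2 ^ k / (real k + 1)) * l)"
      proof (rule sum_mono)
        fix k
        have "cmod (cis t - cis a) \<le> l" using cmod_cis_diff_le[of t a] t by auto
        then have "D k * cmod (cis t - cis a) \<le> cD * (2 ^ k / (real k + 1)) * l"
          using cD by (intro mult_mono) auto
        then show "cmod (gk k (cis t) - gk k (cis a)) \<le> cD * (2 ^ k / (real k + 1)) * l"
          using gk_lipschitz[of "cis t" "cis a" k] by simp
      qed
      also have "\<dots> = cD * l * (\<Sum>k<N. 2 ^ k / (real k + 1))"
        unfolding sum_distrib_left by (intro sum.cong refl) (simp only: mult_ac)
      also have "\<dots> \<le> cD * l * (5 * 2 ^ N / (real N + 1))"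
        using cD l0 by (intro mult_left_mono dyadic_harmonic_sum) auto
      also have "\<dots> = 5 * cD / n * (l * 2 ^ N)" by (simp add: n_def)
      also have "\<dots> \<le> 5 * cD / n * 4"
        using l2 n cD by (intro mult_left_mono) (auto simp: field_simps)
      finally show ?thesis by simp
    qed
    have pw: "cmod (gt (cis t) - c) \<le> (20 * cD + 2) / n + n * (h t)\<^sup>2" if t: "t \<in> {a..a+l}" for t
    proof -
      have "dist (b 0 + (\<Sum>k<K. gk k (cis t))) (gt (cis t)) < 1 / n" using K' by (simp add: K_def)
      then have 1: "cmod (gt (cis t) - (b 0 + (\<Sum>k<K. gk k (cis t)))) \<le> 1 / n"
        by (simp add: dist_norm norm_minus_commute)
      have "{..<K} = {..<N} \<union> {N..<K}" by (auto simp: K_def)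
      then have "(\<Sum>k<K. gk k (cis t)) = (\<Sum>k<N. gk k (cis t)) + (\<Sum>k\<in>{N..<K}. gk k (cis t))"
        by (simp add: sum.union_disjoint ivl_disj_int)
      then have eq: "gt (cis t) - c = (gt (cis t) - (b 0 + (\<Sum>k<K. gk k (cis t)))) + (\<Sum>k<N. gk k (cis t) - gk k (cis a)) + (\<Sum>k\<in>{N..<K}. gk k (cis t))"
        by (simp add: c_def sum_subtractf)
      have 2: "cmod (\<Sum>k<N. gk k (cis t) - gk k (cis a)) \<le> 20 * cD / n"
        by (rule order_trans[OF norm_sum low[OF t]])
      \<comment> \<open>Completing a square gives h <= n h^2 + 1/n, a pointwise substitute for
        Cauchy-Schwarz on the arc: the integral of n h^2 is of the same order l/n as that of
        1/n.\<close>
      have "0 \<le> (n * h t - 1 / 2)\<^sup>2" by simp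
      then have "n * h t \<le> n * (n * (h t)\<^sup>2) + 1" by (simp add: power2_eq_square algebra_simps)
      then have "n * h t \<le> n * (n * (h t)\<^sup>2 + 1 / n)" using n by (simp add: distrib_left)
      then have 3: "h t \<le> n * (h t)\<^sup>2 + 1 / n" using n by (rule mult_left_le_imp_le)
      have "cmod (gt (cis t) - c) \<le> 1 / n + 20 * cD / n + h t"
        unfolding eq h_def by (intro norm_triangle_le add_mono 1 2 order_refl)
      also have "\<dots> \<le> 1 / n + 20 * cD / n + (n * (h t)\<^sup>2 + 1 / n)" using 3 by simp
      finally show ?thesis by (simp add: add_divide_distrib)
    qed
    have ch: "continuous_on UNIV (\<lambda>t. (h t)\<^sup>2)" unfolding h_def
      by (intro continuous_intros continuous_on_compose2[OF gk_continuous[of UNIV]]; simp)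
    have [measurable]: "(\<lambda>t. (h t)\<^sup>2) \<in> borel_measurable borel"
      using borel_measurable_continuous_onI[OF ch] .
    have c0: "0 \<le> (20 * cD + 2) / n" using n cD by simp
    have "(\<integral>\<^sup>+t\<in>{a..a+l}. ennreal (cmod (gt (cis t) - c)) \<partial>lborel)
       \<le> (\<integral>\<^sup>+t. ennreal ((20 * cD + 2) / n) * indicator {a..a+l} t + ennreal n * (ennreal ((h t)\<^sup>2) * indicator {a..a+l} t) \<partial>lborel)"
    proof (rule nn_integral_mono)
      fix t
      show "ennreal (cmod (gt (cis t) - c)) * indicator {a..a+l} t \<le> ennreal ((20 * cD + 2) / n) * indicator {a..a+l} t + ennreal n * (ennreal ((h t)\<^sup>2) * indicator {a..a+l} t)"
      proof (cases "t \<in> {a..a+l}")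
        case True
        have "ennreal (cmod (gt (cis t) - c)) \<le> ennreal ((20 * cD + 2) / n) + ennreal n * ennreal ((h t)\<^sup>2)"
          using pw[OF True] c0 n by (simp add: ennreal_mult[symmetric] ennreal_plus[symmetric] ennreal_leI del: ennreal_plus)
        then show ?thesis using True by simp
      qed simp
    qed
    also have "\<dots> = ennreal ((20 * cD + 2) / n) * ennreal l + ennreal n * (\<integral>\<^sup>+t\<in>{a..a+l}. ennreal ((h t)\<^sup>2) \<partial>lborel)"
      using l0 by (subst nn_integral_add) (auto simp: nn_integral_cmult)
    also have "\<dots> \<le> ennreal ((20 * cD + 2) / n) * ennreal l + ennreal n * ennreal (16 * pi * l * (T / n\<^sup>2))"
    proof (intro add_left_mono mult_left_mono)
      have "(\<integral>\<^sup>+t\<in>{a..a+l}. ennreal ((h t)\<^sup>2) \<partial>lborel) \<le> ennreal (32 * pi / 2 ^ N * (\<Sum>k\<in>{N..<K}. (S k)\<^sup>2))"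
        unfolding h_def by (rule high_blocks_arc[OF N l0 l2])
      also have "\<dots> \<le> ennreal (16 * pi * l * (T / n\<^sup>2))"
      proof (intro ennreal_leI mult_mono)
        show "32 * pi / 2 ^ N \<le> 16 * pi * l" using l1 by (simp add: field_simps)
      qed (use T l0 in \<open>auto simp: n_def sum_nonneg\<close>)
      finally show "(\<integral>\<^sup>+t\<in>{a..a+l}. ennreal ((h t)\<^sup>2) \<partial>lborel) \<le> ennreal (16 * pi * l * (T / n\<^sup>2))" .
    qed simp
    also have "\<dots> = ennreal ((20 * cD + 2) / n * l + n * (16 * pi * l * (T / n\<^sup>2)))"
    proof -
      have "ennreal x * ennreal l + ennreal n * ennreal y = ennreal (x * l + n * y)" if "0 \<le> x" "0 \<le> y" for x y
        using that l0 n by (simp add: ennreal_mult ennreal_plus)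
      then show ?thesis using c0 l0 T by simp
    qed
    also have "(20 * cD + 2) / n * l + n * (16 * pi * l * (T / n\<^sup>2)) = l * (Q / n)"
      using n by (simp add: Q_def power2_eq_square field_simps)
    finally show ?thesis unfolding n_def by blast
  qed
  then show ?thesis using Q0 by blast
qed

lemma gt_LMO:
  "\<exists>K\<ge>0. \<forall>a l. 0 < l \<and> l \<le> 2 * pi \<longrightarrow>
    (\<exists>c. (\<integral>\<^sup>+t\<in>{a..a+l}. ennreal (cmod (gt (cis t) - c)) \<partial>lborel) \<le> ennreal (l * (K / (1 + ln (2 * pi / l)))))"
proof -
  obtain Q where Q: "0 \<le> Q" and QI: "\<forall>N a l. 1 \<le> N \<and> 2 / 2 ^ N < l \<and> l \<le> 4 / 2 ^ N \<longrightarrow>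
    (\<exists>c. (\<integral>\<^sup>+t\<in>{a..a+l}. ennreal (cmod (gt (cis t) - c)) \<partial>lborel) \<le> ennreal (l * (Q / (real N + 1))))"
    using arc_oscillation_scale by (elim exE conjE) (rule that)
  obtain B where B: "0 \<le> B" "\<And>z. cmod z \<le> 1 \<Longrightarrow> cmod (gt z) \<le> B" using gt_bound by auto
  define K where "K = 3 * Q + 4 * B"
  have "\<exists>c. (\<integral>\<^sup>+t\<in>{a..a+l}. ennreal (cmod (gt (cis t) - c)) \<partial>lborel) \<le> ennreal (l * (K / (1 + ln (2 * pi / l))))"
    if l: "0 < l" "l \<le> 2 * pi" for a l
  proof -
    define \<L> where "\<L> = 1 + ln (2 * pi / l)"
    have L1: "1 \<le> \<L>" using l by (simp add: \<L>_def)
    show ?thesis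
    proof (cases "l \<le> 2")
      case True
      then obtain N where N: "1 \<le> N" "2 / 2 ^ N < l" "l \<le> 4 / 2 ^ N" using dyadic_scale[OF l(1)] by auto
      then obtain c where c: "(\<integral>\<^sup>+t\<in>{a..a+l}. ennreal (cmod (gt (cis t) - c)) \<partial>lborel) \<le> ennreal (l * (Q / (real N + 1)))"
        using QI by blast
      have "Q * (1 / (real N + 1)) \<le> Q * (3 / \<L>)"
        unfolding \<L>_def by (intro mult_left_mono inverse_scale_le_log l N Q)
      also have "\<dots> \<le> K / \<L>" using L1 B by (simp add: K_def divide_right_mono)
      finally have "ennreal (l * (Q / (real N + 1))) \<le> ennreal (l * (K / \<L>))"
        using l by (intro ennreal_leI mult_left_mono) auto
      then show ?thesis using c unfolding \<L>_def by (intro exI[of _ c]) (rule order_trans)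
    next
      case False
      \<comment> \<open>For arcs longer than 2 the logarithmic factor is at most pi < 4, so
        boundedness of \<open>gt\<close> already gives the estimate, with c = 0.\<close>
      have "ln (2 * pi / l) \<le> 2 * pi / l - 1" using l by (intro ln_le_minus_one) auto
      also have "2 * pi / l \<le> 2 * pi / 2" using False by (intro divide_left_mono) auto
      finally have "\<L> \<le> 4" using pi_less_4 by (simp add: \<L>_def)
      then have "B * \<L> \<le> K" using B Q mult_left_mono[of \<L> 4 B] by (simp add: K_def)
      then have BK: "B \<le> K / \<L>" using L1 by (simp add: pos_le_divide_eq)
      have "(\<integral>\<^sup>+t\<in>{a..a+l}. ennreal (cmod (gt (cis t) - 0)) \<partial>lborel) \<le> (\<integral>\<^sup>+t\<in>{a..a+l}. ennreal (K / \<L>) \<partial>lborel)"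
        by (intro nn_integral_mono mult_right_mono ennreal_leI) (use order_trans[OF B(2) BK] in auto)
      also have "\<dots> = ennreal (l * (K / \<L>))"
        using l BK B by (simp add: nn_integral_cmult_indicator ennreal_mult[symmetric] mult.commute)
      finally show ?thesis unfolding \<L>_def by blast
    qed
  qed
  moreover have "0 \<le> K" using Q B by (simp add: K_def)
  ultimately show ?thesis by blast
qed

end

section \<open>Multiplication on BMOA\<close>

context block_series
begin

lemma g_bounded: "\<exists>B\<ge>0. \<forall>z. cmod z < 1 \<longrightarrow> cmod (g z) \<le> B"
  using gt_bound by (metis gt_eq_g less_imp_le)

lemma gt_circle_continuous: "continuous_on UNIV (\<lambda>t. gt (cis t))"
  by (rule continuous_on_compose2[OF gt_continuous]) (auto intro!: continuous_intros)

lemma mult_H1: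
  assumes f: "f \<in> H1"
  shows "(\<lambda>z. f z * g z) \<in> H1"
proof -
  obtain B where B: "0 \<le> B" "\<And>z. cmod z < 1 \<Longrightarrow> cmod (g z) \<le> B" using g_bounded by auto
  obtain A where hol: "f holomorphic_on ball 0 1" and A: "0 \<le> A"
     "\<And>r. 0 \<le> r \<Longrightarrow> r < 1 \<Longrightarrow> (\<integral>\<^sup>+t. ennreal (cmod (f (of_real r * cis t))) \<partial>circ) \<le> ennreal A"
    using f unfolding H1_iff by metis
  have "(\<integral>\<^sup>+t. ennreal (cmod (f (of_real r * cis t) * g (of_real r * cis t))) \<partial>circ) \<le> ennreal (B * A)"
    if r: "0 \<le> r" "r < 1" for r
  proof -
    have [measurable]: "(\<lambda>t. f (of_real r * cis t)) \<in> borel_measurable borel"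
      by (rule measurable_disc_circle[OF holomorphic_on_imp_continuous_on[OF hol]]) (use r in auto)
    have "(\<integral>\<^sup>+t. ennreal (cmod (f (of_real r * cis t) * g (of_real r * cis t))) \<partial>circ) \<le> (\<integral>\<^sup>+t. ennreal B * ennreal (cmod (f (of_real r * cis t))) \<partial>circ)"
    proof (rule nn_integral_mono)
      fix t
      have "cmod (g (of_real r * cis t)) \<le> B" using r by (intro B) (simp add: norm_mult)
      then show "ennreal (cmod (f (of_real r * cis t) * g (of_real r * cis t))) \<le> ennreal B * ennreal (cmod (f (of_real r * cis t)))"
        using B(1) mult_right_mono[of "cmod (g (of_real r * cis t))" B "cmod (f (of_real r * cis t))"]
        by (simp add: ennreal_mult[symmetric] norm_mult ennreal_leI mult.commute)
    qed
    also have "\<dots> = ennreal B * (\<integral>\<^sup>+t. ennreal (cmod (f (of_real r * cis t))) \<partial>circ)"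
      by (rule nn_integral_cmult) (simp add: circ_def)
    also have "\<dots> \<le> ennreal B * ennreal A" by (intro mult_left_mono A r) simp
    finally show ?thesis using B A by (simp add: ennreal_mult)
  qed
  moreover have "(\<lambda>z. f z * g z) holomorphic_on ball 0 1" by (intro holomorphic_intros hol g_holomorphic)
  moreover have "0 \<le> B * A" using A B by simp
  ultimately show ?thesis unfolding H1_iff by blast
qed

lemma g_H1: "g \<in> H1"
proof -
  have "(\<lambda>z. 1) \<in> H1" unfolding H1_iff by (intro conjI exI[of _ "2 * pi"]) (auto simp: emeasure_circ)
  from mult_H1[OF this] show ?thesis by simp
qed

text \<open>The oscillation of f g about A c splits into the oscillation of f times a bound for g,
  and the average A of f times the oscillation of g. The average grows at most like the logarithm of
  1/l, and the oscillation of g decays at least as fast, so the logarithms cancel.\<close>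

lemma mult_BMOA:
  assumes f: "f \<in> BMOA"
  shows "(\<lambda>z. f z * g z) \<in> BMOA"
proof -
  obtain C where f1: "f \<in> H1" and C: "bmo_const (bdry f) C" using f unfolding BMOA_iff by blast
  let ?fg = "\<lambda>z. f z * g z"
  define F where "F = bdry f"
  define H where "H = bdry ?fg"
  define G where "G t = gt (cis t)" for t
  have fg1: "?fg \<in> H1" by (rule mult_H1[OF f1])
  interpret F: circle_L1 F unfolding F_def by (rule H1_circle_L1[OF f1])
  interpret H: circle_L1 H unfolding H_def by (rule H1_circle_L1[OF fg1])
  note [measurable] = F.meas H.meas
  have [measurable]: "G \<in> borel_measurable borel"
    unfolding G_def[abs_def] by (rule borel_measurable_continuous_onI[OF gt_circle_continuous])
  have Gper: "G (t + 2 * pi) = G t" for t by (simp add: G_def cis.code)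
  have ae: "AE t in circ. H t = F t * G t"
    using H1_boundary(1)[OF f1]
  proof eventually_elim
    case (elim t)
    have "((\<lambda>r. f (of_real r * cis t) * g (of_real r * cis t)) \<longlongrightarrow> bdry f t * gt (cis t)) (at_left 1)"
      by (intro tendsto_mult elim g_radial_limit)
    then show ?case unfolding H_def F_def G_def by (rule bdry_eqI)
  qed
  have zero: "(\<integral>\<^sup>+t\<in>{a..a+l}. ennreal (cmod (H t - F t * G t)) \<partial>lborel) = 0" if l: "l \<le> 2 * pi" for a l
  proof -
    have "(\<integral>\<^sup>+t\<in>{a..a+l}. ennreal (cmod (H t - F t * G t)) \<partial>lborel) \<le> (\<integral>\<^sup>+t\<in>{a..a+2*pi}. ennreal (cmod (H t - F t * G t)) \<partial>lborel)"
      using l by (intro nn_integral_mono) (auto simp: indicator_def)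
    also have "\<dots> = (\<integral>\<^sup>+t. ennreal (cmod (H t - F t * G t)) \<partial>circ)"
      by (subst nn_integral_periodic) (simp_all add: F.per H.per Gper nn_integral_circ)
    also have "\<dots> = (\<integral>\<^sup>+t. 0 \<partial>circ)" by (rule nn_integral_cong_AE) (use ae in eventually_elim, simp)
    finally show ?thesis by simp
  qed
  obtain M where M: "0 \<le> M" "\<And>a l. 0 < l \<Longrightarrow> l \<le> 2 * pi \<Longrightarrow> cmod (arc_avg F a l) \<le> M * (1 + ln (2 * pi / l))"
    using F.bmo_avg_log[OF C[folded F_def]] by blast
  obtain B where B: "0 \<le> B" "\<And>t. cmod (G t) \<le> B" using gt_bound unfolding G_def by auto
  obtain K where K: "0 \<le> K" and KI: "\<forall>a l. 0 < l \<and> l \<le> 2 * pi \<longrightarrow>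
    (\<exists>c. (\<integral>\<^sup>+t\<in>{a..a+l}. ennreal (cmod (G t - c)) \<partial>lborel) \<le> ennreal (l * (K / (1 + ln (2 * pi / l)))))"
    using gt_LMO[folded G_def] by (elim exE conjE) (rule that)
  have C0: "0 \<le> C" and CI: "\<And>a l. 0 < l \<Longrightarrow> l \<le> 2 * pi \<Longrightarrow> (\<integral>\<^sup>+t\<in>{a..a+l}. ennreal (cmod (F t - arc_avg F a l)) \<partial>lborel) \<le> ennreal (C * l)"
    using C unfolding bmo_const_def F_def by auto
  have "bmo_const H (2 * (B * C + M * K))"
  proof (rule H.bmo_constI)
    show "0 \<le> B * C + M * K" using B C0 M K by simp
    fix a l :: real assume l: "0 < l" "l \<le> 2 * pi"
    define A where "A = arc_avg F a l"
    define \<L> where "\<L> = 1 + ln (2 * pi / l)"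
    have L1: "1 \<le> \<L>" using l by (simp add: \<L>_def)
    obtain c where c: "(\<integral>\<^sup>+t\<in>{a..a+l}. ennreal (cmod (G t - c)) \<partial>lborel) \<le> ennreal (l * (K / \<L>))"
      using KI l unfolding \<L>_def by blast
    have A: "cmod A \<le> M * \<L>" using M l by (simp add: A_def \<L>_def)
    have "(\<integral>\<^sup>+t\<in>{a..a+l}. ennreal (cmod (H t - A * c)) \<partial>lborel) \<le>
      (\<integral>\<^sup>+t. ennreal (cmod (H t - F t * G t)) * indicator {a..a+l} t +
         (ennreal B * (ennreal (cmod (F t - A)) * indicator {a..a+l} t) + ennreal (cmod A) * (ennreal (cmod (G t - c)) * indicator {a..a+l} t)) \<partial>lborel)"
    proof (rule nn_integral_mono)
      fix t
      \<comment> \<open>The first difference is zero almost everywhere only; it is carried along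
        because its integral over any arc vanishes.\<close>
      have eq: "H t - A * c = (H t - F t * G t) + ((F t - A) * G t + A * (G t - c))" by (simp add: algebra_simps)
      have "cmod (H t - A * c) \<le> cmod (H t - F t * G t) + (B * cmod (F t - A) + cmod A * cmod (G t - c))"
        unfolding eq
      proof (intro norm_triangle_le add_mono order_refl)
        show "cmod ((F t - A) * G t) \<le> B * cmod (F t - A)"
          unfolding norm_mult using mult_right_mono[OF B(2)[of t] norm_ge_zero[of "F t - A"]] by (simp add: mult.commute)
      qed (simp add: norm_mult)
      then have "ennreal (cmod (H t - A * c)) \<le> ennreal (cmod (H t - F t * G t)) + (ennreal B * ennreal (cmod (F t - A)) + ennreal (cmod A) * ennreal (cmod (G t - c)))"
        using B by (simp add: ennreal_mult[symmetric] ennreal_plus[symmetric] ennreal_leI del: ennreal_plus)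
      then show "ennreal (cmod (H t - A * c)) * indicator {a..a+l} t \<le> ennreal (cmod (H t - F t * G t)) * indicator {a..a+l} t +
         (ennreal B * (ennreal (cmod (F t - A)) * indicator {a..a+l} t) + ennreal (cmod A) * (ennreal (cmod (G t - c)) * indicator {a..a+l} t))"
        by (simp add: indicator_def)
    qed
    also have "\<dots> = (\<integral>\<^sup>+t\<in>{a..a+l}. ennreal (cmod (H t - F t * G t)) \<partial>lborel) +
         (ennreal B * (\<integral>\<^sup>+t\<in>{a..a+l}. ennreal (cmod (F t - A)) \<partial>lborel) + ennreal (cmod A) * (\<integral>\<^sup>+t\<in>{a..a+l}. ennreal (cmod (G t - c)) \<partial>lborel))"
      by (simp add: nn_integral_add nn_integral_cmult)
    also have "\<dots> \<le> 0 + (ennreal B * ennreal (C * l) + ennreal (M * \<L>) * ennreal (l * (K / \<L>)))"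
      by (intro add_mono mult_mono ennreal_leI A c CI[OF l, of a, folded A_def] zero[OF l(2), THEN eq_refl] order_refl) auto
    also have "\<dots> = ennreal (B * (C * l) + (M * \<L>) * (l * (K / \<L>)))"
    proof -
      have "0 + (ennreal B * ennreal x + ennreal y * ennreal z) = ennreal (B * x + y * z)" if "0 \<le> x" "0 \<le> y" "0 \<le> z" for x y z
        using that B(1) by (simp add: ennreal_mult ennreal_plus)
      then show ?thesis using C0 l M(1) K L1 by simp
    qed
    also have "B * (C * l) + (M * \<L>) * (l * (K / \<L>)) = (B * C + M * K) * l"
      using L1 by (simp add: field_simps)
    finally show "\<exists>c. (\<integral>\<^sup>+t\<in>{a..a+l}. ennreal (cmod (H t - c)) \<partial>lborel) \<le> ennreal ((B * C + M * K) * l)" by blast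
  qed
  then show ?thesis unfolding BMOA_iff H_def using fg1 by blast
qed

section \<open>Integral means and Carleson boxes\<close>

lemma g_integral_means:
  "(\<integral>\<^sup>+ r\<in>{0..<1}. ennreal ((1 - r) * (ln (1 / (1 - r)))^2 * (Minf r (deriv g))^2) \<partial>lborel) < \<infinity>"
proof -
  have "(\<integral>\<^sup>+ r\<in>{0..<1}. ennreal ((1 - r) * (ln (1 / (1 - r)))^2 * (Minf r (deriv g))^2) \<partial>lborel)
     \<le> (\<integral>\<^sup>+r\<in>{0..<1}. ennreal ((1 - r) * (Lg r)\<^sup>2) * (Mr r)\<^sup>2 \<partial>lborel)"
  proof (rule nn_integral_mono)
    fix r :: real
    show "ennreal ((1 - r) * (ln (1 / (1 - r)))^2 * (Minf r (deriv g))^2) * indicator {0..<1} r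
      \<le> ennreal ((1 - r) * (Lg r)\<^sup>2) * (Mr r)\<^sup>2 * indicator {0..<1} r"
    proof (cases "r \<in> {0..<1}")
      case True
      then have r: "0 \<le> r" "r < 1" by auto
      have Lg: "0 \<le> ln (1 / (1 - r))" "ln (1 / (1 - r)) \<le> Lg r" "1 \<le> Lg r"
        using r by (auto simp: Lg_def)
      have "ennreal ((1 - r) * (ln (1 / (1 - r)))^2 * (Minf r (deriv g))^2) \<le> ennreal ((1 - r) * (Lg r)\<^sup>2) * (Mr r)\<^sup>2"
      proof (cases "Mr r")
        case (real m)
        have le: "cmod (deriv g z) \<le> m" if "z \<in> sphere 0 r" for z
          using deriv_g_le_Mr[of z] that r real by simp
        have ne: "of_real r \<in> sphere (0::complex) r" using r by simp
        have "Minf r (deriv g) \<le> m" unfolding Minf_def using ne le by (intro cSUP_least) auto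
        moreover have "0 \<le> Minf r (deriv g)" unfolding Minf_def
          by (rule cSUP_upper2[OF _ ne]) (use le in \<open>auto intro!: bdd_aboveI2[where M=m]\<close>)
        ultimately have "(1 - r) * (ln (1 / (1 - r)))^2 * (Minf r (deriv g))^2 \<le> (1 - r) * (Lg r)\<^sup>2 * m\<^sup>2"
          using Lg r by (intro mult_mono power_mono) auto
        then show ?thesis using real r by (simp add: ennreal_power ennreal_mult[symmetric] ennreal_leI)
      next
        case top
        then show ?thesis using r Lg by (simp add: ennreal_mult_top power2_eq_square)
      qed
      then show ?thesis using True by simp
    qed simp
  qed
  also note Mr_integral
  finally show ?thesis .
qed

end

text \<open>Carleson boxes are not obviously Borel, so their closures are used instead.\<close>

definition cbox_arc :: "real \<Rightarrow> real \<Rightarrow> complex set" where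
  "cbox_arc a l = (\<lambda>(r, \<theta>). of_real r * cis \<theta>) ` ({1 - l / (2 * pi)..1} \<times> {a..a+l})"

lemma cbox_arc_borel [measurable]: "cbox_arc a l \<in> sets borel"
proof -
  have "compact (cbox_arc a l)" unfolding cbox_arc_def
    by (rule compact_continuous_image) (auto intro!: continuous_intros compact_Times simp: case_prod_unfold)
  then show ?thesis by (simp add: borel_closed compact_imp_closed)
qed

text \<open>Counted over the period from a to a + 2 pi, the arc contributes its length and possibly
  the point a + 2 pi, which is congruent to the left end and has measure zero.\<close>

lemma cbox_arc_angular:
  assumes l: "0 < l" "l \<le> 2 * pi" and r: "0 < r" "r < 1"
  shows "(\<integral>\<^sup>+t. indicator (cbox_arc a l) (of_real r * cis t) \<partial>circ) \<le> ennreal l * indicator {1 - l / (2 * pi)..} r"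
proof -
  let ?u = "\<lambda>t. indicator (cbox_arc a l) (of_real r * cis t) :: ennreal"
  have [measurable]: "?u \<in> borel_measurable borel" by measurable
  have "(\<integral>\<^sup>+t. ?u t \<partial>circ) = (\<integral>\<^sup>+t\<in>{a..a+2*pi}. ?u t \<partial>lborel)"
    by (subst nn_integral_periodic) (simp_all add: cis.code nn_integral_circ)
  also have "\<dots> \<le> (\<integral>\<^sup>+t. indicator {1 - l / (2 * pi)..} r * (indicator {a..a+l} t + indicator {a+2*pi} t) \<partial>lborel)"
  proof (rule nn_integral_mono)
    fix t
    show "?u t * indicator {a..a+2*pi} t \<le> indicator {1 - l / (2 * pi)..} r * (indicator {a..a+l} t + indicator {a+2*pi} t)"
    proof (cases "of_real r * cis t \<in> cbox_arc a l \<and> t \<in> {a..a+2*pi}")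
      case True
      then obtain \<rho> \<theta> where e: "of_real r * cis t = of_real \<rho> * cis \<theta>" and \<rho>: "1 - l / (2 * pi) \<le> \<rho>" and \<theta>: "a \<le> \<theta>" "\<theta> \<le> a + l"
        unfolding cbox_arc_def by auto
      have "0 \<le> 1 - l / (2 * pi)" using l by simp
      then have \<rho>0: "0 \<le> \<rho>" using \<rho> by linarith
      have "cmod (of_real r * cis t) = cmod (of_real \<rho> * cis \<theta>)" using e by simp
      then have rr: "\<rho> = r" using r \<rho>0 by (simp add: norm_mult)
      then have ct: "cis t = cis \<theta>" using e r by simp
      have "t \<in> {a..a+l} \<or> t = a + 2 * pi"
      proof (rule ccontr)
        assume n: "\<not> ?thesis"
        then have t: "a + l < t" "t < a + 2 * pi" using True by auto
        have "cos (t - \<theta>) = 1" using ct by (simp add: cos_diff complex_eq_iff flip: power2_eq_square)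
        then obtain k :: int where k: "t - \<theta> = of_int k * 2 * pi" using cos_one_2pi_int by (auto simp: mult_ac)
        have "0 < t - \<theta>" "t - \<theta> < 2 * pi" using t \<theta> by auto
        then have "0 < (of_int k :: real)" "(of_int k :: real) < 1"
          unfolding k by (auto simp: zero_less_mult_iff mult_less_cancel_right2)
        then show False by simp
      qed
      then show ?thesis using True \<rho> rr by (auto simp: indicator_def)
    qed (auto simp: indicator_def)
  qed
  also have "\<dots> = indicator {1 - l / (2 * pi)..} r * ennreal l"
    using l by (subst nn_integral_cmult) (auto simp: nn_integral_add)
  finally show ?thesis by (simp add: mult.commute)
qed

context block_series
begin

text \<open>Inside the box 1 - r <= l/(2 pi), hence the logarithm at r is at least \<L> = 1 + ln (2
  pi / l), and (Lg r)^2 / \<L>^2 >= 1 may be inserted. Integrating in the angle gives l, and what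
  remains is the integral of \<open>Mr_integral\<close> divided by \<L>^2.\<close>

lemma g_BMOA_log: "g \<in> BMOA_log"
proof -
  obtain I where I: "0 \<le> I" "(\<integral>\<^sup>+r\<in>{0..<1}. ennreal ((1 - r) * (Lg r)\<^sup>2) * (Mr r)\<^sup>2 \<partial>lborel) = ennreal I"
    using Mr_integral by (cases "\<integral>\<^sup>+r\<in>{0..<1}. ennreal ((1 - r) * (Lg r)\<^sup>2) * (Mr r)\<^sup>2 \<partial>lborel") auto
  have "(\<integral>\<^sup>+ z\<in>Sbox a l. ennreal (1/pi * (1 - (norm z)^2) * (norm (deriv g z))^2) \<partial>lborel) \<le> ennreal ((9 * I + 1) * l / (ln (2 / l))^2)"
    if l: "0 < l" "l \<le> 2 * pi" "l \<noteq> 2" for a l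
  proof -
    define \<L> where "\<L> = 1 + ln (2 * pi / l)"
    have L1: "1 \<le> \<L>" using l by (simp add: \<L>_def)
    let ?F = "\<lambda>z. ennreal (1/pi * (1 - (cmod z)^2)) * (Mr (cmod z))\<^sup>2 * indicator (cbox_arc a l) z"
    have "(\<integral>\<^sup>+ z\<in>Sbox a l. ennreal (1/pi * (1 - (norm z)^2) * (norm (deriv g z))^2) \<partial>lborel) \<le> (\<integral>\<^sup>+z\<in>ball 0 1. ?F z \<partial>lborel)"
    proof (rule nn_integral_mono)
      fix z
      show "ennreal (1/pi * (1 - (norm z)^2) * (norm (deriv g z))^2) * indicator (Sbox a l) z \<le> ?F z * indicator (ball 0 1) z"
      proof (cases "z \<in> Sbox a l")
        case True
        then obtain r \<theta> where z: "z = of_real r * cis \<theta>" "a \<le> \<theta>" "\<theta> \<le> a + l" "1 - l / (2*pi) \<le> r" "r < 1"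
          unfolding Sbox_def by auto
        have "0 \<le> 1 - l / (2 * pi)" using l by simp
        then have "0 \<le> r" using z by linarith
        then have z1: "cmod z < 1" using z by (simp add: norm_mult)
        have "z \<in> cbox_arc a l" unfolding cbox_arc_def using z by (intro image_eqI[of _ _ "(r, \<theta>)"]) auto
        moreover have "ennreal (1/pi * (1 - (norm z)^2) * (norm (deriv g z))^2) \<le> ennreal (1/pi * (1 - (cmod z)^2)) * (Mr (cmod z))\<^sup>2"
        proof -
          have "(cmod z)\<^sup>2 \<le> 1" using z1 by (simp add: power_le_one)
          then have "ennreal (1/pi * (1 - (norm z)^2) * (norm (deriv g z))^2) = ennreal (1/pi * (1 - (norm z)^2)) * (ennreal (cmod (deriv g z)))\<^sup>2"
            by (subst ennreal_mult) (auto simp: ennreal_power)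
          also have "\<dots> \<le> ennreal (1/pi * (1 - (cmod z)^2)) * (Mr (cmod z))\<^sup>2"
            by (intro mult_left_mono power_mono deriv_g_le_Mr z1) auto
          finally show ?thesis .
        qed
        ultimately show ?thesis using True z1 by simp
      qed simp
    qed
    also have "\<dots> = (\<integral>\<^sup>+r\<in>{0..<1}. ennreal r * (\<integral>\<^sup>+t. ?F (of_real r * cis t) \<partial>circ) \<partial>lborel)"
      by (rule nn_integral_polar) measurable
    also have "\<dots> \<le> (\<integral>\<^sup>+r. ennreal (l / \<L>\<^sup>2) * (ennreal ((1 - r) * (Lg r)\<^sup>2) * (Mr r)\<^sup>2 * indicator {0..<1} r) \<partial>lborel)"
    proof (rule nn_integral_mono)
      fix r :: real
      show "ennreal r * (\<integral>\<^sup>+t. ?F (of_real r * cis t) \<partial>circ) * indicator {0..<1} r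
        \<le> ennreal (l / \<L>\<^sup>2) * (ennreal ((1 - r) * (Lg r)\<^sup>2) * (Mr r)\<^sup>2 * indicator {0..<1} r)"
      proof (cases "0 < r \<and> r < 1")
        case True
        then have r: "0 < r" "r < 1" by auto
        have "(\<integral>\<^sup>+t. ?F (of_real r * cis t) \<partial>circ) = (\<integral>\<^sup>+t. ennreal (1/pi * (1 - r^2)) * (Mr r)\<^sup>2 * indicator (cbox_arc a l) (of_real r * cis t) \<partial>circ)"
          using r by (simp add: norm_mult)
        also have "\<dots> = ennreal (1/pi * (1 - r^2)) * (Mr r)\<^sup>2 * (\<integral>\<^sup>+t. indicator (cbox_arc a l) (of_real r * cis t) \<partial>circ)"
          by (rule nn_integral_cmult) (simp add: circ_def)
        also have "\<dots> \<le> ennreal (1/pi * (1 - r^2)) * (Mr r)\<^sup>2 * (ennreal l * indicator {1 - l / (2 * pi)..} r)"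
          by (intro mult_left_mono cbox_arc_angular l r) simp
        finally have 1: "ennreal r * (\<integral>\<^sup>+t. ?F (of_real r * cis t) \<partial>circ) \<le> ennreal r * (ennreal (1/pi * (1 - r^2)) * (Mr r)\<^sup>2 * (ennreal l * indicator {1 - l / (2 * pi)..} r))"
          by (rule mult_left_mono) simp
        have 2: "ennreal r * (ennreal (1/pi * (1 - r^2)) * (Mr r)\<^sup>2 * (ennreal l * indicator {1 - l / (2 * pi)..} r))
           \<le> ennreal (l / \<L>\<^sup>2) * (ennreal ((1 - r) * (Lg r)\<^sup>2) * (Mr r)\<^sup>2)"
        proof (cases "1 - l / (2 * pi) \<le> r")
          case rl: True
          then have "1 - r \<le> l / (2 * pi)" by simp
          then have "2 * pi / l \<le> 1 / (1 - r)" using r l by (simp add: field_simps)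
          then have "ln (2 * pi / l) \<le> ln (1 / (1 - r))" using r l by (subst ln_le_cancel_iff) auto
          then have "\<L>\<^sup>2 \<le> (Lg r)\<^sup>2" using L1 by (intro power_mono) (auto simp: \<L>_def Lg_def)
          then have "1 \<le> (Lg r)\<^sup>2 / \<L>\<^sup>2" using L1 by (simp add: pos_le_divide_eq)
          moreover have "r * (1/pi * (1 - r^2)) \<le> 1 - r"
          proof -
            have "r * (1 + r) \<le> 1 * 2" using r by (intro mult_mono) auto
            also have "\<dots> \<le> pi" using pi_gt3 by simp
            finally have "(1 - r) * (r * (1 + r)) \<le> (1 - r) * pi" using r by (intro mult_left_mono) auto
            then show ?thesis by (simp add: field_simps power2_eq_square)
          qed
          moreover have "r\<^sup>2 \<le> 1" using r by (simp add: power_le_one)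
          ultimately have "r * (1/pi * (1 - r^2)) * l * 1 \<le> (1 - r) * l * ((Lg r)\<^sup>2 / \<L>\<^sup>2)"
            using r l by (intro mult_mono) auto
          then have e: "ennreal (r * (1/pi * (1 - r^2)) * l) \<le> ennreal (l / \<L>\<^sup>2 * ((1 - r) * (Lg r)\<^sup>2))"
            by (intro ennreal_leI) (simp add: mult_ac)
          have "ennreal r * (ennreal (1/pi * (1 - r^2)) * (Mr r)\<^sup>2 * (ennreal l * 1)) = ennreal (r * (1/pi * (1 - r^2)) * l) * (Mr r)\<^sup>2"
          proof -
            have "ennreal r * (ennreal x * m * (ennreal l * 1)) = ennreal (r * x * l) * m" if "0 \<le> x" for x m
              using r l that by (simp add: ennreal_mult mult_ac)
            then show ?thesis using \<open>r\<^sup>2 \<le> 1\<close> by simp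
          qed
          also have "\<dots> \<le> ennreal (l / \<L>\<^sup>2 * ((1 - r) * (Lg r)\<^sup>2)) * (Mr r)\<^sup>2" by (intro mult_right_mono e) simp
          also have "\<dots> = ennreal (l / \<L>\<^sup>2) * (ennreal ((1 - r) * (Lg r)\<^sup>2) * (Mr r)\<^sup>2)"
            using l by (subst ennreal_mult') (auto simp: mult.assoc)
          finally show ?thesis using rl by simp
        qed simp
        show ?thesis using order_trans[OF 1 2] r by simp
      next
        case False
        then show ?thesis by (cases "r = 0") (auto simp: indicator_def)
      qed
    qed
    also have "\<dots> = ennreal (l / \<L>\<^sup>2) * ennreal I" unfolding I(2)[symmetric] by (rule nn_integral_cmult) measurable
    also have "\<dots> = ennreal (l / \<L>\<^sup>2 * I)" using l I(1) by (intro ennreal_mult[symmetric]) auto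
    also have "\<dots> \<le> ennreal ((9 * I + 1) * l / (ln (2 / l))^2)"
    proof (rule ennreal_leI)
      \<comment> \<open>The target has ln (2/l), which is negative for l > 2. Its modulus is at most
        3 \<L> on either side, and squaring gives the 9; the added 1 makes the constant positive
        also when I = 0.\<close>
      have "ln (2 / l) \<le> ln (2 * pi / l)" using l pi_gt3 by (subst ln_le_cancel_iff) (auto simp: field_simps)
      moreover have "- ln (2 / l) \<le> 3"
      proof -
        have "- ln (2 / l) = ln (l / 2)" using l by (simp add: ln_div)
        also have "\<dots> \<le> l / 2 - 1" using l by (intro ln_le_minus_one) auto
        also have "\<dots> \<le> 3" using l pi_less_4 by simp
        finally show ?thesis .
      qed
      ultimately have "\<bar>ln (2 / l)\<bar> \<le> 3 * \<L>" using L1 by (auto simp: \<L>_def abs_le_iff)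
      then have "(ln (2 / l))\<^sup>2 \<le> (3 * \<L>)\<^sup>2" using abs_le_square_iff[of "ln (2 / l)" "3 * \<L>"] L1 by simp
      moreover have n0: "0 < (ln (2 / l))\<^sup>2" using l by (simp add: ln_div)
      ultimately have "1 / \<L>\<^sup>2 \<le> 9 / (ln (2 / l))\<^sup>2" using L1 by (simp add: divide_simps power_mult_distrib)
      then have "(I * l) * (1 / \<L>\<^sup>2) \<le> (I * l) * (9 / (ln (2 / l))\<^sup>2)" using I l by (intro mult_left_mono) auto
      also have "\<dots> \<le> (9 * I + 1) * l / (ln (2 / l))^2" using n0 l by (simp add: divide_simps algebra_simps)
      finally show "l / \<L>\<^sup>2 * I \<le> (9 * I + 1) * l / (ln (2 / l))^2" by (simp add: mult_ac)
    qed
    finally show ?thesis .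
  qed
  moreover have "0 < 9 * I + 1" using I by simp
  ultimately show ?thesis unfolding BMOA_log_def using g_H1 by blast
qed

end

section \<open>Multiplication on Dirichlet-type spaces\<close>

text \<open>An antiderivative is -L^(1-\<delta>)/(\<delta>-1), finite at every radius below 1; it is
  used up to \<open>rs n\<close>, followed by monotone convergence. The bound is the value of
  L^(1-\<delta>)/(\<delta>-1) at r = 0, where L = 1.\<close>

lemma nn_integral_log_weight:
  assumes d: "1 < \<delta>"
  shows "(\<integral>\<^sup>+r\<in>{0..<1}. ennreal (Lg r powr (- \<delta>) / (1 - r)) \<partial>lborel) \<le> ennreal (1 / (\<delta> - 1))"
proof -
  let ?w = "\<lambda>r. Lg r powr (- \<delta>) / (1 - r)"
  have fin: "(\<integral>\<^sup>+r\<in>{0..rs n}. ennreal (?w r) \<partial>lborel) \<le> ennreal (1 / (\<delta> - 1))" for n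
  proof -
    have "(\<integral>\<^sup>+r\<in>{0..rs n}. ennreal (?w r) \<partial>lborel) = ennreal (- (Lg (rs n) powr (1 - \<delta>)) / (\<delta> - 1) - - (Lg 0 powr (1 - \<delta>)) / (\<delta> - 1))"
    proof (rule nn_integral_FTC_Icc[where F="\<lambda>r. - (Lg r powr (1 - \<delta>)) / (\<delta> - 1)"])
      show "?w \<in> borel_measurable borel" by measurable
      fix r assume "r \<in> {0..rs n}"
      then have r: "0 \<le> r" "r \<le> rs n" by auto
      then have r1: "r < 1" using rs_bounds(2)[of n] by simp
      then have L1: "1 \<le> Lg r" using r by (intro Lg_ge_1) auto
      show "0 \<le> ?w r" using r1 by simp
      have "((\<lambda>r. 1 + ln (1 / (1 - r))) has_real_derivative 1 / (1 - r)) (at r)"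
        using r1 by (auto intro!: derivative_eq_intros simp: divide_simps)
      then have dL: "(Lg has_real_derivative 1 / (1 - r)) (at r)" unfolding Lg_def[abs_def] .
      have "((\<lambda>r. - (Lg r powr (1 - \<delta>)) / (\<delta> - 1)) has_real_derivative - ((1 - \<delta>) * Lg r powr (1 - \<delta> - 1) * (1 / (1 - r))) / (\<delta> - 1)) (at r)"
        using L1 d by (auto intro!: derivative_eq_intros dL)
      also have "- ((1 - \<delta>) * Lg r powr (1 - \<delta> - 1) * (1 / (1 - r))) / (\<delta> - 1) = ?w r"
      proof -
        have "- ((1 - \<delta>) * x * y) / (\<delta> - 1) = x * y" for x y :: real using d by (simp add: field_simps)
        from this[of "Lg r powr (1 - \<delta> - 1)" "1 / (1 - r)"] show ?thesis by (simp only: add_uminus_conv_diff[symmetric]) simp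
      qed
      finally show "((\<lambda>r. - (Lg r powr (1 - \<delta>)) / (\<delta> - 1)) has_real_derivative ?w r) (at r)" .
    qed (rule rs_bounds)
    also have "\<dots> \<le> ennreal (1 / (\<delta> - 1))"
      using d by (intro ennreal_leI) (simp add: Lg_def divide_simps)
    finally show ?thesis .
  qed
  have inc: "incseq (\<lambda>n r. ennreal (?w r) * indicator {0..rs n} r)"
  proof (intro incseq_SucI le_funI mult_left_mono)
    fix n r
    have "rs n \<le> rs (Suc n)" by (simp add: rs_def field_simps)
    then show "indicator {0..rs n} r \<le> (indicator {0..rs (Suc n)} r :: ennreal)" by (auto simp: indicator_def)
  qed simp
  have "(\<integral>\<^sup>+r\<in>{0..<1}. ennreal (?w r) \<partial>lborel) \<le> (\<integral>\<^sup>+r. (SUP n. ennreal (?w r) * indicator {0..rs n} r) \<partial>lborel)"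
  proof (rule nn_integral_mono)
    fix r :: real
    show "ennreal (?w r) * indicator {0..<1} r \<le> (SUP n. ennreal (?w r) * indicator {0..rs n} r)"
    proof (cases "r \<in> {0..<1}")
      case True
      then obtain n where "r < rs n" using order_tendstoD(1)[OF rs_tendsto, of r] by (auto simp: eventually_sequentially)
      then show ?thesis using True by (intro SUP_upper2[of n]) auto
    qed simp
  qed
  also have "\<dots> = (SUP n. \<integral>\<^sup>+r\<in>{0..rs n}. ennreal (?w r) \<partial>lborel)"
    by (rule nn_integral_monotone_convergence_SUP[OF inc]) measurable
  also have "\<dots> \<le> ennreal (1 / (\<delta> - 1))" by (intro SUP_least fin)
  finally show ?thesis .
qed

text \<open>The excess power (v h)^(q - q0) is bounded by the Bloch-type hypothesis v h <= N.
  Integrability thus passes from the smaller exponent to the larger one.\<close>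

lemma powr_raise:
  fixes v h N :: real
  assumes "0 \<le> v" "0 < h" "v * h \<le> N" "q0 \<le> q"
  shows "v powr q * h powr (q - 1) \<le> N powr (q - q0) * (v powr q0 * h powr (q0 - 1))"
proof (cases "v = 0")
  case False
  have "v powr q * h powr (q - 1) = (v * h) powr (q - q0) * (v powr q0 * h powr (q0 - 1))"
    using assms by (simp add: powr_mult powr_diff powr_add field_simps False)
  also have "\<dots> \<le> N powr (q - q0) * (v powr q0 * h powr (q0 - 1))"
    using assms by (intro mult_right_mono powr_mono2) auto
  finally show ?thesis .
qed simp

lemma powr_add_le:
  fixes u v :: real
  assumes "0 \<le> u" "0 \<le> v" "0 < q"
  shows "(u + v) powr q \<le> 2 powr q * (u powr q + v powr q)"
proof -
  have "(u + v) powr q \<le> (2 * max u v) powr q" using assms by (intro powr_mono2) auto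
  also have "\<dots> = 2 powr q * (max u v) powr q" using assms by (simp add: powr_mult)
  also have "\<dots> \<le> 2 powr q * (u powr q + v powr q)" by (intro mult_left_mono) (auto simp: max_def)
  finally show ?thesis .
qed

text \<open>Young's inequality with exponents \<open>2/q\<close> and \<open>2/(2-q)\<close>. The bound \<open>q \<le> 2/3\<close> makes the resulting power
  of \<open>\<phi>\<close> at most one.\<close>

lemma weighted_Young:
  fixes \<phi> \<gamma> h L :: real
  assumes pos: "0 \<le> \<phi>" "0 \<le> \<gamma>" "0 < h" "1 \<le> L" and q: "0 < q" "q \<le> 2 / 3"
  shows "(\<phi> * \<gamma>) powr q * h powr (q - 1) \<le> h * L ^ 3 * \<gamma>\<^sup>2 + (1 + \<phi>) * (L powr (- (3 * q / (2 - q))) / h)"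
proof (cases "\<phi> = 0 \<or> \<gamma> = 0")
  case True
  then show ?thesis using pos by auto
next
  case False
  then have pp: "0 < \<phi>" "0 < \<gamma>" "0 < L" using pos by auto
  define s where "s = 2 * q / (2 - q)"
  define X where "X = h * L ^ 3 * \<gamma>\<^sup>2"
  define Y where "Y = \<phi> powr s * L powr (- (3 * q / (2 - q))) / h"
  have XY: "0 < X" "0 < Y" using pp pos by (auto simp: X_def Y_def)
  \<comment> \<open>All quantities are positive, so the identity of the left side with X^(q/2) Y^(1
    - q/2) is verified by comparing logarithms.\<close>
  have "ln ((\<phi> * \<gamma>) powr q * h powr (q - 1)) = q * (ln \<phi> + ln \<gamma>) + (q - 1) * ln h"
    using pp pos by (simp add: ln_mult ln_powr)
  also have "\<dots> = q / 2 * (ln h + 3 * ln L + 2 * ln \<gamma>) + (1 - q / 2) * (s * ln \<phi> - 3 * q / (2 - q) * ln L - ln h)"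
  proof -
    have "(1 - q / 2) * s = q" "(1 - q / 2) * (3 * q / (2 - q)) = 3 * q / 2" using q by (auto simp: s_def field_simps)
    then have "(1 - q / 2) * (s * ln \<phi> - 3 * q / (2 - q) * ln L - ln h) = q * ln \<phi> - 3 * q / 2 * ln L - (1 - q / 2) * ln h"
      by (simp only: right_diff_distrib mult.assoc[symmetric])
    then show ?thesis by (simp add: algebra_simps)
  qed
  also have "\<dots> = ln (X powr (q / 2) * Y powr (1 - q / 2))"
    using XY pp pos by (simp add: X_def Y_def ln_mult ln_div ln_powr ln_realpow)
  finally have "(\<phi> * \<gamma>) powr q * h powr (q - 1) = X powr (q / 2) * Y powr (1 - q / 2)"
    using XY pp pos by (subst (asm) ln_inj_iff) auto
  also have "\<dots> \<le> (X + Y) powr (q / 2) * (X + Y) powr (1 - q / 2)"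
    using XY q by (intro mult_mono powr_mono2) auto
  also have "\<dots> = X + Y" using XY by (simp add: powr_add[symmetric])
  also have "Y \<le> (1 + \<phi>) * (L powr (- (3 * q / (2 - q))) / h)"
  proof -
    have s: "0 \<le> s" "s \<le> 1" using q by (auto simp: s_def field_simps)
    have "\<phi> powr s \<le> (1 + \<phi>) powr s" using s pp by (intro powr_mono2) auto
    also have "\<dots> \<le> (1 + \<phi>) powr 1" using s pp by (intro powr_mono) auto
    finally have "\<phi> powr s \<le> 1 + \<phi>" using pp by simp
    then have "\<phi> powr s * (L powr (- (3 * q / (2 - q))) / h) \<le> (1 + \<phi>) * (L powr (- (3 * q / (2 - q))) / h)"
      using pos by (intro mult_right_mono) auto
    then show ?thesis by (simp add: Y_def)
  qed
  finally show ?thesis by (simp add: X_def)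
qed

text \<open>The circular means of |f| are bounded uniformly in r, so only the radial weight has to
  be integrable, which is the case for \<delta> > 1.\<close>

lemma H1_log_area:
  assumes f: "f \<in> H1" and d: "1 < \<delta>"
  shows "(\<integral>\<^sup>+z\<in>ball 0 1. ennreal ((1 + cmod (f z)) * (Lg (cmod z) powr (- \<delta>) / (1 - cmod z))) \<partial>lborel) < \<infinity>"
proof -
  obtain A where hol: "f holomorphic_on ball 0 1" and A: "0 \<le> A"
     "\<And>r. 0 \<le> r \<Longrightarrow> r < 1 \<Longrightarrow> (\<integral>\<^sup>+t. ennreal (cmod (f (of_real r * cis t))) \<partial>circ) \<le> ennreal A"
    using f unfolding H1_iff by metis
  note cont = holomorphic_on_imp_continuous_on[OF hol]
  let ?F = "\<lambda>z. ennreal ((1 + cmod (f z)) * (Lg (cmod z) powr (- \<delta>) / (1 - cmod z)))"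
  define f0 where "f0 z = (if z \<in> ball 0 1 then f z else 0)" for z
  have [measurable]: "f0 \<in> borel_measurable borel" unfolding f0_def[abs_def] by (rule disc_measurable[OF cont])
  have "(\<lambda>z. ?F z * indicator (ball 0 1) z) = (\<lambda>z. ennreal ((1 + cmod (f0 z)) * (Lg (cmod z) powr (- \<delta>) / (1 - cmod z))) * indicator (ball 0 1) z)"
    by (auto simp: f0_def indicator_def)
  moreover have "\<dots> \<in> borel_measurable borel" by measurable
  ultimately have m: "(\<lambda>z. ?F z * indicator (ball 0 1) z) \<in> borel_measurable borel" by simp
  have "(\<integral>\<^sup>+z\<in>ball 0 1. ?F z \<partial>lborel) = (\<integral>\<^sup>+r\<in>{0..<1}. ennreal r * (\<integral>\<^sup>+t. ?F (of_real r * cis t) \<partial>circ) \<partial>lborel)"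
    by (rule nn_integral_polar_disc[OF m])
  also have "\<dots> \<le> (\<integral>\<^sup>+r. ennreal (2 * pi + A) * (ennreal (Lg r powr (- \<delta>) / (1 - r)) * indicator {0..<1} r) \<partial>lborel)"
  proof (rule nn_integral_mono)
    fix r :: real
    show "ennreal r * (\<integral>\<^sup>+t. ?F (of_real r * cis t) \<partial>circ) * indicator {0..<1} r \<le> ennreal (2 * pi + A) * (ennreal (Lg r powr (- \<delta>) / (1 - r)) * indicator {0..<1} r)"
    proof (cases "r \<in> {0..<1}")
      case True
      then have r: "0 \<le> r" "r < 1" by auto
      let ?w = "Lg r powr (- \<delta>) / (1 - r)"
      have w: "0 \<le> ?w" using r by simp
      have [measurable]: "(\<lambda>t. f (of_real r * cis t)) \<in> borel_measurable circ"
        using measurable_disc_circle[OF cont r] by (simp add: circ_def)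
      have "(\<integral>\<^sup>+t. ?F (of_real r * cis t) \<partial>circ) = (\<integral>\<^sup>+t. (1 + ennreal (cmod (f (of_real r * cis t)))) * ennreal ?w \<partial>circ)"
        using r w by (intro nn_integral_cong) (simp add: norm_mult ennreal_mult ennreal_plus del: times_divide_eq_right)
      also have "\<dots> = (\<integral>\<^sup>+t. 1 + ennreal (cmod (f (of_real r * cis t))) \<partial>circ) * ennreal ?w"
        by (rule nn_integral_multc) measurable
      also have "(\<integral>\<^sup>+t. 1 + ennreal (cmod (f (of_real r * cis t))) \<partial>circ) = ennreal (2 * pi) + (\<integral>\<^sup>+t. ennreal (cmod (f (of_real r * cis t))) \<partial>circ)"
        by (subst nn_integral_add) (auto simp: circ_def emeasure_density)
      also have "\<dots> \<le> ennreal (2 * pi) + ennreal A" by (intro add_left_mono A r)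
      finally have "(\<integral>\<^sup>+t. ?F (of_real r * cis t) \<partial>circ) \<le> ennreal (2 * pi + A) * ennreal ?w"
        using A(1) by (simp add: ennreal_plus mult_right_mono)
      then have "ennreal r * (\<integral>\<^sup>+t. ?F (of_real r * cis t) \<partial>circ) \<le> 1 * (ennreal (2 * pi + A) * ennreal ?w)"
        using r by (intro mult_mono) auto
      then show ?thesis using True by simp
    qed simp
  qed
  also have "\<dots> = ennreal (2 * pi + A) * (\<integral>\<^sup>+r\<in>{0..<1}. ennreal (Lg r powr (- \<delta>) / (1 - r)) \<partial>lborel)"
    by (rule nn_integral_cmult) measurable
  also have "\<dots> \<le> ennreal (2 * pi + A) * ennreal (1 / (\<delta> - 1))"
    by (intro mult_left_mono nn_integral_log_weight d) simp
  also have "\<dots> < \<infinity>" by (simp add: ennreal_mult_less_top)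
  finally show ?thesis .
qed

lemma one_BMOA: "(\<lambda>z. 1) \<in> BMOA"
proof -
  have b: "bdry (\<lambda>z. 1) t = 1" for t by (rule bdry_eqI) simp
  have h: "(\<lambda>z. 1) \<in> H1" unfolding H1_iff by (intro conjI exI[of _ "2 * pi"]) (auto simp: emeasure_circ)
  interpret circle_L1 "bdry (\<lambda>z. 1)" by (rule H1_circle_L1[OF h])
  have "bmo_const (bdry (\<lambda>z. 1)) (2 * 0)"
    by (rule bmo_constI) (auto simp: b intro!: exI[of _ 1])
  then show ?thesis unfolding BMOA_iff using h by blast
qed

context block_series
begin

text \<open>Each part of the derivative is lowered to a convenient exponent by
  \<open>powr_raise\<close>: f' g to the exponent p at which f is given, and f g' to q0, where
  \<open>weighted_Young\<close> applies. The three resulting integrals are the D^p integral of f,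
  \<open>area_deriv_g\<close> and \<open>H1_log_area\<close>.\<close>

lemma mult_Dir:
  assumes f: "f \<in> Dir p" "f \<in> BMOA" and pq: "0 < p" "p \<le> q" "1 / 2 < q"
  shows "(\<lambda>z. f z * g z) \<in> Dir q"
proof -
  have f1: "f \<in> H1" and hol: "f holomorphic_on ball 0 1" using f by (auto simp: BMOA_def H1_def udisc_def)
  obtain B' where B': "0 \<le> B'" "\<And>z. cmod z < 1 \<Longrightarrow> cmod (g z) \<le> B'" using g_bounded by auto
  define B where "B = B' + 1"
  have B: "0 < B" "\<And>z. cmod z < 1 \<Longrightarrow> cmod (g z) \<le> B" using B' by (auto simp: B_def intro: add_increasing2)
  obtain M where M: "0 \<le> M" "\<And>z. cmod z < 1 \<Longrightarrow> cmod (deriv f z) * (1 - cmod z) \<le> M" using BMOA_Bloch[OF f(2)] by auto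
  obtain M' where M': "0 \<le> M'" "\<And>z. cmod z < 1 \<Longrightarrow> cmod (deriv (\<lambda>z. f z * g z) z) * (1 - cmod z) \<le> M'"
    using BMOA_Bloch[OF mult_BMOA[OF f(2)]] by auto
  have dprod: "deriv (\<lambda>z. f z * g z) z = f z * deriv g z + deriv f z * g z" if z: "cmod z < 1" for z
  proof (rule DERIV_imp_deriv)
    have "(f has_field_derivative deriv f z) (at z)" "(g has_field_derivative deriv g z) (at z)"
      using hol g_holomorphic z by (auto intro!: holomorphic_derivI[of _ "ball 0 1"])
    then show "((\<lambda>z. f z * g z) has_field_derivative f z * deriv g z + deriv f z * g z) (at z)"
      by (auto intro!: derivative_eq_intros)
  qed
  \<comment> \<open>\<open>weighted_Young\<close> asks for q0 <= 2/3, while q0 > 1/2 is equivalent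
    to 3 q0/(2 - q0) > 1.\<close>
  define q0 where "q0 = min q (2 / 3)"
  have q0: "1 / 2 < q0" "q0 \<le> q" "q0 \<le> 2 / 3" using pq by (auto simp: q0_def)
  define \<delta> where "\<delta> = 3 * q0 / (2 - q0)"
  have \<delta>: "1 < \<delta>" using q0 by (simp add: \<delta>_def field_simps)
  define N where "N = M' + M * B"
  define c1 where "c1 = 2 powr q * ((B * M) powr (q - p) * B powr p)"
  define c2 where "c2 = 2 powr q * N powr (q - q0)"
  have c: "0 \<le> c1" "0 \<le> c2" by (auto simp: c1_def c2_def)
  let ?P = "\<lambda>z. ennreal (1 / pi * (1 - cmod z) powr (p - 1) * cmod (deriv f z) powr p)"
  let ?G = "\<lambda>z. ennreal ((1 - cmod z) * Lg (cmod z) ^ 3 * (cmod (deriv g z))\<^sup>2)"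
  let ?H = "\<lambda>z. ennreal ((1 + cmod (f z)) * (Lg (cmod z) powr (- \<delta>) / (1 - cmod z)))"
  have pw: "ennreal (1 / pi * (1 - cmod z) powr (q - 1) * cmod (deriv (\<lambda>z. f z * g z) z) powr q) \<le> ennreal c1 * ?P z + ennreal c2 * (?G z + ?H z)"
    if z: "cmod z < 1" for z
  proof -
    define h where "h = 1 - cmod z"
    have h: "0 < h" using z by (simp add: h_def)
    define u where "u = B * cmod (deriv f z)"
    define v where "v = cmod (f z) * cmod (deriv g z)"
    have uv0: "0 \<le> u" "0 \<le> v" using B by (auto simp: u_def v_def)
    have dd: "cmod (deriv f z * g z) \<le> u" unfolding u_def norm_mult using B(2)[OF z]
      by (metis mult.commute mult_right_mono norm_ge_zero)
    have uh: "u * h \<le> B * M" using M(2)[OF z] B(1) by (simp add: u_def h_def mult.assoc)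
    \<comment> \<open>f may be unbounded, so a Bloch bound on g alone would not control f g'.
      Instead f g' is written as (f g)' - f' g, and the Bloch bound for f g comes from
      \<open>mult_BMOA\<close>.\<close>
    have "v * h = cmod (f z * deriv g z) * h" by (simp add: v_def norm_mult)
    also have "f z * deriv g z = deriv (\<lambda>z. f z * g z) z - deriv f z * g z" using dprod[OF z] by simp
    also have "cmod \<dots> * h \<le> (cmod (deriv (\<lambda>z. f z * g z) z) + u) * h"
      using h dd by (intro mult_right_mono order_trans[OF norm_triangle_ineq4] add_left_mono) auto
    also have "\<dots> \<le> N" using add_mono[OF M'(2)[OF z] uh] by (simp add: N_def h_def algebra_simps)
    finally have vh: "v * h \<le> N" .
    have "cmod (deriv (\<lambda>z. f z * g z) z) \<le> u + v"
      unfolding dprod[OF z] using dd by (intro norm_triangle_le) (simp add: v_def norm_mult)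
    then have "cmod (deriv (\<lambda>z. f z * g z) z) powr q \<le> (u + v) powr q" using pq by (intro powr_mono2) auto
    also have "\<dots> \<le> 2 powr q * (u powr q + v powr q)" using uv0 pq by (intro powr_add_le) auto
    finally have "h powr (q - 1) * cmod (deriv (\<lambda>z. f z * g z) z) powr q \<le> h powr (q - 1) * (2 powr q * (u powr q + v powr q))"
      by (rule mult_left_mono) simp
    also have "\<dots> = 2 powr q * (u powr q * h powr (q - 1) + v powr q * h powr (q - 1))"
      by (simp add: algebra_simps)
    also have "\<dots> \<le> 2 powr q * ((B * M) powr (q - p) * (u powr p * h powr (p - 1)) + N powr (q - q0) * (v powr q0 * h powr (q0 - 1)))"
      by (intro mult_left_mono add_mono powr_raise uv0 h uh vh pq q0) simp
    also have "\<dots> \<le> 2 powr q * ((B * M) powr (q - p) * (u powr p * h powr (p - 1)) + N powr (q - q0) * (h * Lg (cmod z) ^ 3 * (cmod (deriv g z))\<^sup>2 + (1 + cmod (f z)) * (Lg (cmod z) powr (- \<delta>) / h)))"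
      unfolding v_def \<delta>_def using q0 h z by (intro mult_left_mono add_left_mono weighted_Young Lg_ge_1) auto
    also have "u powr p = B powr p * cmod (deriv f z) powr p" using B by (simp add: u_def powr_mult)
    finally have le: "h powr (q - 1) * cmod (deriv (\<lambda>z. f z * g z) z) powr q \<le> 
       c1 * (h powr (p - 1) * cmod (deriv f z) powr p) + c2 * (h * Lg (cmod z) ^ 3 * (cmod (deriv g z))\<^sup>2 + (1 + cmod (f z)) * (Lg (cmod z) powr (- \<delta>) / h))"
      by (simp only: c1_def c2_def distrib_left mult_ac)
    have nn: "0 \<le> h * Lg (cmod z) ^ 3 * (cmod (deriv g z))\<^sup>2" "0 \<le> (1 + cmod (f z)) * (Lg (cmod z) powr (- \<delta>) / h)"
      using h Lg_ge_1[of "cmod z"] z by auto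
    have gen: "ennreal (1 / pi * a * x) \<le> ennreal c1 * ennreal (1 / pi * w * y) + ennreal c2 * (ennreal s + ennreal t)"
      if "a * x \<le> c1 * (w * y) + c2 * (s + t)" "0 \<le> w * y" "0 \<le> s" "0 \<le> t" for a x w y s t :: real
    proof -
      have "1 / pi * (a * x) \<le> 1 / pi * (c1 * (w * y)) + 1 / pi * (c2 * (s + t))"
        using mult_left_mono[OF that(1), of "1 / pi"] by (simp add: distrib_left)
      also have "1 / pi * (c2 * (s + t)) \<le> 1 * (c2 * (s + t))"
        using pi_gt3 c that by (intro mult_right_mono) auto
      finally have "1 / pi * a * x \<le> c1 * (1 / pi * w * y) + c2 * (s + t)" by (simp add: mult_ac)
      then have "ennreal (1 / pi * a * x) \<le> ennreal (c1 * (1 / pi * w * y) + c2 * (s + t))" by (rule ennreal_leI)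
      also have "\<dots> = ennreal c1 * ennreal (1 / pi * w * y) + ennreal c2 * (ennreal s + ennreal t)"
      proof -
        have "ennreal (c1 * x + c2 * (s + t)) = ennreal c1 * ennreal x + ennreal c2 * (ennreal s + ennreal t)" if "0 \<le> x" for x
          using c that \<open>0 \<le> s\<close> \<open>0 \<le> t\<close> by (simp add: ennreal_plus ennreal_mult)
        from this[of "1 / pi * w * y"] show ?thesis using \<open>0 \<le> w * y\<close> by (simp add: mult.assoc)
      qed
      finally show ?thesis .
    qed
    show ?thesis using gen[OF le _ nn] unfolding h_def by simp
  qed
  have dcont: "continuous_on (ball 0 1) (deriv g)" "continuous_on (ball 0 1) (deriv f)" "continuous_on (ball 0 1) f"
    by (intro holomorphic_on_imp_continuous_on holomorphic_deriv g_holomorphic hol open_ball)+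
  define f0 where "f0 z = (if z \<in> ball 0 1 then f z else 0)" for z
  define f' where "f' z = (if z \<in> ball 0 1 then deriv f z else 0)" for z
  define g' where "g' z = (if z \<in> ball 0 1 then deriv g z else 0)" for z
  have [measurable]: "f0 \<in> borel_measurable borel" "f' \<in> borel_measurable borel" "g' \<in> borel_measurable borel"
    unfolding f0_def[abs_def] f'_def[abs_def] g'_def[abs_def] by (intro disc_measurable dcont)+
  have "(\<lambda>z. ?P z * indicator (ball 0 1) z) = (\<lambda>z. ennreal (1 / pi * (1 - cmod z) powr (p - 1) * cmod (f' z) powr p) * indicator (ball 0 1) z)"
    by (auto simp: f'_def indicator_def)
  moreover have "\<dots> \<in> borel_measurable borel" by measurable
  ultimately have mP [measurable]: "(\<lambda>z. ?P z * indicator (ball 0 1) z) \<in> borel_measurable borel" by simp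
  have "(\<lambda>z. ?G z * indicator (ball 0 1) z) = (\<lambda>z. ennreal ((1 - cmod z) * Lg (cmod z) ^ 3 * (cmod (g' z))\<^sup>2) * indicator (ball 0 1) z)"
    by (auto simp: g'_def indicator_def)
  moreover have "\<dots> \<in> borel_measurable borel" by measurable
  ultimately have mG [measurable]: "(\<lambda>z. ?G z * indicator (ball 0 1) z) \<in> borel_measurable borel" by simp
  have "(\<lambda>z. ?H z * indicator (ball 0 1) z) = (\<lambda>z. ennreal ((1 + cmod (f0 z)) * (Lg (cmod z) powr (- \<delta>) / (1 - cmod z))) * indicator (ball 0 1) z)"
    by (auto simp: f0_def indicator_def)
  moreover have "\<dots> \<in> borel_measurable borel" by measurable
  ultimately have mH [measurable]: "(\<lambda>z. ?H z * indicator (ball 0 1) z) \<in> borel_measurable borel" by simp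
  have "(\<integral>\<^sup>+z\<in>ball 0 1. ennreal (1 / pi * (1 - cmod z) powr (q - 1) * cmod (deriv (\<lambda>z. f z * g z) z) powr q) \<partial>lborel)
    \<le> (\<integral>\<^sup>+z. ennreal c1 * (?P z * indicator (ball 0 1) z) + ennreal c2 * (?G z * indicator (ball 0 1) z + ?H z * indicator (ball 0 1) z) \<partial>lborel)"
  proof (rule nn_integral_mono)
    fix z :: complex
    show "ennreal (1 / pi * (1 - cmod z) powr (q - 1) * cmod (deriv (\<lambda>z. f z * g z) z) powr q) * indicator (ball 0 1) z
      \<le> ennreal c1 * (?P z * indicator (ball 0 1) z) + ennreal c2 * (?G z * indicator (ball 0 1) z + ?H z * indicator (ball 0 1) z)"
    proof (cases "cmod z < 1")
      case True
      then have "indicator (ball 0 1) z = (1 :: ennreal)" by simp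
      then show ?thesis using pw[OF True] by (simp only: mult_1_right)
    qed simp
  qed
  also have "\<dots> = ennreal c1 * (\<integral>\<^sup>+z\<in>ball 0 1. ?P z \<partial>lborel) + ennreal c2 * ((\<integral>\<^sup>+z\<in>ball 0 1. ?G z \<partial>lborel) + (\<integral>\<^sup>+z\<in>ball 0 1. ?H z \<partial>lborel))"
    using mP mG mH by (simp add: nn_integral_add nn_integral_cmult)
  also have "\<dots> < \<infinity>"
    using f(1) area_deriv_g H1_log_area[OF f1 \<delta>] by (simp add: Dir_def udisc_def ennreal_mult_less_top)
  finally show ?thesis unfolding Dir_def udisc_def using hol g_holomorphic by (auto intro!: holomorphic_intros)
qed

lemma g_Mult_BMOA: "g \<in> Mult BMOA BMOA"
  unfolding Mult_def udisc_def using mult_BMOA g_holomorphic by blast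

lemma g_Mult_Dir: "0 < p \<Longrightarrow> p \<le> q \<Longrightarrow> 1 / 2 < q \<Longrightarrow> g \<in> Mult (Dir p \<inter> BMOA) (Dir q \<inter> BMOA)"
  unfolding Mult_def udisc_def using mult_BMOA mult_Dir g_holomorphic by blast

end

section \<open>A lacunary series\<close>

text \<open>At n = 1024^k the base is k + 1. The large ratio 1024 leaves room for explicit
  constants: on suitable annuli one term has to outweigh all the others for every choice of
  signs.\<close>

definition lac :: "real \<Rightarrow> nat \<Rightarrow> complex" where
  "lac \<beta> n = (if n \<in> range (\<lambda>k. 1024 ^ k) then of_real ((log 1024 (real n) + 1) powr (- \<beta>)) else 0)"

lemma lac_power: "lac \<beta> (1024 ^ k) = of_real ((real k + 1) powr (- \<beta>))"
proof -
  have "log 1024 (real (1024 ^ k)) = real k" by (simp add: log_nat_power)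
  then show ?thesis unfolding lac_def by simp
qed

lemma strict_mono_1024: "strict_mono (\<lambda>k. 1024 ^ k :: nat)"
  by (auto simp: strict_mono_def)

text \<open>At 1024^k the cubed logarithm is of order k^3, so the series behaves like the sum of
  k^(3 - 2 \<beta>), which converges precisely for \<beta> > 2.\<close>

lemma coeff_cond_lac:
  assumes "2 < \<beta>"
  shows "coeff_cond (lac \<beta>)"
proof -
  let ?F = "\<lambda>n. (norm (lac \<beta> n))\<^sup>2 * (ln (real n)) ^ 3"
  have "summable (\<lambda>n. real n powr (3 - 2 * \<beta>))" using assms by (subst summable_real_powr_iff) auto
  then have s: "summable (\<lambda>k. ln 1024 ^ 3 * real (Suc k) powr (3 - 2 * \<beta>))"
    by (intro summable_mult) (subst summable_Suc_iff)
  have "summable (\<lambda>k. ?F (1024 ^ k))"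
  proof (rule summable_comparison_test_ev[OF _ s], intro always_eventually allI)
    fix k
    have "norm (?F (1024 ^ k)) = (real k + 1) powr (- (2 * \<beta>)) * (real k * ln 1024) ^ 3"
      by (simp add: lac_power ln_realpow power2_eq_square powr_add[symmetric])
    also have "\<dots> \<le> (real k + 1) powr (- (2 * \<beta>)) * ((real k + 1) * ln 1024) ^ 3"
      by (intro mult_left_mono power_mono mult_right_mono) auto
    also have "\<dots> = ln 1024 ^ 3 * ((real k + 1) powr (- (2 * \<beta>)) * (real k + 1) powr 3)"
      by (simp add: power_mult_distrib)
    also have "\<dots> = ln 1024 ^ 3 * real (Suc k) powr (3 - 2 * \<beta>)"
      by (simp only: powr_add[symmetric]) (simp add: add.commute)
    finally show "norm (?F (1024 ^ k)) \<le> ln 1024 ^ 3 * real (Suc k) powr (3 - 2 * \<beta>)" .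
  qed
  then have "summable ?F"
    by (subst (asm) summable_mono_reindex[OF strict_mono_1024]) (auto simp: lac_def)
  then show ?thesis unfolding coeff_cond_def by (subst summable_Suc_iff)
qed

text \<open>A Rademacher function vanishes only where 2^n t is a multiple of 1/2, in particular only
  at rational t. Discarding all rationals is a convenient way to have every sign nonzero at
  once.\<close>

lemma rad_irrational:
  assumes "t \<notin> \<rat>"
  shows "\<bar>rad n t\<bar> = 1"
proof -
  have "2 ^ n * t \<notin> \<rat>"
  proof
    assume "2 ^ n * t \<in> \<rat>"
    then have "2 ^ n * t / 2 ^ n \<in> \<rat>" by (intro Rats_divide) auto
    then show False using assms by simp
  qed
  moreover have "2 ^ n * t = frac (2 ^ n * t) + of_int \<lfloor>2 ^ n * t\<rfloor>" by (simp add: frac_def)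
  ultimately have "frac (2 ^ n * t) \<notin> \<rat>" using Rats_add[OF _ Rats_of_int] by metis
  then have "frac (2 ^ n * t) \<noteq> 0" "frac (2 ^ n * t) \<noteq> 1 / 2" using Rats_number_of by force+
  then show ?thesis using frac_ge_0[of "2 ^ n * t"] unfolding rad_def rad0_def Let_def by auto
qed

lemma AE_irrational: "AE t in lborel. (t::real) \<notin> \<rat>"
proof (rule AE_I'[of "\<rat>"])
  show "\<rat> \<in> null_sets (lborel :: real measure)" by (rule countable_imp_null_set_lborel[OF countable_rat])
qed auto

text \<open>Only the moduli of the coefficients are prescribed, so the conclusions hold for every
  choice of signs.\<close>

locale lacunary =
  fixes \<beta> :: real and \<gamma> :: "nat \<Rightarrow> complex"
  assumes \<beta>: "0 < \<beta>" "\<beta> \<le> 3"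
    and \<gamma>: "cmod (\<gamma> k) = (real k + 1) powr (- \<beta>)"
begin

definition N :: "nat \<Rightarrow> real" where "N k = 1024 ^ k"

lemma N_pos: "0 < N k" by (simp add: N_def)

text \<open>By \<beta> <= 3 consecutive coefficients shrink by at most the factor 8, and 1024/8 =
  128.\<close>

lemma \<gamma>_growth: "128 * (N k * cmod (\<gamma> k)) \<le> N (Suc k) * cmod (\<gamma> (Suc k))"
proof -
  have "2 powr (- 3) * (real k + 1) powr (- \<beta>) \<le> 2 powr (- \<beta>) * (real k + 1) powr (- \<beta>)"
    using \<beta> by (intro mult_right_mono powr_mono) auto
  also have "\<dots> = (2 * (real k + 1)) powr (- \<beta>)" by (rule powr_mult[symmetric])
  also have "\<dots> \<le> (real (Suc k) + 1) powr (- \<beta>)" using \<beta> by (intro powr_mono2') auto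
  finally have "cmod (\<gamma> k) \<le> 8 * cmod (\<gamma> (Suc k))" by (simp add: \<gamma> powr_minus)
  then show ?thesis using N_pos[of k] by (simp add: N_def mult_left_mono)
qed

text \<open>A geometric sum with ratio 128; 127 is the constant that reproduces itself, since (1 +
  1/127)/128 = 1/127.\<close>

lemma low_terms: "(\<Sum>j<k. N j * cmod (\<gamma> j)) \<le> N k * cmod (\<gamma> k) / 127"
proof (induction k)
  case (Suc k)
  then show ?case using \<gamma>_growth[of k] by simp
qed (simp add: N_def)

lemma \<gamma>_mono: "cmod (\<gamma> (k + i)) \<le> cmod (\<gamma> k)"
  unfolding \<gamma> using \<beta> by (intro powr_mono2') auto

text \<open>Bernoulli's inequality is used for a quarter of the exponent, where it still gives 1/2,
  and the result is raised to the fourth power. k >= 1 makes 1024^k divisible by 4 and keeps r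
  nonnegative.\<close>

lemma main_term:
  assumes k: "1 \<le> k" and r: "1 - 2 / N k \<le> r" "r < 1"
  shows "1 / 16 \<le> r ^ (1024 ^ k - 1)"
proof -
  define m where "m = 256 * (1024 :: nat) ^ (k - 1)"
  have "(1024::nat) ^ k = 1024 * 1024 ^ (k - 1)" using k by (cases k) auto
  then have m: "1024 ^ k = 4 * m" by (simp add: m_def)
  then have Nm: "N k = 4 * real m" unfolding N_def by (metis of_nat_mult of_nat_numeral of_nat_power)
  have m1: "1 \<le> m" by (simp add: m_def)
  have x: "2 / N k \<le> 1 / 2" unfolding Nm using m1 by (simp add: field_simps)
  then have r0: "0 \<le> r" using r by simp
  have "1 - real m * (2 / N k) \<le> (1 - 2 / N k) ^ m"
    using Bernoulli_inequality[of "- (2 / N k)" m] x by simp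
  then have "1 / 2 \<le> (1 - 2 / N k) ^ m" unfolding Nm using m1 by simp
  also have "\<dots> \<le> r ^ m" using r x by (intro power_mono) auto
  finally have "(1 / 2) ^ 4 \<le> (r ^ m) ^ 4" by (intro power_mono) auto
  also have "\<dots> = r ^ (4 * m)" by (simp add: power_mult[symmetric] mult.commute)
  also have "\<dots> \<le> r ^ (1024 ^ k - 1)" unfolding m using r0 r by (intro power_decreasing) auto
  finally show ?thesis by (simp add: power4_eq_xxxx)
qed

lemma high_term:
  assumes k: "1 \<le> k" and r: "1 - 2 / N k \<le> r" "r \<le> 1 - 1 / N k"
  shows "N (k + Suc i) * cmod (\<gamma> (k + Suc i)) * r ^ (1024 ^ (k + Suc i) - 1) \<le> N k * cmod (\<gamma> k) * (4 / 1024 ^ Suc i)"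
proof -
  define x where "x = (1024::real) ^ Suc i"
  have x: "0 < x" by (simp add: x_def)
  define M where "M = (1024::nat) ^ (k + Suc i)"
  have M: "real M = N k * x" by (simp add: M_def N_def x_def power_add)
  have N4: "4 \<le> N k"
  proof -
    have "(1024::real) ^ 1 \<le> 1024 ^ k" using k by (intro power_increasing) auto
    then show ?thesis by (simp add: N_def)
  qed
  then have "2 / N k \<le> 2 / 4" by (intro divide_left_mono) auto
  then have r2: "1 / 2 \<le> r" using r by simp
  \<comment> \<open>Replacing the exponent M - 1 of the derivative by M costs a factor 2, because r
    >= 1/2.\<close>
  have "r * r ^ (M - 1) = r ^ M" by (cases M) (auto simp: M_def)
  moreover have "1 / 2 * r ^ (M - 1) \<le> r * r ^ (M - 1)" using r2 by (intro mult_right_mono) auto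
  ultimately have "r ^ (M - 1) \<le> 2 * r ^ M" by simp
  also have "r ^ M \<le> exp (- (1 / N k)) ^ M"
    using r r2 exp_ge_add_one_self[of "- (1 / N k)"] by (intro power_mono) auto
  also have "exp (- (1 / N k)) ^ M = exp (- x)" using M N_pos[of k] by (simp flip: exp_of_nat_mult)
  \<comment> \<open>Quadratic decay suffices: one power of x compensates the growth of N, the other
    gives a convergent geometric series.\<close>
  also have "exp (- x) \<le> 2 / x\<^sup>2"
    using exp_lower_Taylor_quadratic[of x] x by (simp add: exp_minus field_simps)
  finally have "r ^ (M - 1) \<le> 4 / x\<^sup>2" by simp
  then have "(N k * x) * cmod (\<gamma> (k + Suc i)) * r ^ (M - 1) \<le> (N k * x) * cmod (\<gamma> k) * (4 / x\<^sup>2)"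
    using x r2 N_pos[of k] \<gamma>_mono[of k "Suc i"] by (intro mult_mono) auto
  also have "\<dots> = N k * cmod (\<gamma> k) * (4 / x)" using x by (simp add: power2_eq_square)
  finally show ?thesis using M by (simp add: N_def x_def M_def)
qed

text \<open>The k-th term has modulus at least P/16 with P = N k |\<gamma> k|, the lower terms add
  up to at most P/127 and the higher ones to at most 4 P/1023; the difference exceeds P/32.\<close>

lemma lacunary_lower:
  assumes k: "1 \<le> k" and z: "1 - 2 / N k \<le> cmod z" "cmod z \<le> 1 - 1 / N k"
    and s: "(\<lambda>j. of_real (N j) * \<gamma> j * z ^ (1024 ^ j - 1)) sums s"
  shows "N k * cmod (\<gamma> k) / 32 \<le> cmod s"
proof -
  let ?t = "\<lambda>j. of_real (N j) * \<gamma> j * z ^ (1024 ^ j - 1)"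
  define P where "P = N k * cmod (\<gamma> k)"
  have P0: "0 \<le> P" using N_pos[of k] by (simp add: P_def)
  have z1: "cmod z < 1" using z(2) N_pos[of k] by (smt (verit) divide_pos_pos)
  have nt: "cmod (?t j) = N j * cmod (\<gamma> j) * cmod z ^ (1024 ^ j - 1)" for j
    using N_pos[of j] by (simp add: norm_mult norm_power)
  have low: "cmod (\<Sum>j<k. ?t j) \<le> P / 127"
  proof -
    have "cmod (\<Sum>j<k. ?t j) \<le> (\<Sum>j<k. N j * cmod (\<gamma> j))"
    proof (intro sum_norm_le)
      fix j
      have "N j * cmod (\<gamma> j) * cmod z ^ (1024 ^ j - 1) \<le> N j * cmod (\<gamma> j) * 1"
        using z1 N_pos[of j] by (intro mult_left_mono power_le_one) auto
      then show "cmod (?t j) \<le> N j * cmod (\<gamma> j)" unfolding nt by simp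
    qed
    then show ?thesis using low_terms[of k] by (simp add: P_def)
  qed
  have hi: "(\<lambda>i. ?t (i + Suc k)) sums (s - (\<Sum>j<Suc k. ?t j))"
    using s by (rule sums_split_initial_segment)
  have geo: "(\<lambda>i. P * (4 / 1024 ^ Suc i)) sums (P * (4 / 1023))"
  proof -
    have "(\<lambda>i. (P * 4 / 1024) * (1 / 1024) ^ i) sums ((P * 4 / 1024) * (1 / (1 - 1 / 1024)))"
      by (intro sums_mult geometric_sums) simp
    then show ?thesis by (simp add: power_divide mult.commute)
  qed
  have hb: "cmod (?t (i + Suc k)) \<le> P * (4 / 1024 ^ Suc i)" for i
    using high_term[OF k z, of i] unfolding nt P_def by (simp add: add.commute)
  have "cmod (s - (\<Sum>j<Suc k. ?t j)) = cmod (\<Sum>i. ?t (i + Suc k))" using hi by (simp add: sums_iff)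
  also have "\<dots> \<le> (\<Sum>i. P * (4 / 1024 ^ Suc i))"
    by (rule norm_suminf_le[OF hb sums_summable[OF geo]])
  also have "\<dots> = P * (4 / 1023)" using geo by (simp add: sums_iff)
  finally have high: "cmod (s - (\<Sum>j<Suc k. ?t j)) \<le> P * (4 / 1023)" .
  have "P * (1 / 16) \<le> cmod (?t k)"
    unfolding nt P_def[symmetric] using main_term[OF k z(1) z1] P0 by (intro mult_left_mono) auto
  moreover
  have "cmod (x - y - w) \<le> cmod x + cmod y + cmod w" for x y w
    using norm_triangle_ineq4[of "x - y" w] norm_triangle_ineq4[of x y] by linarith
  from this[of s "s - (\<Sum>j<Suc k. ?t j)" "\<Sum>j<k. ?t j"]
  have "cmod (?t k) \<le> cmod s + cmod (s - (\<Sum>j<Suc k. ?t j)) + cmod (\<Sum>j<k. ?t j)" by simp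
  ultimately have "P * (1 / 16) \<le> cmod s + P * (4 / 1023) + P / 127" using low high by linarith
  then show ?thesis using P0 unfolding P_def[symmetric] by linarith
qed

text \<open>On the annulus of index k the integrand is at least of order N |\<gamma>|^q: for q < 1
  the power (1 - |z|)^(q-1) is smallest at the inner edge, where it is (2/N)^(q-1). The annulus has
  width 1/N, so it contributes at least a multiple of |\<gamma>|^q.\<close>

lemma not_Dir:
  assumes q: "0 < q" "q < 1" "\<beta> * q \<le> 1"
    and s: "\<And>z. cmod z < 1 \<Longrightarrow> (\<lambda>j. of_real (N j) * \<gamma> j * z ^ (1024 ^ j - 1)) sums deriv f z"
  shows "f \<notin> Dir q"
proof
  assume f: "f \<in> Dir q"
  define c where "c = 2 powr (q - 1) / 32 powr q"
  have c: "0 < c" by (simp add: c_def)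
  \<comment> \<open>Indexing by \<open>Suc k\<close> keeps all radii above 1/2, so the factor r of
    polar coordinates is harmless, and meets the condition k >= 1 of \<open>lacunary_lower\<close>.
    The ratio 1024 > 2 makes the intervals disjoint.\<close>
  define A where "A k = {1 - 2 / N (Suc k)..1 - 1 / N (Suc k)}" for k
  have N1: "1024 \<le> N (Suc k)" for k
    using power_increasing[of 0 k "1024::real"] by (simp add: N_def)
  have A_half: "1 / 2 \<le> r \<and> r < 1" if "r \<in> A k" for r k
  proof -
    have "2 / N (Suc k) \<le> 2 / 1024" using N1[of k] by (intro divide_left_mono) auto
    moreover have "0 < 1 / N (Suc k)" using N_pos by simp
    moreover have "1 - 2 / N (Suc k) \<le> r" "r \<le> 1 - 1 / N (Suc k)" using that by (auto simp only: A_def atLeastAtMost_iff)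
    ultimately show ?thesis by linarith
  qed
  have A_lt: "r < r'" if "r \<in> A j" "r' \<in> A k" "j < k" for r r' j k
  proof -
    have "(1024::real) ^ 1 * N (Suc j) \<le> N (Suc k)"
      unfolding N_def power_add[symmetric] using that(3) by (intro power_increasing) auto
    then have "2 * N (Suc j) < N (Suc k)" using N_pos[of "Suc j"] by simp
    then have "2 / N (Suc k) < 1 / N (Suc j)" using N_pos[of "Suc j"] N_pos[of "Suc k"] by (simp add: field_simps)
    then show ?thesis using that by (auto simp: A_def)
  qed
  have A_disj: "j = k" if "r \<in> A j" "r \<in> A k" for r j k
    using A_lt[of r j r k] A_lt[of r k r j] that by (cases j k rule: linorder_cases) auto
  \<comment> \<open>A radial step function below the integrand up to the factor 1/pi; its integral
    is c times a tail of the harmonic series.\<close>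
  define \<phi> where "\<phi> r = (\<Sum>k. ennreal (c * N (Suc k) / (real k + 2)) * indicator (A k) r)" for r
  have [measurable]: "\<phi> \<in> borel_measurable borel" unfolding \<phi>_def[abs_def] A_def by measurable
  have lower: "c * N (Suc k) / (real k + 2) \<le> (1 - cmod z) powr (q - 1) * cmod (deriv f z) powr q" if z: "cmod z \<in> A k" for z k
  proof -
    have z1: "cmod z < 1" using A_half[OF z] by simp
    define n where "n = N (Suc k)"
    have n: "0 < n" using N_pos by (simp add: n_def)
    have "(2 / n) powr (q - 1) \<le> (1 - cmod z) powr (q - 1)"
      using q z z1 n by (intro powr_mono2') (auto simp: A_def n_def)
    moreover have "(n * cmod (\<gamma> (Suc k)) / 32) powr q \<le> cmod (deriv f z) powr q"
      using z q n unfolding n_def by (intro powr_mono2 lacunary_lower[OF _ _ _ s[OF z1]]) (auto simp: A_def)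
    ultimately have "(2 / n) powr (q - 1) * (n * cmod (\<gamma> (Suc k)) / 32) powr q \<le> (1 - cmod z) powr (q - 1) * cmod (deriv f z) powr q"
      by (intro mult_mono) auto
    moreover have "(2 / n) powr (q - 1) * (n * cmod (\<gamma> (Suc k)) / 32) powr q = c * n * cmod (\<gamma> (Suc k)) powr q"
      using n by (simp add: c_def powr_divide powr_mult powr_diff)
    \<comment> \<open>Here \<beta> q <= 1 enters: the modulus of coefficient \<open>Suc k\<close> is
      (k+2)^(-\<beta>), so its q-th power is at least harmonic.\<close>
    moreover have "1 / (real k + 2) \<le> cmod (\<gamma> (Suc k)) powr q"
    proof -
      have "(real k + 2) powr (- 1) \<le> (real k + 2) powr (- (\<beta> * q))" using q by (intro powr_mono) auto
      also have "\<dots> = cmod (\<gamma> (Suc k)) powr q" by (simp add: \<gamma> powr_powr add.commute)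
      finally show ?thesis by (simp add: powr_minus_divide)
    qed
    then have "c * n * (1 / (real k + 2)) \<le> c * n * cmod (\<gamma> (Suc k)) powr q" using c n by (intro mult_left_mono) auto
    ultimately show ?thesis by (simp add: n_def)
  qed
  have pw: "ennreal (1 / pi) * \<phi> (cmod z) \<le> ennreal (1 / pi * (1 - cmod z) powr (q - 1) * cmod (deriv f z) powr q)" for z
  proof (cases "\<exists>k. cmod z \<in> A k")
    case True
    then obtain k where k: "cmod z \<in> A k" by blast
    have "\<phi> (cmod z) = (\<Sum>j\<in>{k}. ennreal (c * N (Suc j) / (real j + 2)) * indicator (A j) (cmod z))"
      unfolding \<phi>_def by (rule suminf_finite) (use A_disj[OF k] in \<open>auto simp: indicator_def\<close>)
    also have "\<dots> \<le> ennreal ((1 - cmod z) powr (q - 1) * cmod (deriv f z) powr q)"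
      using lower[OF k] k by (simp add: ennreal_leI)
    finally have "ennreal (1 / pi) * \<phi> (cmod z) \<le> ennreal (1 / pi) * ennreal ((1 - cmod z) powr (q - 1) * cmod (deriv f z) powr q)"
      by (rule mult_left_mono) simp
    also have "\<dots> = ennreal (1 / pi * ((1 - cmod z) powr (q - 1) * cmod (deriv f z) powr q))"
      by (rule ennreal_mult[symmetric]) auto
    finally show ?thesis by (simp add: mult.assoc)
  qed (simp add: \<phi>_def)
  have "\<infinity> = (\<Sum>k. ennreal (c * (1 / (real k + 2))))"
  proof -
    have "\<not> summable (\<lambda>n. c * (1 / real (Suc (Suc n))))"
      using not_summable_harmonic[where 'a=real] c
      by (subst summable_cmult_iff, subst summable_Suc_iff[of "\<lambda>n. 1 / real (Suc n)"], subst summable_Suc_iff[of "\<lambda>n. 1 / real n"]) (simp add: inverse_eq_divide)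
    then have "\<not> summable (\<lambda>k. c * (1 / (real k + 2)))" by (simp add: add.commute)
    then show ?thesis using summable_suminf_not_top[of "\<lambda>k. c * (1 / (real k + 2))"] c by fastforce
  qed
  also have "\<dots> \<le> (\<Sum>k. \<integral>\<^sup>+r. ennreal (c * N (Suc k) / (real k + 2)) * indicator (A k) r \<partial>lborel)"
  proof (intro suminf_le)
    fix k
    have "emeasure lborel (A k) = ennreal (1 / N (Suc k))" unfolding A_def using N_pos[of "Suc k"]
      by (subst emeasure_lborel_Icc) (auto simp: diff_divide_distrib[symmetric] divide_right_mono)
    then have "(\<integral>\<^sup>+r. ennreal (c * N (Suc k) / (real k + 2)) * indicator (A k) r \<partial>lborel) = ennreal (c * N (Suc k) / (real k + 2)) * ennreal (1 / N (Suc k))"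
      by (subst nn_integral_cmult_indicator) (auto simp: A_def)
    also have "\<dots> = ennreal (c * (1 / (real k + 2)))"
      using N_pos[of "Suc k"] c by (subst ennreal_mult[symmetric]) auto
    finally show "ennreal (c * (1 / (real k + 2))) \<le> (\<integral>\<^sup>+r. ennreal (c * N (Suc k) / (real k + 2)) * indicator (A k) r \<partial>lborel)" by simp
  qed auto
  also have "\<dots> = (\<integral>\<^sup>+r. \<phi> r \<partial>lborel)"
    unfolding \<phi>_def by (rule nn_integral_suminf[symmetric]) (simp add: A_def)
  also have "\<dots> \<le> (\<integral>\<^sup>+r\<in>{0..<1}. ennreal (2 * pi * r) * (ennreal (1 / pi) * \<phi> r) \<partial>lborel)"
  proof (rule nn_integral_mono)
    fix r
    show "\<phi> r \<le> ennreal (2 * pi * r) * (ennreal (1 / pi) * \<phi> r) * indicator {0..<1} r"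
    proof (cases "\<exists>k. r \<in> A k")
      case True
      then have r: "1 / 2 \<le> r" "r < 1" using A_half by blast+
      have "1 * \<phi> r \<le> ennreal (2 * r) * \<phi> r" using r by (intro mult_right_mono) auto
      also have "ennreal (2 * r) * \<phi> r = ennreal (2 * pi * r) * (ennreal (1 / pi) * \<phi> r)"
        using r by (simp add: mult.assoc[symmetric] ennreal_mult[symmetric])
      finally show ?thesis using r by simp
    qed (simp add: \<phi>_def)
  qed
  also have "\<dots> = (\<integral>\<^sup>+z\<in>ball 0 1. ennreal (1 / pi) * \<phi> (cmod z) \<partial>lborel)"
    by (rule nn_integral_radial[symmetric]) measurable
  also have "\<dots> \<le> (\<integral>\<^sup>+z\<in>ball 0 1. ennreal (1 / pi * (1 - cmod z) powr (q - 1) * cmod (deriv f z) powr q) \<partial>lborel)"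
    by (intro nn_integral_mono mult_right_mono pw) simp
  also have "\<dots> < \<infinity>" using f by (simp add: Dir_def udisc_def)
  finally show False by simp
qed

end

lemma rand_lac_not_Dir:
  assumes b: "block_series (\<lambda>n. of_real (rad n t) * lac \<beta> n) S D" and t: "t \<notin> \<rat>"
    and \<beta>: "0 < \<beta>" "\<beta> \<le> 3" and q: "0 < q" "q < 1" "\<beta> * q \<le> 1"
  shows "rand_series (lac \<beta>) t \<notin> Dir q"
proof -
  interpret block_series "\<lambda>n. of_real (rad n t) * lac \<beta> n" S D by fact
  interpret lacunary \<beta> "\<lambda>k. of_real (rad (1024 ^ k) t) * lac \<beta> (1024 ^ k)"
    by unfold_locales (simp_all add: \<beta> norm_mult rad_irrational[OF t] lac_power)
  have "g \<notin> Dir q"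
  proof (rule not_Dir[OF q])
    fix z :: complex assume z: "cmod z < 1"
    let ?F = "\<lambda>n. of_nat n * (of_real (rad n t) * lac \<beta> n) * z ^ (n - 1)"
    have "?F sums deriv g z" using g_deriv(2)[OF z] unfolding deriv_g[OF z] .
    then have "(\<lambda>k. ?F (1024 ^ k)) sums deriv g z"
      by (subst sums_mono_reindex[OF strict_mono_1024]) (auto simp: lac_def)
    then show "(\<lambda>j. of_real (N j) * (of_real (rad (1024 ^ j) t) * lac \<beta> (1024 ^ j)) * z ^ (1024 ^ j - 1)) sums deriv g z"
      by (simp add: N_def)
  qed
  moreover have "g = rand_series (lac \<beta>) t" by (auto simp: g_def rand_series_def)
  ultimately show ?thesis by simp
qed

section \<open>The multiplier theorem\<close>

lemma one_Dir: "0 < p \<Longrightarrow> (\<lambda>z. 1) \<in> Dir p"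
  by (simp add: Dir_def)

lemma block_series_rand:
  assumes "block_series (\<lambda>n. of_real (rad n t) * a n) S D"
  shows "(\<integral>\<^sup>+ r\<in>{0..<1}. ennreal ((1 - r) * (ln (1 / (1 - r)))^2 * (Minf r (deriv (rand_series a t)))^2) \<partial>lborel) < \<infinity>"
    and "rand_series a t \<in> BMOA_log \<inter> Hinf"
    and "rand_series a t \<in> Mult BMOA BMOA"
    and "0 < p \<Longrightarrow> p \<le> q \<Longrightarrow> 1 / 2 < q \<Longrightarrow> rand_series a t \<in> Mult (Dir p \<inter> BMOA) (Dir q \<inter> BMOA)"
proof -
  interpret block_series "\<lambda>n. of_real (rad n t) * a n" S D by fact
  have eq: "rand_series a t = g" by (auto simp: g_def rand_series_def)
  show "(\<integral>\<^sup>+ r\<in>{0..<1}. ennreal ((1 - r) * (ln (1 / (1 - r)))^2 * (Minf r (deriv (rand_series a t)))^2) \<partial>lborel) < \<infinity>"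
    unfolding eq by (rule g_integral_means)
  show "rand_series a t \<in> BMOA_log \<inter> Hinf" unfolding eq using g_BMOA_log g_Hinf by blast
  show "rand_series a t \<in> Mult BMOA BMOA" unfolding eq by (rule g_Mult_BMOA)
  show "rand_series a t \<in> Mult (Dir p \<inter> BMOA) (Dir q \<inter> BMOA)" if "0 < p" "p \<le> q" "1 / 2 < q"
    unfolding eq using that by (rule g_Mult_Dir)
qed

theorem theorem9:
  shows "(\<forall>a. coeff_cond a \<longrightarrow>
      (AE t in lborel. t \<in> {0..1} \<longrightarrow>
         (\<integral>\<^sup>+ r\<in>{0..<1}. ennreal ((1 - r) * (ln (1 / (1 - r)))^2 *
              (Minf r (deriv (rand_series a t)))^2) \<partial>lborel) < \<infinity>
       \<and> rand_series a t \<in> BMOA_log \<inter> Hinf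
       \<and> (\<forall>p q. 0 < p \<and> p \<le> q \<and> q > 1/2 \<longrightarrow>
            rand_series a t \<in> Mult (Dir p \<inter> BMOA) (Dir q \<inter> BMOA))))
   \<and> (\<forall>q. 0 < q \<and> q < 1/2 \<longrightarrow>
      (\<exists>a. coeff_cond a
         \<and> (AE t in lborel. t \<in> {0..1} \<longrightarrow> rand_series a t \<notin> Dir q)
         \<and> (AE t in lborel. t \<in> {0..1} \<longrightarrow>
              rand_series a t \<in> Mult BMOA BMOA
            \<and> (\<forall>lam p. lam > 1/2 \<and> 0 < p \<and> p \<le> lam \<longrightarrow>
                 rand_series a t \<in> Mult (Dir p \<inter> BMOA) (Dir lam \<inter> BMOA))
            \<and> (\<forall>p. 0 < p \<and> p \<le> q \<longrightarrow>
                 rand_series a t \<notin> Mult (Dir p \<inter> BMOA) (Dir q \<inter> BMOA)))))"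
proof (intro conjI allI impI)
  fix a assume a: "coeff_cond a"
  show "AE t in lborel. t \<in> {0..1} \<longrightarrow>
         (\<integral>\<^sup>+ r\<in>{0..<1}. ennreal ((1 - r) * (ln (1 / (1 - r)))^2 *
              (Minf r (deriv (rand_series a t)))^2) \<partial>lborel) < \<infinity>
       \<and> rand_series a t \<in> BMOA_log \<inter> Hinf
       \<and> (\<forall>p q. 0 < p \<and> p \<le> q \<and> q > 1/2 \<longrightarrow>
            rand_series a t \<in> Mult (Dir p \<inter> BMOA) (Dir q \<inter> BMOA))"
    using block_series_AE[OF a]
  proof eventually_elim
    case (elim t)
    show ?case
    proof
      assume "t \<in> {0..1}"
      then obtain S D where b: "block_series (\<lambda>n. of_real (rad n t) * a n) S D" using elim by blast
      show "(\<integral>\<^sup>+ r\<in>{0..<1}. ennreal ((1 - r) * (ln (1 / (1 - r)))^2 *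
              (Minf r (deriv (rand_series a t)))^2) \<partial>lborel) < \<infinity>
       \<and> rand_series a t \<in> BMOA_log \<inter> Hinf
       \<and> (\<forall>p q. 0 < p \<and> p \<le> q \<and> q > 1/2 \<longrightarrow>
            rand_series a t \<in> Mult (Dir p \<inter> BMOA) (Dir q \<inter> BMOA))"
        by (intro conjI allI impI block_series_rand(1,2,4)[OF b]) auto
    qed
  qed
next
  fix q :: real assume q: "0 < q \<and> q < 1/2"
  \<comment> \<open>\<beta> <= 1/q gives the divergence, and q < 1/2 leaves room for \<beta> > 2, as
    the coefficient condition demands. The cap 3 bounds the decay of consecutive coefficients in
    \<open>lacunary\<close>.\<close>
  define \<beta> where "\<beta> = min 3 (1 / q)"
  have "2 < 1 / q" using q by (simp add: field_simps)
  then have \<beta>: "2 < \<beta>" "\<beta> \<le> 3" by (auto simp: \<beta>_def)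
  have "\<beta> * q \<le> 1 / q * q" using q by (intro mult_right_mono) (auto simp: \<beta>_def)
  then have \<beta>q: "\<beta> * q \<le> 1" using q by simp
  define a where "a = lac \<beta>"
  have a: "coeff_cond a" unfolding a_def by (rule coeff_cond_lac[OF \<beta>(1)])
  \<comment> \<open>The failure needs no randomness beyond nonvanishing signs; for irrational t it
    holds wherever \<open>block_series\<close> does.\<close>
  have bs: "AE t in lborel. t \<in> {0..1} \<longrightarrow> (\<exists>S D. block_series (\<lambda>n. of_real (rad n t) * a n) S D) \<and> rand_series a t \<notin> Dir q"
    using block_series_AE[OF a] AE_irrational
  proof eventually_elim
    case (elim t)
    show ?case
    proof
      assume "t \<in> {0..1}"
      then obtain S D where b: "block_series (\<lambda>n. of_real (rad n t) * a n) S D" using elim(1) by blast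
      then have "rand_series a t \<notin> Dir q"
        unfolding a_def by (rule rand_lac_not_Dir) (use elim(2) \<beta> \<beta>q q in auto)
      then show "(\<exists>S D. block_series (\<lambda>n. of_real (rad n t) * a n) S D) \<and> rand_series a t \<notin> Dir q" using b by blast
    qed
  qed
  have 1: "AE t in lborel. t \<in> {0..1} \<longrightarrow> rand_series a t \<notin> Dir q"
    using bs by eventually_elim blast
  have 2: "AE t in lborel. t \<in> {0..1} \<longrightarrow>
              rand_series a t \<in> Mult BMOA BMOA
            \<and> (\<forall>lam p. lam > 1/2 \<and> 0 < p \<and> p \<le> lam \<longrightarrow>
                 rand_series a t \<in> Mult (Dir p \<inter> BMOA) (Dir lam \<inter> BMOA))
            \<and> (\<forall>p. 0 < p \<and> p \<le> q \<longrightarrow>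
                 rand_series a t \<notin> Mult (Dir p \<inter> BMOA) (Dir q \<inter> BMOA))"
    using bs
  proof eventually_elim
    case (elim t)
    show ?case
    proof
      assume "t \<in> {0..1}"
      then obtain S D where b: "block_series (\<lambda>n. of_real (rad n t) * a n) S D" and nD: "rand_series a t \<notin> Dir q" using elim by blast
      \<comment> \<open>The constant function 1 lies in every source space, so a multiplier would
        itself belong to \<open>Dir q\<close>.\<close>
      have "rand_series a t \<notin> Mult (Dir p \<inter> BMOA) (Dir q \<inter> BMOA)" if p: "0 < p" for p
      proof
        assume "rand_series a t \<in> Mult (Dir p \<inter> BMOA) (Dir q \<inter> BMOA)"
        then have "(\<lambda>z. 1 * rand_series a t z) \<in> Dir q \<inter> BMOA"
          unfolding Mult_def by (auto dest!: bspec[of _ _ "\<lambda>z. 1"] intro: one_BMOA one_Dir p)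
        then show False using nD by simp
      qed
      then show "rand_series a t \<in> Mult BMOA BMOA
            \<and> (\<forall>lam p. lam > 1/2 \<and> 0 < p \<and> p \<le> lam \<longrightarrow>
                 rand_series a t \<in> Mult (Dir p \<inter> BMOA) (Dir lam \<inter> BMOA))
            \<and> (\<forall>p. 0 < p \<and> p \<le> q \<longrightarrow>
                 rand_series a t \<notin> Mult (Dir p \<inter> BMOA) (Dir q \<inter> BMOA))"
        using block_series_rand(3,4)[OF b] by auto
    qed
  qed
  show "\<exists>a. coeff_cond a
         \<and> (AE t in lborel. t \<in> {0..1} \<longrightarrow> rand_series a t \<notin> Dir q)
         \<and> (AE t in lborel. t \<in> {0..1} \<longrightarrow>
              rand_series a t \<in> Mult BMOA BMOA
            \<and> (\<forall>lam p. lam > 1/2 \<and> 0 < p \<and> p \<le> lam \<longrightarrow>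
                 rand_series a t \<in> Mult (Dir p \<inter> BMOA) (Dir lam \<inter> BMOA))
            \<and> (\<forall>p. 0 < p \<and> p \<le> q \<longrightarrow>
                 rand_series a t \<notin> Mult (Dir p \<inter> BMOA) (Dir q \<inter> BMOA)))"
    using a 1 2 by blast
qed

end
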